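(* Let $0<q<\infty$, $0<r\le\infty$, $s\in\mathbb R$, $\varphi\in\mathcal G_q$, and $\dot{\mathcal A}\in\{\dot{\mathcal N},\dot{\mathcal E}\}$. If $\dot{\mathcal A}=\dot{\mathcal E}$ and $r<\infty$, assume that there exist $\varepsilon>0$, $C_0>0$ with $\frac{t^\varepsilon}{\varphi(t)}\le C_0\frac{u^\varepsilon}{\varphi(u)}$ for all $t\ge u>0$. Then different choices of admissible $\tau$ yield equivalent quasi-norms on $\dot{\mathcal A}^s_{\mathcal M^\varphi_q,r}(\mathbb R^n)$: for any two admissible $\tau,\tilde\tau$ there is $C\ge1$ such that for all $f\in\mathcal S'_\infty(\mathbb R^n)$ the quasi-norms of $f$ defined with $\tau$ and with $\tilde\tau$ satisfy $$C^{-1}\|f\|_{\dot{\mathcal A}^s_{\mathcal M^\varphi_q,r}(\tilde\tau)}\le\|f\|_{\dot{\mathcal A}^s_{\mathcal M^\varphi_q,r}(\tau)}\le C\|f\|_{\dot{\mathcal A}^s_{\mathcal M^\varphi_q,r}(\tilde\tau)} .$$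
   Context: $\mathcal S_\infty(\mathbb R^n)$ is the space of $f\in\mathcal S(\mathbb R^n)$ with $\int x^\alpha f(x)\,dx=0$ for all multi-indices $\alpha$, with the topology induced by $\mathcal S(\mathbb R^n)$; $\mathcal S'_\infty(\mathbb R^n)$ is its topological dual. $Q(r)=[-r,r]^n$. $\mathcal D$ is the set of dyadic cubes $\prod_{k=1}^n[2^{-j}m_k,2^{-j}(m_k+1))$, $j\in\mathbb Z,m\in\mathbb Z^n$; $\ell(Q)=|Q|^{1/n}$. $\mathcal G_q$ is the set of nondecreasing $\varphi:(0,\infty)\to(0,\infty)$ with $\varphi(t_1)t_1^{-n/q}\ge\varphi(t_2)t_2^{-n/q}$ for $0<t_1\le t_2$. $\|f\|_{\mathcal M^\varphi_q}=\sup_{Q\in\mathcal D}\varphi(\ell(Q))\big(\frac1{|Q|}\int_Q|f|^q\big)^{1/q}$. $\tau$ is admissible if $\tau\in C^\infty_{\rm c}(\mathbb R^n)$, $0\notin\operatorname{supp}\tau$ and $\tau>0$ on $Q(2)\setminus Q(1)$. Put $\tau_j=\tau(2^{-j}\cdot)$ for $j\in\mathbb Z$ and $\tau_j(D)f(x)=(2\pi)^{-n/2}\langle f,\mathcal F^{-1}\tau_j(x-\cdot)\rangle$ for $f\in\mathcal S'_\infty(\mathbb R^n)$ (well defined since $\mathcal F^{-1}\tau_j(x-\cdot)\in\mathcal S_\infty$). Then $\|f\|_{\dot{\mathcal N}^s_{\mathcal M^\varphi_q,r}(\tau)}=\big(\sum_{j\in\mathbb Z}2^{jsr}\|\tau_j(D)f\|^r_{\mathcal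 M^\varphi_q}\big)^{1/r}$ and $\|f\|_{\dot{\mathcal E}^s_{\mathcal M^\varphi_q,r}(\tau)}=\big\|\big(\sum_{j\in\mathbb Z}2^{jsr}|\tau_j(D)f|^r\big)^{1/r}\big\|_{\mathcal M^\varphi_q}$ (suprema over $j\in\mathbb Z$ if $r=\infty$); the homogeneous spaces consist of the $f\in\mathcal S'_\infty(\mathbb R^n)$ with finite quasi-norm. *)

theory Defs
  imports "HOL-Analysis.Analysis"
begin

subsection \<open>Smooth functions and the Schwartz space\<close>

definition partial_deriv :: "'n::finite \<Rightarrow> (real ^ 'n \<Rightarrow> complex) \<Rightarrow> real ^ 'n \<Rightarrow> complex"
  where "partial_deriv i f x = frechet_derivative f (at x) (axis i 1)"

text \<open>A multi-index in a derivative is encoded by the list of the coordinates with respect to which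
  one differentiates. For smooth functions the order in the list is irrelevant.\<close>

definition iter_partial :: "'n::finite list \<Rightarrow> (real ^ 'n \<Rightarrow> complex) \<Rightarrow> real ^ 'n \<Rightarrow> complex"
  where "iter_partial ds f = foldr partial_deriv ds f"

definition smooth :: "(real ^ 'n::finite \<Rightarrow> complex) \<Rightarrow> bool"
  where "smooth f \<longleftrightarrow> (\<forall>ds x. iter_partial ds f differentiable (at x))"

definition monomial :: "('n::finite \<Rightarrow> nat) \<Rightarrow> real ^ 'n \<Rightarrow> real"
  where "monomial \<alpha> x = (\<Prod>i\<in>UNIV. (x $ i) ^ \<alpha> i)"

definition schwartz :: "(real ^ 'n::finite \<Rightarrow> complex) set"
  where "schwartz =
    {f. smooth f \<and> (\<forall>\<alpha> ds. bounded (range (\<lambda>x. monomial \<alpha> x *\<^sub>R iter_partial ds f x)))}"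

definition schwartz_seminorm ::
    "('n::finite \<Rightarrow> nat) \<Rightarrow> 'n list \<Rightarrow> (real ^ 'n \<Rightarrow> complex) \<Rightarrow> real"
  where "schwartz_seminorm \<alpha> ds f = (SUP x. cmod (monomial \<alpha> x *\<^sub>R iter_partial ds f x))"

definition schwartz_topology :: "(real ^ 'n::finite \<Rightarrow> complex) topology"
  where "schwartz_topology = topology_generated_by
    {{g \<in> schwartz. schwartz_seminorm \<alpha> ds (\<lambda>x. g x - f x) < e} | f \<alpha> ds e. f \<in> schwartz \<and> 0 < e}"

definition schwartz_inf :: "(real ^ 'n::finite \<Rightarrow> complex) set"
  where "schwartz_inf = {f \<in> schwartz. \<forall>\<alpha>. (\<integral>x. monomial \<alpha> x *\<^sub>R f x \<partial>lborel) = 0}"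

text \<open>Elements of the dual are represented by functions on the whole function type; their values
  outside \<open>schwartz_inf\<close> are unconstrained and are never used.\<close>

definition schwartz_inf_dual :: "((real ^ 'n::finite \<Rightarrow> complex) \<Rightarrow> complex) set"
  where "schwartz_inf_dual = {T.
    (\<forall>f\<in>schwartz_inf. \<forall>g\<in>schwartz_inf. T (\<lambda>x. f x + g x) = T f + T g) \<and>
    (\<forall>c. \<forall>f\<in>schwartz_inf. T (\<lambda>x. c * f x) = c * T f) \<and>
    continuous_map (subtopology schwartz_topology schwartz_inf) euclidean T}"

subsection \<open>Dyadic cubes and generalized Morrey quasi-norms\<close>

definition dyadic_cubes :: "(real ^ 'n::finite) set set"
  where "dyadic_cubes =
    {{x. \<forall>k. 2 powi (-j) * real_of_int (m k) \<le> x $ k \<and> x $ k < 2 powi (-j) * real_of_int (m k + 1)}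
      | (j::int) (m::'n \<Rightarrow> int). True}"

definition side_length :: "(real ^ 'n::finite) set \<Rightarrow> real"
  where "side_length Q = measure lborel Q powr (1 / real CARD('n))"

definition Gclass :: "nat \<Rightarrow> real \<Rightarrow> (real \<Rightarrow> real) set"
  where "Gclass n q = {\<phi>. (\<forall>t>0. 0 < \<phi> t) \<and> mono_on {0<..} \<phi> \<and>
    (\<forall>t1 t2. 0 < t1 \<and> t1 \<le> t2 \<longrightarrow>
      \<phi> t1 * t1 powr (- (real n / q)) \<ge> \<phi> t2 * t2 powr (- (real n / q)))}"

text \<open>Powers with a positive exponent on $[0,\infty]$.\<close>

definition epowr :: "ennreal \<Rightarrow> real \<Rightarrow> ennreal"
  where "epowr x p = (if x = \<infinity> then \<infinity> else ennreal (enn2real x powr p))"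

text \<open>The Morrey quasi-norm is defined for functions with values in $[0,\infty]$, to be applied
  to the modulus of a complex-valued function or to a pointwise $\ell^r$ expression, which may be infinite.\<close>

definition morrey_norm :: "(real \<Rightarrow> real) \<Rightarrow> real \<Rightarrow> (real ^ 'n::finite \<Rightarrow> ennreal) \<Rightarrow> ennreal"
  where "morrey_norm \<phi> q g = (SUP Q\<in>dyadic_cubes.
    ennreal (\<phi> (side_length Q)) *
      epowr ((\<integral>\<^sup>+x\<in>Q. epowr (g x) q \<partial>lborel) / emeasure lborel Q) (1 / q))"

subsection \<open>Littlewood--Paley pieces and the homogeneous quasi-norms\<close>

definition cube :: "real \<Rightarrow> (real ^ 'n::finite) set"
  where "cube R = {x. \<forall>i. \<bar>x $ i\<bar> \<le> R}"

definition supp :: "(real ^ 'n::finite \<Rightarrow> complex) \<Rightarrow> (real ^ 'n) set"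
  where "supp \<tau> = closure {\<xi>. \<tau> \<xi> \<noteq> 0}"

definition admissible :: "(real ^ 'n::finite \<Rightarrow> complex) \<Rightarrow> bool"
  where "admissible \<tau> \<longleftrightarrow> smooth \<tau> \<and> compact (supp \<tau>) \<and> 0 \<notin> supp \<tau> \<and>
    (\<forall>\<xi>\<in>cube 2 - cube 1. \<tau> \<xi> \<in> \<real> \<and> 0 < Re (\<tau> \<xi>))"

definition inv_fourier :: "(real ^ 'n::finite \<Rightarrow> complex) \<Rightarrow> real ^ 'n \<Rightarrow> complex"
  where "inv_fourier g x = of_real ((2 * pi) powr (- (real CARD('n) / 2))) *
    (\<integral>\<xi>. g \<xi> * exp (\<i> * of_real (x \<bullet> \<xi>)) \<partial>lborel)"

definition dilate :: "int \<Rightarrow> (real ^ 'n::finite \<Rightarrow> complex) \<Rightarrow> real ^ 'n \<Rightarrow> complex"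
  where "dilate j \<tau> \<xi> = \<tau> ((2 powi (-j)) *\<^sub>R \<xi>)"

definition fourier_multiplier ::
    "(real ^ 'n::finite \<Rightarrow> complex) \<Rightarrow> ((real ^ 'n \<Rightarrow> complex) \<Rightarrow> complex) \<Rightarrow> real ^ 'n \<Rightarrow> complex"
  where "fourier_multiplier m f x =
    of_real ((2 * pi) powr (- (real CARD('n) / 2))) * f (\<lambda>y. inv_fourier m (x - y))"

definition weighted_lr_norm :: "real \<Rightarrow> ennreal \<Rightarrow> (int \<Rightarrow> ennreal) \<Rightarrow> ennreal"
  where "weighted_lr_norm s r a =
    (if r = \<infinity> then (SUP j. ennreal (2 powr (real_of_int j * s)) * a j)
     else epowr (\<Sum>\<^sub>\<infinity>j. ennreal (2 powr (real_of_int j * s * enn2real r)) * epowr (a j) (enn2real r))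
            (1 / enn2real r))"

datatype scale = N_scale | E_scale

fun hom_norm :: "scale \<Rightarrow> real \<Rightarrow> (real \<Rightarrow> real) \<Rightarrow> real \<Rightarrow> ennreal \<Rightarrow> (real ^ 'n::finite \<Rightarrow> complex)
    \<Rightarrow> ((real ^ 'n \<Rightarrow> complex) \<Rightarrow> complex) \<Rightarrow> ennreal"
  where
    "hom_norm N_scale s \<phi> q r \<tau> f =
      weighted_lr_norm s r
        (\<lambda>j. morrey_norm \<phi> q (\<lambda>x. ennreal (cmod (fourier_multiplier (dilate j \<tau>) f x))))"
  | "hom_norm E_scale s \<phi> q r \<tau> f =
      morrey_norm \<phi> q
        (\<lambda>x. weighted_lr_norm s r (\<lambda>j. ennreal (cmod (fourier_multiplier (dilate j \<tau>) f x))))"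

end

theory Submission
  imports Defs "HOL-Probability.Probability"
begin

text \<open>
Since \<open>\<tau>'\<close> is positive on an annulus, every test function supported away from the origin, in particular
\<open>\<tau>\<close>, is a finite sum of terms \<open>\<mu> l * \<tau>'(2 ^ (-l) \<cdot>)\<close> with test functions \<open>\<mu> l\<close>. Hence \<open>\<tau>\<^sub>j(D) f\<close> is bounded by averages of the
neighbouring pieces \<open>\<tau>'\<^sub>j\<^sub>+\<^sub>l(D) f\<close> against kernels of arbitrary polynomial decay at scale \<open>2 ^ (-j)\<close>, and a cutoff that
equals one on the support of \<open>\<tau>'\<close> gives the same bound of \<open>\<tau>'\<^sub>j(D) f\<close> by itself. Peetre's trick transfers these
bounds to all powers \<open>\<eta> > 0\<close> of the moduli.

It remains to bound sums over scales of such averages on a dyadic cube, tested against a decaying weight. The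
scales finer than the cube are treated without maximal functions: an average over the length \<open>2 ^ (-k)\<close> is nearly
constant over smaller lengths, so that after a summation by parts over the scales the average at scale \<open>k\<close> can be moved onto
the weight and the partial sum of the coarser averages. At
the scales coarser than the cube the pieces are bounded pointwise by \<open>1 / \<phi>\<close>; summing these bounds is where the
growth condition on \<open>\<phi>\<close> enters, and why it is not needed for suprema over the scales.
\<close>

subsection \<open>Averages against rapidly decaying kernels\<close>

text \<open>A route through the Fefferman-Stein maximal inequality would require a Morrey version of
  it. Here sums of averages are treated directly, and the exponent \<open>p = q / r\<close> decides
  how. For \<open>p \<le> 1\<close> the power \<open>p - 1\<close> of a partial sum is nonpositive;
  it is controlled because every piece is dominated by its own average. For \<open>p \<ge> 1\<close>
  the average is cut at dyadic distances, and half of the left-hand side is absorbed. Absorption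
  requires finiteness, so the inequalities are proved for finitely many scales with bounded averages
  and extended by monotone convergence. A supremum over the scales offers no sum to be summed by
  parts; after passing to the powers \<open>q / 2\<close> of the moduli, duality in the exponent 2
  reduces it to a sum. On the side of the functionals the obstacle is that they are given on
  functions with vanishing moments: every function fed to them is kept as the transform of a test
  function supported away from the origin, and their continuity is used through finitely many
  seminorms.\<close>

definition sdist :: "int \<Rightarrow> 'a::euclidean_space \<Rightarrow> 'a \<Rightarrow> real"
  where "sdist k x y = 1 + 2 powr real_of_int k * dist x y"

definition kern :: "int \<Rightarrow> real \<Rightarrow> 'a::euclidean_space \<Rightarrow> 'a \<Rightarrow> real"
  where "kern k N x y = 2 powr (real_of_int k * real DIM('a)) * sdist k x y powr (- N)"

definition avg :: "int \<Rightarrow> real \<Rightarrow> ('a::euclidean_space \<Rightarrow> ennreal) \<Rightarrow> 'a \<Rightarrow> ennreal"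
  where "avg k N b x = (\<integral>\<^sup>+y. ennreal (kern k N x y) * b y \<partial>lborel)"

lemma sdist_ge1: "1 \<le> sdist k x y" and sdist_pos: "0 < sdist k x y"
proof -
  show "1 \<le> sdist k x y" by (simp add: sdist_def)
  then show "0 < sdist k x y" by linarith
qed

lemma sdist_self [simp]: "sdist k x x = 1"
  by (simp add: sdist_def)

lemma sdist_commute: "sdist k x y = sdist k y x"
  by (simp add: sdist_def dist_commute)

text \<open>Expands \<open>(1 + a) * (1 + b)\<close>. The product form is chosen because it survives
  raising to arbitrary nonnegative powers.\<close>

lemma sdist_triangle: "sdist k x z \<le> sdist k x y * sdist k y z"
proof -
  have "2 powr real_of_int k * dist x z \<le> 2 powr real_of_int k * (dist x y + dist y z)"
    by (intro mult_left_mono dist_triangle) auto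
  moreover have "0 \<le> (2 powr real_of_int k * dist x y) * (2 powr real_of_int k * dist y z)"
    by (intro mult_nonneg_nonneg) auto
  ultimately show ?thesis unfolding sdist_def by (simp only: distrib_left distrib_right)
qed

lemma sdist_mono: "i \<le> k \<Longrightarrow> sdist i x y \<le> sdist k x y"
  unfolding sdist_def by (intro add_left_mono mult_right_mono) auto

lemma sdist_measurable [measurable (raw)]:
  "f \<in> borel_measurable M \<Longrightarrow> g \<in> borel_measurable M \<Longrightarrow> (\<lambda>w. sdist k (f w) (g w)) \<in> borel_measurable M"
  unfolding sdist_def by measurable

lemma kern_measurable [measurable (raw)]:
  "f \<in> borel_measurable M \<Longrightarrow> g \<in> borel_measurable M \<Longrightarrow> (\<lambda>w. kern k N (f w) (g w)) \<in> borel_measurable M"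
  unfolding kern_def by measurable

lemma kern_pos: "0 < kern k N x y"
  using sdist_pos[of k x y] by (simp add: kern_def)

lemma kern_nonneg [simp]: "0 \<le> kern k N x y"
  using kern_pos less_imp_le by blast

lemma kern_commute: "kern k N x y = kern k N y x"
  by (simp add: kern_def sdist_commute)

lemma kern_antimono: "M \<le> N \<Longrightarrow> kern k N x y \<le> kern k M x y"
  using sdist_ge1[of k x y] by (auto simp: kern_def intro!: powr_mono)

lemma kern_sdist: "kern k N x y * sdist k x y powr M = kern k (N - M) x y"
  by (simp add: kern_def mult.assoc flip: powr_add)

text \<open>Peetre's inequality: since \<open>sdist\<close> is submultiplicative, moving the base
  point costs one power of the distance per order of decay.\<close>

lemma kern_shift:
  assumes "0 \<le> N"
  shows "kern k N x z \<le> sdist k x y powr N * kern k N y z"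
proof -
  have "sdist k y z powr N \<le> (sdist k x y * sdist k x z) powr N"
    using sdist_triangle[of k y z x] sdist_ge1[of k y z] assms
    by (intro powr_mono2) (auto simp: sdist_commute)
  then have "sdist k y z powr N \<le> sdist k x y powr N * sdist k x z powr N"
    using sdist_ge1 by (simp add: powr_mult)
  then have "sdist k x z powr (-N) \<le> sdist k x y powr N * sdist k y z powr (-N)"
    using sdist_pos[of k x z] sdist_pos[of k y z] by (simp add: powr_minus field_simps)
  then have "2 powr (real_of_int k * real DIM('a)) * sdist k x z powr (-N)
      \<le> 2 powr (real_of_int k * real DIM('a)) * (sdist k x y powr N * sdist k y z powr (-N))"
    by (intro mult_left_mono) auto
  then show ?thesis by (simp add: kern_def mult_ac)
qed

lemma nn_integral_inverse_square:
  "(\<integral>\<^sup>+t. ennreal ((1 + \<bar>t::real\<bar>) powr (-2)) \<partial>lborel) = 2"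
proof -
  have half: "(\<integral>\<^sup>+t. ennreal (1 / (1 + t)^2) * indicator {0::real..} t \<partial>lborel) = ennreal (0 - (- 1 / (1 + 0)))"
  proof (rule nn_integral_FTC_atLeast)
    show "((\<lambda>a. - 1 / (1 + a)) \<longlongrightarrow> (0::real)) at_top" by real_asymp
  qed (auto intro!: derivative_eq_intros simp: power2_eq_square)
  \<comment> \<open>The closed half-line and the reflected open one count the point 0 exactly
    once.\<close>
  have "(\<integral>\<^sup>+t. ennreal ((1 + \<bar>t::real\<bar>) powr (-2)) \<partial>lborel) =
      (\<integral>\<^sup>+t. ennreal (1 / (1 + t)^2) * indicator {0..} t + ennreal (1 / (1 + (-t))^2) * indicator {0<..} (-t) \<partial>lborel)"
    by (intro nn_integral_cong) (auto simp: powr_minus powr_numeral indicator_def field_simps)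
  also have "\<dots> = (\<integral>\<^sup>+t. ennreal (1 / (1 + t)^2) * indicator {0..} t \<partial>lborel) +
      (\<integral>\<^sup>+t. ennreal (1 / (1 + (-t))^2) * indicator {0<..} (-t) \<partial>lborel)"
    by (intro nn_integral_add) auto
  also have "(\<integral>\<^sup>+t. ennreal (1 / (1 + (-t))^2) * indicator {0<..} (-t) \<partial>lborel) =
      (\<integral>\<^sup>+t. ennreal (1 / (1 + t)^2) * indicator {0<..} t \<partial>lborel)"
    using nn_integral_real_affine[of "\<lambda>t. ennreal (1 / (1 + t)^2) * indicator {0<..} t" "-1" 0] by simp
  also have "\<dots> = (\<integral>\<^sup>+t. ennreal (1 / (1 + t)^2) * indicator {0..} t \<partial>lborel)"
    by (intro nn_integral_cong_AE, use AE_lborel_singleton[of "0::real"] in eventually_elim)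
      (auto simp: indicator_def)
  finally show ?thesis using half by simp
qed

lemma nn_integral_inverse_square_scaled:
  "(\<integral>\<^sup>+t. ennreal (2 powr k * (1 + 2 powr k * \<bar>x - t\<bar>) powr (-2)) \<partial>lborel) = 2"
proof -
  have "2 = (\<integral>\<^sup>+t. ennreal ((1 + \<bar>t::real\<bar>) powr (-2)) \<partial>lborel)"
    by (simp add: nn_integral_inverse_square)
  also have "\<dots> = ennreal \<bar>2 powr k\<bar> * (\<integral>\<^sup>+t. ennreal ((1 + \<bar>- (2 powr k * x) + 2 powr k * t\<bar>) powr (-2)) \<partial>lborel)"
    by (subst nn_integral_real_affine[of _ "2 powr k" "- (2 powr k * x)"]) auto
  also have "\<dots> = (\<integral>\<^sup>+t. ennreal (2 powr k) * ennreal ((1 + \<bar>- (2 powr k * x) + 2 powr k * t\<bar>) powr (-2)) \<partial>lborel)"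
    by (subst nn_integral_cmult) auto
  also have "\<dots> = (\<integral>\<^sup>+t. ennreal (2 powr k * (1 + 2 powr k * \<bar>x - t\<bar>) powr (-2)) \<partial>lborel)"
  proof (intro nn_integral_cong)
    fix t :: real
    have "\<bar>- (2 powr k * x) + 2 powr k * t\<bar> = \<bar>2 powr k * (t - x)\<bar>" by (simp add: algebra_simps)
    also have "\<dots> = 2 powr k * \<bar>x - t\<bar>" by (simp add: abs_mult abs_minus_commute)
    finally show "ennreal (2 powr k) * ennreal ((1 + \<bar>- (2 powr k * x) + 2 powr k * t\<bar>) powr (-2))
        = ennreal (2 powr k * (1 + 2 powr k * \<bar>x - t\<bar>) powr (-2))"
      by (simp add: ennreal_mult)
  qed
  finally show ?thesis by simp
qed

text \<open>Two orders of decay are spent on each coordinate, so that the kernel is integrable by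
  reduction to one variable. This is the origin of the recurring threshold
  \<open>2 * real DIM('a)\<close> and of the mass bound \<open>2 ^ DIM('a)\<close>.\<close>

lemma kern_le_prod:
  fixes x y :: "'a::euclidean_space"
  assumes "2 * real DIM('a) \<le> N"
  shows "kern k N x y \<le> (\<Prod>b\<in>Basis. 2 powr k * (1 + 2 powr k * \<bar>x \<bullet> b - y \<bullet> b\<bar>) powr (-2))"
proof -
  have "sdist k x y powr (-N) \<le> sdist k x y powr (real DIM('a) * (-2))"
    using assms sdist_ge1[of k x y] by (intro powr_mono) auto
  also have "\<dots> = (\<Prod>b\<in>(Basis::'a set). sdist k x y powr (-2))"
    using sdist_pos[of k x y] by (simp add: prod_constant powr_power mult.commute)
  also have "\<dots> \<le> (\<Prod>b\<in>(Basis::'a set). (1 + 2 powr k * \<bar>x \<bullet> b - y \<bullet> b\<bar>) powr (-2))"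
  proof (intro prod_mono conjI)
    fix b :: 'a assume b: "b \<in> Basis"
    have "\<bar>x \<bullet> b - y \<bullet> b\<bar> \<le> dist x y"
      using Basis_le_norm[OF b, of "x - y"] by (simp add: dist_norm inner_diff_left)
    then have "1 + 2 powr k * \<bar>x \<bullet> b - y \<bullet> b\<bar> \<le> sdist k x y"
      by (simp add: sdist_def)
    then show "sdist k x y powr (-2) \<le> (1 + 2 powr k * \<bar>x \<bullet> b - y \<bullet> b\<bar>) powr (-2)"
      by (intro powr_mono2') (auto intro: add_pos_nonneg)
  qed auto
  finally have "sdist k x y powr (-N) \<le> (\<Prod>b\<in>(Basis::'a set). (1 + 2 powr k * \<bar>x \<bullet> b - y \<bullet> b\<bar>) powr (-2))" .
  then have "kern k N x y \<le> 2 powr (real_of_int k * real DIM('a)) * (\<Prod>b\<in>(Basis::'a set). (1 + 2 powr k * \<bar>x \<bullet> b - y \<bullet> b\<bar>) powr (-2))"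
    unfolding kern_def by (intro mult_left_mono) auto
  also have "2 powr (real_of_int k * real DIM('a)) = (\<Prod>b\<in>(Basis::'a set). 2 powr k)"
    by (simp add: prod_constant powr_powr[symmetric] powr_realpow)
  finally show ?thesis by (simp add: prod.distrib)
qed

lemma nn_integral_kern_le:
  fixes x :: "'a::euclidean_space"
  assumes "2 * real DIM('a) \<le> N"
  shows "(\<integral>\<^sup>+y. ennreal (kern k N x y) \<partial>lborel) \<le> ennreal (2 ^ DIM('a))"
proof -
  have "(\<integral>\<^sup>+y. ennreal (kern k N x y) \<partial>lborel) \<le>
      (\<integral>\<^sup>+y. ennreal (\<Prod>b\<in>Basis. 2 powr k * (1 + 2 powr k * \<bar>x \<bullet> b - y \<bullet> b\<bar>) powr (-2)) \<partial>lborel)"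
    by (intro nn_integral_mono ennreal_leI kern_le_prod assms)
  also have "\<dots> = (\<integral>\<^sup>+y. (\<Prod>b\<in>Basis. ennreal (2 powr k * (1 + 2 powr k * \<bar>x \<bullet> b - y \<bullet> b\<bar>) powr (-2))) \<partial>lborel)"
    by (intro nn_integral_cong) (simp add: prod_ennreal)
  also have "\<dots> = (\<Prod>b\<in>(Basis::'a set). \<integral>\<^sup>+t. ennreal (2 powr k * (1 + 2 powr k * \<bar>x \<bullet> b - t\<bar>) powr (-2)) \<partial>lborel)"
    by (rule nn_integral_lborel_prod) auto
  also have "\<dots> = 2 ^ DIM('a)"
    by (simp add: nn_integral_inverse_square_scaled)
  also have "\<dots> = ennreal (2 ^ DIM('a))"
    by (simp add: ennreal_power[symmetric])
  finally show ?thesis .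
qed

lemma nn_integral_kern_le':
  fixes x :: "'a::euclidean_space"
  assumes "2 * real DIM('a) \<le> N"
  shows "(\<integral>\<^sup>+y. ennreal (kern k N y x) \<partial>lborel) \<le> ennreal (2 ^ DIM('a))"
  using nn_integral_kern_le[OF assms] by (simp add: kern_commute[of k N _ x])

lemma avg_measurable [measurable]:
  assumes [measurable]: "b \<in> borel_measurable borel"
  shows "avg k N b \<in> borel_measurable borel"
proof -
  show ?thesis unfolding avg_def[abs_def] by measurable
qed

lemma avg_mono: "(\<And>y. b y \<le> b' y) \<Longrightarrow> avg k N b x \<le> avg k N b' x"
  unfolding avg_def by (intro nn_integral_mono mult_left_mono) auto

lemma avg_antimono: "M \<le> N \<Longrightarrow> avg k N b x \<le> avg k M b x"
  unfolding avg_def by (intro nn_integral_mono mult_right_mono ennreal_leI kern_antimono) auto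

lemma avg_cmult:
  assumes [measurable]: "b \<in> borel_measurable borel"
  shows "avg k N (\<lambda>y. c * b y) x = c * avg k N b x"
  unfolding avg_def by (subst nn_integral_cmult[symmetric]) (auto simp: mult_ac)

lemma avg_const_le:
  fixes x :: "'a::euclidean_space"
  assumes "2 * real DIM('a) \<le> N"
  shows "avg k N (\<lambda>y. c) x \<le> ennreal (2 ^ DIM('a)) * c"
proof -
  have "avg k N (\<lambda>y. c) x = (\<integral>\<^sup>+y. ennreal (kern k N x y) \<partial>lborel) * c"
    unfolding avg_def by (rule nn_integral_multc) auto
  also have "\<dots> \<le> ennreal (2 ^ DIM('a)) * c"
    by (intro mult_right_mono nn_integral_kern_le assms) auto
  finally show ?thesis .
qed

text \<open>Averages at scale \<open>k\<close> vary by a bounded factor over lengths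
  \<open>2 powr - k\<close>. This slow variation takes the place of a maximal function.\<close>

lemma avg_shift:
  assumes "0 \<le> N" and [measurable]: "b \<in> borel_measurable borel"
  shows "avg k N b x \<le> ennreal (sdist k x y powr N) * avg k N b y"
proof -
  have "avg k N b x \<le> (\<integral>\<^sup>+z. ennreal (sdist k x y powr N) * (ennreal (kern k N y z) * b z) \<partial>lborel)"
    unfolding avg_def
  proof (intro nn_integral_mono)
    fix z
    have "ennreal (kern k N x z) * b z \<le> ennreal (sdist k x y powr N * kern k N y z) * b z"
      by (intro mult_right_mono ennreal_leI kern_shift assms) auto
    then show "ennreal (kern k N x z) * b z \<le> ennreal (sdist k x y powr N) * (ennreal (kern k N y z) * b z)"
      by (simp add: ennreal_mult mult.assoc)
  qed
  also have "\<dots> = ennreal (sdist k x y powr N) * avg k N b y"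
    unfolding avg_def by (rule nn_integral_cmult) auto
  finally show ?thesis .
qed

text \<open>Fubini's theorem moves the average from \<open>b\<close> to the weight. The variation of
  \<open>w\<close> uses up \<open>M\<close> of the \<open>N\<close> orders of decay, and the
  remaining ones must still make the kernel integrable.\<close>

lemma avg_transfer:
  fixes w :: "'a::euclidean_space \<Rightarrow> ennreal"
  assumes [measurable]: "b \<in> borel_measurable borel" "w \<in> borel_measurable borel"
    and w: "\<And>x y. w x \<le> ennreal (sdist k x y powr M) * w y"
    and N: "2 * real DIM('a) \<le> N - M"
  shows "(\<integral>\<^sup>+x. avg k N b x * w x \<partial>lborel) \<le> ennreal (2 ^ DIM('a)) * (\<integral>\<^sup>+y. b y * w y \<partial>lborel)"
proof -
  have "(\<integral>\<^sup>+x. avg k N b x * w x \<partial>lborel) = (\<integral>\<^sup>+x. (\<integral>\<^sup>+y. ennreal (kern k N x y) * b y * w x \<partial>lborel) \<partial>lborel)"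
    unfolding avg_def by (subst nn_integral_multc) auto
  also have "\<dots> \<le> (\<integral>\<^sup>+x. (\<integral>\<^sup>+y. ennreal (kern k (N - M) x y) * (b y * w y) \<partial>lborel) \<partial>lborel)"
  proof (intro nn_integral_mono)
    fix x y
    have "ennreal (kern k N x y) * b y * w x \<le> ennreal (kern k N x y) * b y * (ennreal (sdist k x y powr M) * w y)"
      by (intro mult_left_mono w) auto
    also have "\<dots> = ennreal (kern k N x y * sdist k x y powr M) * (b y * w y)"
      by (simp add: ennreal_mult mult_ac)
    finally show "ennreal (kern k N x y) * b y * w x \<le> ennreal (kern k (N - M) x y) * (b y * w y)"
      by (simp add: kern_sdist)
  qed
  also have "\<dots> = (\<integral>\<^sup>+y. (\<integral>\<^sup>+x. ennreal (kern k (N - M) x y) * (b y * w y) \<partial>lborel) \<partial>lborel)"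
    by (rule lborel_pair.Fubini') measurable
  also have "\<dots> = (\<integral>\<^sup>+y. (\<integral>\<^sup>+x. ennreal (kern k (N - M) x y) \<partial>lborel) * (b y * w y) \<partial>lborel)"
    by (subst nn_integral_multc) auto
  also have "\<dots> \<le> (\<integral>\<^sup>+y. ennreal (2 ^ DIM('a)) * (b y * w y) \<partial>lborel)"
    by (intro nn_integral_mono mult_right_mono nn_integral_kern_le' N) auto
  also have "\<dots> = ennreal (2 ^ DIM('a)) * (\<integral>\<^sup>+y. b y * w y \<partial>lborel)"
    by (rule nn_integral_cmult) auto
  finally show ?thesis .
qed

subsection \<open>Sums of averages over several scales\<close>

text \<open>Finiteness of \<open>J\<close> is essential, since \<open>J = \<infinity>\<close>
  satisfies the first inequality for every \<open>K\<close>.\<close>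

lemma ennreal_absorb_half:
  assumes "J \<le> ennreal (1/2) * J + K" "J < \<infinity>"
  shows "J \<le> 2 * K"
proof (cases K)
  case (real k)
  obtain j where j: "J = ennreal j" "0 \<le> j" using assms(2) by (cases J) auto
  have "ennreal (1/2) * ennreal j = ennreal (1/2 * j)" using j by (intro ennreal_mult[symmetric]) auto
  then have "ennreal j \<le> ennreal (1/2 * j + k)"
    using assms(1) j real by (subst ennreal_plus) auto
  then have "j \<le> 2 * k" using j real by (subst (asm) ennreal_le_iff) auto
  then have "ennreal j \<le> ennreal (2 * k)" by (rule ennreal_leI)
  also have "\<dots> = 2 * ennreal k" using real by (simp add: ennreal_mult)
  finally show ?thesis using j real by simp
qed (simp add: ennreal_mult_top)

lemma mult_powr_pred: "0 < (s::real) \<Longrightarrow> s * s powr (p - 1) = s powr p"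
  by (simp add: powr_diff)

text \<open>The increment of \<open>s powr p\<close> between \<open>x\<close> and
  \<open>x + y\<close> is measured by the power at the right end, because the partial sums used
  below include the current term.\<close>

lemma powr_add_le_concave:
  fixes x y p :: real
  assumes "0 \<le> x" "0 \<le> y" "p \<le> 1"
  shows "(x + y) powr p \<le> x powr p + y * (x + y) powr (p - 1)"
proof (cases "x = 0")
  \<comment> \<open>By convention \<open>0 powr p = 0\<close> for every \<open>p\<close>, also for
    \<open>p \<le> 0\<close>, so the left end 0 needs separate treatment.\<close>
  case True
  with assms show ?thesis
    by (cases "y = 0") (auto simp: powr_diff)
next
  case False
  have "(x + y) powr p = x * (x + y) powr (p - 1) + y * (x + y) powr (p - 1)"
    using mult_powr_pred[of "x + y" p] assms False by (simp add: distrib_right)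
  moreover have "x * (x + y) powr (p - 1) \<le> x * x powr (p - 1)"
    using assms False by (intro mult_left_mono powr_mono2') auto
  moreover have "x * x powr (p - 1) = x powr p"
    using assms False by (simp add: powr_diff)
  ultimately show ?thesis by linarith
qed

text \<open>For a concave power the slope at the right end is the smallest one on the interval;
  Young's inequality for \<open>x powr p * (x + y) powr (1 - p)\<close> expresses this without
  derivatives.\<close>

lemma powr_add_ge_concave:
  fixes x y p :: real
  assumes "0 \<le> x" "0 \<le> y" "0 < p" "p \<le> 1"
  shows "x powr p + p * (y * (x + y) powr (p - 1)) \<le> (x + y) powr p"
proof (cases "x = 0")
  case True
  have "p * y powr p \<le> 1 * y powr p" using assms by (intro mult_right_mono) auto
  with True show ?thesis
    using assms by (cases "y = 0") (auto simp: powr_diff)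
next
  case False
  with assms have pos: "0 < x" "0 < x + y" by auto
  have "x powr p * (x + y) powr (1 - p) \<le> p * x + (1 - p) * (x + y)"
    using assms pos by (intro Youngs_inequality_0) auto
  also have "\<dots> = (x + y) - p * y" by (simp add: algebra_simps)
  finally have "x powr p * (x + y) powr (1 - p) * (x + y) powr (p - 1) \<le> ((x + y) - p * y) * (x + y) powr (p - 1)"
    by (intro mult_right_mono) auto
  moreover have "x powr p * (x + y) powr (1 - p) * (x + y) powr (p - 1) = x powr p"
    using pos by (simp add: mult.assoc flip: powr_add)
  moreover have "((x + y) - p * y) * (x + y) powr (p - 1) = (x + y) powr p - p * (y * (x + y) powr (p - 1))"
    using mult_powr_pred[OF pos(2), of p] by (simp add: left_diff_distrib)
  ultimately show ?thesis by linarith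
qed

text \<open>For a convex power the slope at the right end is the largest one; this is Young's
  inequality with exponent \<open>1 / p\<close>.\<close>

lemma powr_add_le_convex:
  fixes x y p :: real
  assumes "0 \<le> x" "0 \<le> y" "1 \<le> p"
  shows "(x + y) powr p \<le> x powr p + p * (y * (x + y) powr (p - 1))"
proof (cases "x = 0")
  case True
  have "1 * y powr p \<le> p * y powr p" using assms by (intro mult_right_mono) auto
  with True show ?thesis
    using assms by (cases "y = 0") (auto simp: powr_diff)
next
  case False
  with assms have pos: "0 < x" "0 < x + y" by auto
  have "(x powr p) powr (1/p) * ((x + y) powr p) powr (1 - 1/p) \<le> (1/p) * x powr p + (1 - 1/p) * (x + y) powr p"
    using assms pos by (intro Youngs_inequality_0) auto
  also have "(x powr p) powr (1/p) * ((x + y) powr p) powr (1 - 1/p) = x * (x + y) powr (p - 1)"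
    using assms pos by (simp add: powr_powr algebra_simps)
  finally have "p * (x * (x + y) powr (p - 1)) \<le> p * ((1/p) * x powr p + (1 - 1/p) * (x + y) powr p)"
    using assms by (intro mult_left_mono) auto
  also have "\<dots> = x powr p + p * (x + y) powr p - (x + y) powr p"
    using assms by (simp add: field_simps)
  finally have "p * (x * (x + y) powr (p - 1)) \<le> x powr p + p * (x + y) powr p - (x + y) powr p" .
  moreover have "p * (x + y) powr p = p * (x * (x + y) powr (p - 1)) + p * (y * (x + y) powr (p - 1))"
    using mult_powr_pred[OF pos(2), of p] by (simp add: distrib_right flip: distrib_left)
  ultimately show ?thesis by linarith
qed

section \<open>Partial sums over the coarser scales and summation by parts\<close>

definition partial_sum :: "int set \<Rightarrow> (int \<Rightarrow> real) \<Rightarrow> int \<Rightarrow> real"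
  where "partial_sum F a k = (\<Sum>j\<in>{j\<in>F. j \<le> k}. a j)"

lemma partial_sum_nonneg: "(\<And>j. j \<in> F \<Longrightarrow> 0 \<le> a j) \<Longrightarrow> 0 \<le> partial_sum F a k"
  by (auto simp: partial_sum_def intro!: sum_nonneg)

lemma partial_sum_le_sum: "finite F \<Longrightarrow> (\<And>j. j \<in> F \<Longrightarrow> 0 \<le> a j) \<Longrightarrow> partial_sum F a k \<le> (\<Sum>j\<in>F. a j)"
  by (auto simp: partial_sum_def intro!: sum_mono2)

lemma partial_sum_ge: "finite F \<Longrightarrow> (\<And>j. j \<in> F \<Longrightarrow> 0 \<le> a j) \<Longrightarrow> k \<in> F \<Longrightarrow> a k \<le> partial_sum F a k"
  unfolding partial_sum_def by (rule member_le_sum) auto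

lemma partial_sum_insert_max:
  assumes "finite F" "\<And>j. j \<in> F \<Longrightarrow> j < m"
  shows "partial_sum (insert m F) a m = a m + (\<Sum>j\<in>F. a j)"
    and "k \<in> F \<Longrightarrow> partial_sum (insert m F) a k = partial_sum F a k"
proof -
  have m: "m \<notin> F" using assms(2) by blast
  have "{j \<in> insert m F. j \<le> m} = insert m F" using assms(2) by force
  then show "partial_sum (insert m F) a m = a m + (\<Sum>j\<in>F. a j)"
    using assms(1) m by (simp add: partial_sum_def)
  assume "k \<in> F"
  then have "{j \<in> insert m F. j \<le> k} = {j \<in> F. j \<le> k}" using assms(2) by force
  then show "partial_sum (insert m F) a k = partial_sum F a k" by (simp add: partial_sum_def)
qed

text \<open>Summation by parts along the scales: \<open>(\<Sum>k. a k) powr p\<close> is compared with its telescoping increments.\<close>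

lemma sum_powr_le_partial_sum_concave:
  assumes "finite F" "\<And>k. k \<in> F \<Longrightarrow> 0 \<le> a k" "p \<le> 1"
  shows "(\<Sum>k\<in>F. a k) powr p \<le> (\<Sum>k\<in>F. a k * partial_sum F a k powr (p - 1))"
  using assms(1,2)
proof (induction F rule: finite_linorder_max_induct)
  case (insert m F)
  have m: "m \<notin> F" using insert.hyps by blast
  have "(\<Sum>k\<in>insert m F. a k) powr p = ((\<Sum>k\<in>F. a k) + a m) powr p"
    using insert.hyps m by (simp add: add.commute)
  also have "\<dots> \<le> (\<Sum>k\<in>F. a k) powr p + a m * ((\<Sum>k\<in>F. a k) + a m) powr (p - 1)"
    using insert.prems assms(3) by (intro powr_add_le_concave sum_nonneg) auto
  also have "\<dots> \<le> (\<Sum>k\<in>F. a k * partial_sum F a k powr (p - 1)) + a m * ((\<Sum>k\<in>F. a k) + a m) powr (p - 1)"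
    using insert by auto
  also have "\<dots> = (\<Sum>k\<in>insert m F. a k * partial_sum (insert m F) a k powr (p - 1))"
    using insert.hyps m by (simp add: partial_sum_insert_max add.commute)
  finally show ?case .
qed simp

text \<open>This converse, with the loss \<open>p\<close>, allows the summation by parts to be
  undone once the averages have been moved.\<close>

lemma sum_powr_ge_partial_sum_concave:
  assumes "finite F" "\<And>k. k \<in> F \<Longrightarrow> 0 \<le> a k" "0 < p" "p \<le> 1"
  shows "p * (\<Sum>k\<in>F. a k * partial_sum F a k powr (p - 1)) \<le> (\<Sum>k\<in>F. a k) powr p"
  using assms(1,2)
proof (induction F rule: finite_linorder_max_induct)
  case (insert m F)
  have m: "m \<notin> F" using insert.hyps by blast
  have "p * (\<Sum>k\<in>insert m F. a k * partial_sum (insert m F) a k powr (p - 1)) =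
      p * (\<Sum>k\<in>F. a k * partial_sum F a k powr (p - 1)) + p * (a m * ((\<Sum>k\<in>F. a k) + a m) powr (p - 1))"
    using insert.hyps m by (simp add: partial_sum_insert_max add.commute distrib_left)
  also have "\<dots> \<le> (\<Sum>k\<in>F. a k) powr p + p * (a m * ((\<Sum>k\<in>F. a k) + a m) powr (p - 1))"
    using insert by auto
  also have "\<dots> \<le> ((\<Sum>k\<in>F. a k) + a m) powr p"
    using insert.prems assms(3,4) by (intro powr_add_ge_concave sum_nonneg) auto
  also have "\<dots> = (\<Sum>k\<in>insert m F. a k) powr p"
    using insert.hyps m by (simp add: add.commute)
  finally show ?case .
qed simp

lemma sum_powr_le_partial_sum_convex:
  assumes "finite F" "\<And>k. k \<in> F \<Longrightarrow> 0 \<le> a k" "1 \<le> p"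
  shows "(\<Sum>k\<in>F. a k) powr p \<le> p * (\<Sum>k\<in>F. a k * partial_sum F a k powr (p - 1))"
  using assms(1,2)
proof (induction F rule: finite_linorder_max_induct)
  case (insert m F)
  have m: "m \<notin> F" using insert.hyps by blast
  have "(\<Sum>k\<in>insert m F. a k) powr p = ((\<Sum>k\<in>F. a k) + a m) powr p"
    using insert.hyps m by (simp add: add.commute)
  also have "\<dots> \<le> (\<Sum>k\<in>F. a k) powr p + p * (a m * ((\<Sum>k\<in>F. a k) + a m) powr (p - 1))"
    using insert.prems assms(3) by (intro powr_add_le_convex sum_nonneg) auto
  also have "\<dots> \<le> p * (\<Sum>k\<in>F. a k * partial_sum F a k powr (p - 1)) + p * (a m * ((\<Sum>k\<in>F. a k) + a m) powr (p - 1))"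
    using insert by auto
  also have "\<dots> = p * (\<Sum>k\<in>insert m F. a k * partial_sum (insert m F) a k powr (p - 1))"
    using insert.hyps m by (simp add: partial_sum_insert_max add.commute distrib_left)
  finally show ?case .
qed simp

text \<open>Averages with real values: their finiteness is part of the assumption, and real powers
  of their sums, negative ones included, can be taken.\<close>

definition avg_family :: "real \<Rightarrow> int set \<Rightarrow> (int \<Rightarrow> 'a::euclidean_space \<Rightarrow> real) \<Rightarrow> (int \<Rightarrow> 'a \<Rightarrow> real) \<Rightarrow> bool"
  where "avg_family N F a b \<longleftrightarrow> finite F \<and> (\<forall>k\<in>F. b k \<in> borel_measurable borel \<and>
    (\<forall>x. 0 \<le> b k x \<and> 0 \<le> a k x \<and> ennreal (a k x) = avg k N (\<lambda>y. ennreal (b k y)) x))"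

lemma avg_familyD:
  assumes "avg_family N F a b"
  shows "finite F" "k \<in> F \<Longrightarrow> b k \<in> borel_measurable borel" "k \<in> F \<Longrightarrow> 0 \<le> b k x" "k \<in> F \<Longrightarrow> 0 \<le> a k x"
    "k \<in> F \<Longrightarrow> avg k N (\<lambda>y. ennreal (b k y)) x = ennreal (a k x)"
  using assms by (auto simp: avg_family_def)

lemma avg_family_measurable:
  assumes "avg_family N F a b" "k \<in> F"
  shows "a k \<in> borel_measurable borel"
proof -
  have [measurable]: "b k \<in> borel_measurable borel" using avg_familyD(2)[OF assms] .
  have "a k = (\<lambda>x. enn2real (avg k N (\<lambda>y. ennreal (b k y)) x))"
    using avg_familyD(4,5)[OF assms] by auto
  also have "\<dots> \<in> borel_measurable borel" by measurable
  finally show ?thesis .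
qed

lemma partial_sum_measurable:
  assumes "finite F" "\<And>k. k \<in> F \<Longrightarrow> a k \<in> borel_measurable M"
  shows "(\<lambda>x. partial_sum F (\<lambda>k. a k x) j) \<in> borel_measurable M"
  unfolding partial_sum_def using assms by (intro borel_measurable_sum) auto

lemma avg_family_shift:
  assumes "avg_family N F a b" "0 \<le> N" "j \<in> F" "j \<le> k"
  shows "a j x \<le> sdist k x y powr N * a j y"
proof -
  note D = avg_familyD[OF assms(1)]
  have "ennreal (a j x) \<le> ennreal (sdist j x y powr N) * ennreal (a j y)"
    using avg_shift[OF assms(2), of "\<lambda>y. ennreal (b j y)" j x y] D(2)[OF assms(3)] D(5)[OF assms(3)] by simp
  then have "ennreal (a j x) \<le> ennreal (sdist j x y powr N * a j y)"
    using D(4)[OF assms(3)] by (simp add: ennreal_mult)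
  then have "a j x \<le> sdist j x y powr N * a j y"
    using D(4)[OF assms(3)] by (subst (asm) ennreal_le_iff) (auto intro!: mult_nonneg_nonneg)
  also have "\<dots> \<le> sdist k x y powr N * a j y"
    using sdist_mono[OF assms(4), of x y] sdist_ge1[of j x y] assms(2) D(4)[OF assms(3)]
    by (intro mult_right_mono powr_mono2) auto
  finally show ?thesis .
qed

text \<open>Coarser averages vary even more slowly, so the sum of all averages up to scale
  \<open>k\<close> still varies slowly at scale \<open>k\<close>. For this reason the partial sums
  run over the coarser scales.\<close>

lemma partial_sum_shift:
  assumes "avg_family N F a b" "0 \<le> N"
  shows "partial_sum F (\<lambda>j. a j x) k \<le> sdist k x y powr N * partial_sum F (\<lambda>j. a j y) k"
proof -
  have "partial_sum F (\<lambda>j. a j x) k \<le> (\<Sum>j\<in>{j\<in>F. j \<le> k}. sdist k x y powr N * a j y)"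
    unfolding partial_sum_def by (intro sum_mono avg_family_shift[OF assms]) auto
  then show ?thesis by (simp add: partial_sum_def sum_distrib_left)
qed

text \<open>The weight of a cube of side \<open>2 powr - i\<close> varies slowly at every finer
  scale \<open>k\<close>; this is the source of the condition \<open>i \<le> k\<close> on the
  families below.\<close>

lemma kern_coarse_shift:
  fixes x y :: "'a::euclidean_space"
  assumes "i \<le> k" "0 \<le> M"
  shows "kern i M x0 x \<le> sdist k x y powr M * kern i M x0 y"
proof -
  have "kern i M x0 x \<le> sdist i x y powr M * kern i M y x0"
    using kern_shift[OF assms(2), of i x x0 y] by (simp add: kern_commute[of i M x0])
  also have "\<dots> \<le> sdist k x y powr M * kern i M y x0"
    using sdist_mono[OF assms(1), of x y] sdist_ge1[of i x y] assms(2) by (intro mult_right_mono powr_mono2) auto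
  finally show ?thesis by (simp add: kern_commute[of i M x0])
qed

text \<open>After summation by parts, \<open>a k\<close> is an average of \<open>b k\<close> which
  is moved onto \<open>S k powr (p - 1)\<close> times the weight. This costs
  \<open>N * (1 - p) + 2 * n\<close> orders, and \<open>4 * n \<le> N * p\<close> leaves the
  necessary \<open>2 * n\<close>. Domination of \<open>b\<close> by \<open>a\<close> bounds the
  partial sums of \<open>b\<close> by those of \<open>a\<close>; the nonpositive exponent
  \<open>p - 1\<close> reverses the inequality, and the summation by parts is undone for
  \<open>b\<close>.\<close>

lemma vector_valued_concave:
  fixes a b :: "int \<Rightarrow> 'a::euclidean_space \<Rightarrow> real"
  assumes ab: "avg_family N F a b" and F: "\<And>k. k \<in> F \<Longrightarrow> i \<le> k"
    and p: "0 < p" "p \<le> 1" and D: "0 < D" "\<And>k x. k \<in> F \<Longrightarrow> b k x \<le> D * a k x"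
    and N: "4 * real DIM('a) \<le> N * p"
  shows "(\<integral>\<^sup>+x. ennreal ((\<Sum>k\<in>F. a k x) powr p * kern i (2 * real DIM('a)) x0 x) \<partial>lborel)
    \<le> ennreal (2 ^ DIM('a) * D powr (1 - p) / p) *
      (\<integral>\<^sup>+x. ennreal ((\<Sum>k\<in>F. b k x) powr p * kern i (2 * real DIM('a)) x0 x) \<partial>lborel)"
proof -
  define n where "n = real DIM('a)"
  define S where "S k x = partial_sum F (\<lambda>j. a j x) k" for k x
  define w where "w x = kern i (2 * n) x0 x" for x
  note fin = avg_familyD(1)[OF ab]
  have [measurable]: "b k \<in> borel_measurable borel" "a k \<in> borel_measurable borel" if "k \<in> F" for k
    using avg_familyD(2)[OF ab that] avg_family_measurable[OF ab that] by auto
  have b0: "0 \<le> b k x" and a0: "0 \<le> a k x" if "k \<in> F" for k x using avg_familyD[OF ab] that by auto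
  have [measurable]: "S k \<in> borel_measurable borel" for k
    unfolding S_def using fin by (intro partial_sum_measurable) auto
  have [measurable]: "w \<in> borel_measurable borel" unfolding w_def by measurable
  have w0: "0 \<le> w x" for x by (simp add: w_def)
  have n0: "0 \<le> n" by (simp add: n_def)
  have N0: "0 \<le> N" using N p by (smt (verit) mult_nonneg_nonneg of_nat_0_le_iff zero_less_mult_pos2 mult_neg_pos)
  have S0: "0 \<le> S k x" for k x unfolding S_def by (intro partial_sum_nonneg a0)
  have Sshift: "S k x \<le> sdist k x y powr N * S k y" for k x y
    unfolding S_def by (rule partial_sum_shift[OF ab N0])
  \<comment> \<open>As the exponent is nonpositive, the shift of \<open>S k\<close> is used in the
    direction from \<open>y\<close> to \<open>x\<close>. If \<open>S k x\<close> vanishes, the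
    left-hand side is 0 by the convention for \<open>powr\<close>.\<close>
  have Spow: "S k x powr (p - 1) \<le> sdist k x y powr (N * (1 - p)) * S k y powr (p - 1)" for k x y
  proof (cases "S k x = 0")
    case True
    then show ?thesis by simp
  next
    case False
    then have pos: "0 < S k x" "0 < S k y"
      using S0[of k x] S0[of k y] Sshift[of k x y] by (auto simp: less_le)
    have "(sdist k x y powr N * S k x) powr (p - 1) \<le> S k y powr (p - 1)"
      using pos p Sshift[of k y x] by (intro powr_mono2') (auto simp: sdist_commute)
    then have "sdist k x y powr (N * (p - 1)) * S k x powr (p - 1) \<le> S k y powr (p - 1)"
      using pos sdist_pos[of k x y] by (simp add: powr_mult powr_powr)
    then have "sdist k x y powr (N * (1 - p)) * (sdist k x y powr (N * (p - 1)) * S k x powr (p - 1))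
        \<le> sdist k x y powr (N * (1 - p)) * S k y powr (p - 1)"
      by (intro mult_left_mono) auto
    moreover have "sdist k x y powr (N * (1 - p)) * sdist k x y powr (N * (p - 1)) = 1"
      using sdist_pos[of k x y] by (simp add: algebra_simps flip: powr_add)
    ultimately show ?thesis by (simp add: mult.assoc[symmetric])
  qed
  have trans: "(\<integral>\<^sup>+x. ennreal (a k x * S k x powr (p - 1) * w x) \<partial>lborel) \<le>
      ennreal (2 ^ DIM('a)) * (\<integral>\<^sup>+x. ennreal (b k x * S k x powr (p - 1) * w x) \<partial>lborel)" if k: "k \<in> F" for k
  proof -
    have "(\<integral>\<^sup>+x. ennreal (a k x * S k x powr (p - 1) * w x) \<partial>lborel) =
       (\<integral>\<^sup>+x. avg k N (\<lambda>y. ennreal (b k y)) x * ennreal (S k x powr (p - 1) * w x) \<partial>lborel)"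
      using a0[OF k] w0 by (simp add: avg_familyD(5)[OF ab k] mult.assoc flip: ennreal_mult)
    also have "\<dots> \<le> ennreal (2 ^ DIM('a)) * (\<integral>\<^sup>+x. ennreal (b k x) * ennreal (S k x powr (p - 1) * w x) \<partial>lborel)"
    proof (rule avg_transfer[where M = "N * (1 - p) + 2 * n"])
      show "2 * real DIM('a) \<le> N - (N * (1 - p) + 2 * n)"
        using N by (simp add: n_def algebra_simps)
      fix x y :: 'a
      have "S k x powr (p - 1) * w x \<le> (sdist k x y powr (N * (1 - p)) * S k y powr (p - 1)) * (sdist k x y powr (2 * n) * w y)"
        using F[OF k] n0 by (intro mult_mono Spow) (auto simp: w_def intro!: kern_coarse_shift)
      also have "\<dots> = sdist k x y powr (N * (1 - p) + 2 * n) * (S k y powr (p - 1) * w y)"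
        by (simp add: powr_add mult_ac)
      finally show "ennreal (S k x powr (p - 1) * w x) \<le>
          ennreal (sdist k x y powr (N * (1 - p) + 2 * n)) * ennreal (S k y powr (p - 1) * w y)"
        by (simp add: w0 flip: ennreal_mult)
    qed (use k in auto)
    also have "\<dots> = ennreal (2 ^ DIM('a)) * (\<integral>\<^sup>+x. ennreal (b k x * S k x powr (p - 1) * w x) \<partial>lborel)"
      using b0[OF k] w0 by (simp add: mult.assoc flip: ennreal_mult)
    finally show ?thesis .
  qed
  have lower: "(\<Sum>k\<in>F. b k x * S k x powr (p - 1)) \<le> D powr (1 - p) / p * (\<Sum>k\<in>F. b k x) powr p" for x
  proof -
    have "b k x * S k x powr (p - 1) \<le> D powr (1 - p) * (b k x * partial_sum F (\<lambda>j. b j x) k powr (p - 1))" if k: "k \<in> F" for k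
    proof (cases "b k x = 0")
      case False
      then have "0 < b k x" using b0[OF k, of x] by simp
      then have B: "0 < partial_sum F (\<lambda>j. b j x) k" using partial_sum_ge[of F "\<lambda>j. b j x" k] fin b0 k by force
      have "partial_sum F (\<lambda>j. b j x) k \<le> (\<Sum>j\<in>{j\<in>F. j \<le> k}. D * a j x)"
        unfolding partial_sum_def by (intro sum_mono D(2)) auto
      then have le: "partial_sum F (\<lambda>j. b j x) k / D \<le> S k x"
        using D(1) by (simp add: S_def partial_sum_def field_simps flip: sum_distrib_left)
      have "S k x powr (p - 1) \<le> (partial_sum F (\<lambda>j. b j x) k / D) powr (p - 1)"
        using B D(1) p by (intro powr_mono2' le) auto
      also have "\<dots> = partial_sum F (\<lambda>j. b j x) k powr (p - 1) * D powr (1 - p)"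
        using B D(1) by (simp add: powr_divide powr_diff)
      finally show ?thesis using b0[OF k, of x] by (simp add: mult_left_mono mult_ac)
    qed simp
    then have "(\<Sum>k\<in>F. b k x * S k x powr (p - 1)) \<le> D powr (1 - p) * (\<Sum>k\<in>F. b k x * partial_sum F (\<lambda>j. b j x) k powr (p - 1))"
      by (subst sum_distrib_left) (intro sum_mono)
    also have "(\<Sum>k\<in>F. b k x * partial_sum F (\<lambda>j. b j x) k powr (p - 1)) \<le> (\<Sum>k\<in>F. b k x) powr p / p"
      using sum_powr_ge_partial_sum_concave[of F "\<lambda>j. b j x" p] fin b0 p by (simp add: field_simps)
    finally show ?thesis by (simp add: mult_left_mono)
  qed
  have "(\<integral>\<^sup>+x. ennreal ((\<Sum>k\<in>F. a k x) powr p * w x) \<partial>lborel) \<le>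
      (\<integral>\<^sup>+x. (\<Sum>k\<in>F. ennreal (a k x * S k x powr (p - 1) * w x)) \<partial>lborel)"
  proof (intro nn_integral_mono)
    fix x
    have "(\<Sum>k\<in>F. a k x) powr p * w x \<le> (\<Sum>k\<in>F. a k x * S k x powr (p - 1)) * w x"
      unfolding S_def using fin a0 p w0 by (intro mult_right_mono sum_powr_le_partial_sum_concave) auto
    then show "ennreal ((\<Sum>k\<in>F. a k x) powr p * w x) \<le> (\<Sum>k\<in>F. ennreal (a k x * S k x powr (p - 1) * w x))"
      using a0 w0 by (subst sum_ennreal) (auto simp: sum_distrib_right intro!: ennreal_leI)
  qed
  also have "\<dots> = (\<Sum>k\<in>F. \<integral>\<^sup>+x. ennreal (a k x * S k x powr (p - 1) * w x) \<partial>lborel)"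
    by (rule nn_integral_sum) auto
  also have "\<dots> \<le> (\<Sum>k\<in>F. ennreal (2 ^ DIM('a)) * (\<integral>\<^sup>+x. ennreal (b k x * S k x powr (p - 1) * w x) \<partial>lborel))"
    by (intro sum_mono trans)
  also have "\<dots> = ennreal (2 ^ DIM('a)) * (\<integral>\<^sup>+x. (\<Sum>k\<in>F. ennreal (b k x * S k x powr (p - 1) * w x)) \<partial>lborel)"
    by (subst nn_integral_sum) (auto simp: sum_distrib_left)
  also have "\<dots> \<le> ennreal (2 ^ DIM('a)) * (\<integral>\<^sup>+x. ennreal (D powr (1 - p) / p) * ennreal ((\<Sum>k\<in>F. b k x) powr p * w x) \<partial>lborel)"
  proof (intro mult_left_mono nn_integral_mono)
    fix x
    have "(\<Sum>k\<in>F. b k x * S k x powr (p - 1)) * w x \<le> D powr (1 - p) / p * (\<Sum>k\<in>F. b k x) powr p * w x"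
      by (intro mult_right_mono lower w0)
    then show "(\<Sum>k\<in>F. ennreal (b k x * S k x powr (p - 1) * w x)) \<le>
        ennreal (D powr (1 - p) / p) * ennreal ((\<Sum>k\<in>F. b k x) powr p * w x)"
      using b0 w0 p by (subst sum_ennreal) (auto simp: sum_distrib_right mult.assoc intro!: ennreal_leI simp flip: ennreal_mult)
  qed auto
  also have "\<dots> = ennreal (2 ^ DIM('a)) * (ennreal (D powr (1 - p) / p) * (\<integral>\<^sup>+x. ennreal ((\<Sum>k\<in>F. b k x) powr p * w x) \<partial>lborel))"
    by (subst nn_integral_cmult) auto
  also have "\<dots> = ennreal (2 ^ DIM('a) * D powr (1 - p) / p) * (\<integral>\<^sup>+x. ennreal ((\<Sum>k\<in>F. b k x) powr p * w x) \<partial>lborel)"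
    using p by (simp add: mult.assoc[symmetric] flip: ennreal_mult)
  finally show ?thesis unfolding w_def n_def .
qed

section \<open>The vector-valued inequality for exponents at least one\<close>

lemma sdist_triangle_add: "sdist k x z \<le> sdist k x y + sdist k y z"
proof -
  have "2 powr real_of_int k * dist x z \<le> 2 powr real_of_int k * (dist x y + dist y z)"
    by (intro mult_left_mono dist_triangle) auto
  then show ?thesis by (simp add: sdist_def distrib_left)
qed

text \<open>The part of the average within distance \<open>2 ^ l\<close>, in units of
  \<open>2 powr - k\<close>. It is normalised by the volume at scale \<open>k\<close> and not by
  that of the ball, so that \<open>avg\<close> is recovered from the weights
  \<open>2 powr (- real l * N)\<close> up to a constant.\<close>

definition ball_avg :: "int \<Rightarrow> nat \<Rightarrow> ('a::euclidean_space \<Rightarrow> ennreal) \<Rightarrow> 'a \<Rightarrow> ennreal"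
  where "ball_avg k l b x = (\<integral>\<^sup>+y. ennreal (2 powr (real_of_int k * real DIM('a)) * indicator {..2 ^ l} (sdist k x y)) * b y \<partial>lborel)"

lemma ball_avg_measurable [measurable]:
  assumes [measurable]: "b \<in> borel_measurable borel"
  shows "ball_avg k l b \<in> borel_measurable borel"
  unfolding ball_avg_def[abs_def] by measurable

lemma pow2_powr: "((2::real) ^ l) powr c = 2 powr (real l * c)"
  by (simp add: powr_powr flip: powr_realpow)

text \<open>Balls of radius \<open>2 ^ l\<close> about nearby points lie in one of radius
  \<open>2 * 2 ^ l\<close>. The additive triangle inequality matters: the product form would give
  the radius \<open>4 ^ l\<close>, and for \<open>p \<ge> 2\<close> the resulting loss could not be
  summed over \<open>l\<close>.\<close>

lemma ball_avg_le_avg: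
  fixes x y :: "'a::euclidean_space"
  assumes [measurable]: "b \<in> borel_measurable borel" and "0 \<le> N" "sdist k x y \<le> 2 ^ l" "j \<le> k"
  shows "ball_avg j l b x \<le> ennreal ((2 * 2 ^ l) powr N) * avg j N b y"
proof -
  have "ball_avg j l b x \<le> (\<integral>\<^sup>+z. ennreal ((2 * 2 ^ l) powr N) * (ennreal (kern j N y z) * b z) \<partial>lborel)"
    unfolding ball_avg_def
  proof (intro nn_integral_mono)
    fix z
    have "2 powr (real_of_int j * real DIM('a)) * indicator {..2 ^ l} (sdist j x z) \<le> (2 * 2 ^ l) powr N * kern j N y z"
    proof (cases "sdist j x z \<le> 2 ^ l")
      case True
      have "sdist j y z \<le> sdist j y x + sdist j x z" by (rule sdist_triangle_add)
      also have "\<dots> \<le> 2 * 2 ^ l"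
        using sdist_mono[OF assms(4), of x y] assms(3) True by (simp add: sdist_commute[of j y x])
      finally have "sdist j y z powr N \<le> (2 * 2 ^ l) powr N"
        using assms(2) sdist_ge1[of j y z] by (intro powr_mono2) auto
      then have "1 \<le> (2 * 2 ^ l) powr N * sdist j y z powr (-N)"
        using sdist_pos[of j y z] by (simp add: powr_minus field_simps)
      then have "2 powr (real_of_int j * real DIM('a)) * 1 \<le> 2 powr (real_of_int j * real DIM('a)) * ((2 * 2 ^ l) powr N * sdist j y z powr (-N))"
        by (intro mult_left_mono) auto
      then show ?thesis using True by (simp add: kern_def mult_ac)
    qed simp
    then have "ennreal (2 powr (real_of_int j * real DIM('a)) * indicator {..2 ^ l} (sdist j x z)) * b z \<le>
       ennreal ((2 * 2 ^ l) powr N * kern j N y z) * b z"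
      by (intro mult_right_mono ennreal_leI) auto
    then show "ennreal (2 powr (real_of_int j * real DIM('a)) * indicator {..2 ^ l} (sdist j x z)) * b z \<le>
       ennreal ((2 * 2 ^ l) powr N) * (ennreal (kern j N y z) * b z)"
      by (simp add: ennreal_mult mult.assoc)
  qed
  also have "\<dots> = ennreal ((2 * 2 ^ l) powr N) * avg j N b y"
    unfolding avg_def by (rule nn_integral_cmult) auto
  finally show ?thesis .
qed

text \<open>A ball kernel compares the weights at distance at most \<open>2 ^ l\<close>, so no decay
  has to be spent on their variation. The price is the mass of the ball, bounded through a kernel of
  order \<open>2 * real DIM('a)\<close>.\<close>

lemma ball_avg_transfer:
  fixes w w' :: "'a::euclidean_space \<Rightarrow> ennreal"
  assumes [measurable]: "b \<in> borel_measurable borel" "w \<in> borel_measurable borel" "w' \<in> borel_measurable borel"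
    and w: "\<And>x y. sdist k x y \<le> 2 ^ l \<Longrightarrow> w x \<le> w' y"
  shows "(\<integral>\<^sup>+x. ball_avg k l b x * w x \<partial>lborel) \<le> ennreal (2 ^ DIM('a) * (2 ^ l) powr (2 * real DIM('a))) * (\<integral>\<^sup>+y. b y * w' y \<partial>lborel)"
proof -
  define K where "K x y = 2 powr (real_of_int k * real DIM('a)) * indicator {..2 ^ l} (sdist k x y)" for x y :: 'a
  have [measurable (raw)]: "f \<in> borel_measurable M \<Longrightarrow> g \<in> borel_measurable M \<Longrightarrow> (\<lambda>w. K (f w) (g w)) \<in> borel_measurable M"
    for f g and M :: "'c measure" unfolding K_def by measurable
  have Kle: "K x y \<le> (2 ^ l) powr (2 * real DIM('a)) * kern k (2 * real DIM('a)) x y" for x y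
  proof (cases "sdist k x y \<le> 2 ^ l")
    case True
    then have "sdist k x y powr (2 * real DIM('a)) \<le> (2 ^ l) powr (2 * real DIM('a))"
      using sdist_ge1[of k x y] by (intro powr_mono2) auto
    then have "1 \<le> (2 ^ l) powr (2 * real DIM('a)) * sdist k x y powr (- (2 * real DIM('a)))"
      using sdist_pos[of k x y] by (simp add: powr_minus field_simps)
    then have "2 powr (real_of_int k * real DIM('a)) * 1 \<le> 2 powr (real_of_int k * real DIM('a)) * ((2 ^ l) powr (2 * real DIM('a)) * sdist k x y powr (- (2 * real DIM('a))))"
      by (intro mult_left_mono) auto
    then show ?thesis using True by (simp add: K_def kern_def mult_ac)
  qed (auto simp: K_def)
  have "(\<integral>\<^sup>+x. ball_avg k l b x * w x \<partial>lborel) = (\<integral>\<^sup>+x. (\<integral>\<^sup>+y. ennreal (K x y) * b y * w x \<partial>lborel) \<partial>lborel)"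
    unfolding ball_avg_def K_def[symmetric] by (subst nn_integral_multc) auto
  also have "\<dots> \<le> (\<integral>\<^sup>+x. (\<integral>\<^sup>+y. ennreal (K x y) * (b y * w' y) \<partial>lborel) \<partial>lborel)"
  proof (intro nn_integral_mono)
    fix x y
    show "ennreal (K x y) * b y * w x \<le> ennreal (K x y) * (b y * w' y)"
    proof (cases "sdist k x y \<le> 2 ^ l")
      case True
      then show ?thesis unfolding mult.assoc by (intro mult_left_mono w) auto
    qed (auto simp: K_def)
  qed
  also have "\<dots> = (\<integral>\<^sup>+y. (\<integral>\<^sup>+x. ennreal (K x y) * (b y * w' y) \<partial>lborel) \<partial>lborel)"
    by (rule lborel_pair.Fubini') measurable
  also have "\<dots> = (\<integral>\<^sup>+y. (\<integral>\<^sup>+x. ennreal (K x y) \<partial>lborel) * (b y * w' y) \<partial>lborel)"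
    by (subst nn_integral_multc) auto
  also have "\<dots> \<le> (\<integral>\<^sup>+y. ennreal (2 ^ DIM('a) * (2 ^ l) powr (2 * real DIM('a))) * (b y * w' y) \<partial>lborel)"
  proof (intro nn_integral_mono mult_right_mono)
    fix y
    have "(\<integral>\<^sup>+x. ennreal (K x y) \<partial>lborel) \<le> (\<integral>\<^sup>+x. ennreal ((2 ^ l) powr (2 * real DIM('a))) * ennreal (kern k (2 * real DIM('a)) x y) \<partial>lborel)"
      by (intro nn_integral_mono) (auto simp flip: ennreal_mult intro!: ennreal_leI Kle)
    also have "\<dots> = ennreal ((2 ^ l) powr (2 * real DIM('a))) * (\<integral>\<^sup>+x. ennreal (kern k (2 * real DIM('a)) x y) \<partial>lborel)"
      by (rule nn_integral_cmult) auto
    also have "\<dots> \<le> ennreal ((2 ^ l) powr (2 * real DIM('a))) * ennreal (2 ^ DIM('a))"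
      by (intro mult_left_mono nn_integral_kern_le') auto
    also have "\<dots> = ennreal (2 ^ DIM('a) * (2 ^ l) powr (2 * real DIM('a)))"
      by (simp add: mult_ac flip: ennreal_mult)
    finally show "(\<integral>\<^sup>+x. ennreal (K x y) \<partial>lborel) \<le> ennreal (2 ^ DIM('a) * (2 ^ l) powr (2 * real DIM('a)))" .
  qed auto
  also have "\<dots> = ennreal (2 ^ DIM('a) * (2 ^ l) powr (2 * real DIM('a))) * (\<integral>\<^sup>+y. b y * w' y \<partial>lborel)"
    by (rule nn_integral_cmult) auto
  finally show ?thesis .
qed

lemma avg_le_suminf_ball_avg:
  fixes b :: "'a::euclidean_space \<Rightarrow> ennreal"
  assumes [measurable]: "b \<in> borel_measurable borel" and "0 \<le> N"
  shows "avg k N b x \<le> (\<Sum>l. ennreal (2 powr (N - real l * N)) * ball_avg k l b x)"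
proof -
  define K where "K l y = 2 powr (real_of_int k * real DIM('a)) * indicator {..2 ^ l} (sdist k x y)" for l and y :: 'a
  have [measurable]: "K l \<in> borel_measurable borel" for l unfolding K_def by measurable
  have "avg k N b x \<le> (\<integral>\<^sup>+y. (\<Sum>l. ennreal (2 powr (N - real l * N)) * (ennreal (K l y) * b y)) \<partial>lborel)"
    unfolding avg_def
  proof (intro nn_integral_mono)
    fix y
    obtain m :: nat where m: "sdist k x y \<le> 2 ^ m"
      using real_arch_pow[of 2 "sdist k x y"] by (auto intro: less_imp_le)
    \<comment> \<open>The least radius that reaches \<open>y\<close>: unless \<open>l = 0\<close>,
      the next smaller radius fails, which accounts for the offset \<open>N\<close> in the exponent
      \<open>N - real l * N\<close>.\<close>
    define l where "l = (LEAST l. sdist k x y \<le> 2 ^ l)"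
    have l: "sdist k x y \<le> 2 ^ l" unfolding l_def by (rule LeastI[of _ m]) (rule m)
    have "sdist k x y powr (-N) \<le> 2 powr (N - real l * N)"
    proof (cases "l = 0")
      case True
      have "sdist k x y powr (-N) \<le> sdist k x y powr 0" using sdist_ge1[of k x y] assms(2) by (intro powr_mono) auto
      also have "\<dots> \<le> 1" by simp
      also have "1 \<le> 2 powr (N - real l * N)" using True assms(2) by (simp add: ge_one_powr_ge_zero)
      finally show ?thesis .
    next
      case False
      then have "\<not> sdist k x y \<le> 2 ^ (l - 1)" unfolding l_def using not_less_Least by (metis diff_less l_def less_one not_gr0)
      then have "sdist k x y powr (-N) \<le> (2 ^ (l - 1)) powr (-N)"
        using assms(2) by (intro powr_mono2') auto
      also have "\<dots> = 2 powr (N - real l * N)"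
        using False by (cases l) (auto simp: pow2_powr algebra_simps)
      finally show ?thesis .
    qed
    then have "kern k N x y \<le> 2 powr (N - real l * N) * K l y"
      using l by (auto simp: kern_def K_def mult.commute intro!: mult_left_mono)
    then have "ennreal (kern k N x y) * b y \<le> ennreal (2 powr (N - real l * N)) * (ennreal (K l y) * b y)"
      by (auto simp: K_def mult.assoc[symmetric] simp flip: ennreal_mult intro!: mult_right_mono ennreal_leI)
    also have "\<dots> = (\<Sum>l'\<in>{l}. ennreal (2 powr (N - l' * N)) * (ennreal (K l' y) * b y))" by simp
    also have "\<dots> \<le> (\<Sum>l. ennreal (2 powr (N - real l * N)) * (ennreal (K l y) * b y))"
      by (rule sum_le_suminf) auto
    finally show "ennreal (kern k N x y) * b y \<le> \<dots>" .
  qed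
  also have "\<dots> = (\<Sum>l. \<integral>\<^sup>+y. ennreal (2 powr (N - real l * N)) * (ennreal (K l y) * b y) \<partial>lborel)"
    by (rule nn_integral_suminf) auto
  also have "\<dots> = (\<Sum>l. ennreal (2 powr (N - real l * N)) * ball_avg k l b x)"
    unfolding ball_avg_def K_def[symmetric] by (intro suminf_cong nn_integral_cmult) auto
  finally show ?thesis .
qed

lemma two_powr_minus: "2 powr (- real l) = (1/2) ^ l"
  using powr_realpow[of "1/2" l] by (simp add: powr_divide powr_minus inverse_eq_divide)

lemma two_powr_minus_two: "2 powr (- real l - 2) = (1/2) ^ l / 4"
proof -
  have "2 powr (- real l - 2) = 2 powr (- real l) / 4" by (subst powr_diff) simp
  then show ?thesis by (simp only: two_powr_minus)
qed

lemma le_mult_powr_minus: "a * 2 powr e \<le> b \<Longrightarrow> a \<le> b * 2 powr (- e)" for a b e :: real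
  by (simp add: powr_minus field_simps)

text \<open>For large \<open>p\<close> the variation of \<open>S k powr (p - 1)\<close> costs about
  \<open>N * (p - 1)\<close> orders, more than the kernel has, and raising \<open>N\<close> does not
  help. The average is therefore cut into balls, on which partial sums can be compared with bounded
  loss, and at each point a single ball carries a sufficient share of the total. The factor
  \<open>(\<Sum>k\<in>F. a k x) powr (p - 1)\<close> that stays on the right is removed afterwards
  by absorption.\<close>

lemma vector_valued_convex_aux:
  fixes a b :: "int \<Rightarrow> 'a::euclidean_space \<Rightarrow> real"
  assumes ab: "avg_family N F a b" and F: "\<And>k. k \<in> F \<Longrightarrow> i \<le> k"
    and p: "1 \<le> p"
    and N: "4 * real DIM('a) + p + 1 \<le> N"
  shows "(\<integral>\<^sup>+x. ennreal ((\<Sum>k\<in>F. a k x) powr p * kern i (2 * real DIM('a)) x0 x) \<partial>lborel)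
    \<le> ennreal (2 * 2 powr ((N + 2) * p) * (p * 2 powr (N * (p - 1) + DIM('a)))) *
      (\<integral>\<^sup>+x. ennreal ((\<Sum>k\<in>F. b k x) * (\<Sum>k\<in>F. a k x) powr (p - 1) * kern i (2 * real DIM('a)) x0 x) \<partial>lborel)"
proof -
  define n where "n = real DIM('a)"
  define S where "S k x = partial_sum F (\<lambda>j. a j x) k" for k x
  define T where "T x = (\<Sum>k\<in>F. a k x)" for x
  define w where "w x = kern i (2 * n) x0 x" for x
  define d where "d l k x = enn2real (ball_avg k l (\<lambda>y. ennreal (b k y)) x)" for l k x
  define E where "E l x = (\<Sum>k\<in>F. d l k x)" for l x
  define I where "I = (\<integral>\<^sup>+x. ennreal ((\<Sum>k\<in>F. b k x) * T x powr (p - 1) * w x) \<partial>lborel)"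
  note fin = avg_familyD(1)[OF ab]
  have [measurable]: "b k \<in> borel_measurable borel" "a k \<in> borel_measurable borel" if "k \<in> F" for k
    using avg_familyD(2)[OF ab that] avg_family_measurable[OF ab that] by auto
  have b0: "0 \<le> b k x" and a0: "0 \<le> a k x" if "k \<in> F" for k x using avg_familyD[OF ab] that by auto
  have [measurable]: "S k \<in> borel_measurable borel" for k
    unfolding S_def using fin by (intro partial_sum_measurable) auto
  have [measurable]: "w \<in> borel_measurable borel" unfolding w_def by measurable
  have [measurable]: "T \<in> borel_measurable borel" unfolding T_def by measurable
  have [measurable]: "d l k \<in> borel_measurable borel" if "k \<in> F" for l k
    using that unfolding d_def by measurable
  have [measurable]: "E l \<in> borel_measurable borel" for l unfolding E_def by measurable
  have w0: "0 \<le> w x" for x by (simp add: w_def)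
  have n0: "0 \<le> n" by (simp add: n_def)
  have N0: "0 \<le> N" using N p by (smt (verit) of_nat_0_le_iff)
  have S0: "0 \<le> S k x" for k x unfolding S_def by (intro partial_sum_nonneg a0)
  have T0: "0 \<le> T x" for x unfolding T_def by (intro sum_nonneg a0)
  have d0: "0 \<le> d l k x" for l k x by (simp add: d_def)
  have ST: "S k x \<le> T x" for k x unfolding S_def T_def by (intro partial_sum_le_sum fin a0)
  have Bfin: "ball_avg k l (\<lambda>y. ennreal (b k y)) x = ennreal (d l k x)" if k: "k \<in> F" for k l x
  proof -
    have "ball_avg k l (\<lambda>y. ennreal (b k y)) x \<le> ennreal ((2 * 2 ^ l) powr N) * avg k N (\<lambda>y. ennreal (b k y)) x"
      using k N0 by (intro ball_avg_le_avg) auto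
    also have "\<dots> < \<infinity>" using avg_familyD(5)[OF ab k] by (simp add: ennreal_mult_less_top)
    finally show ?thesis by (simp add: d_def)
  qed
  have dle: "d l j x \<le> (2 * 2 ^ l) powr N * a j y" if "sdist k x y \<le> 2 ^ l" "j \<le> k" "j \<in> F" for l j k x y
  proof -
    have "ennreal (d l j x) \<le> ennreal ((2 * 2 ^ l) powr N) * ennreal (a j y)"
      using ball_avg_le_avg[OF _ N0 that(1,2), of "\<lambda>y. ennreal (b j y)"] that(3)
      by (simp add: Bfin avg_familyD(5)[OF ab that(3)])
    then show ?thesis using a0[OF that(3)]
      by (subst (asm) ennreal_mult[symmetric]) (auto intro!: mult_nonneg_nonneg)
  qed
  \<comment> \<open>Partial sums of the truncated averages at \<open>x\<close> are bounded by
    partial sums of the full averages at any nearby \<open>y\<close>. This replaces the slow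
    variation used for \<open>p \<le> 1\<close>.\<close>
  have Dle: "partial_sum F (\<lambda>j. d l j x) k \<le> (2 * 2 ^ l) powr N * S k y" if "sdist k x y \<le> 2 ^ l" for l k x y
    unfolding partial_sum_def S_def by (subst sum_distrib_left) (intro sum_mono dle[OF that], auto)
  \<comment> \<open>In the exponent of \<open>2 ^ l\<close>, the term \<open>N * (p - 1)\<close>
    comes from the partial sums, one \<open>2 * n\<close> from the weight and the other from the
    mass of the ball.\<close>
  have El: "(\<integral>\<^sup>+x. ennreal (E l x powr p * w x) \<partial>lborel) \<le>
      ennreal (p * 2 powr (N * (p - 1) + n) * 2 powr (real l * (N * (p - 1) + 4 * n))) * I" for l
  proof -
    have [measurable]: "(\<lambda>x. partial_sum F (\<lambda>k. d l k x) j) \<in> borel_measurable borel" for j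
      using fin by (intro partial_sum_measurable) auto
    define c where "c = (2 * 2 ^ l) powr (N * (p - 1)) * (2 ^ l) powr (2 * n)"
    have c0: "0 \<le> c" by (simp add: c_def)
    have c1: "2 ^ DIM('a) * (2 ^ l) powr (2 * n) * c = 2 powr (N * (p - 1) + n) * 2 powr (real l * (N * (p - 1) + 4 * n))"
    proof -
      have "2 ^ DIM('a) = (2::real) powr n" by (simp add: n_def powr_realpow)
      then show ?thesis unfolding c_def
        by (simp add: powr_mult pow2_powr algebra_simps flip: powr_add)
    qed
    have tr: "(\<integral>\<^sup>+x. ennreal (d l k x * partial_sum F (\<lambda>j. d l j x) k powr (p - 1) * w x) \<partial>lborel) \<le>
      ennreal (2 ^ DIM('a) * (2 ^ l) powr (2 * n)) * (ennreal c * (\<integral>\<^sup>+x. ennreal (b k x * S k x powr (p - 1) * w x) \<partial>lborel))"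
      if k: "k \<in> F" for k
    proof -
      have "(\<integral>\<^sup>+x. ennreal (d l k x * partial_sum F (\<lambda>j. d l j x) k powr (p - 1) * w x) \<partial>lborel) =
        (\<integral>\<^sup>+x. ball_avg k l (\<lambda>y. ennreal (b k y)) x * ennreal (partial_sum F (\<lambda>j. d l j x) k powr (p - 1) * w x) \<partial>lborel)"
        using d0 w0 by (simp add: Bfin[OF k] mult.assoc flip: ennreal_mult)
      also have "\<dots> \<le> ennreal (2 ^ DIM('a) * (2 ^ l) powr (2 * real DIM('a))) *
          (\<integral>\<^sup>+x. ennreal (b k x) * (ennreal c * ennreal (S k x powr (p - 1) * w x)) \<partial>lborel)"
      proof (rule ball_avg_transfer)
        fix x y :: 'a assume xy: "sdist k x y \<le> 2 ^ l"
        have "partial_sum F (\<lambda>j. d l j x) k powr (p - 1) \<le> ((2 * 2 ^ l) powr N * S k y) powr (p - 1)"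
          using Dle[OF xy] p d0 by (intro powr_mono2) (auto intro!: partial_sum_nonneg)
        also have "\<dots> = (2 * 2 ^ l) powr (N * (p - 1)) * S k y powr (p - 1)"
          using S0 by (simp add: powr_mult powr_powr)
        finally have 1: "partial_sum F (\<lambda>j. d l j x) k powr (p - 1) \<le> (2 * 2 ^ l) powr (N * (p - 1)) * S k y powr (p - 1)" .
        have "w x \<le> sdist k x y powr (2 * n) * w y"
          unfolding w_def using F[OF k] n0 by (intro kern_coarse_shift) auto
        also have "\<dots> \<le> (2 ^ l) powr (2 * n) * w y"
          using xy n0 w0 sdist_ge1[of k x y] by (intro mult_right_mono powr_mono2) auto
        finally have "partial_sum F (\<lambda>j. d l j x) k powr (p - 1) * w x \<le>
            ((2 * 2 ^ l) powr (N * (p - 1)) * S k y powr (p - 1)) * ((2 ^ l) powr (2 * n) * w y)"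
          using 1 w0 by (intro mult_mono) auto
        then show "ennreal (partial_sum F (\<lambda>j. d l j x) k powr (p - 1) * w x) \<le> ennreal c * ennreal (S k y powr (p - 1) * w y)"
          using w0 c0 by (auto simp: c_def mult_ac simp flip: ennreal_mult intro!: ennreal_leI)
      qed (use k in auto)
      also have "(\<integral>\<^sup>+x. ennreal (b k x) * (ennreal c * ennreal (S k x powr (p - 1) * w x)) \<partial>lborel) =
        (\<integral>\<^sup>+x. ennreal c * ennreal (b k x * S k x powr (p - 1) * w x) \<partial>lborel)"
        using b0[OF k] w0 c0 by (intro nn_integral_cong) (simp add: mult_ac flip: ennreal_mult)
      also have "\<dots> = ennreal c * (\<integral>\<^sup>+x. ennreal (b k x * S k x powr (p - 1) * w x) \<partial>lborel)"
        using k by (intro nn_integral_cmult) auto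
      finally show ?thesis by (simp add: n_def)
    qed
    have "(\<integral>\<^sup>+x. ennreal (E l x powr p * w x) \<partial>lborel) \<le>
        (\<integral>\<^sup>+x. (\<Sum>k\<in>F. ennreal p * ennreal (d l k x * partial_sum F (\<lambda>j. d l j x) k powr (p - 1) * w x)) \<partial>lborel)"
    proof (intro nn_integral_mono)
      fix x
      have "E l x powr p * w x \<le> p * (\<Sum>k\<in>F. d l k x * partial_sum F (\<lambda>j. d l j x) k powr (p - 1)) * w x"
        unfolding E_def using fin d0 p w0 by (intro mult_right_mono sum_powr_le_partial_sum_convex) auto
      also have "\<dots> = (\<Sum>k\<in>F. p * (d l k x * partial_sum F (\<lambda>j. d l j x) k powr (p - 1) * w x))"
        by (simp add: sum_distrib_left sum_distrib_right mult_ac)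
      finally show "ennreal (E l x powr p * w x) \<le> (\<Sum>k\<in>F. ennreal p * ennreal (d l k x * partial_sum F (\<lambda>j. d l j x) k powr (p - 1) * w x))"
        using d0 w0 p by (simp flip: ennreal_mult) (auto intro!: ennreal_leI)
    qed
    also have "\<dots> = (\<Sum>k\<in>F. ennreal p * (\<integral>\<^sup>+x. ennreal (d l k x * partial_sum F (\<lambda>j. d l j x) k powr (p - 1) * w x) \<partial>lborel))"
      by (subst nn_integral_sum) (auto intro!: sum.cong nn_integral_cmult)
    also have "\<dots> \<le> (\<Sum>k\<in>F. ennreal p * (ennreal (2 ^ DIM('a) * (2 ^ l) powr (2 * n)) * (ennreal c * (\<integral>\<^sup>+x. ennreal (b k x * S k x powr (p - 1) * w x) \<partial>lborel))))"
      by (intro sum_mono mult_left_mono tr) auto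
    also have "\<dots> = ennreal (p * 2 powr (N * (p - 1) + n) * 2 powr (real l * (N * (p - 1) + 4 * n))) *
        (\<Sum>k\<in>F. (\<integral>\<^sup>+x. ennreal (b k x * S k x powr (p - 1) * w x) \<partial>lborel))"
      unfolding mult.assoc c1[symmetric] using c0 p by (simp add: sum_distrib_left ennreal_mult mult.assoc)
    also have "(\<Sum>k\<in>F. (\<integral>\<^sup>+x. ennreal (b k x * S k x powr (p - 1) * w x) \<partial>lborel)) =
        (\<integral>\<^sup>+x. (\<Sum>k\<in>F. ennreal (b k x * S k x powr (p - 1) * w x)) \<partial>lborel)"
      by (rule nn_integral_sum[symmetric]) auto
    also have "\<dots> \<le> I" unfolding I_def
    proof (intro nn_integral_mono)
      fix x
      have "(\<Sum>k\<in>F. b k x * S k x powr (p - 1) * w x) \<le> (\<Sum>k\<in>F. b k x * T x powr (p - 1) * w x)"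
        using b0 w0 S0 ST p by (intro sum_mono mult_right_mono mult_left_mono powr_mono2) auto
      then show "(\<Sum>k\<in>F. ennreal (b k x * S k x powr (p - 1) * w x)) \<le> ennreal ((\<Sum>k\<in>F. b k x) * T x powr (p - 1) * w x)"
        using b0 w0 by (subst sum_ennreal) (auto simp: sum_distrib_right intro!: ennreal_leI)
    qed
    finally show ?thesis by (simp add: mult_left_mono)
  qed
  \<comment> \<open>Some annulus carries a \<open>2 powr (-l)\<close> fraction of the whole average.\<close>
  have "\<exists>l. T x powr p \<le> 2 powr ((N + 2) * p) * (2 powr (- (real l * (N - 1) * p)) * E l x powr p)" for x
  proof (cases "T x = 0")
    case False
    then have Tpos: "0 < T x" using T0[of x] by simp
    \<comment> \<open>If the threshold failed for every \<open>l\<close>, the weighted series would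
      be at most the sum of \<open>T x / 4 * (1/2) ^ l\<close>, which is \<open>T x / 2\<close> and
      thus smaller than \<open>T x\<close>.\<close>
    have "\<exists>l. T x * 2 powr (real l * (N - 1) - N - 2) \<le> E l x"
    proof (rule ccontr)
      assume "\<not> ?thesis"
      then have less: "E l x \<le> T x * 2 powr (real l * (N - 1) - N - 2)" for l by (meson linear)
      have "ennreal (T x) = (\<Sum>k\<in>F. avg k N (\<lambda>y. ennreal (b k y)) x)"
        using a0 by (simp add: T_def avg_familyD(5)[OF ab])
      also have "\<dots> \<le> (\<Sum>k\<in>F. (\<Sum>l. ennreal (2 powr (N - real l * N)) * ennreal (d l k x)))"
      proof (intro sum_mono)
        fix k assume k: "k \<in> F"
        show "avg k N (\<lambda>y. ennreal (b k y)) x \<le> (\<Sum>l. ennreal (2 powr (N - real l * N)) * ennreal (d l k x))"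
          using avg_le_suminf_ball_avg[where b = "\<lambda>y. ennreal (b k y)" and N = N and k = k and x = x] N0 k by (simp add: Bfin)
      qed
      also have "\<dots> = (\<Sum>l. (\<Sum>k\<in>F. ennreal (2 powr (N - real l * N)) * ennreal (d l k x)))"
        by (rule suminf_sum[symmetric]) auto
      also have "\<dots> = (\<Sum>l. ennreal (2 powr (N - real l * N) * E l x))"
        using d0 by (simp add: E_def sum_distrib_left flip: ennreal_mult)
      also have "\<dots> \<le> (\<Sum>l. ennreal (T x / 4 * (1/2) ^ l))"
      proof (intro suminf_le allI ennreal_leI)
        fix l :: nat
        have "2 powr (N - real l * N) * E l x \<le> 2 powr (N - real l * N) * (T x * 2 powr (real l * (N - 1) - N - 2))"
          by (intro mult_left_mono less) auto
        also have "\<dots> = T x * 2 powr (- real l - 2)"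
          by (simp add: algebra_simps flip: powr_add)
        also have "\<dots> = T x / 4 * (1/2) ^ l"
          by (simp add: two_powr_minus_two)
        finally show "2 powr (N - real l * N) * E l x \<le> T x / 4 * (1/2) ^ l" .
      qed auto
      also have "\<dots> = ennreal (\<Sum>l. T x / 4 * (1/2) ^ l)"
        using Tpos by (intro suminf_ennreal2) (auto intro!: summable_mult summable_geometric)
      also have "(\<Sum>l. T x / 4 * (1/2::real) ^ l) = T x / 2"
        by (subst suminf_mult) (auto simp: suminf_geometric summable_geometric)
      finally show False using Tpos by simp
    qed
    then obtain l :: nat where l: "T x * 2 powr (real l * (N - 1) - N - 2) \<le> E l x" by blast
    then have "(T x * 2 powr (real l * (N - 1) - N - 2)) powr p \<le> E l x powr p"
      using p Tpos by (intro powr_mono2) auto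
    then have "T x powr p * 2 powr ((real l * (N - 1) - N - 2) * p) \<le> E l x powr p"
      using Tpos by (simp add: powr_mult powr_powr)
    then have "T x powr p \<le> E l x powr p * 2 powr (- ((real l * (N - 1) - N - 2) * p))"
      by (rule le_mult_powr_minus)
    also have "2 powr (- ((real l * (N - 1) - N - 2) * p)) = 2 powr ((N + 2) * p) * 2 powr (- (real l * (N - 1) * p))"
      by (simp add: algebra_simps flip: powr_add)
    finally show ?thesis by (intro exI[of _ l]) (simp only: mult.left_commute[of "E l x powr p"] mult.commute[of "E l x powr p"])
  qed auto
  \<comment> \<open>The index \<open>l\<close> depends on \<open>x\<close>; bounding by the sum over
    all \<open>l\<close> avoids a measurable choice.\<close>
  then have Tp: "ennreal (T x powr p * w x) \<le> (\<Sum>l. ennreal (2 powr ((N + 2) * p) * 2 powr (- (real l * (N - 1) * p))) * ennreal (E l x powr p * w x))" for x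
  proof -
    obtain l where l: "T x powr p \<le> 2 powr ((N + 2) * p) * (2 powr (- (real l * (N - 1) * p)) * E l x powr p)"
      using \<open>\<And>x. \<exists>l. T x powr p \<le> _ l x\<close> by blast
    have "T x powr p * w x \<le> 2 powr ((N + 2) * p) * (2 powr (- (real l * (N - 1) * p)) * E l x powr p) * w x"
      by (intro mult_right_mono l w0)
    then have "ennreal (T x powr p * w x) \<le> (\<Sum>l\<in>{l}. ennreal (2 powr ((N + 2) * p) * 2 powr (- (real l * (N - 1) * p))) * ennreal (E l x powr p * w x))"
      using w0 by (auto simp: mult_ac simp flip: ennreal_mult intro!: ennreal_leI)
    also have "\<dots> \<le> (\<Sum>l. ennreal (2 powr ((N + 2) * p) * 2 powr (- (real l * (N - 1) * p))) * ennreal (E l x powr p * w x))"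
      by (rule sum_le_suminf) auto
    finally show ?thesis .
  qed
  define C where "C = 2 powr ((N + 2) * p) * (p * 2 powr (N * (p - 1) + n))"
  have C0: "0 \<le> C" using p by (simp add: C_def)
  have "(\<integral>\<^sup>+x. ennreal (T x powr p * w x) \<partial>lborel) \<le>
      (\<integral>\<^sup>+x. (\<Sum>l. ennreal (2 powr ((N + 2) * p) * 2 powr (- (real l * (N - 1) * p))) * ennreal (E l x powr p * w x)) \<partial>lborel)"
    by (intro nn_integral_mono Tp)
  also have "\<dots> = (\<Sum>l. ennreal (2 powr ((N + 2) * p) * 2 powr (- (real l * (N - 1) * p))) * (\<integral>\<^sup>+x. ennreal (E l x powr p * w x) \<partial>lborel))"
    by (subst nn_integral_suminf) (auto intro!: suminf_cong nn_integral_cmult)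
  also have "\<dots> \<le> (\<Sum>l. ennreal (2 powr ((N + 2) * p) * 2 powr (- (real l * (N - 1) * p))) *
      (ennreal (p * 2 powr (N * (p - 1) + n) * 2 powr (real l * (N * (p - 1) + 4 * n))) * I))"
    by (intro suminf_le allI mult_left_mono El) auto
  also have "\<dots> \<le> (\<Sum>l. ennreal (C * (1/2)^l) * I)"
  proof (intro suminf_le allI)
    fix l :: nat
    have "2 powr ((N + 2) * p) * 2 powr (- (real l * (N - 1) * p)) * (p * 2 powr (N * (p - 1) + n) * 2 powr (real l * (N * (p - 1) + 4 * n)))
       = C * 2 powr (real l * (- N + p + 4 * n))"
      by (simp add: C_def algebra_simps flip: powr_add)
    \<comment> \<open>The condition \<open>4 * n + p + 1 \<le> N\<close> yields at least the decay
      \<open>2 powr - l\<close>.\<close>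
    also have "\<dots> \<le> C * 2 powr (real l * (-1))"
      using N C0 by (intro mult_left_mono powr_mono) (auto simp: n_def)
    also have "\<dots> = C * (1/2)^l" using two_powr_minus[of l] by simp
    finally show "ennreal (2 powr ((N + 2) * p) * 2 powr (- (real l * (N - 1) * p))) *
      (ennreal (p * 2 powr (N * (p - 1) + n) * 2 powr (real l * (N * (p - 1) + 4 * n))) * I) \<le> ennreal (C * (1/2)^l) * I"
      using p by (auto simp: mult.assoc[symmetric] simp flip: ennreal_mult intro!: mult_right_mono ennreal_leI)
  qed auto
  also have "\<dots> = (\<Sum>l. ennreal (C * (1/2)^l)) * I" by simp
  also have "(\<Sum>l. ennreal (C * (1/2)^l)) = ennreal (\<Sum>l. C * (1/2)^l)"
    using C0 by (intro suminf_ennreal2) (auto intro!: summable_mult summable_geometric)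
  also have "(\<Sum>l. C * (1/2::real)^l) = 2 * C"
    by (subst suminf_mult) (auto simp: suminf_geometric summable_geometric)
  finally show ?thesis unfolding C_def I_def T_def w_def n_def by (simp add: mult_ac)
qed

text \<open>The qualitative bound \<open>H\<close> makes the left-hand side finite, so that half of it can be absorbed.\<close>

lemma vector_valued_convex:
  fixes a b :: "int \<Rightarrow> 'a::euclidean_space \<Rightarrow> real"
  assumes p: "1 \<le> p" and N: "4 * real DIM('a) + p + 1 \<le> N"
  shows "\<exists>C>0. \<forall>F i x0 H. \<forall>a b :: int \<Rightarrow> 'a \<Rightarrow> real. avg_family N F a b \<longrightarrow> (\<forall>k\<in>F. i \<le> k) \<longrightarrow> (\<forall>k\<in>F. \<forall>x. a k x \<le> H) \<longrightarrow>
    (\<integral>\<^sup>+x. ennreal ((\<Sum>k\<in>F. a k x) powr p * kern i (2 * real DIM('a)) x0 x) \<partial>lborel)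
    \<le> ennreal C * (\<integral>\<^sup>+x. ennreal ((\<Sum>k\<in>F. b k x) powr p * kern i (2 * real DIM('a)) x0 x) \<partial>lborel)"
proof -
  define C1 where "C1 = 2 * 2 powr ((N + 2) * p) * (p * 2 powr (N * (p - 1) + DIM('a)))"
  have C1: "0 < C1" using p by (simp add: C1_def)
  show ?thesis
  proof (intro exI[of _ "(2 * C1) powr p"] conjI allI impI)
    show "0 < (2 * C1) powr p" using C1 by simp
    fix F i and x0 :: 'a and H and a b :: "int \<Rightarrow> 'a \<Rightarrow> real"
    assume ab: "avg_family N F a b" and F: "\<forall>k\<in>F. i \<le> k" and H: "\<forall>k\<in>F. \<forall>x. a k x \<le> H"
    define w where "w x = kern i (2 * real DIM('a)) x0 x" for x
    define S where "S x = (\<Sum>k\<in>F. a k x)" for x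
    define B where "B x = (\<Sum>k\<in>F. b k x)" for x
    have [measurable]: "b k \<in> borel_measurable borel" "a k \<in> borel_measurable borel" if "k \<in> F" for k
      using avg_familyD(2)[OF ab that] avg_family_measurable[OF ab that] by auto
    have [measurable]: "S \<in> borel_measurable borel" "B \<in> borel_measurable borel" "w \<in> borel_measurable borel"
      unfolding S_def B_def w_def by measurable
    have B0: "0 \<le> B x" and S0: "0 \<le> S x" and w0: "0 \<le> w x" for x
      unfolding B_def S_def w_def using avg_familyD[OF ab] by (auto intro!: sum_nonneg)
    define J where "J = (\<integral>\<^sup>+x. ennreal (S x powr p * w x) \<partial>lborel)"
    define K where "K = (\<integral>\<^sup>+x. ennreal (B x powr p * w x) \<partial>lborel)"
    \<comment> \<open>Young's inequality by cases. The coefficient \<open>1 / (2 * C1)\<close> is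
      chosen so that multiplication by \<open>C1\<close> leaves exactly one half to be
      absorbed.\<close>
    have pw: "B x * S x powr (p - 1) \<le> 1 / (2 * C1) * S x powr p + (2 * C1) powr (p - 1) * B x powr p" for x
    proof (cases "S x = 0")
      case True
      then show ?thesis by simp
    next
      case False
      then have Sp: "0 < S x" using S0[of x] by simp
      show ?thesis
      proof (cases "B x \<le> S x / (2 * C1)")
        case True
        have "B x * S x powr (p - 1) \<le> (S x / (2 * C1)) * S x powr (p - 1)"
          using True by (intro mult_right_mono) auto
        also have "\<dots> = 1 / (2 * C1) * S x powr p"
          using mult_powr_pred[OF Sp, of p] by simp
        finally show ?thesis by (smt (verit) powr_ge_zero mult_nonneg_nonneg)
      next
        case False
        then have "S x \<le> 2 * C1 * B x" using C1 by (simp add: field_simps)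
        then have "S x powr (p - 1) \<le> (2 * C1 * B x) powr (p - 1)" using p S0 by (intro powr_mono2) auto
        also have "\<dots> = (2 * C1) powr (p - 1) * B x powr (p - 1)" using C1 B0 by (simp add: powr_mult)
        finally have "B x * S x powr (p - 1) \<le> B x * ((2 * C1) powr (p - 1) * B x powr (p - 1))"
          using B0 by (intro mult_left_mono) auto
        also have "\<dots> = (2 * C1) powr (p - 1) * B x powr p"
          using mult_powr_pred[of "B x" p] False Sp C1 by (smt (verit) mult.left_commute divide_pos_pos)
        finally show ?thesis using C1 by (smt (verit) powr_ge_zero mult_nonneg_nonneg divide_nonneg_nonneg)
      qed
    qed
    have "J \<le> ennreal C1 * (\<integral>\<^sup>+x. ennreal (B x * S x powr (p - 1) * w x) \<partial>lborel)"
      unfolding J_def S_def B_def w_def C1_def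
      by (rule vector_valued_convex_aux[OF ab _ p N]) (use F in auto)
    also have "\<dots> \<le> ennreal C1 * (\<integral>\<^sup>+x. (ennreal (1 / (2 * C1)) * ennreal (S x powr p * w x) + ennreal ((2 * C1) powr (p - 1)) * ennreal (B x powr p * w x)) \<partial>lborel)"
    proof (intro mult_left_mono nn_integral_mono)
      fix x
      have "B x * S x powr (p - 1) * w x \<le> (1 / (2 * C1) * S x powr p + (2 * C1) powr (p - 1) * B x powr p) * w x"
        by (intro mult_right_mono pw w0)
      then show "ennreal (B x * S x powr (p - 1) * w x) \<le> ennreal (1 / (2 * C1)) * ennreal (S x powr p * w x) + ennreal ((2 * C1) powr (p - 1)) * ennreal (B x powr p * w x)"
        using C1 w0 by (auto simp: distrib_right mult.assoc simp flip: ennreal_mult ennreal_plus intro!: ennreal_leI)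
    qed auto
    also have "\<dots> = ennreal C1 * (ennreal (1 / (2 * C1)) * J + ennreal ((2 * C1) powr (p - 1)) * K)"
      unfolding J_def K_def by (subst nn_integral_add) (auto simp: nn_integral_cmult)
    also have "\<dots> = ennreal (1/2) * J + ennreal (C1 * (2 * C1) powr (p - 1)) * K"
      using C1 by (simp add: distrib_left mult.assoc[symmetric] flip: ennreal_mult)
    finally have main: "J \<le> ennreal (1/2) * J + ennreal (C1 * (2 * C1) powr (p - 1)) * K" .
    have "J \<le> (\<integral>\<^sup>+x. ennreal ((card F * \<bar>H\<bar>) powr p) * ennreal (w x) \<partial>lborel)"
      unfolding J_def
    proof (intro nn_integral_mono)
      fix x
      have "S x \<le> (\<Sum>k\<in>F. \<bar>H\<bar>)" unfolding S_def using H by (intro sum_mono) (smt (verit))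
      then have "S x powr p \<le> (card F * \<bar>H\<bar>) powr p" using p S0 by (intro powr_mono2) auto
      then show "ennreal (S x powr p * w x) \<le> ennreal ((card F * \<bar>H\<bar>) powr p) * ennreal (w x)"
        using w0 by (auto simp flip: ennreal_mult intro!: ennreal_leI mult_right_mono)
    qed
    also have "\<dots> = ennreal ((card F * \<bar>H\<bar>) powr p) * (\<integral>\<^sup>+x. ennreal (w x) \<partial>lborel)"
      by (rule nn_integral_cmult) auto
    also have "\<dots> \<le> ennreal ((card F * \<bar>H\<bar>) powr p) * ennreal (2 ^ DIM('a))"
      unfolding w_def by (intro mult_left_mono nn_integral_kern_le) auto
    also have "\<dots> < \<infinity>" by (simp add: ennreal_mult_less_top)
    finally have Jfin: "J < \<infinity>" .
    have "2 * ennreal (C1 * (2 * C1) powr (p - 1)) = ennreal ((2 * C1) powr p)"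
      using C1 mult_powr_pred[of "2 * C1" p] ennreal_mult[of 2 "C1 * (2 * C1) powr (p - 1)"] by (simp add: mult.assoc)
    then have "J \<le> ennreal ((2 * C1) powr p) * K"
      using ennreal_absorb_half[OF main Jfin] by (simp add: mult.assoc[symmetric])
    then show "(\<integral>\<^sup>+x. ennreal ((\<Sum>k\<in>F. a k x) powr p * kern i (2 * real DIM('a)) x0 x) \<partial>lborel)
      \<le> ennreal ((2 * C1) powr p) * (\<integral>\<^sup>+x. ennreal ((\<Sum>k\<in>F. b k x) powr p * kern i (2 * real DIM('a)) x0 x) \<partial>lborel)"
      unfolding J_def K_def S_def B_def w_def .
  qed
qed

subsection \<open>Morrey bounds of averages\<close>

definition dcube :: "int \<Rightarrow> ('n::finite \<Rightarrow> int) \<Rightarrow> (real ^ 'n) set"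
  where "dcube i m = {x. \<forall>k. 2 powi (-i) * real_of_int (m k) \<le> x $ k \<and> x $ k < 2 powi (-i) * real_of_int (m k + 1)}"

lemma dyadic_cubes_eq: "dyadic_cubes = range (\<lambda>(i, m). dcube i m)"
  unfolding dyadic_cubes_def dcube_def by auto

lemma powi_powr: "(2::real) powi i = 2 powr real_of_int i"
  by (simp add: powr_real_of_int')

text \<open>Written with integer parts, membership shows that the cubes of one generation partition
  the space and that the index of the cube is a measurable function of the point.\<close>

lemma dcube_iff: "x \<in> dcube i m \<longleftrightarrow> (\<forall>k. \<lfloor>2 powr real_of_int i * x $ k\<rfloor> = m k)"
proof -
  have "(2 powi (-i) * real_of_int (m k) \<le> x $ k \<and> x $ k < 2 powi (-i) * real_of_int (m k + 1)) \<longleftrightarrow>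
     \<lfloor>2 powr real_of_int i * x $ k\<rfloor> = m k" for k
  proof -
    define c where "c = 2 powr real_of_int i"
    have e: "2 powi (-i) = 1 / c" "0 < c" by (simp_all add: c_def powi_powr powr_minus divide_inverse)
    show ?thesis unfolding c_def[symmetric] e(1) using e(2) by (simp add: floor_eq_iff field_simps)
  qed
  then show ?thesis by (auto simp: dcube_def)
qed

lemma vec_nth_measurable [measurable (raw)]:
  "f \<in> borel_measurable M \<Longrightarrow> (\<lambda>w. (f w :: real ^ 'n::finite) $ k) \<in> borel_measurable M"
  by (rule measurable_compose[of f M borel]) (auto intro!: borel_measurable_continuous_onI continuous_intros)

lemma dcube_borel [measurable]: "dcube i m \<in> sets borel"
proof -
  have "dcube i m = {x \<in> space borel. \<forall>k. 2 powi (-i) * real_of_int (m k) \<le> x $ k \<and> x $ k < 2 powi (-i) * real_of_int (m k + 1)}"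
    by (simp add: dcube_def)
  also have "\<dots> \<in> sets borel" by measurable
  finally show ?thesis .
qed

text \<open>The half-open cube lies between an open and a closed box of equal measure.\<close>

lemma emeasure_dcube:
  "emeasure lborel (dcube i m :: (real ^ 'n::finite) set) = ennreal (2 powr (- (real_of_int i * real CARD('n))))"
proof -
  define l :: "real ^ 'n" where "l = (\<chi> k. 2 powi (-i) * real_of_int (m k))"
  define u :: "real ^ 'n" where "u = (\<chi> k. 2 powi (-i) * real_of_int (m k + 1))"
  have diff: "(u - l) \<bullet> b = 2 powi (-i)" if "b \<in> Basis" for b
    using that by (auto simp: l_def u_def Basis_vec_def inner_axis algebra_simps)
  have le: "l \<bullet> b \<le> u \<bullet> b" if "b \<in> Basis" for b
    using diff[OF that] by (simp add: inner_diff_left) (smt (verit) zero_less_power_int)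
  have "(\<Prod>b\<in>(Basis::(real^'n) set). (u - l) \<bullet> b) = (\<Prod>b\<in>(Basis::(real^'n) set). 2 powi (-i))"
    by (intro prod.cong diff) auto
  also have "\<dots> = 2 powr (- (real_of_int i * real CARD('n)))"
    by (simp add: prod_constant powi_powr powr_powr flip: powr_realpow)
  finally have P: "(\<Prod>b\<in>(Basis::(real^'n) set). (u - l) \<bullet> b) = 2 powr (- (real_of_int i * real CARD('n)))" .
  have "box l u \<subseteq> dcube i m" "dcube i m \<subseteq> cbox l u"
    by (auto simp: dcube_def box_def cbox_def l_def u_def Basis_vec_def inner_axis less_imp_le)
  then have "emeasure lborel (box l u) \<le> emeasure lborel (dcube i m)"
    "emeasure lborel (dcube i m) \<le> emeasure lborel (cbox l u)"
    by (auto intro!: emeasure_mono)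
  moreover have "emeasure lborel (box l u) = ennreal (2 powr (- (real_of_int i * real CARD('n))))"
    "emeasure lborel (cbox l u) = ennreal (2 powr (- (real_of_int i * real CARD('n))))"
    using le P by (auto simp: emeasure_lborel_box_eq emeasure_lborel_cbox_eq)
  ultimately show ?thesis by simp
qed

lemma side_length_dcube: "side_length (dcube i m :: (real ^ 'n::finite) set) = 2 powr (- real_of_int i)"
  by (simp add: side_length_def measure_def emeasure_dcube powr_powr)

lemma sdist_dcube_le:
  fixes x y :: "real ^ 'n::finite"
  assumes "x \<in> dcube i m" "y \<in> dcube i m"
  shows "sdist i x y \<le> 1 + real CARD('n)"
proof -
  have "norm (x - y) \<le> (\<Sum>k\<in>UNIV. \<bar>(x - y) $ k\<bar>)" by (rule norm_le_l1_cart)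
  also have "\<dots> \<le> (\<Sum>k\<in>(UNIV::'n set). 2 powr (- real_of_int i))"
  proof (intro sum_mono)
    fix k
    have "2 powi (-i) * real_of_int (m k + 1) = 2 powi (-i) * real_of_int (m k) + 2 powi (-i)"
      by (simp add: distrib_left)
    then show "\<bar>(x - y) $ k\<bar> \<le> 2 powr (- real_of_int i)"
      using assms unfolding dcube_def powi_powr by (auto simp: abs_le_iff dest!: spec[of _ k])
  qed
  finally have "2 powr real_of_int i * dist x y \<le> 2 powr real_of_int i * (real CARD('n) * 2 powr (- real_of_int i))"
    by (intro mult_left_mono) (auto simp: dist_norm)
  also have "\<dots> = real CARD('n)" by (simp add: powr_minus)
  finally show ?thesis by (simp add: sdist_def)
qed

lemma kern_dcube_ge:
  fixes x y :: "real ^ 'n::finite"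
  assumes "x \<in> dcube i m" "y \<in> dcube i m"
  shows "1 \<le> (1 + real CARD('n)) powr (2 * real CARD('n)) * 2 powr (- (real_of_int i * real CARD('n))) * kern i (2 * real CARD('n)) x y"
proof -
  have "sdist i x y powr (2 * real CARD('n)) \<le> (1 + real CARD('n)) powr (2 * real CARD('n))"
    using sdist_dcube_le[OF assms] sdist_ge1[of i x y] by (intro powr_mono2) auto
  then have "1 \<le> (1 + real CARD('n)) powr (2 * real CARD('n)) * sdist i x y powr (- (2 * real CARD('n)))"
    using sdist_pos[of i x y] by (simp add: powr_minus field_simps)
  moreover have "2 powr (- (real_of_int i * real CARD('n))) * 2 powr (real_of_int i * real CARD('n)) = (1::real)"
    by (simp flip: powr_add)
  ultimately have "1 \<le> (2 powr (- (real_of_int i * real CARD('n))) * 2 powr (real_of_int i * real CARD('n))) *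
      ((1 + real CARD('n)) powr (2 * real CARD('n)) * sdist i x y powr (- (2 * real CARD('n))))"
    by simp
  then show ?thesis by (simp add: kern_def mult_ac)
qed

text \<open>The kernel is comparable to a constant on each cube of side \<open>2 powr - i\<close>.
  Instead of summing over the grid, the normalised kernel \<open>v * e y z\<close> of pairs in a
  common cube is inserted and Fubini's theorem applied; the inner integral then extends over a
  single cube.\<close>

lemma avg_le_of_dcubes:
  fixes f :: "real ^ 'n::finite \<Rightarrow> ennreal"
  assumes [measurable]: "f \<in> borel_measurable borel"
    and f: "\<And>m. (\<integral>\<^sup>+x\<in>dcube i m. f x \<partial>lborel) \<le> ennreal (2 powr (- (real_of_int i * real CARD('n)))) * V"
  shows "avg i (2 * real CARD('n)) f x \<le> ennreal ((1 + real CARD('n)) powr (2 * real CARD('n)) * 2 ^ CARD('n)) * V"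
proof -
  define n where "n = real CARD('n)"
  define J where "J y = (\<lambda>k. \<lfloor>2 powr real_of_int i * y $ k\<rfloor>)" for y :: "real ^ 'n"
  define e :: "real ^ 'n \<Rightarrow> real ^ 'n \<Rightarrow> ennreal" where "e y z = (if J y = J z then 1 else 0)" for y z
  define v where "v = 2 powr (real_of_int i * n)"
  define c where "c = (1 + n) powr (2 * n)"
  have J: "y \<in> dcube i (J y)" for y by (simp add: dcube_iff J_def)
  have e_ind: "e y z = indicator (dcube i (J z)) y" for y z
    using dcube_iff[of y i "J z"] by (auto simp: e_def J_def fun_eq_iff indicator_def)
  have esym: "e y z = e z y" for y z by (auto simp: e_def)
  have [measurable]: "(\<lambda>p. e (fst p) (snd p)) \<in> borel_measurable (lborel \<Otimes>\<^sub>M lborel)"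
    unfolding e_def J_def fun_eq_iff by measurable
  have [measurable (raw)]: "g \<in> borel_measurable M \<Longrightarrow> h \<in> borel_measurable M \<Longrightarrow> (\<lambda>w. e (g w) (h w)) \<in> borel_measurable M"
    for g h and M :: "'c measure"
    by (rule measurable_compose[of "\<lambda>w. (g w, h w)" M "lborel \<Otimes>\<^sub>M lborel" "\<lambda>p. e (fst p) (snd p)", simplified]) auto
  have v0: "0 < v" "ennreal v * ennreal (2 powr (- (real_of_int i * n))) = 1"
    by (simp_all add: v_def flip: ennreal_mult powr_add)
  have e1: "(\<integral>\<^sup>+z. ennreal v * e y z \<partial>lborel) = 1" for y
  proof -
    have "(\<integral>\<^sup>+z. ennreal v * e y z \<partial>lborel) = (\<integral>\<^sup>+z. ennreal v * indicator (dcube i (J y)) z \<partial>lborel)"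
      by (subst esym) (simp add: e_ind)
    also have "\<dots> = ennreal v * emeasure lborel (dcube i (J y))"
      by (simp add: nn_integral_cmult)
    finally show ?thesis using v0 by (simp add: emeasure_dcube n_def)
  qed
  have "avg i (2 * n) f x = (\<integral>\<^sup>+y. (\<integral>\<^sup>+z. ennreal v * e y z \<partial>lborel) * (ennreal (kern i (2 * n) x y) * f y) \<partial>lborel)"
    by (simp add: avg_def e1)
  also have "\<dots> = (\<integral>\<^sup>+y. (\<integral>\<^sup>+z. ennreal v * e y z * (ennreal (kern i (2 * n) x y) * f y) \<partial>lborel) \<partial>lborel)"
    by (subst nn_integral_multc) auto
  also have "\<dots> \<le> (\<integral>\<^sup>+y. (\<integral>\<^sup>+z. ennreal v * e y z * (ennreal (c * kern i (2 * n) x z) * f y) \<partial>lborel) \<partial>lborel)"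
  proof (intro nn_integral_mono)
    fix y z
    show "ennreal v * e y z * (ennreal (kern i (2 * n) x y) * f y) \<le> ennreal v * e y z * (ennreal (c * kern i (2 * n) x z) * f y)"
    proof (cases "J y = J z")
      case True
      have "kern i (2 * n) x y \<le> sdist i y z powr (2 * n) * kern i (2 * n) x z"
        using kern_shift[of "2 * n" i y x z] by (simp add: n_def kern_commute[of i _ x])
      also have "\<dots> \<le> c * kern i (2 * n) x z"
        using sdist_dcube_le[of y i "J z" z] J[of y] J[of z] True sdist_ge1[of i y z]
        by (auto simp: c_def n_def intro!: mult_right_mono powr_mono2)
      finally show ?thesis by (intro mult_left_mono mult_right_mono ennreal_leI) auto
    qed (simp add: e_def)
  qed
  also have "\<dots> = (\<integral>\<^sup>+z. (\<integral>\<^sup>+y. ennreal v * e y z * (ennreal (c * kern i (2 * n) x z) * f y) \<partial>lborel) \<partial>lborel)"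
    by (rule lborel_pair.Fubini') measurable
  also have "\<dots> \<le> (\<integral>\<^sup>+z. ennreal c * (ennreal (kern i (2 * n) x z) * V) \<partial>lborel)"
  proof (intro nn_integral_mono)
    fix z
    have "(\<integral>\<^sup>+y. ennreal v * e y z * (ennreal (c * kern i (2 * n) x z) * f y) \<partial>lborel) =
        (\<integral>\<^sup>+y. ennreal v * ennreal (c * kern i (2 * n) x z) * (f y * indicator (dcube i (J z)) y) \<partial>lborel)"
      by (intro nn_integral_cong) (simp add: e_ind mult_ac)
    also have "\<dots> = ennreal v * ennreal (c * kern i (2 * n) x z) * (\<integral>\<^sup>+y\<in>dcube i (J z). f y \<partial>lborel)"
      by (rule nn_integral_cmult) auto
    also have "\<dots> \<le> ennreal v * ennreal (c * kern i (2 * n) x z) * (ennreal (2 powr (- (real_of_int i * n))) * V)"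
      using f by (intro mult_left_mono) (auto simp: n_def)
    also have "\<dots> = (ennreal v * ennreal (2 powr (- (real_of_int i * n)))) * (ennreal (c * kern i (2 * n) x z) * V)"
      by (simp only: mult_ac)
    also have "\<dots> = ennreal c * (ennreal (kern i (2 * n) x z) * V)"
      unfolding v0(2) by (simp add: ennreal_mult c_def mult.assoc)
    finally show "(\<integral>\<^sup>+y. ennreal v * e y z * (ennreal (c * kern i (2 * n) x z) * f y) \<partial>lborel) \<le> ennreal c * (ennreal (kern i (2 * n) x z) * V)" .
  qed
  also have "\<dots> = ennreal c * avg i (2 * n) (\<lambda>_. V) x"
    unfolding avg_def by (rule nn_integral_cmult) auto
  also have "\<dots> \<le> ennreal c * (ennreal (2 ^ CARD('n)) * V)"
    using avg_const_le[of "2 * n" i V x] by (intro mult_left_mono) (auto simp: n_def)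
  also have "\<dots> = ennreal (c * 2 ^ CARD('n)) * V"
    by (simp add: c_def ennreal_mult mult.assoc)
  finally show ?thesis by (simp add: c_def n_def)
qed

text \<open>Conversely, a kernel centred in the cube dominates its normalised indicator up to a
  constant, so an integral over a cube may be tested against a slowly varying weight.\<close>

lemma nn_integral_dcube_le_kern:
  fixes f :: "real ^ 'n::finite \<Rightarrow> real"
  assumes [measurable]: "f \<in> borel_measurable borel" and f: "\<And>x. 0 \<le> f x" and x0: "x0 \<in> dcube i m"
  shows "(\<integral>\<^sup>+x\<in>dcube i m. ennreal (f x) \<partial>lborel) \<le>
    ennreal ((1 + real CARD('n)) powr (2 * real CARD('n)) * 2 powr (- (real_of_int i * real CARD('n)))) *
      (\<integral>\<^sup>+x. ennreal (f x * kern i (2 * real CARD('n)) x0 x) \<partial>lborel)"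
proof -
  define c where "c = (1 + real CARD('n)) powr (2 * real CARD('n)) * 2 powr (- (real_of_int i * real CARD('n)))"
  have "(\<integral>\<^sup>+x\<in>dcube i m. ennreal (f x) \<partial>lborel) \<le> (\<integral>\<^sup>+x. ennreal c * ennreal (f x * kern i (2 * real CARD('n)) x0 x) \<partial>lborel)"
  proof (intro nn_integral_mono)
    fix x
    show "ennreal (f x) * indicator (dcube i m) x \<le> ennreal c * ennreal (f x * kern i (2 * real CARD('n)) x0 x)"
    proof (cases "x \<in> dcube i m")
      case True
      have "f x * 1 \<le> f x * (c * kern i (2 * real CARD('n)) x0 x)"
        using kern_dcube_ge[OF x0 True] f unfolding c_def by (intro mult_left_mono) auto
      then show ?thesis using True f by (auto simp: c_def mult_ac simp flip: ennreal_mult intro!: ennreal_leI)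
    qed auto
  qed
  also have "\<dots> = ennreal c * (\<integral>\<^sup>+x. ennreal (f x * kern i (2 * real CARD('n)) x0 x) \<partial>lborel)"
    by (rule nn_integral_cmult) auto
  finally show ?thesis by (simp add: c_def)
qed

lemma vector_valued_average:
  assumes p: "0 < p" and D: "0 < D" and N: "4 * real DIM('a::euclidean_space) + p + 1 + 4 * real DIM('a) / p \<le> N"
  shows "\<exists>C>0. \<forall>F i x0 H. \<forall>a b :: int \<Rightarrow> 'a \<Rightarrow> real. avg_family N F a b \<longrightarrow> (\<forall>k\<in>F. i \<le> k) \<longrightarrow>
    (\<forall>k\<in>F. \<forall>x. a k x \<le> H) \<longrightarrow> (\<forall>k\<in>F. \<forall>x. b k x \<le> D * a k x) \<longrightarrow>
    (\<integral>\<^sup>+x. ennreal ((\<Sum>k\<in>F. a k x) powr p * kern i (2 * real DIM('a)) x0 x) \<partial>lborel)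
    \<le> ennreal C * (\<integral>\<^sup>+x. ennreal ((\<Sum>k\<in>F. b k x) powr p * kern i (2 * real DIM('a)) x0 x) \<partial>lborel)"
proof (cases "1 \<le> p")
  case True
  have "4 * real DIM('a) + p + 1 \<le> N" using N p by (smt (verit) divide_nonneg_nonneg of_nat_0_le_iff)
  from vector_valued_convex[OF True this] show ?thesis by blast
next
  case False
  have "4 * real DIM('a) / p \<le> N" using N p by (smt (verit) of_nat_0_le_iff)
  then have "4 * real DIM('a) \<le> N * p" using p by (simp add: field_simps)
  with False p D show ?thesis
    by (intro exI[of _ "2 ^ DIM('a) * D powr (1 - p) / p"] conjI allI impI vector_valued_concave) auto
qed

lemma sum_powr_split:
  fixes u v p :: real
  assumes "0 \<le> u" "0 \<le> v" "0 < p"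
  shows "(u + v) powr p \<le> 2 powr p * (u powr p + v powr p)"
proof -
  have "(u + v) powr p \<le> (2 * max u v) powr p" using assms by (intro powr_mono2) auto
  also have "\<dots> = 2 powr p * max u v powr p" using assms by (simp add: powr_mult)
  also have "max u v powr p \<le> u powr p + v powr p" by (auto simp: max_def)
  finally show ?thesis by (simp add: mult_left_mono)
qed

lemma dcube_nonempty: "\<exists>x0 :: real ^ 'n::finite. x0 \<in> dcube i m"
  using dcube_iff[of "\<chi> j. 2 powr (- real_of_int i) * real_of_int (m j)" i m]
  by (auto simp: mult.assoc[symmetric] simp flip: powr_add)

section \<open>Morrey conditions with a dyadic weight\<close>

locale morrey_weight =
  fixes W :: "int \<Rightarrow> real" and q :: real
  assumes W_pos: "0 < W i" and W_antimono: "i \<le> k \<Longrightarrow> W k \<le> W i" and q_pos: "0 < q"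
begin

text \<open>For \<open>W i = \<phi> (2 powr - i)\<close> this is the Morrey condition for \<open>f powr (1 / q)\<close>, raised to the power \<open>q\<close>.\<close>

definition morrey_bound :: "real \<Rightarrow> (real ^ 'n::finite \<Rightarrow> real) \<Rightarrow> bool"
  where "morrey_bound Y f \<longleftrightarrow> (\<forall>i m. (\<integral>\<^sup>+x\<in>dcube i m. ennreal (f x) \<partial>lborel) \<le>
    ennreal (Y * (2 powr (- (real_of_int i * real CARD('n))) * (1 / W i) powr q)))"

lemma morrey_bound_mono:
  assumes "morrey_bound Y f" "\<And>x. g x \<le> f x"
  shows "morrey_bound Y g"
  unfolding morrey_bound_def
proof (intro allI)
  fix i m
  have "(\<integral>\<^sup>+x\<in>dcube i m. ennreal (g x) \<partial>lborel) \<le> (\<integral>\<^sup>+x\<in>dcube i m. ennreal (f x) \<partial>lborel)"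
    by (intro nn_integral_mono mult_right_mono ennreal_leI assms(2)) auto
  also have "\<dots> \<le> ennreal (Y * (2 powr (- (real_of_int i * real CARD('a))) * (1 / W i) powr q))"
    using assms(1) by (simp add: morrey_bound_def)
  finally show "(\<integral>\<^sup>+x\<in>dcube i m. ennreal (g x) \<partial>lborel) \<le> ennreal (Y * (2 powr (- (real_of_int i * real CARD('a))) * (1 / W i) powr q))" .
qed

definition cube_const :: "'n::finite itself \<Rightarrow> real"
  where "cube_const _ = (1 + real CARD('n)) powr (2 * real CARD('n))"

lemma cube_const_pos: "0 < cube_const TYPE('n::finite)"
  by (simp add: cube_const_def)

text \<open>All cubes of generation \<open>i\<close> carry the same bound, so the average at that
  scale inherits it at every point.\<close>

lemma morrey_bound_avg:
  fixes f :: "real ^ 'n::finite \<Rightarrow> real"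
  assumes "morrey_bound Y f" and [measurable]: "f \<in> borel_measurable borel" and Y: "0 \<le> Y"
  shows "avg i (2 * real CARD('n)) (\<lambda>y. ennreal (f y)) x \<le> ennreal (cube_const TYPE('n) * 2 ^ CARD('n) * Y * (1 / W i) powr q)"
proof -
  have "avg i (2 * real CARD('n)) (\<lambda>y. ennreal (f y)) x \<le>
      ennreal (cube_const TYPE('n) * 2 ^ CARD('n)) * ennreal (Y * (1 / W i) powr q)"
    unfolding cube_const_def
  proof (rule avg_le_of_dcubes)
    fix m
    show "(\<integral>\<^sup>+x\<in>dcube i m. ennreal (f x) \<partial>lborel) \<le>
      ennreal (2 powr (- (real_of_int i * real CARD('n)))) * ennreal (Y * (1 / W i) powr q)"
      using assms(1) Y unfolding morrey_bound_def by (simp add: mult_ac flip: ennreal_mult)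
  qed auto
  also have "\<dots> = ennreal (cube_const TYPE('n) * 2 ^ CARD('n) * Y * (1 / W i) powr q)"
    using Y cube_const_pos[where 'n='n] by (simp add: mult.assoc flip: ennreal_mult)
  finally show ?thesis .
qed

text \<open>The pattern of the Morrey estimates below: on a cube of side \<open>2 powr - i\<close>
  the finer scales are tested against the weight of the cube, while the coarser ones are bounded by
  the constant \<open>B * (1 / W i) powr q\<close>.\<close>

lemma morrey_bound_of_fine_coarse:
  fixes f h :: "real ^ 'n::finite \<Rightarrow> real"
  assumes [measurable]: "f \<in> borel_measurable borel" and f: "\<And>x. 0 \<le> f x"
    and fine: "(\<integral>\<^sup>+x. ennreal (f x * kern i (2 * real CARD('n)) x0 x) \<partial>lborel) \<le> ennreal (A * (1 / W i) powr q)"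
    and h: "\<And>x. h x \<le> f x + B * (1 / W i) powr q" and x0: "x0 \<in> dcube i m" and AB: "0 \<le> A" "0 \<le> B"
  shows "(\<integral>\<^sup>+x\<in>dcube i m. ennreal (h x) \<partial>lborel) \<le>
    ennreal ((cube_const TYPE('n) * A + B) * (2 powr (- (real_of_int i * real CARD('n))) * (1 / W i) powr q))"
proof -
  let ?v = "2 powr (- (real_of_int i * real CARD('n)))"
  have "(\<integral>\<^sup>+x\<in>dcube i m. ennreal (h x) \<partial>lborel) \<le>
      (\<integral>\<^sup>+x. (ennreal (f x) * indicator (dcube i m) x + ennreal (B * (1 / W i) powr q) * indicator (dcube i m) x) \<partial>lborel)"
    using h f AB by (intro nn_integral_mono) (auto simp: indicator_def simp flip: ennreal_plus intro!: ennreal_leI)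
  also have "\<dots> = (\<integral>\<^sup>+x\<in>dcube i m. ennreal (f x) \<partial>lborel) + ennreal (B * (1 / W i) powr q) * emeasure lborel (dcube i m :: (real^'n) set)"
    by (subst nn_integral_add) (auto simp: nn_integral_cmult_indicator)
  also have "(\<integral>\<^sup>+x\<in>dcube i m. ennreal (f x) \<partial>lborel) \<le> ennreal (cube_const TYPE('n) * ?v) * (\<integral>\<^sup>+x. ennreal (f x * kern i (2 * real CARD('n)) x0 x) \<partial>lborel)"
    unfolding cube_const_def by (rule nn_integral_dcube_le_kern[OF _ f x0]) auto
  also have "\<dots> \<le> ennreal (cube_const TYPE('n) * ?v) * ennreal (A * (1 / W i) powr q)"
    by (intro mult_left_mono fine) auto
  finally have "(\<integral>\<^sup>+x\<in>dcube i m. ennreal (h x) \<partial>lborel) \<le>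
     ennreal (cube_const TYPE('n) * ?v) * ennreal (A * (1 / W i) powr q) + ennreal (B * (1 / W i) powr q) * ennreal ?v"
    by (simp add: emeasure_dcube add_right_mono)
  also have "\<dots> = ennreal ((cube_const TYPE('n) * A + B) * (?v * (1 / W i) powr q))"
    using AB cube_const_pos[where 'n='n] by (simp add: algebra_simps flip: ennreal_mult ennreal_plus)
  finally show ?thesis .
qed

lemma W_quot_mono: "k \<le> i \<Longrightarrow> (1 / W k) powr q \<le> (1 / W i) powr q"
  using W_pos[of i] W_pos[of k] W_antimono[of k i] q_pos by (intro powr_mono2) (auto intro!: divide_left_mono)

text \<open>For cubes at least as long as the averaging length the average is moved onto the weight
  of the cube. On smaller cubes it is bounded pointwise by the Morrey condition at its own scale,
  which is the better bound by monotonicity of \<open>W\<close>.\<close>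

lemma morrey_bound_single:
  fixes f a :: "real ^ 'n::finite \<Rightarrow> real"
  assumes f: "morrey_bound Y f" and [measurable]: "f \<in> borel_measurable borel" and f0: "\<And>x. 0 \<le> f x" and Y: "0 \<le> Y"
    and N: "4 * real CARD('n) \<le> N" and a: "\<And>x. 0 \<le> a x" "\<And>x. ennreal (a x) \<le> avg k N (\<lambda>y. ennreal (f y)) x"
  shows "morrey_bound ((cube_const TYPE('n) * (2 ^ CARD('n) * (cube_const TYPE('n) * 2 ^ CARD('n))) + cube_const TYPE('n) * 2 ^ CARD('n)) * Y) a"
proof -
  define g where "g = cube_const TYPE('n)"
  have g0: "0 < g" unfolding g_def by (rule cube_const_pos)
  have Avk: "avg k N (\<lambda>y. ennreal (f y)) x \<le> ennreal (g * 2 ^ CARD('n) * Y * (1 / W k) powr q)" for x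
    using order_trans[OF avg_antimono morrey_bound_avg[OF f _ Y]] N unfolding g_def by auto
  define a' where "a' x = enn2real (avg k N (\<lambda>y. ennreal (f y)) x)" for x
  have [measurable]: "a' \<in> borel_measurable borel" unfolding a'_def by measurable
  have a': "ennreal (a' x) = avg k N (\<lambda>y. ennreal (f y)) x" for x
    using le_less_trans[OF Avk[of x]] by (simp add: a'_def)
  have a'0: "0 \<le> a' x" for x by (simp add: a'_def)
  have aa': "a x \<le> a' x" for x using a(2)[of x] a'0 by (simp add: a'[symmetric])
  have a'k: "a' x \<le> g * 2 ^ CARD('n) * Y * (1 / W k) powr q" for x
    using Avk[of x] Y g0 unfolding a'[symmetric] by simp
  have "morrey_bound ((g * (2 ^ CARD('n) * (g * 2 ^ CARD('n))) + g * 2 ^ CARD('n)) * Y) a"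
    unfolding morrey_bound_def
  proof (intro allI)
    fix i and m :: "'n \<Rightarrow> int"
    have "0 \<le> 1 / W i * (1 / W i) powr q" using W_pos[of i] by simp
    show "(\<integral>\<^sup>+x\<in>dcube i m. ennreal (a x) \<partial>lborel) \<le>
      ennreal ((g * (2 ^ CARD('n) * (g * 2 ^ CARD('n))) + g * 2 ^ CARD('n)) * Y * (2 powr (- (real_of_int i * real CARD('n))) * (1 / W i) powr q))"
    proof (cases "i \<le> k")
      case True
      obtain x0 where x0: "x0 \<in> dcube i m" using dcube_nonempty by blast
      have "(\<integral>\<^sup>+x. ennreal (a' x * kern i (2 * real CARD('n)) x0 x) \<partial>lborel) =
         (\<integral>\<^sup>+x. avg k N (\<lambda>y. ennreal (f y)) x * ennreal (kern i (2 * real CARD('n)) x0 x) \<partial>lborel)"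
        by (simp add: a'0 ennreal_mult a')
      also have "\<dots> \<le> ennreal (2 ^ DIM(real^'n)) * (\<integral>\<^sup>+x. ennreal (f x) * ennreal (kern i (2 * real CARD('n)) x0 x) \<partial>lborel)"
        using N True by (intro avg_transfer[where M = "2 * real CARD('n)"])
          (auto simp flip: ennreal_mult intro!: ennreal_leI kern_coarse_shift)
      also have "(\<integral>\<^sup>+x. ennreal (f x) * ennreal (kern i (2 * real CARD('n)) x0 x) \<partial>lborel) = avg i (2 * real CARD('n)) (\<lambda>y. ennreal (f y)) x0"
        by (simp add: avg_def mult.commute)
      also have "ennreal (2 ^ DIM(real^'n)) * \<dots> \<le> ennreal (2 ^ DIM(real^'n)) * ennreal (g * 2 ^ CARD('n) * Y * (1 / W i) powr q)"
        using morrey_bound_avg[OF f _ Y] unfolding g_def by (intro mult_left_mono) auto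
      also have "\<dots> = ennreal ((2 ^ CARD('n) * (g * 2 ^ CARD('n)) * Y) * (1 / W i) powr q)"
        using g0 Y by (simp add: mult.assoc flip: ennreal_mult)
      finally have fine: "(\<integral>\<^sup>+x. ennreal (a' x * kern i (2 * real CARD('n)) x0 x) \<partial>lborel) \<le> ennreal ((2 ^ CARD('n) * (g * 2 ^ CARD('n)) * Y) * (1 / W i) powr q)" .
      have "a x \<le> a' x + (g * 2 ^ CARD('n) * Y) * (1 / W i) powr q" for x
        using aa'[of x] g0 Y by (smt (verit) mult_nonneg_nonneg powr_ge_zero zero_le_power)
      from morrey_bound_of_fine_coarse[OF _ a'0 fine this x0] show ?thesis
        using g0 Y by (simp add: g_def algebra_simps)
    next
      case False
      have "a x \<le> 0 + (g * 2 ^ CARD('n) * Y) * (1 / W i) powr q" for x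
        using aa'[of x] a'k[of x] W_quot_mono[of k i] False g0 Y
        by (smt (verit, best) mult_left_mono mult_nonneg_nonneg zero_le_power)
      moreover obtain x0 where x0: "x0 \<in> dcube i m" using dcube_nonempty by blast
      ultimately show ?thesis
        using morrey_bound_of_fine_coarse[of "\<lambda>_. 0" i x0 "2 ^ CARD('n) * (g * 2 ^ CARD('n)) * Y" a "g * 2 ^ CARD('n) * Y" m] g0 Y
        by (simp add: g_def algebra_simps)
    qed
  qed
  then show ?thesis unfolding g_def .
qed

text \<open>An inequality of Plancherel-Polya-Nikolskij type: control by its own average at scale
  \<open>k\<close> upgrades the Morrey condition to a pointwise bound with
  \<open>1 / W k\<close>.\<close>

lemma pointwise_of_morrey_bound:
  fixes h :: "real ^ 'n::finite \<Rightarrow> real"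
  assumes h: "morrey_bound Y (\<lambda>x. h x powr q)" and [measurable]: "h \<in> borel_measurable borel" and h0: "\<And>x. 0 \<le> h x"
    and Y: "0 \<le> Y" and D: "0 \<le> D"
    and self: "\<And>x. ennreal (h x powr q) \<le> ennreal D * avg k (2 * real CARD('n)) (\<lambda>y. ennreal (h y powr q)) x"
  shows "h x \<le> (D * (cube_const TYPE('n) * 2 ^ CARD('n)) * Y) powr (1 / q) * (1 / W k)"
proof -
  have "ennreal (h x powr q) \<le> ennreal D * ennreal (cube_const TYPE('n) * 2 ^ CARD('n) * Y * (1 / W k) powr q)"
    using order_trans[OF self mult_left_mono[OF morrey_bound_avg[OF h _ Y]]] by simp
  also have "\<dots> = ennreal (D * (cube_const TYPE('n) * 2 ^ CARD('n)) * Y * (1 / W k) powr q)"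
    using D Y cube_const_pos[where 'n='n] by (simp add: mult.assoc flip: ennreal_mult)
  finally have "h x powr q \<le> D * (cube_const TYPE('n) * 2 ^ CARD('n)) * Y * (1 / W k) powr q"
    using D Y cube_const_pos[where 'n='n] by (subst (asm) ennreal_le_iff) auto
  then have "(h x powr q) powr (1 / q) \<le> (D * (cube_const TYPE('n) * 2 ^ CARD('n)) * Y * (1 / W k) powr q) powr (1 / q)"
    using q_pos by (intro powr_mono2) auto
  then show ?thesis using q_pos h0[of x] W_pos[of k] D Y cube_const_pos[where 'n='n]
    by (simp add: powr_powr powr_mult)
qed

end

lemma powr_mult3:
  fixes c y v s r :: real
  shows "0 \<le> c \<Longrightarrow> 0 \<le> v \<Longrightarrow> (c * y powr s * v) powr r = c powr r * y powr (s * r) * v powr r"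
  by (simp add: powr_mult powr_powr)

context morrey_weight
begin

text \<open>At the scales finer than the cube the vector-valued inequality is applied to
  \<open>r\<close>-th powers with the exponent \<open>q / r\<close>. The coarser scales are summed
  after the pointwise bound, where \<open>Wsum\<close> compares their sum with the contribution of
  the cube. The averages \<open>a\<close> are part of the conclusion because their finiteness rests
  on the same pointwise bound.\<close>

lemma morrey_bound_lr:
  fixes r D N G :: real
  assumes r: "0 < r" and D: "0 < D" and G: "0 \<le> G"
    and N: "4 * real CARD('n::finite) + q / r + 1 + 4 * real CARD('n) / (q / r) \<le> N"
    and Wsum: "\<And>i K. finite K \<Longrightarrow> (\<And>k. k \<in> K \<Longrightarrow> k < i) \<Longrightarrow> (\<Sum>k\<in>K. (1 / W k) powr r) \<le> G * (1 / W i) powr r"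
  shows "\<exists>C>0. \<forall>F Y. \<forall>h :: int \<Rightarrow> real ^ 'n \<Rightarrow> real. finite F \<longrightarrow> 0 \<le> Y \<longrightarrow>
    (\<forall>k\<in>F. h k \<in> borel_measurable borel \<and> (\<forall>x. 0 \<le> h k x \<and>
       ennreal (h k x powr q) \<le> ennreal D * avg k (2 * real CARD('n)) (\<lambda>y. ennreal (h k y powr q)) x \<and>
       ennreal (h k x powr r) \<le> ennreal D * avg k N (\<lambda>y. ennreal (h k y powr r)) x)) \<longrightarrow>
    morrey_bound Y (\<lambda>x. (\<Sum>k\<in>F. h k x powr r) powr (q / r)) \<longrightarrow>
    (\<exists>a. (\<forall>k\<in>F. \<forall>x. 0 \<le> a k x \<and> ennreal (a k x) = avg k N (\<lambda>y. ennreal (h k y powr r)) x) \<and>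
       morrey_bound (C * Y) (\<lambda>x. (\<Sum>k\<in>F. a k x) powr (q / r)))"
proof -
  define n where "n = real CARD('n)"
  define p where "p = q / r"
  define g where "g = cube_const TYPE('n)"
  define c where "c = (D * (g * 2 ^ CARD('n))) powr (1 / q)"
  have p: "0 < p" using r q_pos by (simp add: p_def)
  have g0: "0 < g" unfolding g_def by (rule cube_const_pos)
  have "4 * real DIM(real^'n) + p + 1 + 4 * real DIM(real^'n) / p \<le> N" using N by (simp add: p_def)
  from vector_valued_average[OF p D this]
  obtain Cv where Cv: "0 < Cv" "\<forall>F i x0 H. \<forall>a b :: int \<Rightarrow> real^'n \<Rightarrow> real. avg_family N F a b \<longrightarrow> (\<forall>k\<in>F. i \<le> k) \<longrightarrow>
    (\<forall>k\<in>F. \<forall>x. a k x \<le> H) \<longrightarrow> (\<forall>k\<in>F. \<forall>x. b k x \<le> D * a k x) \<longrightarrow>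
    (\<integral>\<^sup>+x. ennreal ((\<Sum>k\<in>F. a k x) powr p * kern i (2 * real DIM(real^'n)) x0 x) \<partial>lborel)
    \<le> ennreal Cv * (\<integral>\<^sup>+x. ennreal ((\<Sum>k\<in>F. b k x) powr p * kern i (2 * real DIM(real^'n)) x0 x) \<partial>lborel)"
    by blast
  have N2: "2 * real DIM(real^'n) \<le> N" using N p unfolding p_def[symmetric] by (simp, smt (verit) divide_nonneg_nonneg of_nat_0_le_iff)
  define A where "A = 2 powr p * Cv * (g * 2 ^ CARD('n))"
  define B where "B = 2 powr p * (2 ^ CARD('n) * c powr r * G) powr p"
  have A0: "0 < A" and B0: "0 \<le> B" using Cv g0 by (simp_all add: A_def B_def)
  show ?thesis
  proof (intro exI[of _ "g * A + B"] conjI allI impI)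
    show "0 < g * A + B" using A0 B0 g0 by (simp add: add_pos_nonneg)
    fix F Y and h :: "int \<Rightarrow> real ^ 'n \<Rightarrow> real"
    assume fin: "finite F" and Y: "0 \<le> Y" and h: "(\<forall>k\<in>F. h k \<in> borel_measurable borel \<and> (\<forall>x. 0 \<le> h k x \<and>
       ennreal (h k x powr q) \<le> ennreal D * avg k (2 * real CARD('n)) (\<lambda>y. ennreal (h k y powr q)) x \<and>
       ennreal (h k x powr r) \<le> ennreal D * avg k N (\<lambda>y. ennreal (h k y powr r)) x))"
      and mb: "morrey_bound Y (\<lambda>x. (\<Sum>k\<in>F. h k x powr r) powr (q / r))"
    have [measurable]: "h k \<in> borel_measurable borel" if "k \<in> F" for k using h that by blast
    define b where "b k x = h k x powr r" for k x
    define a where "a k x = enn2real (avg k N (\<lambda>y. ennreal (b k y)) x)" for k x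
    \<comment> \<open>Bounds the \<open>k\<close>-th average at every point: the pointwise bound of
      \<open>h k\<close>, raised to the power \<open>r\<close>, times the mass
      \<open>2 ^ CARD('n)\<close> of the kernel.\<close>
    define U where "U k = 2 ^ CARD('n) * (c powr r * Y powr (1 / p) * (1 / W k) powr r)" for k
    have [measurable]: "b k \<in> borel_measurable borel" "a k \<in> borel_measurable borel" if "k \<in> F" for k
      using that unfolding b_def a_def by measurable
    have b0: "0 \<le> b k x" and a0: "0 \<le> a k x" for k x by (simp_all add: b_def a_def)
    have hle: "h k x \<le> c * Y powr (1 / q) * (1 / W k)" if k: "k \<in> F" for k x
    proof -
      have "morrey_bound Y (\<lambda>x. h k x powr q)"
      proof (rule morrey_bound_mono[OF mb])
        fix x
        have "h k x powr q = (h k x powr r) powr (q / r)" using r by (simp add: powr_powr)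
        also have "\<dots> \<le> (\<Sum>k\<in>F. h k x powr r) powr (q / r)"
          using fin k r q_pos by (intro powr_mono2 member_le_sum) auto
        finally show "h k x powr q \<le> (\<Sum>k\<in>F. h k x powr r) powr (q / r)" .
      qed
      then have "h k x \<le> (D * (cube_const TYPE('n) * 2 ^ CARD('n)) * Y) powr (1 / q) * (1 / W k)"
        using h k Y D by (intro pointwise_of_morrey_bound) auto
      then show ?thesis using D g0 Y by (simp add: c_def g_def powr_mult)
    qed
    have ble: "b k x \<le> c powr r * Y powr (1 / p) * (1 / W k) powr r" if k: "k \<in> F" for k x
    proof -
      have "b k x \<le> (c * Y powr (1 / q) * (1 / W k)) powr r"
        unfolding b_def using hle[OF k] h k r by (intro powr_mono2) auto
      also have "\<dots> = c powr r * Y powr (1 / p) * (1 / W k) powr r"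
        using W_pos[of k] by (subst powr_mult3) (auto simp: c_def p_def)
      finally show ?thesis .
    qed
    have AvU: "avg k N (\<lambda>y. ennreal (b k y)) x \<le> ennreal (U k)" if k: "k \<in> F" for k x
    proof -
      have "avg k N (\<lambda>y. ennreal (b k y)) x \<le> avg k N (\<lambda>y. ennreal (c powr r * Y powr (1 / p) * (1 / W k) powr r)) x"
        by (intro avg_mono ennreal_leI ble k)
      also have "\<dots> \<le> ennreal (2 ^ DIM(real^'n)) * ennreal (c powr r * Y powr (1 / p) * (1 / W k) powr r)"
        by (rule avg_const_le[OF N2])
      also have "\<dots> = ennreal (U k)" by (simp add: U_def flip: ennreal_mult)
      finally show ?thesis .
    qed
    have ea: "ennreal (a k x) = avg k N (\<lambda>y. ennreal (b k y)) x" if k: "k \<in> F" for k x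
      using le_less_trans[OF AvU[OF k, of x]] by (simp add: a_def)
    have aU: "a k x \<le> U k" if k: "k \<in> F" for k x
      using AvU[OF k, of x] unfolding ea[OF k, symmetric] by (subst (asm) ennreal_le_iff) (auto simp: U_def)
    have U0: "0 \<le> U k" for k by (simp add: U_def)
    have bDa: "b k x \<le> D * a k x" if k: "k \<in> F" for k x
    proof -
      have "ennreal (b k x) \<le> ennreal (D * a k x)"
        using h k D a0 by (simp add: ennreal_mult ea[OF k]) (simp add: b_def)
      then show ?thesis using D a0 by (subst (asm) ennreal_le_iff) auto
    qed
    have av: "avg_family N F' a b" if "F' \<subseteq> F" for F'
      unfolding avg_family_def using that fin ea b0 a0 by (auto intro: finite_subset)
    have "morrey_bound ((g * A + B) * Y) (\<lambda>x. (\<Sum>k\<in>F. a k x) powr p)"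
      unfolding morrey_bound_def
    proof (intro allI)
      fix i and m :: "'n \<Rightarrow> int"
      define F1 where "F1 = {k\<in>F. i \<le> k}"
      define F2 where "F2 = {k\<in>F. k < i}"
      have F12: "finite F1" "finite F2" "F1 \<subseteq> F" "F2 \<subseteq> F" "F1 \<inter> F2 = {}" "F = F1 \<union> F2"
        using fin by (auto simp: F1_def F2_def)
      obtain x0 :: "real^'n" where x0: "x0 \<in> dcube i m" using dcube_nonempty by blast
      have [measurable]: "(\<lambda>x. \<Sum>k\<in>F1. a k x) \<in> borel_measurable borel"
        using F12(3) by (intro borel_measurable_sum) auto
      have fine: "(\<integral>\<^sup>+x. ennreal (2 powr p * (\<Sum>k\<in>F1. a k x) powr p * kern i (2 * real CARD('n)) x0 x) \<partial>lborel) \<le> ennreal (A * Y * (1 / W i) powr q)"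
      proof -
        have "(\<integral>\<^sup>+x. ennreal (2 powr p * (\<Sum>k\<in>F1. a k x) powr p * kern i (2 * real CARD('n)) x0 x) \<partial>lborel) =
            (\<integral>\<^sup>+x. ennreal (2 powr p) * ennreal ((\<Sum>k\<in>F1. a k x) powr p * kern i (2 * real CARD('n)) x0 x) \<partial>lborel)"
          by (simp add: mult.assoc flip: ennreal_mult)
        also have "\<dots> = ennreal (2 powr p) * (\<integral>\<^sup>+x. ennreal ((\<Sum>k\<in>F1. a k x) powr p * kern i (2 * real CARD('n)) x0 x) \<partial>lborel)"
          by (rule nn_integral_cmult) measurable
        also have "\<dots> \<le> ennreal (2 powr p) * (ennreal Cv * (\<integral>\<^sup>+x. ennreal ((\<Sum>k\<in>F1. b k x) powr p * kern i (2 * real CARD('n)) x0 x) \<partial>lborel))"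
        proof (intro mult_left_mono)
          \<comment> \<open>Any finite bound serves here; it only certifies finiteness and does not
            enter \<open>Cv\<close>.\<close>
          have "\<forall>k\<in>F1. \<forall>x. a k x \<le> (\<Sum>k\<in>F. U k)"
            using aU F12(3) fin U0 by (meson member_le_sum order_trans subsetD)
          then show "(\<integral>\<^sup>+x. ennreal ((\<Sum>k\<in>F1. a k x) powr p * kern i (2 * real CARD('n)) x0 x) \<partial>lborel) \<le>
              ennreal Cv * (\<integral>\<^sup>+x. ennreal ((\<Sum>k\<in>F1. b k x) powr p * kern i (2 * real CARD('n)) x0 x) \<partial>lborel)"
            using Cv(2)[rule_format, OF av[OF F12(3)], of i "\<Sum>k\<in>F. U k" x0] bDa F12(3) by (auto simp: F1_def)
        qed auto
        also have "(\<integral>\<^sup>+x. ennreal ((\<Sum>k\<in>F1. b k x) powr p * kern i (2 * real CARD('n)) x0 x) \<partial>lborel) \<le>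
            avg i (2 * real CARD('n)) (\<lambda>y. ennreal ((\<Sum>k\<in>F. b k y) powr p)) x0"
          unfolding avg_def
        proof (intro nn_integral_mono)
          fix x
          have "(\<Sum>k\<in>F1. b k x) powr p \<le> (\<Sum>k\<in>F. b k x) powr p"
            using F12 fin b0 p by (intro powr_mono2 sum_mono2 sum_nonneg) auto
          then show "ennreal ((\<Sum>k\<in>F1. b k x) powr p * kern i (2 * real CARD('n)) x0 x) \<le>
              ennreal (kern i (2 * real CARD('n)) x0 x) * ennreal ((\<Sum>k\<in>F. b k x) powr p)"
            by (subst mult.commute) (auto simp: ennreal_mult intro!: mult_left_mono ennreal_leI)
        qed
        also have "\<dots> \<le> ennreal (g * 2 ^ CARD('n) * Y * (1 / W i) powr q)"
          unfolding g_def using mb Y by (intro morrey_bound_avg) (auto simp: b_def p_def)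
        finally have "(\<integral>\<^sup>+x. ennreal (2 powr p * (\<Sum>k\<in>F1. a k x) powr p * kern i (2 * real CARD('n)) x0 x) \<partial>lborel) \<le>
           ennreal (2 powr p) * (ennreal Cv * ennreal (g * 2 ^ CARD('n) * Y * (1 / W i) powr q))"
          by (simp add: mult_left_mono)
        also have "\<dots> = ennreal (A * Y * (1 / W i) powr q)"
          using Cv g0 Y by (simp add: A_def mult.assoc flip: ennreal_mult)
        finally show ?thesis .
      qed
      have split: "(\<Sum>k\<in>F. a k x) powr p \<le> 2 powr p * (\<Sum>k\<in>F1. a k x) powr p + B * Y * (1 / W i) powr q" for x
      proof -
        have "(\<Sum>k\<in>F2. a k x) \<le> (\<Sum>k\<in>F2. 2 ^ CARD('n) * c powr r * Y powr (1 / p) * (1 / W k) powr r)"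
          using aU F12 by (intro sum_mono) (auto simp: U_def mult.assoc)
        also have "\<dots> \<le> 2 ^ CARD('n) * c powr r * Y powr (1 / p) * (G * (1 / W i) powr r)"
          using Wsum[OF F12(2), of i] by (simp add: F2_def flip: sum_distrib_left) (intro mult_left_mono, auto)
        also have "\<dots> = (2 ^ CARD('n) * c powr r * G) * Y powr (1 / p) * (1 / W i) powr r" by simp
        finally have "(\<Sum>k\<in>F2. a k x) powr p \<le> ((2 ^ CARD('n) * c powr r * G) * Y powr (1 / p) * (1 / W i) powr r) powr p"
          using p a0 by (intro powr_mono2 sum_nonneg) auto
        also have "\<dots> = (2 ^ CARD('n) * c powr r * G) powr p * Y * (1 / W i) powr q"
        proof (subst powr_mult3)
          show "(2 ^ CARD('n) * c powr r * G) powr p * Y powr (1 / p * p) * ((1 / W i) powr r) powr p =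
              (2 ^ CARD('n) * c powr r * G) powr p * Y * (1 / W i) powr q"
            using p r Y by (simp add: powr_powr) (simp add: p_def)
        qed (use G in auto)
        finally have c: "(\<Sum>k\<in>F2. a k x) powr p \<le> (2 ^ CARD('n) * c powr r * G) powr p * Y * (1 / W i) powr q" .
        have "(\<Sum>k\<in>F. a k x) = (\<Sum>k\<in>F1. a k x) + (\<Sum>k\<in>F2. a k x)"
          using F12 by (simp add: sum.union_disjoint)
        then have "(\<Sum>k\<in>F. a k x) powr p \<le> 2 powr p * ((\<Sum>k\<in>F1. a k x) powr p + (\<Sum>k\<in>F2. a k x) powr p)"
          using p a0 by (simp only:) (intro sum_powr_split sum_nonneg, auto)
        also have "\<dots> \<le> 2 powr p * ((\<Sum>k\<in>F1. a k x) powr p + (2 ^ CARD('n) * c powr r * G) powr p * Y * (1 / W i) powr q)"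
          by (intro mult_left_mono add_left_mono c) auto
        finally show ?thesis by (simp add: B_def algebra_simps)
      qed
      have "(\<integral>\<^sup>+x\<in>dcube i m. ennreal ((\<Sum>k\<in>F. a k x) powr p) \<partial>lborel) \<le>
         ennreal ((cube_const TYPE('n) * (A * Y) + B * Y) * (2 powr (- (real_of_int i * real CARD('n))) * (1 / W i) powr q))"
        using morrey_bound_of_fine_coarse[OF _ _ fine split x0] A0 B0 Y by simp
      then show "(\<integral>\<^sup>+x\<in>dcube i m. ennreal ((\<Sum>k\<in>F. a k x) powr p) \<partial>lborel) \<le>
         ennreal ((g * A + B) * Y * (2 powr (- (real_of_int i * real CARD('n))) * (1 / W i) powr q))"
        by (simp add: g_def algebra_simps)
    qed
    then show "\<exists>a. (\<forall>k\<in>F. \<forall>x. 0 \<le> a k x \<and> ennreal (a k x) = avg k N (\<lambda>y. ennreal (h k y powr r)) x) \<and>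
       morrey_bound ((g * A + B) * Y) (\<lambda>x. (\<Sum>k\<in>F. a k x) powr (q / r))"
      using ea a0 unfolding b_def p_def by (intro exI[of _ a]) auto
  qed
qed

end

section \<open>Maximal averages\<close>

definition fmax :: "int set \<Rightarrow> (int \<Rightarrow> real) \<Rightarrow> real"
  where "fmax F f = Max (insert 0 (f ` F))"

lemma fmax_nonneg: "finite F \<Longrightarrow> 0 \<le> fmax F f"
  by (simp add: fmax_def)

lemma fmax_ge: "finite F \<Longrightarrow> k \<in> F \<Longrightarrow> f k \<le> fmax F f"
  by (simp add: fmax_def)

lemma fmax_leI: "finite F \<Longrightarrow> 0 \<le> c \<Longrightarrow> (\<And>k. k \<in> F \<Longrightarrow> f k \<le> c) \<Longrightarrow> fmax F f \<le> c"
  by (auto simp: fmax_def)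

lemma fmax_measurable:
  assumes "finite F" "\<And>k. k \<in> F \<Longrightarrow> f k \<in> borel_measurable M"
  shows "(\<lambda>x. fmax F (\<lambda>k. f k x)) \<in> borel_measurable M"
  using assms
proof (induction F rule: finite_induct)
  case (insert k F)
  have "fmax (insert k F) (\<lambda>k. f k x) = max (f k x) (fmax F (\<lambda>k. f k x))" for x
    using insert.hyps unfolding fmax_def image_insert by (subst insert_commute) (rule Max_insert, auto)
  with insert show ?case by simp
qed (simp add: fmax_def)

text \<open>The element 0 inserted in \<open>fmax\<close> is harmless for a nonempty family of
  nonnegative values.\<close>

lemma fmax_attained:
  assumes "finite F" "F \<noteq> {}" "\<And>k. k \<in> F \<Longrightarrow> 0 \<le> f k"
  shows "\<exists>k\<in>F. f k = fmax F f"
proof -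
  obtain k where k: "k \<in> F" using assms by blast
  have "fmax F f = Max (f ` F)"
  proof (rule antisym)
    show "fmax F f \<le> Max (f ` F)"
      using assms k by (intro fmax_leI) (auto intro: order_trans[OF assms(3)] Max_ge)
  qed (use assms in \<open>auto intro!: fmax_ge\<close>)
  then show ?thesis using Max_in[of "f ` F"] assms by (metis finite_imageI image_iff image_is_empty)
qed

text \<open>By symmetry of the kernel the average passes from \<open>b\<close> to \<open>c\<close>,
  which, unlike \<open>w\<close>, is not assumed to vary slowly and is averaged in turn.\<close>

lemma avg_adjoint:
  fixes w :: "'a::euclidean_space \<Rightarrow> ennreal"
  assumes [measurable]: "b \<in> borel_measurable borel" "c \<in> borel_measurable borel" "w \<in> borel_measurable borel"
    and w: "\<And>x y. w x \<le> ennreal (sdist k x y powr M) * w y"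
  shows "(\<integral>\<^sup>+x. avg k N b x * (c x * w x) \<partial>lborel) \<le> (\<integral>\<^sup>+y. b y * w y * avg k (N - M) c y \<partial>lborel)"
proof -
  have "(\<integral>\<^sup>+x. avg k N b x * (c x * w x) \<partial>lborel) = (\<integral>\<^sup>+x. (\<integral>\<^sup>+y. ennreal (kern k N x y) * b y * (c x * w x) \<partial>lborel) \<partial>lborel)"
    unfolding avg_def by (subst nn_integral_multc) auto
  also have "\<dots> \<le> (\<integral>\<^sup>+x. (\<integral>\<^sup>+y. b y * w y * (ennreal (kern k (N - M) y x) * c x) \<partial>lborel) \<partial>lborel)"
  proof (intro nn_integral_mono)
    fix x y
    have "ennreal (kern k N x y) * b y * (c x * w x) \<le> ennreal (kern k N x y) * b y * (c x * (ennreal (sdist k x y powr M) * w y))"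
      by (intro mult_left_mono w) auto
    also have "\<dots> = ennreal (kern k N x y * sdist k x y powr M) * (b y * w y * c x)"
      by (simp add: ennreal_mult mult_ac)
    finally show "ennreal (kern k N x y) * b y * (c x * w x) \<le> b y * w y * (ennreal (kern k (N - M) y x) * c x)"
      by (simp add: kern_sdist kern_commute[of k _ y] mult_ac)
  qed
  also have "\<dots> = (\<integral>\<^sup>+y. (\<integral>\<^sup>+x. b y * w y * (ennreal (kern k (N - M) y x) * c x) \<partial>lborel) \<partial>lborel)"
    by (rule lborel_pair.Fubini') measurable
  also have "\<dots> = (\<integral>\<^sup>+y. b y * w y * avg k (N - M) c y \<partial>lborel)"
    unfolding avg_def by (subst nn_integral_cmult) auto
  finally show ?thesis .
qed

text \<open>The maximal average is dual to the sum of averages over the sets where a given scale is the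
  first to attain the maximum.\<close>

lemma maximal_average:
  assumes N: "6 * real DIM('a::euclidean_space) + 3 \<le> N"
  shows "\<exists>C>0. \<forall>F i x0 H u. \<forall>a b :: int \<Rightarrow> 'a \<Rightarrow> real. avg_family N F a b \<longrightarrow> (\<forall>k\<in>F. i \<le> k) \<longrightarrow>
    (\<forall>k\<in>F. \<forall>x. a k x \<le> H) \<longrightarrow> u \<in> borel_measurable borel \<longrightarrow> (\<forall>x. 0 \<le> u x) \<longrightarrow> (\<forall>k\<in>F. \<forall>x. b k x \<le> u x) \<longrightarrow>
    (\<integral>\<^sup>+x. ennreal (fmax F (\<lambda>k. a k x) powr 2 * kern i (2 * real DIM('a)) x0 x) \<partial>lborel)
    \<le> ennreal C * (\<integral>\<^sup>+x. ennreal (u x powr 2 * kern i (2 * real DIM('a)) x0 x) \<partial>lborel)"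
proof -
  define n where "n = real DIM('a)"
  \<comment> \<open>Passing to the dual averages loses \<open>2 * n\<close> orders to the weight;
    together with the requirement of the convex case for \<open>p = 2\<close> this gives
    \<open>6 * real DIM('a) + 3\<close>.\<close>
  have "1 \<le> (2::real)" "4 * real DIM('a) + 2 + 1 \<le> N - 2 * n" using N by (auto simp: n_def)
  from vector_valued_convex[OF this]
  obtain C where C: "0 < C" "\<forall>F i x0 H. \<forall>a b :: int \<Rightarrow> 'a \<Rightarrow> real. avg_family (N - 2 * n) F a b \<longrightarrow> (\<forall>k\<in>F. i \<le> k) \<longrightarrow>
    (\<forall>k\<in>F. \<forall>x. a k x \<le> H) \<longrightarrow>
    (\<integral>\<^sup>+x. ennreal ((\<Sum>k\<in>F. a k x) powr 2 * kern i (2 * real DIM('a)) x0 x) \<partial>lborel)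
    \<le> ennreal C * (\<integral>\<^sup>+x. ennreal ((\<Sum>k\<in>F. b k x) powr 2 * kern i (2 * real DIM('a)) x0 x) \<partial>lborel)"
    by blast
  show ?thesis
  proof (intro exI[of _ C] conjI allI impI)
    show "0 < C" by (rule C)
    fix F i and x0 :: 'a and H u and a b :: "int \<Rightarrow> 'a \<Rightarrow> real"
    assume ab: "avg_family N F a b" and F: "\<forall>k\<in>F. i \<le> k" and H: "\<forall>k\<in>F. \<forall>x. a k x \<le> H"
      and [measurable]: "u \<in> borel_measurable borel" and u0: "\<forall>x. 0 \<le> u x" and bu: "\<forall>k\<in>F. \<forall>x. b k x \<le> u x"
    note fin = avg_familyD(1)[OF ab]
    have [measurable]: "b k \<in> borel_measurable borel" "a k \<in> borel_measurable borel" if "k \<in> F" for k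
      using avg_familyD(2)[OF ab that] avg_family_measurable[OF ab that] by auto
    have a0: "0 \<le> a k x" if "k \<in> F" for k x using avg_familyD[OF ab] that by auto
    define w where "w x = kern i (2 * n) x0 x" for x
    define m where "m x = fmax F (\<lambda>k. a k x)" for x
    \<comment> \<open>Ties go to the smallest scale, so for nonempty \<open>F\<close> exactly one
      \<open>k \<in> F\<close> satisfies \<open>E k x\<close>, and the functions \<open>c k\<close>
      split \<open>m\<close> into disjoint pieces.\<close>
    define E where "E k x \<longleftrightarrow> a k x = m x \<and> (\<forall>j\<in>F. j < k \<longrightarrow> a j x < m x)" for k x
    define c where "c k x = (if E k x then m x else 0)" for k x
    have [measurable]: "m \<in> borel_measurable borel" unfolding m_def using fin by (intro fmax_measurable) auto
    have [measurable]: "w \<in> borel_measurable borel" unfolding w_def by measurable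
    have [measurable]: "Measurable.pred borel (E k)" if "k \<in> F" for k
      using that fin unfolding E_def by measurable
    have [measurable]: "c k \<in> borel_measurable borel" if "k \<in> F" for k
      using that unfolding c_def by measurable
    have m0: "0 \<le> m x" for x unfolding m_def by (rule fmax_nonneg[OF fin])
    have w0: "0 \<le> w x" for x by (simp add: w_def)
    have c0: "0 \<le> c k x" for k x using m0 by (simp add: c_def)
    have mH: "m x \<le> \<bar>H\<bar>" for x unfolding m_def using H by (intro fmax_leI fin) (auto, smt (verit))
    have wshift: "ennreal (w x) \<le> ennreal (sdist k x y powr (2 * n)) * ennreal (w y)" if "k \<in> F" for k x y
      using F that unfolding w_def by (auto simp: n_def simp flip: ennreal_mult intro!: ennreal_leI kern_coarse_shift)
    have csum: "(\<Sum>k\<in>F. c k x) = m x" and csum': "(\<Sum>k\<in>F. c k x * a k x) = m x powr 2" for x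
    proof -
      have "(\<Sum>k\<in>F. c k x) = m x \<and> (\<Sum>k\<in>F. c k x * a k x) = m x powr 2"
      proof (cases "F = {}")
        case True
        then show ?thesis by (simp add: m_def fmax_def)
      next
        case False
        define K where "K = {k\<in>F. a k x = m x}"
        have K: "finite K" "K \<noteq> {}" using fmax_attained[OF fin False, of "\<lambda>k. a k x"] a0 fin by (auto simp: K_def m_def)
        define k0 where "k0 = Min K"
        have k0: "k0 \<in> K" unfolding k0_def using K by (rule Min_in)
        have am: "a k x \<le> m x" if "k \<in> F" for k unfolding m_def by (rule fmax_ge[OF fin that])
        have E: "E k x \<longleftrightarrow> k = k0" if k: "k \<in> F" for k
        proof
          assume "E k x"
          then have kK: "k \<in> K" and lt: "\<forall>j\<in>F. j < k \<longrightarrow> a j x < m x" using k by (auto simp: E_def K_def)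
          have "k0 \<le> k" using K kK by (simp add: k0_def)
          moreover have "\<not> k0 < k" using lt k0 by (auto simp: K_def)
          ultimately show "k = k0" by simp
        next
          assume "k = k0"
          moreover have "a j x < m x" if "j \<in> F" "j < k0" for j
          proof -
            have "j \<notin> K" using K that by (auto simp: k0_def)
            then show ?thesis using am[OF that(1)] that by (auto simp: K_def less_le)
          qed
          ultimately show "E k x" using k0 by (auto simp: E_def K_def)
        qed
        have k0F: "k0 \<in> F" "a k0 x = m x" using k0 by (auto simp: K_def)
        have "(\<Sum>k\<in>F. c k x) = (\<Sum>k\<in>F. if k = k0 then m x else 0)"
          by (intro sum.cong) (auto simp: c_def E)
        moreover have "(\<Sum>k\<in>F. c k x * a k x) = (\<Sum>k\<in>F. if k = k0 then m x * a k x else 0)"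
          by (intro sum.cong) (auto simp: c_def E)
        ultimately show ?thesis using fin k0F m0[of x] by (simp add: powr_numeral power2_eq_square)
      qed
      then show "(\<Sum>k\<in>F. c k x) = m x" "(\<Sum>k\<in>F. c k x * a k x) = m x powr 2" by auto
    qed
    have N2: "2 * real DIM('a) \<le> N - 2 * n" using N by (simp add: n_def)
    have Avc: "avg k (N - 2 * n) (\<lambda>y. ennreal (c k y)) x \<le> ennreal (2 ^ DIM('a) * \<bar>H\<bar>)" for k x
    proof -
      have "avg k (N - 2 * n) (\<lambda>y. ennreal (c k y)) x \<le> avg k (N - 2 * n) (\<lambda>y. ennreal \<bar>H\<bar>) x"
        using mH m0 by (intro avg_mono ennreal_leI) (auto simp: c_def)
      also have "\<dots> \<le> ennreal (2 ^ DIM('a)) * ennreal \<bar>H\<bar>" by (rule avg_const_le[OF N2])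
      also have "\<dots> = ennreal (2 ^ DIM('a) * \<bar>H\<bar>)" by (simp flip: ennreal_mult)
      finally show ?thesis .
    qed
    define a' where "a' k x = enn2real (avg k (N - 2 * n) (\<lambda>y. ennreal (c k y)) x)" for k x
    have ea': "ennreal (a' k x) = avg k (N - 2 * n) (\<lambda>y. ennreal (c k y)) x" for k x
      using le_less_trans[OF Avc[of k x]] by (simp add: a'_def)
    have a'0: "0 \<le> a' k x" for k x by (simp add: a'_def)
    have a'H: "a' k x \<le> 2 ^ DIM('a) * \<bar>H\<bar>" for k x
      using Avc[of k x] unfolding ea'[symmetric] by (subst (asm) ennreal_le_iff) auto
    have av': "avg_family (N - 2 * n) F a' c"
      unfolding avg_family_def using fin ea' a'0 c0 by auto
    have [measurable]: "a' k \<in> borel_measurable borel" if "k \<in> F" for k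
      using avg_family_measurable[OF av' that] .
    define S where "S x = (\<Sum>k\<in>F. a' k x)" for x
    have [measurable]: "S \<in> borel_measurable borel" unfolding S_def by measurable
    have S0: "0 \<le> S x" for x unfolding S_def by (intro sum_nonneg a'0)
    define I where "I = (\<integral>\<^sup>+x. ennreal (m x powr 2 * w x) \<partial>lborel)"
    define U where "U = (\<integral>\<^sup>+x. ennreal (u x powr 2 * w x) \<partial>lborel)"
    have "I = (\<integral>\<^sup>+x. (\<Sum>k\<in>F. ennreal (a k x) * (ennreal (c k x) * ennreal (w x))) \<partial>lborel)"
      unfolding I_def
    proof (intro nn_integral_cong)
      fix x
      have "(\<Sum>k\<in>F. ennreal (a k x) * (ennreal (c k x) * ennreal (w x))) = (\<Sum>k\<in>F. ennreal (a k x * (c k x * w x)))"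
        using a0 c0 w0 by (intro sum.cong) (auto simp: ennreal_mult)
      also have "\<dots> = ennreal (\<Sum>k\<in>F. a k x * (c k x * w x))"
        using a0 c0 w0 by (intro sum_ennreal) auto
      also have "(\<Sum>k\<in>F. a k x * (c k x * w x)) = m x powr 2 * w x"
        unfolding csum'[symmetric] sum_distrib_right by (simp add: mult_ac)
      finally show "ennreal (m x powr 2 * w x) = (\<Sum>k\<in>F. ennreal (a k x) * (ennreal (c k x) * ennreal (w x)))" by simp
    qed
    also have "\<dots> = (\<Sum>k\<in>F. \<integral>\<^sup>+x. ennreal (a k x) * (ennreal (c k x) * ennreal (w x)) \<partial>lborel)"
      by (rule nn_integral_sum) auto
    also have "\<dots> \<le> (\<Sum>k\<in>F. \<integral>\<^sup>+x. ennreal (u x) * ennreal (w x) * ennreal (a' k x) \<partial>lborel)"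
    proof (intro sum_mono)
      fix k assume k: "k \<in> F"
      have "(\<integral>\<^sup>+x. ennreal (a k x) * (ennreal (c k x) * ennreal (w x)) \<partial>lborel) \<le>
          (\<integral>\<^sup>+x. ennreal (b k x) * ennreal (w x) * avg k (N - 2 * n) (\<lambda>y. ennreal (c k y)) x \<partial>lborel)"
        unfolding avg_familyD(5)[OF ab k, symmetric] using k by (intro avg_adjoint wshift) auto
      also have "\<dots> \<le> (\<integral>\<^sup>+x. ennreal (u x) * ennreal (w x) * ennreal (a' k x) \<partial>lborel)"
        unfolding ea' using bu k by (intro nn_integral_mono mult_right_mono ennreal_leI) auto
      finally show "(\<integral>\<^sup>+x. ennreal (a k x) * (ennreal (c k x) * ennreal (w x)) \<partial>lborel) \<le> \<dots>" .
    qed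
    also have "\<dots> = (\<integral>\<^sup>+x. (\<Sum>k\<in>F. ennreal (u x) * ennreal (w x) * ennreal (a' k x)) \<partial>lborel)"
      by (rule nn_integral_sum[symmetric]) auto
    \<comment> \<open>The weighted Cauchy inequality; the coefficient \<open>1 / (2 * C)\<close>
      times the constant \<open>C\<close> of the vector-valued inequality leaves one half of
      \<open>I\<close>.\<close>
    also have "\<dots> \<le> (\<integral>\<^sup>+x. ennreal (1 / (2 * C)) * ennreal (S x powr 2 * w x) + ennreal (C / 2) * ennreal (u x powr 2 * w x) \<partial>lborel)"
    proof (intro nn_integral_mono)
      fix x
      have "0 \<le> (S x - C * u x)\<^sup>2 / (2 * C)" using C by simp
      also have "\<dots> = 1 / (2 * C) * (S x)\<^sup>2 + C / 2 * (u x)\<^sup>2 - u x * S x"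
        using C by (simp add: power2_eq_square field_simps)
      finally have "u x * S x * w x \<le> (1 / (2 * C) * (S x)\<^sup>2 + C / 2 * (u x)\<^sup>2) * w x"
        using w0 by (intro mult_right_mono) auto
      then have "u x * S x * w x \<le> 1 / (2 * C) * (S x powr 2 * w x) + C / 2 * (u x powr 2 * w x)"
        using S0 u0 by (simp add: powr_numeral algebra_simps)
      then have le: "ennreal (u x * S x * w x) \<le> ennreal (1 / (2 * C)) * ennreal (S x powr 2 * w x) + ennreal (C / 2) * ennreal (u x powr 2 * w x)"
        using C w0 by (auto simp flip: ennreal_mult ennreal_plus intro!: ennreal_leI)
      have "(\<Sum>k\<in>F. ennreal (u x) * ennreal (w x) * ennreal (a' k x)) = ennreal (u x) * ennreal (w x) * ennreal (S x)"
        using a'0 by (simp add: S_def flip: sum_distrib_left)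
      also have "\<dots> = ennreal (u x * S x * w x)" using u0 w0 S0 by (simp add: mult_ac flip: ennreal_mult)
      finally show "(\<Sum>k\<in>F. ennreal (u x) * ennreal (w x) * ennreal (a' k x)) \<le>
          ennreal (1 / (2 * C)) * ennreal (S x powr 2 * w x) + ennreal (C / 2) * ennreal (u x powr 2 * w x)"
        using le by (rule ord_eq_le_trans)
    qed
    also have "\<dots> = ennreal (1 / (2 * C)) * (\<integral>\<^sup>+x. ennreal (S x powr 2 * w x) \<partial>lborel) + ennreal (C / 2) * U"
      unfolding U_def by (subst nn_integral_add) (auto simp: nn_integral_cmult)
    \<comment> \<open>The functions \<open>c k\<close> add up to \<open>m\<close>, so the
      vector-valued inequality returns the integral \<open>I\<close> itself.\<close>
    also have "(\<integral>\<^sup>+x. ennreal (S x powr 2 * w x) \<partial>lborel) \<le> ennreal C * I"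
      using C(2)[rule_format, OF av', of i "2 ^ DIM('a) * \<bar>H\<bar>" x0] F a'H by (simp add: S_def w_def I_def n_def csum)
    finally have "I \<le> ennreal (1 / (2 * C)) * (ennreal C * I) + ennreal (C / 2) * U"
      by (simp add: mult_left_mono add_right_mono)
    also have "ennreal (1 / (2 * C)) * (ennreal C * I) = ennreal (1/2) * I"
      using C by (simp add: mult.assoc[symmetric] flip: ennreal_mult)
    finally have main: "I \<le> ennreal (1/2) * I + ennreal (C / 2) * U" .
    have "I \<le> (\<integral>\<^sup>+x. ennreal (\<bar>H\<bar> powr 2) * ennreal (w x) \<partial>lborel)"
      unfolding I_def
    proof (intro nn_integral_mono)
      fix x
      have "m x powr 2 * w x \<le> \<bar>H\<bar> powr 2 * w x"
        using mH m0 w0 by (intro mult_right_mono powr_mono2) auto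
      then show "ennreal (m x powr 2 * w x) \<le> ennreal (\<bar>H\<bar> powr 2) * ennreal (w x)"
        unfolding ennreal_mult[OF powr_ge_zero w0, symmetric] by (rule ennreal_leI)
    qed
    also have "\<dots> = ennreal (\<bar>H\<bar> powr 2) * (\<integral>\<^sup>+x. ennreal (w x) \<partial>lborel)"
      by (rule nn_integral_cmult) auto
    also have "\<dots> \<le> ennreal (\<bar>H\<bar> powr 2) * ennreal (2 ^ DIM('a))"
      unfolding w_def n_def by (intro mult_left_mono nn_integral_kern_le) auto
    also have "\<dots> < \<infinity>" by (simp add: ennreal_mult_less_top)
    finally have "I \<le> 2 * (ennreal (C / 2) * U)" by (rule ennreal_absorb_half[OF main])
    also have "\<dots> = ennreal C * U"
    proof -
      have "(2::ennreal) * ennreal (C / 2) = ennreal (2 * (C / 2))" using C by (subst ennreal_mult) auto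
      then show ?thesis by (simp add: mult.assoc[symmetric])
    qed
    finally show "(\<integral>\<^sup>+x. ennreal (fmax F (\<lambda>k. a k x) powr 2 * kern i (2 * real DIM('a)) x0 x) \<partial>lborel)
      \<le> ennreal C * (\<integral>\<^sup>+x. ennreal (u x powr 2 * kern i (2 * real DIM('a)) x0 x) \<partial>lborel)"
      unfolding I_def U_def m_def w_def n_def .
  qed
qed

context morrey_weight
begin

text \<open>The powers \<open>q / 2\<close> bring the maximal inequality into the exponent 2. At the
  coarser scales the maximum of the pointwise bounds is taken, and monotonicity of \<open>W\<close>
  suffices where a sum would require decay.\<close>

lemma morrey_bound_sup:
  fixes D N :: real
  assumes D: "0 < D" and N: "6 * real CARD('n::finite) + 3 \<le> N"
  shows "\<exists>C>0. \<forall>F Y. \<forall>h :: int \<Rightarrow> real ^ 'n \<Rightarrow> real. finite F \<longrightarrow> 0 \<le> Y \<longrightarrow>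
    (\<forall>k\<in>F. h k \<in> borel_measurable borel \<and> (\<forall>x. 0 \<le> h k x \<and>
       ennreal (h k x powr q) \<le> ennreal D * avg k (2 * real CARD('n)) (\<lambda>y. ennreal (h k y powr q)) x)) \<longrightarrow>
    morrey_bound Y (\<lambda>x. fmax F (\<lambda>k. h k x) powr q) \<longrightarrow>
    (\<exists>a. (\<forall>k\<in>F. \<forall>x. 0 \<le> a k x \<and> ennreal (a k x) = avg k N (\<lambda>y. ennreal (h k y powr (q / 2))) x) \<and>
       morrey_bound (C * Y) (\<lambda>x. fmax F (\<lambda>k. a k x) powr 2))"
proof -
  define g where "g = cube_const TYPE('n)"
  define c where "c = (D * (g * 2 ^ CARD('n))) powr (1 / q)"
  have g0: "0 < g" unfolding g_def by (rule cube_const_pos)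
  have "6 * real DIM(real^'n) + 3 \<le> N" using N by simp
  from maximal_average[OF this]
  obtain Cv where Cv: "0 < Cv" "\<forall>F i x0 H u. \<forall>a b :: int \<Rightarrow> real^'n \<Rightarrow> real. avg_family N F a b \<longrightarrow> (\<forall>k\<in>F. i \<le> k) \<longrightarrow>
    (\<forall>k\<in>F. \<forall>x. a k x \<le> H) \<longrightarrow> u \<in> borel_measurable borel \<longrightarrow> (\<forall>x. 0 \<le> u x) \<longrightarrow> (\<forall>k\<in>F. \<forall>x. b k x \<le> u x) \<longrightarrow>
    (\<integral>\<^sup>+x. ennreal (fmax F (\<lambda>k. a k x) powr 2 * kern i (2 * real DIM(real^'n)) x0 x) \<partial>lborel)
    \<le> ennreal Cv * (\<integral>\<^sup>+x. ennreal (u x powr 2 * kern i (2 * real DIM(real^'n)) x0 x) \<partial>lborel)"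
    by blast
  have N2: "2 * real DIM(real^'n) \<le> N" using N by simp
  define A where "A = Cv * (g * 2 ^ CARD('n))"
  define B where "B = (2 ^ CARD('n) * c powr (q / 2)) powr 2"
  have A0: "0 < A" and B0: "0 \<le> B" using Cv g0 by (simp_all add: A_def B_def)
  show ?thesis
  proof (intro exI[of _ "g * A + B"] conjI allI impI)
    show "0 < g * A + B" using A0 B0 g0 by (simp add: add_pos_nonneg)
    fix F Y and h :: "int \<Rightarrow> real ^ 'n \<Rightarrow> real"
    assume fin: "finite F" and Y: "0 \<le> Y" and h: "(\<forall>k\<in>F. h k \<in> borel_measurable borel \<and> (\<forall>x. 0 \<le> h k x \<and>
       ennreal (h k x powr q) \<le> ennreal D * avg k (2 * real CARD('n)) (\<lambda>y. ennreal (h k y powr q)) x))"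
      and mb: "morrey_bound Y (\<lambda>x. fmax F (\<lambda>k. h k x) powr q)"
    have [measurable]: "h k \<in> borel_measurable borel" if "k \<in> F" for k using h that by blast
    define b where "b k x = h k x powr (q / 2)" for k x
    define a where "a k x = enn2real (avg k N (\<lambda>y. ennreal (b k y)) x)" for k x
    define U where "U k = 2 ^ CARD('n) * (c powr (q / 2) * Y powr (1 / 2) * (1 / W k) powr (q / 2))" for k
    define u where "u x = fmax F (\<lambda>k. h k x) powr (q / 2)" for x
    have [measurable]: "b k \<in> borel_measurable borel" "a k \<in> borel_measurable borel" if "k \<in> F" for k
      using that unfolding b_def a_def by measurable
    have [measurable]: "(\<lambda>x. fmax F (\<lambda>k. h k x)) \<in> borel_measurable borel" using fin by (intro fmax_measurable) auto
    have [measurable]: "u \<in> borel_measurable borel" unfolding u_def by measurable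
    have b0: "0 \<le> b k x" and a0: "0 \<le> a k x" for k x by (simp_all add: b_def a_def)
    have hle: "h k x \<le> c * Y powr (1 / q) * (1 / W k)" if k: "k \<in> F" for k x
    proof -
      have "morrey_bound Y (\<lambda>x. h k x powr q)"
        using h k q_pos by (intro morrey_bound_mono[OF mb] powr_mono2 fmax_ge[OF fin]) auto
      then have "h k x \<le> (D * (cube_const TYPE('n) * 2 ^ CARD('n)) * Y) powr (1 / q) * (1 / W k)"
        using h k Y D by (intro pointwise_of_morrey_bound) auto
      then show ?thesis using D g0 Y by (simp add: c_def g_def powr_mult)
    qed
    have ble: "b k x \<le> c powr (q / 2) * Y powr (1 / 2) * (1 / W k) powr (q / 2)" if k: "k \<in> F" for k x
    proof -
      have "b k x \<le> (c * Y powr (1 / q) * (1 / W k)) powr (q / 2)"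
        unfolding b_def using hle[OF k] h k q_pos by (intro powr_mono2) auto
      also have "\<dots> = c powr (q / 2) * Y powr (1 / 2) * (1 / W k) powr (q / 2)"
        using W_pos[of k] q_pos by (subst powr_mult3) (auto simp: c_def)
      finally show ?thesis .
    qed
    have AvU: "avg k N (\<lambda>y. ennreal (b k y)) x \<le> ennreal (U k)" if k: "k \<in> F" for k x
    proof -
      have "avg k N (\<lambda>y. ennreal (b k y)) x \<le> avg k N (\<lambda>y. ennreal (c powr (q / 2) * Y powr (1 / 2) * (1 / W k) powr (q / 2))) x"
        by (intro avg_mono ennreal_leI ble k)
      also have "\<dots> \<le> ennreal (2 ^ DIM(real^'n)) * ennreal (c powr (q / 2) * Y powr (1 / 2) * (1 / W k) powr (q / 2))"
        by (rule avg_const_le[OF N2])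
      also have "\<dots> = ennreal (U k)" by (simp add: U_def flip: ennreal_mult)
      finally show ?thesis .
    qed
    have ea: "ennreal (a k x) = avg k N (\<lambda>y. ennreal (b k y)) x" if k: "k \<in> F" for k x
      using le_less_trans[OF AvU[OF k, of x]] by (simp add: a_def)
    have aU: "a k x \<le> U k" if k: "k \<in> F" for k x
      using AvU[OF k, of x] unfolding ea[OF k, symmetric] by (subst (asm) ennreal_le_iff) (auto simp: U_def)
    have U0: "0 \<le> U k" for k by (simp add: U_def)
    have bu: "b k x \<le> u x" if "k \<in> F" for k x
      unfolding b_def u_def using h that q_pos by (intro powr_mono2 fmax_ge[OF fin]) auto
    have u2: "u x powr 2 = fmax F (\<lambda>k. h k x) powr q" for x by (simp add: u_def powr_powr)
    have av: "avg_family N F' a b" if "F' \<subseteq> F" for F'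
      unfolding avg_family_def using that fin ea b0 a0 by (auto intro: finite_subset)
    have "morrey_bound ((g * A + B) * Y) (\<lambda>x. fmax F (\<lambda>k. a k x) powr 2)"
      unfolding morrey_bound_def
    proof (intro allI)
      fix i and m :: "'n \<Rightarrow> int"
      define F1 where "F1 = {k\<in>F. i \<le> k}"
      have F1: "finite F1" "F1 \<subseteq> F" using fin by (auto simp: F1_def)
      obtain x0 :: "real^'n" where x0: "x0 \<in> dcube i m" using dcube_nonempty by blast
      have [measurable]: "(\<lambda>x. fmax F1 (\<lambda>k. a k x)) \<in> borel_measurable borel"
        using F1 by (intro fmax_measurable) auto
      have fine: "(\<integral>\<^sup>+x. ennreal (fmax F1 (\<lambda>k. a k x) powr 2 * kern i (2 * real CARD('n)) x0 x) \<partial>lborel) \<le> ennreal (A * Y * (1 / W i) powr q)"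
      proof -
        have "\<forall>k\<in>F1. \<forall>x. a k x \<le> (\<Sum>k\<in>F. U k)"
          using aU F1 fin U0 by (meson member_le_sum order_trans subsetD)
        then have "(\<integral>\<^sup>+x. ennreal (fmax F1 (\<lambda>k. a k x) powr 2 * kern i (2 * real CARD('n)) x0 x) \<partial>lborel) \<le>
            ennreal Cv * (\<integral>\<^sup>+x. ennreal (u x powr 2 * kern i (2 * real CARD('n)) x0 x) \<partial>lborel)"
          using Cv(2)[rule_format, OF av[OF F1(2)], of i "\<Sum>k\<in>F. U k" u x0] bu F1(2) by (auto simp: F1_def u_def)
        also have "(\<integral>\<^sup>+x. ennreal (u x powr 2 * kern i (2 * real CARD('n)) x0 x) \<partial>lborel) =
            avg i (2 * real CARD('n)) (\<lambda>y. ennreal (fmax F (\<lambda>k. h k y) powr q)) x0"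
          unfolding avg_def u2 by (intro nn_integral_cong) (subst mult.commute, simp add: ennreal_mult)
        also have "\<dots> \<le> ennreal (g * 2 ^ CARD('n) * Y * (1 / W i) powr q)"
          unfolding g_def using mb Y by (intro morrey_bound_avg) auto
        finally have "(\<integral>\<^sup>+x. ennreal (fmax F1 (\<lambda>k. a k x) powr 2 * kern i (2 * real CARD('n)) x0 x) \<partial>lborel) \<le>
           ennreal Cv * ennreal (g * 2 ^ CARD('n) * Y * (1 / W i) powr q)"
          by (simp add: mult_left_mono)
        also have "\<dots> = ennreal (A * Y * (1 / W i) powr q)"
          using Cv g0 Y by (simp add: A_def mult.assoc flip: ennreal_mult)
        finally show ?thesis .
      qed
      have split: "fmax F (\<lambda>k. a k x) powr 2 \<le> fmax F1 (\<lambda>k. a k x) powr 2 + B * Y * (1 / W i) powr q" for x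
      proof -
        define s where "s = 2 ^ CARD('n) * c powr (q / 2) * Y powr (1 / 2) * (1 / W i) powr (q / 2)"
        have s0: "0 \<le> s" by (simp add: s_def)
        have s2: "s powr 2 = B * Y * (1 / W i) powr q"
          unfolding s_def using Y by (subst powr_mult3) (auto simp: B_def powr_powr)
        have coarse: "a k x \<le> s" if "k \<in> F" "k < i" for k
        proof -
          have "(1 / W k) powr (q / 2) \<le> (1 / W i) powr (q / 2)"
            using W_pos[of i] W_pos[of k] W_antimono[of k i] q_pos that by (intro powr_mono2) (auto intro!: divide_left_mono)
          then have "U k \<le> s" unfolding U_def s_def mult.assoc by (intro mult_left_mono) auto
          then show ?thesis using aU[OF that(1), of x] by linarith
        qed
        have "fmax F (\<lambda>k. a k x) \<le> max (fmax F1 (\<lambda>k. a k x)) s"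
        proof (rule fmax_leI[OF fin])
          fix k assume k: "k \<in> F"
          show "a k x \<le> max (fmax F1 (\<lambda>k. a k x)) s"
            using coarse[OF k] fmax_ge[OF F1(1), of k "\<lambda>k. a k x"] k by (cases "k < i") (auto simp: F1_def max.coboundedI1 max.coboundedI2)
        qed (use s0 in auto)
        then have "fmax F (\<lambda>k. a k x) powr 2 \<le> max (fmax F1 (\<lambda>k. a k x)) s powr 2"
          using fmax_nonneg[OF fin] by (intro powr_mono2) auto
        also have "\<dots> \<le> fmax F1 (\<lambda>k. a k x) powr 2 + s powr 2" by (auto simp: max_def)
        finally show ?thesis by (simp add: s2)
      qed
      have "(\<integral>\<^sup>+x\<in>dcube i m. ennreal (fmax F (\<lambda>k. a k x) powr 2) \<partial>lborel) \<le>
         ennreal ((cube_const TYPE('n) * (A * Y) + B * Y) * (2 powr (- (real_of_int i * real CARD('n))) * (1 / W i) powr q))"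
        using morrey_bound_of_fine_coarse[OF _ _ fine split x0] A0 B0 Y by simp
      then show "(\<integral>\<^sup>+x\<in>dcube i m. ennreal (fmax F (\<lambda>k. a k x) powr 2) \<partial>lborel) \<le>
         ennreal ((g * A + B) * Y * (2 powr (- (real_of_int i * real CARD('n))) * (1 / W i) powr q))"
        by (simp add: g_def algebra_simps)
    qed
    then show "\<exists>a. (\<forall>k\<in>F. \<forall>x. 0 \<le> a k x \<and> ennreal (a k x) = avg k N (\<lambda>y. ennreal (h k y powr (q / 2))) x) \<and>
       morrey_bound ((g * A + B) * Y) (\<lambda>x. fmax F (\<lambda>k. a k x) powr 2)"
      using ea a0 unfolding b_def by (intro exI[of _ a]) auto
  qed
qed

end

subsection \<open>The quasi-norms as integral bounds\<close>

lemma epowr_ennreal: "0 \<le> v \<Longrightarrow> epowr (ennreal v) p = ennreal (v powr p)"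
  by (simp add: epowr_def)

lemma epowr_top [simp]: "epowr \<infinity> p = \<infinity>" "epowr top p = top"
  by (simp_all add: epowr_def)

lemma epowr_0 [simp]: "epowr 0 p = 0"
  by (simp add: epowr_def)

lemma epowr_mono: "x \<le> y \<Longrightarrow> 0 \<le> p \<Longrightarrow> epowr x p \<le> epowr y p"
  by (cases x; cases y) (auto simp: epowr_ennreal top_unique intro!: ennreal_leI powr_mono2)

lemma epowr_epowr: "0 < p \<Longrightarrow> 0 < p' \<Longrightarrow> epowr (epowr x p) p' = epowr x (p * p')"
  by (cases x) (auto simp: epowr_ennreal powr_powr)

lemma epowr_one [simp]: "epowr x 1 = x"
  by (cases x) (auto simp: epowr_ennreal)

lemma epowr_inverse: "0 < p \<Longrightarrow> epowr (epowr x p) (1 / p) = x" "0 < p \<Longrightarrow> epowr (epowr x (1 / p)) p = x"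
  by (simp_all add: epowr_epowr)

lemma epowr_le_iff: "0 < p \<Longrightarrow> epowr x p \<le> y \<longleftrightarrow> x \<le> epowr y (1 / p)"
  using epowr_mono[of "epowr x p" y "1 / p"] epowr_mono[of x "epowr y (1 / p)" p] by (auto simp: epowr_inverse)

text \<open>The maps \<open>epowr _ p\<close> and \<open>epowr _ (1 / p)\<close> are monotone and
  inverse to each other, hence preserve suprema.\<close>

lemma epowr_SUP: "0 < p \<Longrightarrow> I \<noteq> {} \<Longrightarrow> epowr (SUP i\<in>I. u i) p = (SUP i\<in>I. epowr (u i) p)"
proof (rule antisym)
  assume p: "0 < p"
  have "u i \<le> epowr (SUP i\<in>I. epowr (u i) p) (1 / p)" if "i \<in> I" for i
    using p that by (subst epowr_le_iff[symmetric]) (auto intro: SUP_upper)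
  then show "epowr (SUP i\<in>I. u i) p \<le> (SUP i\<in>I. epowr (u i) p)"
    using p by (subst epowr_le_iff) (auto intro: SUP_least)
  show "(SUP i\<in>I. epowr (u i) p) \<le> epowr (SUP i\<in>I. u i) p"
    using p by (intro SUP_least epowr_mono SUP_upper) auto
qed

lemma epowr_cmult: "0 < c \<Longrightarrow> epowr (ennreal c * x) p = ennreal (c powr p) * epowr x p"
  by (cases x) (auto simp: epowr_ennreal powr_mult ennreal_mult_top ennreal_mult[symmetric])

text \<open>The crude comparison of a sum with its largest term treats \<open>p \<le> 1\<close> and
  \<open>p \<ge> 1\<close> alike.\<close>

lemma epowr_sum_le:
  assumes "finite L" "0 < p"
  shows "epowr (\<Sum>l\<in>L. x l) p \<le> ennreal (real (card L) powr p) * (\<Sum>l\<in>L. epowr (x l) p)"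
proof (cases "L = {}")
  case False
  then have card: "0 < real (card L)" using assms by (simp add: card_gt_0_iff)
  obtain m where m: "m \<in> L" "x m = Max (x ` L)"
    using Max_in[of "x ` L"] assms False by (metis (no_types, lifting) finite_imageI image_iff image_is_empty)
  have "(\<Sum>l\<in>L. x l) \<le> (\<Sum>l\<in>L. x m)" using m assms by (intro sum_mono) auto
  also have "\<dots> = ennreal (real (card L)) * x m" by (simp add: ennreal_of_nat_eq_real_of_nat)
  finally have "epowr (\<Sum>l\<in>L. x l) p \<le> epowr (ennreal (real (card L)) * x m) p"
    using assms by (intro epowr_mono) auto
  also have "\<dots> = ennreal (real (card L) powr p) * epowr (x m) p" by (rule epowr_cmult[OF card])
  also have "\<dots> \<le> ennreal (real (card L) powr p) * (\<Sum>l\<in>L. epowr (x l) p)"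
    using m assms by (intro mult_left_mono member_le_sum) auto
  finally show ?thesis .
qed simp

section \<open>Sequence norms as limits over finite windows of scales\<close>

definition window :: "nat \<Rightarrow> int set"
  where "window n = {- int n..int n}"

lemma finite_window [simp]: "finite (window n)"
  by (simp add: window_def)

lemma window_mono: "m \<le> n \<Longrightarrow> window m \<subseteq> window n"
  by (auto simp: window_def)

lemma window_exhausts: "finite F \<Longrightarrow> \<exists>n. F \<subseteq> window n"
proof -
  assume F: "finite F"
  have "F \<subseteq> window (nat (Max (insert 0 (abs ` F))))"
  proof
    fix k assume "k \<in> F"
    then have "\<bar>k\<bar> \<le> Max (insert 0 (abs ` F))" using F by auto
    then show "k \<in> window (nat (Max (insert 0 (abs ` F))))" by (auto simp: window_def)
  qed
  then show ?thesis by blast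
qed

lemma sum_le_infsum_ennreal: "finite F \<Longrightarrow> (\<Sum>k\<in>F. f k) \<le> (\<Sum>\<^sub>\<infinity>k. f k)" for f :: "'a \<Rightarrow> ennreal"
  by (subst nonneg_infsum_complete) (auto intro!: SUP_upper)

text \<open>A sequence of windows replaces the directed family of all finite sets, so that monotone
  convergence applies to integrals of the sums.\<close>

lemma infsum_int_ennreal: "(\<Sum>\<^sub>\<infinity>k. f k) = (SUP n. \<Sum>k\<in>window n. f k)" for f :: "int \<Rightarrow> ennreal"
proof (rule antisym)
  have "(\<Sum>k\<in>F. f k) \<le> (SUP n. \<Sum>k\<in>window n. f k)" if F: "finite F" for F
  proof -
    obtain n where "F \<subseteq> window n" using window_exhausts[OF F] by blast
    then have "(\<Sum>k\<in>F. f k) \<le> (\<Sum>k\<in>window n. f k)" by (intro sum_mono2) auto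
    also have "\<dots> \<le> (SUP n. \<Sum>k\<in>window n. f k)" by (rule SUP_upper) simp
    finally show ?thesis .
  qed
  then show "(\<Sum>\<^sub>\<infinity>k. f k) \<le> (SUP n. \<Sum>k\<in>window n. f k)"
    by (subst nonneg_infsum_complete) (auto intro!: SUP_least)
  show "(SUP n. \<Sum>k\<in>window n. f k) \<le> (\<Sum>\<^sub>\<infinity>k. f k)"
    by (intro SUP_least sum_le_infsum_ennreal) simp
qed

lemma lr_term:
  assumes "0 \<le> (v::real)" "0 < p"
  shows "ennreal (2 powr (real_of_int j * s * p)) * epowr (ennreal v) p = ennreal ((2 powr (real_of_int j * s) * v) powr p)"
  using assms by (simp add: epowr_ennreal powr_mult powr_powr flip: ennreal_mult)

text \<open>The \<open>q\<close>-th power, which stands under the Morrey integral, becomes an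
  increasing limit of real-valued finite expressions; it is for these that averages are
  estimated.\<close>

lemma weighted_lr_norm_finite_powr:
  assumes "\<And>j. 0 \<le> v j" "0 < r" "r < \<infinity>" "0 < q"
  shows "epowr (weighted_lr_norm s r (\<lambda>j. ennreal (v j))) q =
    (SUP n. ennreal ((\<Sum>j\<in>window n. (2 powr (real_of_int j * s) * v j) powr enn2real r) powr (q / enn2real r)))"
proof -
  define p where "p = enn2real r"
  have p: "0 < p" using assms by (simp add: p_def enn2real_positive_iff)
  have "weighted_lr_norm s r (\<lambda>j. ennreal (v j)) =
      epowr (SUP n. \<Sum>j\<in>window n. ennreal ((2 powr (real_of_int j * s) * v j) powr p)) (1 / p)"
    using assms p unfolding weighted_lr_norm_def p_def[symmetric] by (simp add: lr_term infsum_int_ennreal)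
  then have "epowr (weighted_lr_norm s r (\<lambda>j. ennreal (v j))) q =
      epowr (SUP n. \<Sum>j\<in>window n. ennreal ((2 powr (real_of_int j * s) * v j) powr p)) (q / p)"
    using p assms by (simp add: epowr_epowr)
  also have "\<dots> = (SUP n. epowr (\<Sum>j\<in>window n. ennreal ((2 powr (real_of_int j * s) * v j) powr p)) (q / p))"
    using p assms by (intro epowr_SUP) auto
  also have "\<dots> = (SUP n. ennreal ((\<Sum>j\<in>window n. (2 powr (real_of_int j * s) * v j) powr p) powr (q / p)))"
    by (simp add: epowr_ennreal sum_nonneg)
  finally show ?thesis by (simp add: p_def)
qed

lemma weighted_lr_norm_infinite_powr:
  assumes "\<And>j. 0 \<le> v j" "0 < q"
  shows "epowr (weighted_lr_norm s \<infinity> (\<lambda>j. ennreal (v j))) q =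
    (SUP n. ennreal (fmax (window n) (\<lambda>j. 2 powr (real_of_int j * s) * v j) powr q))"
proof -
  let ?u = "\<lambda>j. 2 powr (real_of_int j * s) * v j"
  have "(SUP j. ennreal (?u j)) = (SUP n. ennreal (fmax (window n) ?u))"
  proof (rule antisym)
    show "(SUP j. ennreal (?u j)) \<le> (SUP n. ennreal (fmax (window n) ?u))"
    proof (rule SUP_least)
      fix j :: int
      have "ennreal (?u j) \<le> ennreal (fmax (window (nat \<bar>j\<bar>)) ?u)"
        by (intro ennreal_leI fmax_ge) (auto simp: window_def)
      also have "\<dots> \<le> (SUP n. ennreal (fmax (window n) ?u))" by (rule SUP_upper) simp
      finally show "ennreal (?u j) \<le> \<dots>" .
    qed
    show "(SUP n. ennreal (fmax (window n) ?u)) \<le> (SUP j. ennreal (?u j))"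
    proof (rule SUP_least)
      fix n
      have "\<exists>j\<in>window n. ?u j = fmax (window n) ?u"
        using assms by (intro fmax_attained) (auto simp: window_def)
      then obtain j where j: "?u j = fmax (window n) ?u" by blast
      show "ennreal (fmax (window n) ?u) \<le> (SUP j. ennreal (?u j))"
        unfolding j[symmetric] by (rule SUP_upper) simp
    qed
  qed
  then have "weighted_lr_norm s \<infinity> (\<lambda>j. ennreal (v j)) = (SUP n. ennreal (fmax (window n) ?u))"
    using assms by (simp add: weighted_lr_norm_def flip: ennreal_mult)
  then show ?thesis
    using assms by (simp add: epowr_SUP epowr_ennreal fmax_nonneg)
qed

lemma infsum_shift_le:
  fixes x y :: "int \<Rightarrow> ennreal"
  assumes L: "finite L" and y: "\<And>j. y j \<le> (\<Sum>l\<in>L. c l * x (j + l))"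
  shows "(\<Sum>\<^sub>\<infinity>j. y j) \<le> (\<Sum>l\<in>L. c l) * (\<Sum>\<^sub>\<infinity>j. x j)"
  unfolding infsum_int_ennreal[of y]
proof (rule SUP_least)
  fix n
  have "(\<Sum>j\<in>window n. y j) \<le> (\<Sum>j\<in>window n. \<Sum>l\<in>L. c l * x (j + l))" by (intro sum_mono y)
  also have "\<dots> = (\<Sum>l\<in>L. c l * (\<Sum>j\<in>window n. x (j + l)))"
    by (subst sum.swap) (simp add: sum_distrib_left)
  also have "\<dots> \<le> (\<Sum>l\<in>L. c l * (\<Sum>\<^sub>\<infinity>j. x j))"
  proof (intro sum_mono mult_left_mono)
    fix l
    have "(\<Sum>j\<in>window n. x (j + l)) = (\<Sum>j\<in>(\<lambda>j. j + l) ` window n. x j)"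
      by (subst sum.reindex) (auto simp: inj_on_def)
    also have "\<dots> \<le> (\<Sum>\<^sub>\<infinity>j. x j)" by (rule sum_le_infsum_ennreal) simp
    finally show "(\<Sum>j\<in>window n. x (j + l)) \<le> (\<Sum>\<^sub>\<infinity>j. x j)" .
  qed auto
  finally show "(\<Sum>j\<in>window n. y j) \<le> (\<Sum>l\<in>L. c l) * (\<Sum>\<^sub>\<infinity>j. x j)" by (simp add: sum_distrib_right)
qed

text \<open>A shift of the scales by \<open>l\<close> changes the weights by the constant factor
  \<open>2 powr (- (real_of_int l * s))\<close>, and finitely many shifts occur.\<close>

lemma weighted_lr_norm_shift:
  fixes s :: real
  assumes L: "finite L" and r: "0 < r" and c: "0 < c"
  shows "\<exists>C>0. \<forall>x y. (\<forall>j. y j \<le> ennreal c * (\<Sum>l\<in>L. x (j + l))) \<longrightarrow>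
    weighted_lr_norm s r y \<le> ennreal C * weighted_lr_norm s r x"
proof (cases "r = \<infinity>")
  case True
  \<comment> \<open>The summand 1 keeps the constant positive when \<open>L\<close> is
    empty.\<close>
  define C where "C = c * (\<Sum>l\<in>L. 2 powr (- (real_of_int l * s))) + 1"
  have C: "0 < C" using c by (simp add: C_def add_nonneg_pos sum_nonneg)
  have "weighted_lr_norm s r y \<le> ennreal C * weighted_lr_norm s r x"
    if y: "\<forall>j. y j \<le> ennreal c * (\<Sum>l\<in>L. x (j + l))" for x y
  proof -
    define X where "X = weighted_lr_norm s r x"
    have X: "ennreal (2 powr (real_of_int j * s)) * x j \<le> X" for j
      unfolding X_def weighted_lr_norm_def using True by (auto intro: SUP_upper)
    have "ennreal (2 powr (real_of_int j * s)) * y j \<le> ennreal C * X" for j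
    proof -
      have "ennreal (2 powr (real_of_int j * s)) * y j \<le> ennreal (2 powr (real_of_int j * s)) * (ennreal c * (\<Sum>l\<in>L. x (j + l)))"
        using y by (intro mult_left_mono) auto
      also have "\<dots> = ennreal c * (\<Sum>l\<in>L. ennreal (2 powr (- (real_of_int l * s))) * (ennreal (2 powr (real_of_int (j + l) * s)) * x (j + l)))"
        unfolding mult.left_commute[of _ "ennreal c"] sum_distrib_left
      proof (intro sum.cong refl arg_cong[where f = "\<lambda>v. ennreal c * v"])
        fix l
        have "ennreal (2 powr (real_of_int j * s)) = ennreal (2 powr (- (real_of_int l * s))) * ennreal (2 powr (real_of_int (j + l) * s))"
          by (simp add: algebra_simps flip: ennreal_mult powr_add)
        then show "ennreal (2 powr (real_of_int j * s)) * x (j + l) =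
          ennreal (2 powr (- (real_of_int l * s))) * (ennreal (2 powr (real_of_int (j + l) * s)) * x (j + l))"
          by (simp add: mult.assoc)
      qed
      also have "\<dots> \<le> ennreal c * (\<Sum>l\<in>L. ennreal (2 powr (- (real_of_int l * s))) * X)"
        by (intro mult_left_mono sum_mono X) auto
      also have "\<dots> = ennreal (c * (\<Sum>l\<in>L. 2 powr (- (real_of_int l * s)))) * X"
        using c by (simp add: ennreal_mult sum_nonneg mult.assoc flip: sum_distrib_right sum_ennreal)
      also have "\<dots> \<le> ennreal C * X" by (intro mult_right_mono ennreal_leI) (auto simp: C_def)
      finally show ?thesis .
    qed
    then have "weighted_lr_norm s r y \<le> ennreal C * X"
      unfolding weighted_lr_norm_def[of s r y] if_P[OF True] by (intro SUP_least)
    then show ?thesis by (simp add: X_def)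
  qed
  with C show ?thesis by blast
next
  case False
  define p where "p = enn2real r"
  have p: "0 < p" using r False by (simp add: p_def enn2real_positive_iff less_top)
  define K where "K = c powr p * real (card L) powr p * (\<Sum>l\<in>L. 2 powr (- (real_of_int l * s * p))) + 1"
  have K: "0 < K" by (simp add: K_def add_nonneg_pos sum_nonneg)
  have "weighted_lr_norm s r y \<le> ennreal (K powr (1 / p)) * weighted_lr_norm s r x"
    if y: "\<forall>j. y j \<le> ennreal c * (\<Sum>l\<in>L. x (j + l))" for x y
  proof -
    define X where "X j = ennreal (2 powr (real_of_int j * s * p)) * epowr (x j) p" for j
    have "(\<Sum>\<^sub>\<infinity>j. ennreal (2 powr (real_of_int j * s * p)) * epowr (y j) p) \<le>
       (\<Sum>l\<in>L. ennreal (c powr p * real (card L) powr p * 2 powr (- (real_of_int l * s * p)))) * (\<Sum>\<^sub>\<infinity>j. X j)"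
    proof (rule infsum_shift_le[OF L])
      fix j
      have "epowr (y j) p \<le> epowr (ennreal c * (\<Sum>l\<in>L. x (j + l))) p"
        using y p by (intro epowr_mono) auto
      also have "\<dots> \<le> ennreal (c powr p) * (ennreal (real (card L) powr p) * (\<Sum>l\<in>L. epowr (x (j + l)) p))"
        using L p c by (subst epowr_cmult) (auto intro!: mult_left_mono epowr_sum_le)
      finally have "ennreal (2 powr (real_of_int j * s * p)) * epowr (y j) p \<le>
         ennreal (2 powr (real_of_int j * s * p)) * (ennreal (c powr p) * (ennreal (real (card L) powr p) * (\<Sum>l\<in>L. epowr (x (j + l)) p)))"
        by (intro mult_left_mono) auto
      also have "\<dots> = (\<Sum>l\<in>L. ennreal (2 powr (real_of_int j * s * p)) * ennreal (c powr p * real (card L) powr p) * epowr (x (j + l)) p)"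
        by (simp add: sum_distrib_left ennreal_mult mult.assoc)
      also have "\<dots> = (\<Sum>l\<in>L. ennreal (c powr p * real (card L) powr p * 2 powr (- (real_of_int l * s * p))) * X (j + l))"
      proof (intro sum.cong refl)
        fix l
        have "ennreal (2 powr (real_of_int j * s * p)) = ennreal (2 powr (- (real_of_int l * s * p))) * ennreal (2 powr (real_of_int (j + l) * s * p))"
          by (simp add: algebra_simps flip: ennreal_mult powr_add)
        then show "ennreal (2 powr (real_of_int j * s * p)) * ennreal (c powr p * real (card L) powr p) * epowr (x (j + l)) p =
           ennreal (c powr p * real (card L) powr p * 2 powr (- (real_of_int l * s * p))) * X (j + l)"
          by (simp add: X_def ennreal_mult mult_ac)
      qed
      finally show "ennreal (2 powr (real_of_int j * s * p)) * epowr (y j) p \<le> \<dots>" .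
    qed
    also have "(\<Sum>l\<in>L. ennreal (c powr p * real (card L) powr p * 2 powr (- (real_of_int l * s * p)))) \<le> ennreal K"
      by (subst sum_ennreal) (auto simp: K_def sum_distrib_left intro!: ennreal_leI)
    finally have "(\<Sum>\<^sub>\<infinity>j. ennreal (2 powr (real_of_int j * s * p)) * epowr (y j) p) \<le> ennreal K * (\<Sum>\<^sub>\<infinity>j. X j)"
      by (simp add: mult_right_mono)
    then have "epowr (\<Sum>\<^sub>\<infinity>j. ennreal (2 powr (real_of_int j * s * p)) * epowr (y j) p) (1 / p) \<le> epowr (ennreal K * (\<Sum>\<^sub>\<infinity>j. X j)) (1 / p)"
      using p by (intro epowr_mono) auto
    also have "\<dots> = ennreal (K powr (1 / p)) * epowr (\<Sum>\<^sub>\<infinity>j. X j) (1 / p)"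
      using K by (rule epowr_cmult)
    finally show ?thesis using False by (simp add: weighted_lr_norm_def p_def X_def)
  qed
  with K show ?thesis by (intro exI[of _ "K powr (1 / p)"]) auto
qed

lemma (in morrey_weight) morrey_bound_cmult:
  assumes "morrey_bound Y f" "0 \<le> c" "f \<in> borel_measurable borel"
  shows "morrey_bound (c * Y) (\<lambda>x. c * f x)"
  unfolding morrey_bound_def
proof (intro allI)
  fix i m
  note [measurable] = assms(3)
  have "(\<integral>\<^sup>+x\<in>dcube i m. ennreal (c * f x) \<partial>lborel) = (\<integral>\<^sup>+x. ennreal c * (ennreal (f x) * indicator (dcube i m) x) \<partial>lborel)"
    using assms(2) by (simp add: ennreal_mult' mult.assoc)
  also have "\<dots> = ennreal c * (\<integral>\<^sup>+x\<in>dcube i m. ennreal (f x) \<partial>lborel)"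
    by (rule nn_integral_cmult) measurable
  also have "\<dots> \<le> ennreal c * ennreal (Y * (2 powr (- (real_of_int i * real CARD('a))) * (1 / W i) powr q))"
    using assms(1) unfolding morrey_bound_def by (intro mult_left_mono) auto
  also have "\<dots> = ennreal (c * Y * (2 powr (- (real_of_int i * real CARD('a))) * (1 / W i) powr q))"
    using assms(2) by (simp add: ennreal_mult' mult.assoc)
  finally show "(\<integral>\<^sup>+x\<in>dcube i m. ennreal (c * f x) \<partial>lborel) \<le> \<dots>" .
qed

lemma (in morrey_weight) morrey_bound_sum:
  fixes f :: "'l \<Rightarrow> real ^ 'n::finite \<Rightarrow> real"
  assumes "finite L" "\<And>l. l \<in> L \<Longrightarrow> morrey_bound (Y l) (f l)" "\<And>l. l \<in> L \<Longrightarrow> f l \<in> borel_measurable borel"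
    "\<And>l x. l \<in> L \<Longrightarrow> 0 \<le> f l x" "\<And>l. l \<in> L \<Longrightarrow> 0 \<le> Y l"
  shows "morrey_bound (\<Sum>l\<in>L. Y l) (\<lambda>x. \<Sum>l\<in>L. f l x)"
  unfolding morrey_bound_def
proof (intro allI)
  fix i m
  let ?v = "2 powr (- (real_of_int i * real CARD('n))) * (1 / W i) powr q"
  note [measurable] = assms(3)
  have "(\<integral>\<^sup>+x\<in>dcube i m. ennreal (\<Sum>l\<in>L. f l x) \<partial>lborel) = (\<integral>\<^sup>+x. (\<Sum>l\<in>L. ennreal (f l x) * indicator (dcube i m) x) \<partial>lborel)"
    using assms(4) by (intro nn_integral_cong) (simp flip: sum_ennreal sum_distrib_right)
  also have "\<dots> = (\<Sum>l\<in>L. \<integral>\<^sup>+x\<in>dcube i m. ennreal (f l x) \<partial>lborel)"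
    by (rule nn_integral_sum) measurable
  also have "\<dots> \<le> (\<Sum>l\<in>L. ennreal (Y l * ?v))"
    using assms(2) unfolding morrey_bound_def by (intro sum_mono) auto
  also have "\<dots> = ennreal ((\<Sum>l\<in>L. Y l) * ?v)"
    using assms(5) by (subst sum_ennreal) (auto simp: sum_distrib_right)
  finally show "(\<integral>\<^sup>+x\<in>dcube i m. ennreal (\<Sum>l\<in>L. f l x) \<partial>lborel) \<le> ennreal ((\<Sum>l\<in>L. Y l) * ?v)" .
qed

lemma Gclass_morrey_weight:
  assumes "0 < q" "\<phi> \<in> Gclass n q"
  shows "morrey_weight (\<lambda>i. \<phi> (2 powr (- real_of_int i))) q"
proof
  show "0 < q" by fact
  show "0 < \<phi> (2 powr (- real_of_int i))" for i using assms(2) by (auto simp: Gclass_def)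
  have mono: "mono_on {0<..} \<phi>" using assms(2) by (simp add: Gclass_def)
  show "\<phi> (2 powr (- real_of_int k)) \<le> \<phi> (2 powr (- real_of_int i))" if "i \<le> k" for i k
    by (rule mono_onD[OF mono]) (use that in auto)
qed

context
  fixes \<phi> :: "real \<Rightarrow> real" and q :: real and W :: "int \<Rightarrow> real"
  assumes W: "morrey_weight W q" and W_def: "\<And>i. W i = \<phi> (2 powr (- real_of_int i))"
begin

interpretation morrey_weight W q by (rule W)

text \<open>Removes the supremum and both roots cube by cube, so that integrals of
  \<open>q\<close>-th powers can be estimated directly.\<close>

lemma morrey_norm_le_iff:
  fixes F :: "real ^ 'n::finite \<Rightarrow> ennreal"
  assumes "0 \<le> X"
  shows "morrey_norm \<phi> q F \<le> ennreal X \<longleftrightarrow> (\<forall>i m. (\<integral>\<^sup>+x\<in>dcube i m. epowr (F x) q \<partial>lborel) \<le>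
    ennreal (X powr q * (2 powr (- (real_of_int i * real CARD('n))) * (1 / W i) powr q)))"
proof -
  have "ennreal (\<phi> (side_length Q)) * epowr (I / emeasure lborel Q) (1 / q) \<le> ennreal X \<longleftrightarrow>
      I \<le> ennreal (X powr q * (2 powr (- (real_of_int i * real CARD('n))) * (1 / W i) powr q))"
    if Q: "Q = (dcube i m :: (real^'n) set)" for Q i m I
  proof -
    define v where "v = 2 powr (- (real_of_int i * real CARD('n)))"
    define w where "w = W i"
    have v: "0 < v" "emeasure lborel Q = ennreal v" by (simp_all add: v_def Q emeasure_dcube)
    have w: "0 < w" "\<phi> (side_length Q) = w" using W_pos[of i] by (simp_all add: w_def Q side_length_dcube W_def)
    have "I \<le> ennreal (X powr q * (v * (1 / w) powr q)) \<longleftrightarrow> ennreal w * epowr (I / ennreal v) (1 / q) \<le> ennreal X"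
    proof (cases I)
      case (real t)
      have "ennreal w * epowr (I / ennreal v) (1 / q) = ennreal (w * (t / v) powr (1 / q))"
        using real v w by (simp add: divide_ennreal epowr_ennreal ennreal_mult)
      also have "\<dots> \<le> ennreal X \<longleftrightarrow> w * (t / v) powr (1 / q) \<le> X"
        using assms by (intro ennreal_le_iff)
      also have "\<dots> \<longleftrightarrow> (t / v) powr (1 / q) \<le> X / w"
        using w by (simp add: field_simps)
      also have "\<dots> \<longleftrightarrow> t / v \<le> (X / w) powr q"
      proof
        assume "(t / v) powr (1 / q) \<le> X / w"
        then have "((t / v) powr (1 / q)) powr q \<le> (X / w) powr q" using q_pos by (intro powr_mono2) auto
        then show "t / v \<le> (X / w) powr q" using q_pos real v by (simp add: powr_powr)
      next
        assume "t / v \<le> (X / w) powr q"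
        then have "(t / v) powr (1 / q) \<le> ((X / w) powr q) powr (1 / q)" using q_pos real v by (intro powr_mono2) auto
        then show "(t / v) powr (1 / q) \<le> X / w" using q_pos assms w by (simp add: powr_powr)
      qed
      also have "\<dots> \<longleftrightarrow> t \<le> X powr q * (v * (1 / w) powr q)"
        using v w assms by (simp add: powr_divide field_simps)
      also have "\<dots> \<longleftrightarrow> I \<le> ennreal (X powr q * (v * (1 / w) powr q))"
        using real v w by (subst real(2)) (subst ennreal_le_iff, auto)
      finally show ?thesis by simp
    next
      case top
      then show ?thesis using v w by (simp add: top_unique ennreal_mult_top ennreal_top_divide)
    qed
    then show ?thesis by (simp add: v w v_def w_def)
  qed
  then show ?thesis
    unfolding morrey_norm_def SUP_le_iff dyadic_cubes_eq by (auto simp: image_iff)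
qed

lemma morrey_bound_of_morrey_norm:
  fixes F :: "real ^ 'n::finite \<Rightarrow> ennreal"
  assumes "morrey_norm \<phi> q F \<le> ennreal X" "0 \<le> X" "\<And>x. ennreal (f x) \<le> epowr (F x) q"
  shows "morrey_bound (X powr q) f"
  unfolding morrey_bound_def
proof (intro allI)
  fix i m
  have "(\<integral>\<^sup>+x\<in>dcube i m. ennreal (f x) \<partial>lborel) \<le> (\<integral>\<^sup>+x\<in>dcube i m. epowr (F x) q \<partial>lborel)"
    by (intro nn_integral_mono mult_right_mono assms(3)) auto
  also have "\<dots> \<le> ennreal (X powr q * (2 powr (- (real_of_int i * real CARD('n))) * (1 / W i) powr q))"
    using assms(1) unfolding morrey_norm_le_iff[OF assms(2)] by blast
  finally show "(\<integral>\<^sup>+x\<in>dcube i m. ennreal (f x) \<partial>lborel) \<le> \<dots>" .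
qed

text \<open>Monotone convergence on each cube; the bounds for the finite windows enter with a
  constant independent of the window.\<close>

lemma morrey_norm_of_morrey_bound:
  fixes F :: "real ^ 'n::finite \<Rightarrow> ennreal" and f :: "nat \<Rightarrow> real ^ 'n \<Rightarrow> real"
  assumes f: "\<And>n. morrey_bound (C * X powr q) (f n)" "\<And>n. f n \<in> borel_measurable borel" "\<And>x. incseq (\<lambda>n. f n x)"
    and F: "\<And>x. epowr (F x) q = (SUP n. ennreal (f n x))" and "0 \<le> X" "0 \<le> C"
  shows "morrey_norm \<phi> q F \<le> ennreal (C powr (1 / q) * X)"
proof -
  have "(\<integral>\<^sup>+x\<in>dcube i m. epowr (F x) q \<partial>lborel) \<le>
    ennreal ((C powr (1 / q) * X) powr q * (2 powr (- (real_of_int i * real CARD('n))) * (1 / W i) powr q))" for i m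
  proof -
    note [measurable] = f(2)
    have "(\<integral>\<^sup>+x\<in>dcube i m. epowr (F x) q \<partial>lborel) = (\<integral>\<^sup>+x. (SUP n. ennreal (f n x) * indicator (dcube i m) x) \<partial>lborel)"
      by (simp add: F SUP_mult_right_ennreal)
    also have "\<dots> = (SUP n. \<integral>\<^sup>+x\<in>dcube i m. ennreal (f n x) \<partial>lborel)"
    proof (rule nn_integral_monotone_convergence_SUP)
      show "incseq (\<lambda>n x. ennreal (f n x) * indicator (dcube i m) x)"
        using f(3) by (auto simp: incseq_def le_fun_def intro!: mult_right_mono ennreal_leI)
    qed measurable
    also have "\<dots> \<le> ennreal (C * X powr q * (2 powr (- (real_of_int i * real CARD('n))) * (1 / W i) powr q))"
      using f(1) unfolding morrey_bound_def by (intro SUP_least) auto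
    also have "C * X powr q = (C powr (1 / q) * X) powr q"
      using q_pos assms by (simp add: powr_mult powr_powr)
    finally show ?thesis .
  qed
  then show ?thesis using assms by (subst morrey_norm_le_iff) auto
qed

end

subsection \<open>Estimates for controlled families\<close>

text \<open>The constant \<open>D \<eta> N\<close> is independent of the scale, the point and the
  family, which makes the final constants uniform over all functionals. All exponents \<eta> are
  included because \<open>q\<close>, \<open>r\<close> and \<open>q / 2\<close> occur later.\<close>

definition controlled :: "(real \<Rightarrow> real \<Rightarrow> real) \<Rightarrow> int set \<Rightarrow> (int \<Rightarrow> real ^ 'n::finite \<Rightarrow> real) \<Rightarrow> (int \<Rightarrow> real ^ 'n \<Rightarrow> real) \<Rightarrow> bool"
  where "controlled D L t g \<longleftrightarrow>
    (\<forall>k. g k \<in> borel_measurable borel \<and> t k \<in> borel_measurable borel \<and> (\<forall>x. 0 \<le> g k x \<and> 0 \<le> t k x)) \<and>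
    (\<forall>\<eta>>0. \<forall>N\<ge>2 * real CARD('n). \<forall>k x.
      ennreal (g k x powr \<eta>) \<le> ennreal (D \<eta> N) * avg k N (\<lambda>y. ennreal (g k y powr \<eta>)) x \<and>
      ennreal (t k x powr \<eta>) \<le> ennreal (D \<eta> N) * (\<Sum>l\<in>L. avg (k + l) N (\<lambda>y. ennreal (g (k + l) y powr \<eta>)) x))"

lemma controlledD:
  fixes g :: "int \<Rightarrow> real ^ 'n::finite \<Rightarrow> real"
  assumes "controlled D L t g"
  shows "g k \<in> borel_measurable borel" "t k \<in> borel_measurable borel" "0 \<le> g k x" "0 \<le> t k x"
    "0 < \<eta> \<Longrightarrow> 2 * real CARD('n) \<le> N \<Longrightarrow> ennreal (g k x powr \<eta>) \<le> ennreal (D \<eta> N) * avg k N (\<lambda>y. ennreal (g k y powr \<eta>)) x"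
    "0 < \<eta> \<Longrightarrow> 2 * real CARD('n) \<le> N \<Longrightarrow> ennreal (t k x powr \<eta>) \<le> ennreal (D \<eta> N) * (\<Sum>l\<in>L. avg (k + l) N (\<lambda>y. ennreal (g (k + l) y powr \<eta>)) x)"
  using assms unfolding controlled_def by blast+

text \<open>The smoothness weight is constant at each scale and passes through the averages;
  comparing the scales \<open>k\<close> and \<open>k + l\<close> leaves a factor that depends on
  \<open>l\<close> alone.\<close>

lemma controlled_weighted:
  fixes g :: "int \<Rightarrow> real ^ 'n::finite \<Rightarrow> real" and s :: real
  assumes c: "controlled D L t g" and \<eta>: "0 < \<eta>" "2 * real CARD('n) \<le> N"
  defines "h \<equiv> \<lambda>k x. 2 powr (real_of_int k * s) * g k x"
  shows "ennreal (h k x powr \<eta>) \<le> ennreal (D \<eta> N) * avg k N (\<lambda>y. ennreal (h k y powr \<eta>)) x"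
    and "ennreal ((2 powr (real_of_int k * s) * t k x) powr \<eta>) \<le> ennreal (D \<eta> N) *
      (\<Sum>l\<in>L. ennreal (2 powr (- (real_of_int l * s * \<eta>))) * avg (k + l) N (\<lambda>y. ennreal (h (k + l) y powr \<eta>)) x)"
proof -
  note cD = controlledD[OF c]
  note [measurable] = cD(1)
  define e where "e k = ennreal (2 powr (real_of_int k * s * \<eta>))" for k
  have h: "ennreal (h k x powr \<eta>) = e k * ennreal (g k x powr \<eta>)" for k x
    using cD(3) by (simp add: h_def e_def powr_mult powr_powr ennreal_mult)
  have Avh: "avg k N (\<lambda>y. ennreal (h k y powr \<eta>)) x = e k * avg k N (\<lambda>y. ennreal (g k y powr \<eta>)) x" for k x
    unfolding h by (rule avg_cmult) measurable
  show "ennreal (h k x powr \<eta>) \<le> ennreal (D \<eta> N) * avg k N (\<lambda>y. ennreal (h k y powr \<eta>)) x"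
    unfolding Avh unfolding h mult.left_commute[of _ "e k"] by (intro mult_left_mono cD(5) \<eta>) auto
  have "ennreal ((2 powr (real_of_int k * s) * t k x) powr \<eta>) = e k * ennreal (t k x powr \<eta>)"
    using cD(4) by (simp add: e_def powr_mult powr_powr ennreal_mult)
  also have "\<dots> \<le> e k * (ennreal (D \<eta> N) * (\<Sum>l\<in>L. avg (k + l) N (\<lambda>y. ennreal (g (k + l) y powr \<eta>)) x))"
    by (intro mult_left_mono cD(6) \<eta>) auto
  also have "\<dots> = ennreal (D \<eta> N) * (\<Sum>l\<in>L. e k * avg (k + l) N (\<lambda>y. ennreal (g (k + l) y powr \<eta>)) x)"
    by (simp add: sum_distrib_left mult.left_commute)
  also have "\<dots> = ennreal (D \<eta> N) * (\<Sum>l\<in>L. ennreal (2 powr (- (real_of_int l * s * \<eta>))) * avg (k + l) N (\<lambda>y. ennreal (h (k + l) y powr \<eta>)) x)"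
  proof (intro arg_cong[where f = "\<lambda>v. ennreal (D \<eta> N) * v"] sum.cong refl)
    fix l
    have "e k = ennreal (2 powr (- (real_of_int l * s * \<eta>))) * e (k + l)"
      by (simp add: e_def algebra_simps flip: ennreal_mult powr_add)
    then show "e k * avg (k + l) N (\<lambda>y. ennreal (g (k + l) y powr \<eta>)) x =
        ennreal (2 powr (- (real_of_int l * s * \<eta>))) * avg (k + l) N (\<lambda>y. ennreal (h (k + l) y powr \<eta>)) x"
      unfolding Avh by (simp add: mult.assoc)
  qed
  finally show "ennreal ((2 powr (real_of_int k * s) * t k x) powr \<eta>) \<le> \<dots>" .
qed

text \<open>Hypothesis \<open>d\<close> makes \<open>1 / W k\<close> decay geometrically in the
  distance \<open>i - k\<close>, and different scales have different distances, so the sum is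
  dominated by a geometric series.\<close>

lemma geometric_weight_sum:
  assumes W: "\<And>i. 0 < W i" and \<epsilon>: "0 < \<epsilon>" and C0: "0 < C0" and r: "0 < r"
    and d: "\<And>k i. k \<le> i \<Longrightarrow> 1 / W k \<le> C0 * 2 powr (- (real_of_int (i - k) * \<epsilon>)) * (1 / W i)"
    and K: "finite K" "\<And>k. k \<in> K \<Longrightarrow> k < i"
  shows "(\<Sum>k\<in>K. (1 / W k) powr r) \<le> C0 powr r * (1 / (1 - 2 powr (- (\<epsilon> * r)))) * (1 / W i) powr r"
proof -
  define z where "z = 2 powr (- (\<epsilon> * r))"
  have z: "0 < z" "z < 1" using \<epsilon> r by (auto simp: z_def powr_less_one)
  have "(1 / W k) powr r \<le> (C0 powr r * (1 / W i) powr r) * z ^ nat (i - k)" if k: "k \<in> K" for k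
  proof -
    have "(1 / W k) powr r \<le> (C0 * 2 powr (- (real_of_int (i - k) * \<epsilon>)) * (1 / W i)) powr r"
      using d[of k i] K(2)[OF k] r W[of k] by (intro powr_mono2) auto
    also have "\<dots> = C0 powr r * 2 powr (- (real_of_int (i - k) * \<epsilon>) * r) * (1 / W i) powr r"
      using C0 W[of i] by (subst powr_mult3) (auto simp: less_imp_le)
    also have "2 powr (- (real_of_int (i - k) * \<epsilon>) * r) = z powr real (nat (i - k))"
      using K(2)[OF k] by (simp add: z_def powr_powr algebra_simps)
    also have "\<dots> = z ^ nat (i - k)" using z by (simp add: powr_realpow)
    finally show ?thesis by (simp add: mult_ac)
  qed
  then have 1: "(\<Sum>k\<in>K. (1 / W k) powr r) \<le> (C0 powr r * (1 / W i) powr r) * (\<Sum>k\<in>K. z ^ nat (i - k))"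
    by (subst sum_distrib_left) (intro sum_mono)
  have "(\<Sum>k\<in>K. z ^ nat (i - k)) = (\<Sum>j\<in>(\<lambda>k. nat (i - k)) ` K. z ^ j)"
    using K(2) by (subst sum.reindex) (fastforce simp: inj_on_def)+
  also have "\<dots> \<le> (\<Sum>j. z ^ j)"
    using z K(1) by (intro sum_le_suminf) (auto intro: summable_geometric)
  also have "\<dots> = 1 / (1 - z)" using z by (intro suminf_geometric) auto
  finally have "(C0 powr r * (1 / W i) powr r) * (\<Sum>k\<in>K. z ^ nat (i - k)) \<le> (C0 powr r * (1 / W i) powr r) * (1 / (1 - z))"
    by (intro mult_left_mono) auto
  with 1 show ?thesis unfolding z_def by (simp add: mult_ac)
qed

lemma avg_real_measurable:
  assumes "\<And>x. 0 \<le> a x" "\<And>x. ennreal (a x) = avg k N b x" "b \<in> borel_measurable borel"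
  shows "a \<in> borel_measurable borel"
proof -
  note [measurable] = assms(3)
  have "a = (\<lambda>x. enn2real (avg k N b x))" using assms(1) by (simp flip: assms(2))
  also have "\<dots> \<in> borel_measurable borel" by measurable
  finally show ?thesis .
qed

lemma controlled_term_le:
  fixes g :: "int \<Rightarrow> real ^ 'n::finite \<Rightarrow> real" and s :: real
  assumes c: "controlled D L t g" and \<eta>: "0 < \<eta>" "2 * real CARD('n) \<le> N" and D: "0 \<le> D \<eta> N"
    and a: "\<And>l. l \<in> L \<Longrightarrow> 0 \<le> a (j + l) x"
      "\<And>l. l \<in> L \<Longrightarrow> ennreal (a (j + l) x) = avg (j + l) N (\<lambda>y. ennreal ((2 powr (real_of_int (j + l) * s) * g (j + l) y) powr \<eta>)) x"
  shows "(2 powr (real_of_int j * s) * t j x) powr \<eta> \<le> D \<eta> N * (\<Sum>l\<in>L. 2 powr (- (real_of_int l * s * \<eta>)) * a (j + l) x)"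
proof -
  have "ennreal ((2 powr (real_of_int j * s) * t j x) powr \<eta>) \<le>
      ennreal (D \<eta> N) * (\<Sum>l\<in>L. ennreal (2 powr (- (real_of_int l * s * \<eta>))) * ennreal (a (j + l) x))"
    using controlled_weighted(2)[OF c \<eta>, of j s x] by (simp add: a(2))
  also have "\<dots> = ennreal (D \<eta> N * (\<Sum>l\<in>L. 2 powr (- (real_of_int l * s * \<eta>)) * a (j + l) x))"
  proof -
    have "(\<Sum>l\<in>L. ennreal (2 powr (- (real_of_int l * s * \<eta>))) * ennreal (a (j + l) x)) =
        (\<Sum>l\<in>L. ennreal (2 powr (- (real_of_int l * s * \<eta>)) * a (j + l) x))"
      using a(1) by (intro sum.cong refl) (simp add: ennreal_mult)
    also have "\<dots> = ennreal (\<Sum>l\<in>L. 2 powr (- (real_of_int l * s * \<eta>)) * a (j + l) x)"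
      using a(1) by (intro sum_ennreal) auto
    finally show ?thesis using D a(1) by (simp only:) (rule ennreal_mult[symmetric], auto intro!: sum_nonneg)
  qed
  finally show ?thesis using D a(1) by (subst (asm) ennreal_le_iff) (auto intro!: mult_nonneg_nonneg sum_nonneg)
qed

lemma controlled_E_finite:
  fixes s :: real and D :: "real \<Rightarrow> real \<Rightarrow> real"
  assumes q: "0 < q" and r: "0 < r" "r < \<infinity>" and \<phi>: "\<phi> \<in> Gclass CARD('n::finite) q"
    and eps: "\<exists>\<epsilon>>0. \<exists>C0>0. \<forall>t u. 0 < u \<and> u \<le> t \<longrightarrow> t powr \<epsilon> / \<phi> t \<le> C0 * (u powr \<epsilon> / \<phi> u)"
    and L: "finite L" and D: "\<And>\<eta> N. 0 < D \<eta> N"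
  shows "\<exists>C>0. \<forall>t g :: int \<Rightarrow> real ^ 'n \<Rightarrow> real. controlled D L t g \<longrightarrow>
    morrey_norm \<phi> q (\<lambda>x. weighted_lr_norm s r (\<lambda>j. ennreal (t j x))) \<le>
    ennreal C * morrey_norm \<phi> q (\<lambda>x. weighted_lr_norm s r (\<lambda>j. ennreal (g j x)))"
proof -
  define W where "W i = \<phi> (2 powr (- real_of_int i))" for i
  have mw: "morrey_weight W q" unfolding W_def by (rule Gclass_morrey_weight[OF q \<phi>])
  interpret morrey_weight W q by (rule mw)
  define p where "p = enn2real r"
  have p: "0 < p" using r by (simp add: p_def enn2real_positive_iff)
  define N where "N = 4 * real CARD('n) + q / p + 1 + 4 * real CARD('n) / (q / p)"
  have N2: "2 * real CARD('n) \<le> N"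
  proof -
    have "0 \<le> q / p" "0 \<le> 4 * real CARD('n) / (q / p)" using p q by auto
    then show ?thesis unfolding N_def by simp
  qed
  obtain \<epsilon> C0 where eps': "0 < \<epsilon>" "0 < C0" "\<And>t u. 0 < u \<Longrightarrow> u \<le> t \<Longrightarrow> t powr \<epsilon> / \<phi> t \<le> C0 * (u powr \<epsilon> / \<phi> u)"
    using eps by blast
  define G where "G = C0 powr p * (1 / (1 - 2 powr (- (\<epsilon> * p))))"
  have "2 powr (- (\<epsilon> * p)) < 1" using p eps' by (auto simp: powr_less_one)
  then have G0: "0 \<le> G" by (simp add: G_def)
  \<comment> \<open>The growth condition for the lengths \<open>u = 2 powr - i\<close> and
    \<open>t = 2 powr - k\<close>.\<close>
  have dec: "1 / W k \<le> C0 * 2 powr (- (real_of_int (i - k) * \<epsilon>)) * (1 / W i)" if "k \<le> i" for k i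
  proof -
    have "(2 powr (- real_of_int k)) powr \<epsilon> / W k \<le> C0 * ((2 powr (- real_of_int i)) powr \<epsilon> / W i)"
      unfolding W_def using that by (intro eps'(3)) auto
    then have "(2 powr (- real_of_int k)) powr \<epsilon> / W k * 2 powr (real_of_int k * \<epsilon>) \<le> C0 * ((2 powr (- real_of_int i)) powr \<epsilon> / W i) * 2 powr (real_of_int k * \<epsilon>)"
      by (intro mult_right_mono) auto
    moreover have "(2 powr (- real_of_int k)) powr \<epsilon> * 2 powr (real_of_int k * \<epsilon>) = 1"
      by (simp add: powr_powr flip: powr_add)
    moreover have "(2 powr (- real_of_int i)) powr \<epsilon> * 2 powr (real_of_int k * \<epsilon>) = 2 powr (- (real_of_int (i - k) * \<epsilon>))"
      by (simp add: powr_powr algebra_simps flip: powr_add)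
    ultimately show ?thesis by (simp add: mult_ac)
  qed
  have Wsum: "(\<Sum>k\<in>K. (1 / W k) powr p) \<le> G * (1 / W i) powr p" if "finite K" "\<And>k. k \<in> K \<Longrightarrow> k < i" for K i
    unfolding G_def by (rule geometric_weight_sum[OF W_pos eps'(1,2) p dec that])
  \<comment> \<open>One constant serves the exponent \<open>q\<close>, from which the pointwise
    bounds come, and the exponent \<open>p\<close>, to which the vector-valued inequality is
    applied.\<close>
  define Dm where "Dm = max (D q (2 * real CARD('n))) (D p N)"
  have Dm: "0 < Dm" "D q (2 * real CARD('n)) \<le> Dm" "D p N \<le> Dm" using D by (auto simp: Dm_def less_max_iff_disj)
  have "4 * real CARD('n) + q / p + 1 + 4 * real CARD('n) / (q / p) \<le> N" by (simp add: N_def)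
  note ex = morrey_bound_lr[OF p Dm(1) G0 this Wsum]
  obtain C1 where C1: "0 < C1 \<and> (\<forall>F Y. \<forall>h :: int \<Rightarrow> real ^ 'n \<Rightarrow> real. finite F \<longrightarrow> 0 \<le> Y \<longrightarrow>
    (\<forall>k\<in>F. h k \<in> borel_measurable borel \<and> (\<forall>x. 0 \<le> h k x \<and>
       ennreal (h k x powr q) \<le> ennreal Dm * avg k (2 * real CARD('n)) (\<lambda>y. ennreal (h k y powr q)) x \<and>
       ennreal (h k x powr p) \<le> ennreal Dm * avg k N (\<lambda>y. ennreal (h k y powr p)) x)) \<longrightarrow>
    morrey_bound Y (\<lambda>x. (\<Sum>k\<in>F. h k x powr p) powr (q / p)) \<longrightarrow>
    (\<exists>a. (\<forall>k\<in>F. \<forall>x. 0 \<le> a k x \<and> ennreal (a k x) = avg k N (\<lambda>y. ennreal (h k y powr p)) x) \<and>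
       morrey_bound (C1 * Y) (\<lambda>x. (\<Sum>k\<in>F. a k x) powr (q / p))))"
    using ex by (rule exE)
  note C1 = C1[THEN conjunct1] C1[THEN conjunct2]
  define \<Gamma> where "\<Gamma> = Dm * (\<Sum>l\<in>L. 2 powr (- (real_of_int l * s * p)))"
  define C where "C = (\<Gamma> powr (q / p) * C1) powr (1 / q) + 1"
  have C: "0 < C" by (simp add: C_def add_nonneg_pos)
  show ?thesis
  proof (intro exI[of _ C] conjI allI impI C)
    fix t g :: "int \<Rightarrow> real ^ 'n \<Rightarrow> real"
    assume c: "controlled D L t g"
    note cD = controlledD[OF c]
    note [measurable] = cD(1,2)
    let ?G = "\<lambda>x. weighted_lr_norm s r (\<lambda>j. ennreal (g j x))"
    show "morrey_norm \<phi> q (\<lambda>x. weighted_lr_norm s r (\<lambda>j. ennreal (t j x))) \<le> ennreal C * morrey_norm \<phi> q ?G"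
    proof (cases "morrey_norm \<phi> q ?G")
      \<comment> \<open>An infinite right-hand side is harmless because \<open>C\<close> is
        positive; this is the purpose of the summand 1 in \<open>C\<close>.\<close>
      case top
      then show ?thesis using C by (simp add: ennreal_mult_top)
    next
      case (real X)
      define h where "h k x = 2 powr (real_of_int k * s) * g k x" for k x
      have h0: "0 \<le> h k x" for k x using cD(3) by (simp add: h_def)
      have [measurable]: "h k \<in> borel_measurable borel" for k unfolding h_def by measurable
      define f where "f n x = (\<Sum>j\<in>window n. (2 powr (real_of_int j * s) * t j x) powr p) powr (q / p)" for n x
      have mf: "morrey_bound (\<Gamma> powr (q / p) * C1 * X powr q) (f n)" for n
      proof -
        \<comment> \<open>The scales reached from the window by the shifts in \<open>L\<close>;
          these are the scales of \<open>g\<close> that enter the bound for the window of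
          \<open>t\<close>.\<close>
        define F where "F = (\<Union>l\<in>L. (\<lambda>j. j + l) ` window n)"
        have F: "finite F" using L by (simp add: F_def)
        have jl: "j + l \<in> F" if "j \<in> window n" "l \<in> L" for j l using that by (auto simp: F_def)
        have "morrey_bound (X powr q) (\<lambda>x. (\<Sum>k\<in>F. h k x powr p) powr (q / p))"
        proof (rule morrey_bound_of_morrey_norm[OF mw W_def, of ?G])
          fix x
          obtain n' where n': "F \<subseteq> window n'" using window_exhausts[OF F] by blast
          have "ennreal ((\<Sum>k\<in>F. h k x powr p) powr (q / p)) \<le> ennreal ((\<Sum>k\<in>window n'. h k x powr p) powr (q / p))"
            using n' p q by (intro ennreal_leI powr_mono2 sum_mono2) (auto simp: sum_nonneg)
          also have "\<dots> \<le> epowr (?G x) q"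
            using cD(3) r q by (subst weighted_lr_norm_finite_powr) (auto simp: h_def p_def intro!: SUP_upper2[of n'])
          finally show "ennreal ((\<Sum>k\<in>F. h k x powr p) powr (q / p)) \<le> epowr (?G x) q" .
        qed (use real in auto)
        moreover have "\<forall>k\<in>F. h k \<in> borel_measurable borel \<and> (\<forall>x. 0 \<le> h k x \<and>
           ennreal (h k x powr q) \<le> ennreal Dm * avg k (2 * real CARD('n)) (\<lambda>y. ennreal (h k y powr q)) x \<and>
           ennreal (h k x powr p) \<le> ennreal Dm * avg k N (\<lambda>y. ennreal (h k y powr p)) x)"
        proof (intro ballI conjI allI)
          fix k and x :: "real^'n"
          have "ennreal (h k x powr q) \<le> ennreal (D q (2 * real CARD('n))) * avg k (2 * real CARD('n)) (\<lambda>y. ennreal (h k y powr q)) x"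
            unfolding h_def by (rule controlled_weighted(1)[OF c q]) simp
          also have "\<dots> \<le> ennreal Dm * avg k (2 * real CARD('n)) (\<lambda>y. ennreal (h k y powr q)) x"
            by (intro mult_right_mono ennreal_leI Dm) auto
          finally show "ennreal (h k x powr q) \<le> \<dots>" .
          have "ennreal (h k x powr p) \<le> ennreal (D p N) * avg k N (\<lambda>y. ennreal (h k y powr p)) x"
            unfolding h_def by (rule controlled_weighted(1)[OF c p N2])
          also have "\<dots> \<le> ennreal Dm * avg k N (\<lambda>y. ennreal (h k y powr p)) x"
            by (intro mult_right_mono ennreal_leI Dm) auto
          finally show "ennreal (h k x powr p) \<le> \<dots>" .
        qed (use h0 in auto)
        ultimately obtain a where a: "\<forall>k\<in>F. \<forall>x. 0 \<le> a k x \<and> ennreal (a k x) = avg k N (\<lambda>y. ennreal (h k y powr p)) x"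
            "morrey_bound (C1 * X powr q) (\<lambda>x. (\<Sum>k\<in>F. a k x) powr (q / p))"
          using C1(2) F powr_ge_zero[of X q] by blast
        have [measurable]: "a k \<in> borel_measurable borel" if "k \<in> F" for k
          by (rule avg_real_measurable[of _ k N "\<lambda>y. ennreal (h k y powr p)"]) (use a that in auto)
        have "morrey_bound (\<Gamma> powr (q / p) * (C1 * X powr q)) (\<lambda>x. \<Gamma> powr (q / p) * (\<Sum>k\<in>F. a k x) powr (q / p))"
          by (rule morrey_bound_cmult[OF a(2)]) auto
        then show ?thesis unfolding mult.assoc
        proof (rule morrey_bound_mono)
          fix x
          have "(\<Sum>j\<in>window n. (2 powr (real_of_int j * s) * t j x) powr p) \<le>
             (\<Sum>j\<in>window n. Dm * (\<Sum>l\<in>L. 2 powr (- (real_of_int l * s * p)) * a (j + l) x))"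
          proof (intro sum_mono)
            fix j assume j: "j \<in> window n"
            have "(2 powr (real_of_int j * s) * t j x) powr p \<le> D p N * (\<Sum>l\<in>L. 2 powr (- (real_of_int l * s * p)) * a (j + l) x)"
              using a(1) jl[OF j] D[of p N] unfolding h_def by (intro controlled_term_le[OF c p N2]) (auto simp: less_imp_le)
            also have "\<dots> \<le> Dm * (\<Sum>l\<in>L. 2 powr (- (real_of_int l * s * p)) * a (j + l) x)"
              using a(1) jl[OF j] by (intro mult_right_mono Dm sum_nonneg) auto
            finally show "(2 powr (real_of_int j * s) * t j x) powr p \<le> \<dots>" .
          qed
          also have "\<dots> = Dm * (\<Sum>l\<in>L. 2 powr (- (real_of_int l * s * p)) * (\<Sum>j\<in>window n. a (j + l) x))"
            unfolding sum_distrib_left[symmetric] by (subst sum.swap) (simp add: sum_distrib_left)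
          also have "\<dots> \<le> Dm * (\<Sum>l\<in>L. 2 powr (- (real_of_int l * s * p)) * (\<Sum>k\<in>F. a k x))"
          proof (intro mult_left_mono sum_mono)
            fix l assume l: "l \<in> L"
            have "(\<Sum>j\<in>window n. a (j + l) x) = (\<Sum>k\<in>(\<lambda>j. j + l) ` window n. a k x)"
              by (subst sum.reindex) (auto simp: inj_on_def)
            also have "\<dots> \<le> (\<Sum>k\<in>F. a k x)"
              using F l a(1) by (intro sum_mono2) (auto simp: F_def)
            finally show "(\<Sum>j\<in>window n. a (j + l) x) \<le> (\<Sum>k\<in>F. a k x)" .
          qed (use Dm in auto)
          also have "\<dots> = \<Gamma> * (\<Sum>k\<in>F. a k x)" by (simp add: \<Gamma>_def sum_distrib_right)
          finally have "f n x \<le> (\<Gamma> * (\<Sum>k\<in>F. a k x)) powr (q / p)"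
            unfolding f_def using p q by (intro powr_mono2) (auto simp: sum_nonneg)
          also have "\<dots> = \<Gamma> powr (q / p) * (\<Sum>k\<in>F. a k x) powr (q / p)"
            by (rule powr_mult)
          finally show "f n x \<le> \<dots>" .
        qed
      qed
      have "morrey_norm \<phi> q (\<lambda>x. weighted_lr_norm s r (\<lambda>j. ennreal (t j x))) \<le> ennreal ((\<Gamma> powr (q / p) * C1) powr (1 / q) * X)"
      proof (rule morrey_norm_of_morrey_bound[OF mw W_def mf])
        show "f n \<in> borel_measurable borel" for n unfolding f_def by measurable
        show "incseq (\<lambda>n. f n x)" for x
          unfolding incseq_def f_def using p q window_mono by (auto intro!: powr_mono2 sum_mono2 simp: sum_nonneg)
        show "epowr (weighted_lr_norm s r (\<lambda>j. ennreal (t j x))) q = (SUP n. ennreal (f n x))" for x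
          unfolding f_def p_def by (rule weighted_lr_norm_finite_powr[OF cD(4) r q])
      qed (use real C1 in auto)
      also have "\<dots> \<le> ennreal (C * X)" using real by (intro ennreal_leI mult_right_mono) (auto simp: C_def)
      also have "\<dots> = ennreal C * morrey_norm \<phi> q ?G" using C real by (simp add: ennreal_mult)
      finally show ?thesis .
    qed
  qed
qed

lemma controlled_E_infinite:
  fixes s :: real and D :: "real \<Rightarrow> real \<Rightarrow> real"
  assumes q: "0 < q" and \<phi>: "\<phi> \<in> Gclass CARD('n::finite) q"
    and L: "finite L" and D: "\<And>\<eta> N. 0 < D \<eta> N"
  shows "\<exists>C>0. \<forall>t g :: int \<Rightarrow> real ^ 'n \<Rightarrow> real. controlled D L t g \<longrightarrow>
    morrey_norm \<phi> q (\<lambda>x. weighted_lr_norm s \<infinity> (\<lambda>j. ennreal (t j x))) \<le>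
    ennreal C * morrey_norm \<phi> q (\<lambda>x. weighted_lr_norm s \<infinity> (\<lambda>j. ennreal (g j x)))"
proof -
  define W where "W i = \<phi> (2 powr (- real_of_int i))" for i
  have mw: "morrey_weight W q" unfolding W_def by (rule Gclass_morrey_weight[OF q \<phi>])
  interpret morrey_weight W q by (rule mw)
  define N where "N = 6 * real CARD('n) + 3"
  have N2: "2 * real CARD('n) \<le> N" by (simp add: N_def)
  define p where "p = q / 2"
  have p: "0 < p" using q by (simp add: p_def)
  have "6 * real CARD('n) + 3 \<le> N" by (simp add: N_def)
  note ex = morrey_bound_sup[OF D[of q "2 * real CARD('n)"] this, folded p_def]
  obtain C1 where C1: "0 < C1 \<and> (\<forall>F Y. \<forall>h :: int \<Rightarrow> real ^ 'n \<Rightarrow> real. finite F \<longrightarrow> 0 \<le> Y \<longrightarrow>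
    (\<forall>k\<in>F. h k \<in> borel_measurable borel \<and> (\<forall>x. 0 \<le> h k x \<and>
       ennreal (h k x powr q) \<le> ennreal (D q (2 * real CARD('n))) * avg k (2 * real CARD('n)) (\<lambda>y. ennreal (h k y powr q)) x)) \<longrightarrow>
    morrey_bound Y (\<lambda>x. fmax F (\<lambda>k. h k x) powr q) \<longrightarrow>
    (\<exists>a. (\<forall>k\<in>F. \<forall>x. 0 \<le> a k x \<and> ennreal (a k x) = avg k N (\<lambda>y. ennreal (h k y powr p)) x) \<and>
       morrey_bound (C1 * Y) (\<lambda>x. fmax F (\<lambda>k. a k x) powr 2)))"
    using ex by (rule exE)
  note C1 = C1[THEN conjunct1] C1[THEN conjunct2]
  define \<Gamma> where "\<Gamma> = D p N * (\<Sum>l\<in>L. 2 powr (- (real_of_int l * s * p)))"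
  have \<Gamma>0: "0 \<le> \<Gamma>" using D[of p N] by (simp add: \<Gamma>_def sum_nonneg)
  define C where "C = (\<Gamma> powr 2 * C1) powr (1 / q) + 1"
  have C: "0 < C" by (simp add: C_def add_nonneg_pos)
  show ?thesis
  proof (intro exI[of _ C] conjI allI impI C)
    fix t g :: "int \<Rightarrow> real ^ 'n \<Rightarrow> real"
    assume c: "controlled D L t g"
    note cD = controlledD[OF c]
    note [measurable] = cD(1,2)
    let ?G = "\<lambda>x. weighted_lr_norm s \<infinity> (\<lambda>j. ennreal (g j x))"
    show "morrey_norm \<phi> q (\<lambda>x. weighted_lr_norm s \<infinity> (\<lambda>j. ennreal (t j x))) \<le> ennreal C * morrey_norm \<phi> q ?G"
    proof (cases "morrey_norm \<phi> q ?G")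
      case top
      then show ?thesis using C by (simp add: ennreal_mult_top)
    next
      case (real X)
      define h where "h k x = 2 powr (real_of_int k * s) * g k x" for k x
      have h0: "0 \<le> h k x" for k x using cD(3) by (simp add: h_def)
      have [measurable]: "h k \<in> borel_measurable borel" for k unfolding h_def by measurable
      define v where "v j x = 2 powr (real_of_int j * s) * t j x" for j x
      have v0: "0 \<le> v j x" for j x using cD(4) by (simp add: v_def)
      have [measurable]: "v j \<in> borel_measurable borel" for j unfolding v_def by measurable
      define f where "f n x = fmax (window n) (\<lambda>j. v j x) powr q" for n x
      have mf: "morrey_bound (\<Gamma> powr 2 * C1 * X powr q) (f n)" for n
      proof -
        define F where "F = (\<Union>l\<in>L. (\<lambda>j. j + l) ` window n)"
        have F: "finite F" using L by (simp add: F_def)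
        have jl: "j + l \<in> F" if "j \<in> window n" "l \<in> L" for j l using that by (auto simp: F_def)
        have "morrey_bound (X powr q) (\<lambda>x. fmax F (\<lambda>k. h k x) powr q)"
        proof (rule morrey_bound_of_morrey_norm[OF mw W_def, of ?G])
          fix x
          obtain n' where n': "F \<subseteq> window n'" using window_exhausts[OF F] by blast
          have "fmax F (\<lambda>k. h k x) \<le> fmax (window n') (\<lambda>k. h k x)"
            using n' by (intro fmax_leI F fmax_ge) (auto simp: fmax_nonneg)
          then have "ennreal (fmax F (\<lambda>k. h k x) powr q) \<le> ennreal (fmax (window n') (\<lambda>k. h k x) powr q)"
            using q fmax_nonneg[OF F] by (intro ennreal_leI powr_mono2) auto
          also have "\<dots> \<le> epowr (?G x) q"
            using cD(3) q by (subst weighted_lr_norm_infinite_powr) (auto simp: h_def intro!: SUP_upper2[of n'])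
          finally show "ennreal (fmax F (\<lambda>k. h k x) powr q) \<le> epowr (?G x) q" .
        qed (use real in auto)
        moreover have "\<forall>k\<in>F. h k \<in> borel_measurable borel \<and> (\<forall>x. 0 \<le> h k x \<and>
           ennreal (h k x powr q) \<le> ennreal (D q (2 * real CARD('n))) * avg k (2 * real CARD('n)) (\<lambda>y. ennreal (h k y powr q)) x)"
        proof (intro ballI conjI allI)
          fix k and x :: "real^'n"
          show "ennreal (h k x powr q) \<le> ennreal (D q (2 * real CARD('n))) * avg k (2 * real CARD('n)) (\<lambda>y. ennreal (h k y powr q)) x"
            unfolding h_def by (rule controlled_weighted(1)[OF c q]) simp
        qed (use h0 in auto)
        ultimately obtain a where a: "\<forall>k\<in>F. \<forall>x. 0 \<le> a k x \<and> ennreal (a k x) = avg k N (\<lambda>y. ennreal (h k y powr p)) x"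
            "morrey_bound (C1 * X powr q) (\<lambda>x. fmax F (\<lambda>k. a k x) powr 2)"
          using C1(2) F powr_ge_zero[of X q] by blast
        have am: "a k \<in> borel_measurable borel" if "k \<in> F" for k
          by (rule avg_real_measurable[of _ k N "\<lambda>y. ennreal (h k y powr p)"]) (use a that in auto)
        have [measurable]: "(\<lambda>x. fmax F (\<lambda>k. a k x)) \<in> borel_measurable borel"
          by (rule fmax_measurable[OF F am])
        have "morrey_bound (\<Gamma> powr 2 * (C1 * X powr q)) (\<lambda>x. \<Gamma> powr 2 * fmax F (\<lambda>k. a k x) powr 2)"
          by (rule morrey_bound_cmult[OF a(2)]) auto
        then show ?thesis unfolding mult.assoc
        proof (rule morrey_bound_mono)
          fix x
          define M where "M = fmax F (\<lambda>k. a k x)"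
          have M0: "0 \<le> M" unfolding M_def by (rule fmax_nonneg[OF F])
          \<comment> \<open>The power \<open>q / 2\<close> is undone at each scale, before the
            maximum over the window is taken; all averages are bounded by their maximum
            \<open>M\<close>.\<close>
          have vle: "v j x \<le> (\<Gamma> * M) powr (1 / p)" if j: "j \<in> window n" for j
          proof -
            have "v j x powr p \<le> D p N * (\<Sum>l\<in>L. 2 powr (- (real_of_int l * s * p)) * a (j + l) x)"
              unfolding v_def using a(1) jl[OF j] D[of p N] unfolding h_def
              by (intro controlled_term_le[OF c p N2]) (auto simp: less_imp_le)
            also have "\<dots> \<le> D p N * (\<Sum>l\<in>L. 2 powr (- (real_of_int l * s * p)) * M)"
              using D[of p N] jl[OF j] F unfolding M_def
              by (intro mult_left_mono sum_mono fmax_ge[of F _ "\<lambda>k. a k x"]) (auto simp: less_imp_le)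
            also have "\<dots> = \<Gamma> * M" by (simp add: \<Gamma>_def sum_distrib_right)
            finally have "(v j x powr p) powr (1 / p) \<le> (\<Gamma> * M) powr (1 / p)" using p by (intro powr_mono2) auto
            then show ?thesis using p v0[of j x] by (simp add: powr_powr)
          qed
          have "fmax (window n) (\<lambda>j. v j x) \<le> (\<Gamma> * M) powr (1 / p)"
            using vle by (intro fmax_leI) auto
          then have "f n x \<le> ((\<Gamma> * M) powr (1 / p)) powr q"
            unfolding f_def using q fmax_nonneg[of "window n"] by (intro powr_mono2) auto
          also have "\<dots> = \<Gamma> powr 2 * M powr 2"
            using \<Gamma>0 M0 q by (simp add: powr_powr p_def powr_mult del: powr_numeral)
          finally show "f n x \<le> \<Gamma> powr 2 * fmax F (\<lambda>k. a k x) powr 2" by (simp only: M_def)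
        qed
      qed
      have "morrey_norm \<phi> q (\<lambda>x. weighted_lr_norm s \<infinity> (\<lambda>j. ennreal (t j x))) \<le> ennreal ((\<Gamma> powr 2 * C1) powr (1 / q) * X)"
      proof (rule morrey_norm_of_morrey_bound[OF mw W_def mf])
        show "f n \<in> borel_measurable borel" for n
          unfolding f_def using fmax_measurable[of "window n" v borel] by measurable
        show "incseq (\<lambda>n. f n x)" for x
          unfolding incseq_def f_def
        proof (intro allI impI powr_mono2 fmax_leI)
          fix m n k assume "m \<le> n" "k \<in> window m"
          then show "v k x \<le> fmax (window n) (\<lambda>j. v j x)" using window_mono by (intro fmax_ge) auto
        qed (use q in \<open>auto simp: fmax_nonneg\<close>)
        show "epowr (weighted_lr_norm s \<infinity> (\<lambda>j. ennreal (t j x))) q = (SUP n. ennreal (f n x))" for x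
          unfolding f_def v_def by (rule weighted_lr_norm_infinite_powr[OF cD(4) q])
      qed (use real C1 in auto)
      also have "\<dots> \<le> ennreal (C * X)" using real by (intro ennreal_leI mult_right_mono) (auto simp: C_def)
      also have "\<dots> = ennreal C * morrey_norm \<phi> q ?G" using C real by (simp add: ennreal_mult)
      finally show ?thesis .
    qed
  qed
qed

text \<open>Each scale is estimated separately in the Morrey quasi-norm, so no sum over coarser
  scales occurs under the integral. The sequence norm is applied to the resulting inequality between
  numbers.\<close>

lemma controlled_N:
  fixes s :: real and D :: "real \<Rightarrow> real \<Rightarrow> real"
  assumes q: "0 < q" and r: "0 < r" and \<phi>: "\<phi> \<in> Gclass CARD('n::finite) q"
    and L: "finite L" and D: "\<And>\<eta> N. 0 < D \<eta> N"
  shows "\<exists>C>0. \<forall>t g :: int \<Rightarrow> real ^ 'n \<Rightarrow> real. controlled D L t g \<longrightarrow>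
    weighted_lr_norm s r (\<lambda>j. morrey_norm \<phi> q (\<lambda>x. ennreal (t j x))) \<le>
    ennreal C * weighted_lr_norm s r (\<lambda>j. morrey_norm \<phi> q (\<lambda>x. ennreal (g j x)))"
proof -
  define W where "W i = \<phi> (2 powr (- real_of_int i))" for i
  have mw: "morrey_weight W q" unfolding W_def by (rule Gclass_morrey_weight[OF q \<phi>])
  interpret morrey_weight W q by (rule mw)
  define N where "N = 4 * real CARD('n)"
  have N2: "2 * real CARD('n) \<le> N" by (simp add: N_def)
  define C1 where "C1 = cube_const TYPE('n) * (2 ^ CARD('n) * (cube_const TYPE('n) * 2 ^ CARD('n))) + cube_const TYPE('n) * 2 ^ CARD('n)"
  have C10: "0 < C1" using cube_const_pos[where 'n = 'n] by (simp add: C1_def add_pos_pos)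
  define c where "c = (D q N * C1 * real (card L)) powr (1 / q) + 1"
  have c0: "0 < c" by (simp add: c_def add_nonneg_pos)
  obtain C where C: "0 < C \<and> (\<forall>x y. (\<forall>j. y j \<le> ennreal c * (\<Sum>l\<in>L. x (j + l))) \<longrightarrow>
    weighted_lr_norm s r y \<le> ennreal C * weighted_lr_norm s r x)"
    using weighted_lr_norm_shift[OF L r c0] by (rule exE)
  note C = C[THEN conjunct1] C[THEN conjunct2]
  show ?thesis
  proof (intro exI[of _ C] conjI allI impI C(1) C(2)[rule_format])
    fix t g :: "int \<Rightarrow> real ^ 'n \<Rightarrow> real" and j
    assume ct: "controlled D L t g"
    note cD = controlledD[OF ct]
    note [measurable] = cD(1,2)
    define X where "X k = morrey_norm \<phi> q (\<lambda>x. ennreal (g k x))" for k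
    show "morrey_norm \<phi> q (\<lambda>x. ennreal (t j x)) \<le> ennreal c * (\<Sum>l\<in>L. morrey_norm \<phi> q (\<lambda>x. ennreal (g (j + l) x)))"
    proof (cases "\<exists>l\<in>L. X (j + l) = \<infinity>")
      case True
      then have "(\<Sum>l\<in>L. X (j + l)) = \<infinity>" using L by auto
      then show ?thesis using c0 by (simp add: X_def ennreal_mult_top)
    next
      case False
      define Z where "Z l = enn2real (X (j + l))" for l
      have Z: "X (j + l) = ennreal (Z l)" if "l \<in> L" for l using False that by (simp add: Z_def less_top)
      have Z0: "0 \<le> Z l" for l by (simp add: Z_def)
      have mg: "morrey_bound (Z l powr q) (\<lambda>x. g (j + l) x powr q)" if "l \<in> L" for l
        by (rule morrey_bound_of_morrey_norm[OF mw W_def, of "\<lambda>x. ennreal (g (j + l) x)"])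
          (use Z[OF that] Z0 cD(3) in \<open>auto simp: X_def epowr_ennreal\<close>)
      define a where "a k x = enn2real (avg k N (\<lambda>y. ennreal (g k y powr q)) x)" for k x
      have [measurable]: "a k \<in> borel_measurable borel" for k unfolding a_def by measurable
      have a0: "0 \<le> a k x" for k x by (simp add: a_def)
      have ea: "ennreal (a (j + l) x) = avg (j + l) N (\<lambda>y. ennreal (g (j + l) y powr q)) x" if "l \<in> L" for l x
      proof -
        have "avg (j + l) N (\<lambda>y. ennreal (g (j + l) y powr q)) x \<le> avg (j + l) (2 * real CARD('n)) (\<lambda>y. ennreal (g (j + l) y powr q)) x"
          by (rule avg_antimono[OF N2])
        also have "\<dots> \<le> ennreal (cube_const TYPE('n) * 2 ^ CARD('n) * Z l powr q * (1 / W (j + l)) powr q)"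
          by (rule morrey_bound_avg[OF mg[OF that]]) auto
        also have "\<dots> < \<infinity>" by simp
        finally show ?thesis by (simp add: a_def)
      qed
      have ma: "morrey_bound (C1 * Z l powr q) (a (j + l))" if "l \<in> L" for l
        unfolding C1_def using mg[OF that] ea[OF that] a0
        by (intro morrey_bound_single[where k = "j + l" and N = N]) (auto simp: N_def)
      have "morrey_bound (D q N * (\<Sum>l\<in>L. C1 * Z l powr q)) (\<lambda>x. D q N * (\<Sum>l\<in>L. a (j + l) x))"
        using D[of q N] C10 L a0 ma by (intro morrey_bound_cmult morrey_bound_sum) (auto simp: less_imp_le)
      then have mt: "morrey_bound (D q N * (\<Sum>l\<in>L. C1 * Z l powr q)) (\<lambda>x. t j x powr q)"
      proof (rule morrey_bound_mono)
        fix x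
        \<comment> \<open>The instance \<open>s = 0\<close> of the weighted estimate; here the
          smoothness weights belong to the outer sequence norm.\<close>
        have "(2 powr (real_of_int j * 0) * t j x) powr q \<le> D q N * (\<Sum>l\<in>L. 2 powr (- (real_of_int l * 0 * q)) * a (j + l) x)"
          using a0 ea D[of q N] by (intro controlled_term_le[OF ct q N2]) (auto simp: less_imp_le)
        then show "t j x powr q \<le> D q N * (\<Sum>l\<in>L. a (j + l) x)" by simp
      qed
      define Y where "Y = (\<Sum>l\<in>L. Z l)"
      have Y0: "0 \<le> Y" unfolding Y_def by (intro sum_nonneg Z0)
      have "D q N * (\<Sum>l\<in>L. C1 * Z l powr q) \<le> D q N * (\<Sum>l\<in>L. C1 * Y powr q)"
        using D[of q N] C10 L Z0 q unfolding Y_def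
        by (intro mult_left_mono sum_mono powr_mono2 member_le_sum) (auto simp: less_imp_le)
      also have "\<dots> = D q N * C1 * real (card L) * Y powr q" by simp
      finally have le: "D q N * (\<Sum>l\<in>L. C1 * Z l powr q) \<le> D q N * C1 * real (card L) * Y powr q" .
      have mt': "morrey_bound (D q N * C1 * real (card L) * Y powr q) (\<lambda>x. t j x powr q)"
        unfolding morrey_bound_def
      proof (intro allI)
        fix i and m :: "'n \<Rightarrow> int"
        have "(\<integral>\<^sup>+x\<in>dcube i m. ennreal (t j x powr q) \<partial>lborel) \<le> ennreal (D q N * (\<Sum>l\<in>L. C1 * Z l powr q) * (2 powr (- (real_of_int i * real CARD('n))) * (1 / W i) powr q))"
          using mt unfolding morrey_bound_def by blast
        also have "\<dots> \<le> ennreal (D q N * C1 * real (card L) * Y powr q * (2 powr (- (real_of_int i * real CARD('n))) * (1 / W i) powr q))"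
          by (intro ennreal_leI mult_right_mono le) auto
        finally show "(\<integral>\<^sup>+x\<in>dcube i m. ennreal (t j x powr q) \<partial>lborel) \<le> \<dots>" .
      qed
      have "morrey_norm \<phi> q (\<lambda>x. ennreal (t j x)) \<le> ennreal ((D q N * C1 * real (card L)) powr (1 / q) * Y)"
        using D[of q N] C10 Y0 cD(4)
        by (intro morrey_norm_of_morrey_bound[OF mw W_def, where f = "\<lambda>_ x. t j x powr q"] mt') (auto simp: epowr_ennreal less_imp_le)
      also have "\<dots> \<le> ennreal (c * Y)" using Y0 by (intro ennreal_leI mult_right_mono) (auto simp: c_def)
      also have "\<dots> = ennreal c * (\<Sum>l\<in>L. ennreal (Z l))" using c0 Z0 by (simp add: Y_def ennreal_mult sum_nonneg)
      also have "\<dots> = ennreal c * (\<Sum>l\<in>L. morrey_norm \<phi> q (\<lambda>x. ennreal (g (j + l) x)))" by (simp add: Z[symmetric] X_def)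
      finally show ?thesis .
    qed
  qed
qed

subsection \<open>Powers of band-limited functions\<close>

text \<open>Peetre's trick. The kernel bound for all orders is applied once with the (function dependent) growth
  order, to see that the maximal function is finite, and a second time to remove that dependence.\<close>

lemma peetre_finite:
  fixes g :: "'a::euclidean_space \<Rightarrow> real"
  assumes g: "g \<in> borel_measurable borel" "\<And>x. 0 \<le> g x"
    and K: "0 \<le> K" "\<And>x. ennreal (g x) \<le> ennreal K * avg k a (\<lambda>y. ennreal (g y)) x"
    and \<eta>: "0 < \<eta>" "\<eta> \<le> 1" and a: "0 \<le> a"
    and B: "\<And>y. g y \<le> B * sdist k x y powr a"
  shows "ennreal (g x powr \<eta>) \<le> ennreal K * avg k (a * \<eta>) (\<lambda>y. ennreal (g y powr \<eta>)) x"
proof -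
  note [measurable] = g(1)
  define V where "V = avg k (a * \<eta>) (\<lambda>y. ennreal (g y powr \<eta>)) x"
  \<comment> \<open>Its supremum \<open>G\<close> is Peetre's maximal function of order
    \<open>a\<close> at \<open>x\<close>, and \<open>fB\<close> shows that it is finite.\<close>
  define f where "f y = g y * sdist k x y powr (- a)" for y
  define G where "G = (SUP y. f y)"
  have fB: "f y \<le> B" for y
  proof -
    have "f y \<le> (B * sdist k x y powr a) * sdist k x y powr (- a)"
      unfolding f_def by (intro mult_right_mono B) auto
    moreover have "sdist k x y powr a * sdist k x y powr (- a) = 1" using sdist_pos[of k x y] by (simp add: powr_minus)
    ultimately show ?thesis by (simp add: mult.assoc)
  qed
  then have bdd: "bdd_above (range f)" by (intro bdd_aboveI[of _ B]) auto
  have fG: "f y \<le> G" for y unfolding G_def by (rule cSUP_upper[OF _ bdd]) simp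
  have gG: "g y \<le> G * sdist k x y powr a" for y
    using mult_right_mono[OF fG[of y], of "sdist k x y powr a"] sdist_pos[of k x y] by (simp add: f_def powr_minus field_simps)
  have f0: "0 \<le> f y" for y using g by (simp add: f_def)
  have G0: "0 \<le> G" using f0[of x] fG[of x] by linarith
  have gxG: "g x \<le> G" using gG[of x] by simp
  \<comment> \<open>In \<open>g = g powr \<eta> * g powr (1 - \<eta>)\<close> the second factor is
    estimated through \<open>G\<close>. This lowers the order of the kernel from \<open>a\<close> to
    \<open>a * \<eta>\<close> and leaves \<open>G powr (1 - \<eta>)\<close>, which can be cancelled
    against \<open>G\<close> since \<open>G\<close> is finite.\<close>
  have key: "ennreal (f y) \<le> ennreal (K * G powr (1 - \<eta>)) * V" for y
  proof -
    have "ennreal (f y) = ennreal (sdist k x y powr (- a)) * ennreal (g y)"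
      using g by (simp add: f_def mult.commute ennreal_mult)
    also have "\<dots> \<le> ennreal (sdist k x y powr (- a)) * (ennreal K * avg k a (\<lambda>y. ennreal (g y)) y)"
      by (intro mult_left_mono K) auto
    also have "\<dots> \<le> ennreal (sdist k x y powr (- a)) * (ennreal K * (ennreal (sdist k y x powr a) * avg k a (\<lambda>y. ennreal (g y)) x))"
      using a by (intro mult_left_mono avg_shift) auto
    also have "\<dots> = ennreal (sdist k x y powr (- a) * sdist k y x powr a) * (ennreal K * avg k a (\<lambda>y. ennreal (g y)) x)"
      by (simp add: ennreal_mult mult_ac)
    also have "sdist k x y powr (- a) * sdist k y x powr a = 1"
      using sdist_pos[of k x y] by (simp add: sdist_commute[of k y x] powr_minus)
    also have "ennreal 1 * (ennreal K * avg k a (\<lambda>y. ennreal (g y)) x) \<le> ennreal K * (ennreal (G powr (1 - \<eta>)) * V)"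
    proof -
      have "avg k a (\<lambda>y. ennreal (g y)) x \<le> (\<integral>\<^sup>+z. ennreal (G powr (1 - \<eta>)) * (ennreal (kern k (a * \<eta>) x z) * ennreal (g z powr \<eta>)) \<partial>lborel)"
        unfolding avg_def
      proof (intro nn_integral_mono)
        fix z
        have "g z = g z powr \<eta> * g z powr (1 - \<eta>)" using g(2)[of z] by (simp flip: powr_add)
        also have "\<dots> \<le> g z powr \<eta> * (G * sdist k x z powr a) powr (1 - \<eta>)"
          using gG[of z] g(2)[of z] \<eta> by (intro mult_left_mono powr_mono2) auto
        also have "\<dots> = g z powr \<eta> * (G powr (1 - \<eta>) * sdist k x z powr (a * (1 - \<eta>)))"
          using G0 by (simp add: powr_mult powr_powr)
        finally have "kern k a x z * g z \<le> kern k a x z * (g z powr \<eta> * (G powr (1 - \<eta>) * sdist k x z powr (a * (1 - \<eta>))))"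
          by (intro mult_left_mono) auto
        also have "\<dots> = G powr (1 - \<eta>) * ((kern k a x z * sdist k x z powr (a * (1 - \<eta>))) * g z powr \<eta>)"
          by (simp only: mult_ac)
        also have "kern k a x z * sdist k x z powr (a * (1 - \<eta>)) = kern k (a * \<eta>) x z"
          unfolding kern_sdist by (simp add: algebra_simps)
        finally show "ennreal (kern k a x z) * ennreal (g z) \<le> ennreal (G powr (1 - \<eta>)) * (ennreal (kern k (a * \<eta>) x z) * ennreal (g z powr \<eta>))"
          using g(2) by (simp flip: ennreal_mult)
      qed
      also have "\<dots> = ennreal (G powr (1 - \<eta>)) * V"
        unfolding V_def avg_def by (rule nn_integral_cmult) measurable
      finally show ?thesis by (simp add: mult_left_mono)
    qed
    finally show ?thesis using K(1) by (simp add: ennreal_mult mult.assoc)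
  qed
  show ?thesis
  proof (cases "G = 0")
    case True
    then have "g x = 0" using gxG g(2)[of x] by simp
    then show ?thesis by simp
  next
    case False
    then have Gp: "0 < G" using G0 by simp
    show ?thesis
    proof (cases V)
      case (real v)
      have "f y \<le> K * G powr (1 - \<eta>) * v" for y
        using key[of y] real K(1) by (simp flip: ennreal_mult)
      then have "G \<le> K * G powr (1 - \<eta>) * v" unfolding G_def by (intro cSUP_least) auto
      then have "G powr \<eta> * G powr (1 - \<eta>) \<le> (K * v) * G powr (1 - \<eta>)"
        using Gp by (simp add: mult_ac flip: powr_add)
      then have "G powr \<eta> \<le> K * v" using Gp by simp
      moreover have "g x powr \<eta> \<le> G powr \<eta>" using gxG g(2) \<eta> by (intro powr_mono2) auto
      ultimately have "ennreal (g x powr \<eta>) \<le> ennreal (K * v)" by (intro ennreal_leI) linarith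
      then show ?thesis using real K(1) by (simp add: ennreal_mult V_def)
    next
      case top
      show ?thesis
      \<comment> \<open>As \<open>0 * \<infinity> = 0\<close>, the case \<open>K = 0\<close> needs
        the separate observation that \<open>g x\<close> vanishes.\<close>
      proof (cases "K = 0")
        case True
        then have "g x = 0" using K(2)[of x] g(2)[of x] by simp
        then show ?thesis by simp
      next
        case False
        then show ?thesis using top K(1) by (simp add: V_def ennreal_mult_top)
      qed
    qed
  qed
qed

lemma peetre_small:
  fixes g :: "'a::euclidean_space \<Rightarrow> real"
  assumes g: "g \<in> borel_measurable borel" "\<And>x. 0 \<le> g x"
    and K: "\<And>N. 0 \<le> K N" "\<And>N x. 0 \<le> N \<Longrightarrow> ennreal (g x) \<le> ennreal (K N) * avg k N (\<lambda>y. ennreal (g y)) x"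
    and growth: "\<And>y. g y \<le> H * (1 + norm y) powr M"
    and \<eta>: "0 < \<eta>" "\<eta> \<le> 1" and N: "0 \<le> N"
  shows "ennreal (g x powr \<eta>) \<le> ennreal (K (N / \<eta>)) * avg k N (\<lambda>y. ennreal (g y powr \<eta>)) x"
proof (cases "avg k N (\<lambda>y. ennreal (g y powr \<eta>)) x")
  case (real v)
  note [measurable] = g(1)
  define a where "a = N / \<eta>"
  have a: "0 \<le> a" "a * \<eta> = N" using \<eta> N by (auto simp: a_def)
  \<comment> \<open>The desired order \<open>a = N / \<eta>\<close> may lie below the growth order
    \<open>M\<close>, and then the maximal function of order \<open>a\<close> is not yet known to be
    finite; the order \<open>a'\<close> is large enough.\<close>
  define a' where "a' = max a \<bar>M\<bar>"
  have a': "0 \<le> a'" "a \<le> a'" "M \<le> a'" by (auto simp: a'_def)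
  have 1: "\<exists>B. \<forall>z. g z \<le> B * sdist k y z powr a'" for y
  proof (intro exI allI)
    fix z
    define c where "c = (1 + norm y) * (1 + 2 powr (- real_of_int k))"
    have H: "0 \<le> H" using growth[of 0] g(2)[of 0] by simp
    have "norm z \<le> norm y + dist y z" using norm_triangle_ineq[of y "z - y"] by (simp add: dist_norm norm_minus_commute)
    then have "1 + norm z \<le> (1 + norm y) * (1 + dist y z)"
      using mult_nonneg_nonneg[OF norm_ge_zero[of y] zero_le_dist[of y z]] by (simp only: distrib_left distrib_right mult_1 mult_1_right)
    also have "1 + dist y z \<le> (1 + 2 powr (- real_of_int k)) * sdist k y z"
      using zero_le_dist[of y z] by (simp add: sdist_def algebra_simps powr_minus flip: powr_add)
    finally have "1 + norm z \<le> c * sdist k y z" by (simp add: c_def mult.assoc mult_left_mono)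
    have "g z \<le> H * (1 + norm z) powr M" by (rule growth)
    also have "\<dots> \<le> H * (1 + norm z) powr a'"
      using H a' by (intro mult_left_mono powr_mono) auto
    also have "\<dots> \<le> H * (c * sdist k y z) powr a'"
      using H a' \<open>1 + norm z \<le> c * sdist k y z\<close> by (intro mult_left_mono powr_mono2) auto
    also have "\<dots> = H * c powr a' * sdist k y z powr a'"
      using sdist_pos[of k y z] by (simp add: c_def powr_mult)
    finally show "g z \<le> (H * ((1 + norm y) * (1 + 2 powr (- real_of_int k))) powr a') * sdist k y z powr a'"
      by (simp add: c_def)
  qed
  have 2: "ennreal (g y powr \<eta>) \<le> ennreal (K a' * sdist k x y powr N * v)" for y
  proof -
    obtain B where B: "\<And>z. g z \<le> B * sdist k y z powr a'" using 1[of y] by blast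
    have "ennreal (g y powr \<eta>) \<le> ennreal (K a') * avg k (a' * \<eta>) (\<lambda>y. ennreal (g y powr \<eta>)) y"
      by (rule peetre_finite[OF g K(1) K(2)[OF a'(1)] \<eta> a'(1) B])
    also have "\<dots> \<le> ennreal (K a') * avg k N (\<lambda>y. ennreal (g y powr \<eta>)) y"
      using a' \<eta> unfolding a(2)[symmetric] by (intro mult_left_mono avg_antimono mult_right_mono) auto
    also have "\<dots> \<le> ennreal (K a') * (ennreal (sdist k y x powr N) * avg k N (\<lambda>y. ennreal (g y powr \<eta>)) x)"
      using N by (intro mult_left_mono avg_shift) auto
    also have "\<dots> = ennreal (K a' * sdist k x y powr N * v)"
      using real K(1) by (simp add: sdist_commute[of k y x] mult.assoc flip: ennreal_mult)
    finally show ?thesis .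
  qed
  \<comment> \<open>The slow variation of the average now shows that \<open>g\<close> grows with
    order at most \<open>a\<close>. The constant here depends on \<open>g\<close> through
    \<open>a'\<close>, but it merely certifies finiteness and disappears in the second
    application.\<close>
  have "g y \<le> (K a' * v) powr (1 / \<eta>) * sdist k x y powr a" for y
  proof -
    have "g y powr \<eta> \<le> K a' * sdist k x y powr N * v"
      using 2[of y] real K(1)[of a'] by (subst (asm) ennreal_le_iff) auto
    then have "(g y powr \<eta>) powr (1 / \<eta>) \<le> (K a' * v * sdist k x y powr N) powr (1 / \<eta>)"
      using \<eta> by (intro powr_mono2) (auto simp: mult_ac)
    then show ?thesis using \<eta> g(2)[of y] real K(1)[of a'] sdist_pos[of k x y]
      by (simp add: powr_powr powr_mult a_def)
  qed
  from peetre_finite[OF g K(1) K(2)[OF a(1)] \<eta> a(1) this] show ?thesis by (simp add: a(2) a_def[symmetric])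
next
  case top
  show ?thesis
  proof (cases "K (N / \<eta>) = 0")
    case True
    then have "g x = 0" using K(2)[of "N / \<eta>" x] g(2)[of x] N \<eta> by simp
    then show ?thesis by simp
  next
    case False
    then have "0 < K (N / \<eta>)" using K(1)[of "N / \<eta>"] by simp
    then show ?thesis using top by (simp add: ennreal_mult_top)
  qed
qed

text \<open>Jensen's inequality for a kernel that is not normalised, obtained from
  \<open>u \<le> c + c powr (1 - \<eta>) * u powr \<eta>\<close> by optimising in
  \<open>c\<close>.\<close>

lemma avg_powr_ge:
  fixes g :: "'a::euclidean_space \<Rightarrow> real"
  assumes g: "g \<in> borel_measurable borel" "\<And>x. 0 \<le> g x" and \<eta>: "1 \<le> \<eta>" and N: "2 * real DIM('a) \<le> N"
    and K: "0 \<le> K" "0 \<le> y" "ennreal y \<le> ennreal K * avg k N (\<lambda>y. ennreal (g y)) x"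
  shows "ennreal (y powr \<eta>) \<le> ennreal ((K * (2 ^ DIM('a) + 1)) powr \<eta>) * avg k N (\<lambda>y. ennreal (g y powr \<eta>)) x"
proof (cases "K = 0")
  case True
  then have "y = 0" using K by simp
  then show ?thesis by simp
next
  case False
  then have Kp: "0 < K" using K by simp
  note [measurable] = g(1)
  show ?thesis
  proof (cases "avg k N (\<lambda>y. ennreal (g y powr \<eta>)) x")
    case (real v)
    have le: "y \<le> K * (2 ^ DIM('a) * c + c powr (1 - \<eta>) * v)" if c: "0 < c" for c
    proof -
      have pt: "u \<le> c + c powr (1 - \<eta>) * u powr \<eta>" if "0 \<le> u" for u :: real
      proof (cases "u \<le> c")
        case True
        then show ?thesis by (smt (verit) mult_nonneg_nonneg powr_ge_zero)
      next
        case False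
        have "1 \<le> (u / c) powr (\<eta> - 1)" using False c \<eta> by (intro ge_one_powr_ge_zero) auto
        then have "u * 1 \<le> u * (u / c) powr (\<eta> - 1)" using that by (intro mult_left_mono) auto
        also have "\<dots> = c powr (1 - \<eta>) * u powr \<eta>"
          using False c mult_powr_pred[of u \<eta>] by (simp add: powr_divide powr_diff field_simps)
        finally show ?thesis using c by simp
      qed
      have "avg k N (\<lambda>y. ennreal (g y)) x \<le> (\<integral>\<^sup>+z. ennreal (kern k N x z) * ennreal c + ennreal (c powr (1 - \<eta>)) * (ennreal (kern k N x z) * ennreal (g z powr \<eta>)) \<partial>lborel)"
        unfolding avg_def
      proof (intro nn_integral_mono)
        fix z
        have "kern k N x z * g z \<le> kern k N x z * (c + c powr (1 - \<eta>) * g z powr \<eta>)"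
          by (intro mult_left_mono pt g) auto
        then have "ennreal (kern k N x z * g z) \<le> ennreal (kern k N x z * c + c powr (1 - \<eta>) * (kern k N x z * g z powr \<eta>))"
          by (intro ennreal_leI) (simp add: algebra_simps)
        also have "\<dots> = ennreal (kern k N x z) * ennreal c + ennreal (c powr (1 - \<eta>)) * (ennreal (kern k N x z) * ennreal (g z powr \<eta>))"
          using c by (simp add: ennreal_mult)
        finally show "ennreal (kern k N x z) * ennreal (g z) \<le> \<dots>" using g(2) by (simp add: ennreal_mult)
      qed
      also have "\<dots> = avg k N (\<lambda>_. ennreal c) x + ennreal (c powr (1 - \<eta>)) * ennreal v"
        unfolding real(2)[symmetric] avg_def by (subst nn_integral_add) (auto simp: nn_integral_cmult)
      also have "\<dots> \<le> ennreal (2 ^ DIM('a)) * ennreal c + ennreal (c powr (1 - \<eta>)) * ennreal v"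
        by (intro add_right_mono avg_const_le N)
      also have "\<dots> = ennreal (2 ^ DIM('a) * c + c powr (1 - \<eta>) * v)"
        using c real by (simp flip: ennreal_mult ennreal_plus)
      finally have "ennreal y \<le> ennreal K * ennreal (2 ^ DIM('a) * c + c powr (1 - \<eta>) * v)"
        using K(3) mult_left_mono order_trans by fastforce
      also have "\<dots> = ennreal (K * (2 ^ DIM('a) * c + c powr (1 - \<eta>) * v))"
        using K(1) c real by (intro ennreal_mult[symmetric]) auto
      finally show ?thesis using K(1) c real by (subst (asm) ennreal_le_iff) auto
    qed
    have "y powr \<eta> \<le> (K * (2 ^ DIM('a) + 1)) powr \<eta> * v"
    proof (cases "v = 0")
      \<comment> \<open>The optimal \<open>c\<close> would be 0, so arbitrarily small values of
        \<open>c\<close> are used instead.\<close>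
      case True
      have "y \<le> 0"
      proof (rule field_le_epsilon)
        fix e :: real assume e: "0 < e"
        have "y \<le> K * (2 ^ DIM('a) * (e / (K * 2 ^ DIM('a))))"
          using le[of "e / (K * 2 ^ DIM('a))"] e Kp True by simp
        then show "y \<le> 0 + e" using Kp by simp
      qed
      then have "y = 0" using K by simp
      with True show ?thesis by simp
    next
      case False
      then have v: "0 < v" using real by simp
      \<comment> \<open>With \<open>c = v powr (1 / \<eta>)\<close> the terms \<open>c\<close> and
        \<open>c powr (1 - \<eta>) * v\<close> coincide.\<close>
      have "(v powr (1 / \<eta>)) powr (1 - \<eta>) * v = v powr (1 / \<eta>)"
        using v \<eta> mult_powr_pred[OF v, of "1 / \<eta>"] by (simp add: powr_powr diff_divide_distrib mult.commute)
      then have "y \<le> (K * (2 ^ DIM('a) + 1)) * v powr (1 / \<eta>)"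
        using le[of "v powr (1 / \<eta>)"] v by (simp add: algebra_simps)
      then have "y powr \<eta> \<le> ((K * (2 ^ DIM('a) + 1)) * v powr (1 / \<eta>)) powr \<eta>"
        using K \<eta> by (intro powr_mono2) auto
      then show ?thesis using \<eta> v K by (simp add: powr_mult powr_powr)
    qed
    then show ?thesis using real by (auto simp flip: ennreal_mult intro!: ennreal_leI)
  next
    case top
    have "0 < K * (2 ^ DIM('a) + 1)" using Kp by (intro mult_pos_pos add_pos_pos) auto
    then have "0 < (K * (2 ^ DIM('a) + 1)) powr \<eta>" unfolding powr_gt_zero by linarith
    then show ?thesis using top by (simp add: ennreal_mult_top)
  qed
qed

text \<open>Unlike \<open>K\<close>, the growth data \<open>H\<close> and \<open>M\<close> may
  depend on the scale and on the family; the bounds derived from this definition must not depend on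
  them.\<close>

definition band_limited :: "(real \<Rightarrow> real) \<Rightarrow> int set \<Rightarrow> (int \<Rightarrow> real ^ 'n::finite \<Rightarrow> real) \<Rightarrow> (int \<Rightarrow> real ^ 'n \<Rightarrow> real) \<Rightarrow> bool"
  where "band_limited K L t g \<longleftrightarrow>
    (\<forall>k. g k \<in> borel_measurable borel \<and> t k \<in> borel_measurable borel \<and> (\<forall>x. 0 \<le> g k x \<and> 0 \<le> t k x)) \<and>
    (\<forall>k. \<exists>H M. \<forall>y. g k y \<le> H * (1 + norm y) powr M) \<and>
    (\<forall>N\<ge>0. \<forall>k x. ennreal (g k x) \<le> ennreal (K N) * avg k N (\<lambda>y. ennreal (g k y)) x \<and>
      ennreal (t k x) \<le> ennreal (K N) * (\<Sum>l\<in>L. avg (k + l) N (\<lambda>y. ennreal (g (k + l) y)) x))"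

text \<open>For \<open>g\<close> the claim is Peetre's trick or Jensen's inequality. As
  \<open>t\<close> is bounded by averages of \<open>g\<close> and not by averages of itself, the
  trick is not applied to it; instead, first-power averages of \<open>g\<close> are bounded by power
  means of \<open>g\<close>, using the slow variation of the latter.\<close>

lemma controlled_of_band_limited:
  assumes K: "\<And>N. 0 \<le> K N" and L: "finite L"
  shows "\<exists>D. (\<forall>\<eta> N. 0 < D \<eta> N) \<and> (\<forall>t g :: int \<Rightarrow> real ^ 'n::finite \<Rightarrow> real. band_limited K L t g \<longrightarrow> controlled D L t g)"
proof -
  define n where "n = real CARD('n)"
  define D1 where "D1 \<eta> N = (if \<eta> \<le> 1 then K (N / \<eta>) else (K N * (2 ^ CARD('n) + 1)) powr \<eta>) + 1" for \<eta> N :: real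
  have D1: "0 < D1 \<eta> N" for \<eta> N using K[of "N / \<eta>"] by (simp add: D1_def add_nonneg_pos)
  \<comment> \<open>Of the order \<open>N / \<eta> + 2 * n\<close>, the part
    \<open>N / \<eta>\<close> compensates the growth of \<open>g\<close> away from \<open>x\<close>,
    and \<open>2 * n\<close> keeps the kernel integrable.\<close>
  define K' where "K' \<eta> N = (K (N / \<eta> + 2 * n) + 1) * 2 ^ CARD('n)" for \<eta> N :: real
  have K': "0 < K' \<eta> N" for \<eta> N using K[of "N / \<eta> + 2 * n"] by (simp add: K'_def add_nonneg_pos)
  define D2 where "D2 \<eta> N = K' \<eta> N powr \<eta> * real (card L) powr \<eta> * D1 \<eta> N" for \<eta> N :: real
  have D2: "0 \<le> D2 \<eta> N" for \<eta> N using D1[of \<eta> N] by (simp add: D2_def)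
  define D where "D \<eta> N = D1 \<eta> N + D2 \<eta> N" for \<eta> N :: real
  have D: "0 < D \<eta> N" "D1 \<eta> N \<le> D \<eta> N" "D2 \<eta> N \<le> D \<eta> N" for \<eta> N
    using D1[of \<eta> N] D2[of \<eta> N] by (auto simp: D_def add_pos_nonneg)
  have "controlled D L t g" if b: "band_limited K L t g" for t g :: "int \<Rightarrow> real ^ 'n \<Rightarrow> real"
  proof -
    have meas [measurable]: "g k \<in> borel_measurable borel" "t k \<in> borel_measurable borel" and g0: "0 \<le> g k x" and t0: "0 \<le> t k x" for k x
      using b by (auto simp: band_limited_def)
    have growth: "\<exists>H M. \<forall>y. g k y \<le> H * (1 + norm y) powr M" for k using b by (auto simp: band_limited_def)
    have gK: "ennreal (g k x) \<le> ennreal (K N) * avg k N (\<lambda>y. ennreal (g k y)) x" if "0 \<le> N" for N k x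
      using b that by (auto simp: band_limited_def)
    have tK: "ennreal (t k x) \<le> ennreal (K N) * (\<Sum>l\<in>L. avg (k + l) N (\<lambda>y. ennreal (g (k + l) y)) x)" if "0 \<le> N" for N k x
      using b that by (auto simp: band_limited_def)
    have g1: "ennreal (g k x powr \<eta>) \<le> ennreal (D1 \<eta> N) * avg k N (\<lambda>y. ennreal (g k y powr \<eta>)) x"
      if \<eta>: "0 < \<eta>" and N: "2 * n \<le> N" for \<eta> N k x
    proof -
      have N0: "0 \<le> N" using N unfolding n_def by (smt (verit) of_nat_0_le_iff)
      have "ennreal (g k x powr \<eta>) \<le> ennreal (if \<eta> \<le> 1 then K (N / \<eta>) else (K N * (2 ^ CARD('n) + 1)) powr \<eta>) * avg k N (\<lambda>y. ennreal (g k y powr \<eta>)) x"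
      proof (cases "\<eta> \<le> 1")
        case True
        obtain H M where HM: "\<And>y. g k y \<le> H * (1 + norm y) powr M" using growth[of k] by blast
        have "ennreal (g k x powr \<eta>) \<le> ennreal (K (N / \<eta>)) * avg k N (\<lambda>y. ennreal (g k y powr \<eta>)) x"
          by (rule peetre_small[OF meas(1) g0 K gK HM \<eta> True N0])
        then show ?thesis using True by simp
      next
        case False
        have "ennreal (g k x powr \<eta>) \<le> ennreal ((K N * (2 ^ DIM(real^'n) + 1)) powr \<eta>) * avg k N (\<lambda>y. ennreal (g k y powr \<eta>)) x"
          by (rule avg_powr_ge[OF meas(1) g0 _ _ K g0 gK[OF N0]]) (use False N in \<open>auto simp: n_def\<close>)
        then show ?thesis using False by simp
      qed
      also have "\<dots> \<le> ennreal (D1 \<eta> N) * avg k N (\<lambda>y. ennreal (g k y powr \<eta>)) x"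
        by (intro mult_right_mono ennreal_leI) (auto simp: D1_def)
      finally show ?thesis .
    qed
    have Avg: "avg k (N / \<eta> + 2 * n) (\<lambda>y. ennreal (g k y)) x \<le>
       ennreal (2 ^ CARD('n)) * epowr (ennreal (D1 \<eta> N) * avg k N (\<lambda>y. ennreal (g k y powr \<eta>)) x) (1 / \<eta>)"
      if \<eta>: "0 < \<eta>" and N: "2 * n \<le> N" for \<eta> N k x
    proof (cases "avg k N (\<lambda>y. ennreal (g k y powr \<eta>)) x")
      case (real v)
      have N0: "0 \<le> N" using N unfolding n_def by (smt (verit) of_nat_0_le_iff)
      have gy: "g k y \<le> (D1 \<eta> N * v) powr (1 / \<eta>) * sdist k x y powr (N / \<eta>)" for y
      proof -
        have "ennreal (g k y powr \<eta>) \<le> ennreal (D1 \<eta> N) * avg k N (\<lambda>y. ennreal (g k y powr \<eta>)) y"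
          by (rule g1[OF \<eta> N])
        also have "\<dots> \<le> ennreal (D1 \<eta> N) * (ennreal (sdist k y x powr N) * avg k N (\<lambda>y. ennreal (g k y powr \<eta>)) x)"
          using N0 by (intro mult_left_mono avg_shift) auto
        also have "\<dots> = ennreal (D1 \<eta> N * v * sdist k x y powr N)"
          using real D1[of \<eta> N] by (simp add: sdist_commute[of k y x] mult_ac less_imp_le flip: ennreal_mult)
        finally have "g k y powr \<eta> \<le> D1 \<eta> N * v * sdist k x y powr N"
          using real D1[of \<eta> N] by (subst (asm) ennreal_le_iff) auto
        then have "(g k y powr \<eta>) powr (1 / \<eta>) \<le> (D1 \<eta> N * v * sdist k x y powr N) powr (1 / \<eta>)"
          using \<eta> by (intro powr_mono2) auto
        then show ?thesis using \<eta> g0[of k y] real D1[of \<eta> N] sdist_pos[of k x y]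
          by (simp add: powr_powr powr_mult)
      qed
      have "avg k (N / \<eta> + 2 * n) (\<lambda>y. ennreal (g k y)) x \<le> avg k (2 * n) (\<lambda>y. ennreal ((D1 \<eta> N * v) powr (1 / \<eta>))) x"
        unfolding avg_def
      proof (intro nn_integral_mono)
        fix y
        have "kern k (N / \<eta> + 2 * n) x y * g k y \<le> kern k (N / \<eta> + 2 * n) x y * ((D1 \<eta> N * v) powr (1 / \<eta>) * sdist k x y powr (N / \<eta>))"
          by (intro mult_left_mono gy) auto
        also have "\<dots> = (kern k (N / \<eta> + 2 * n) x y * sdist k x y powr (N / \<eta>)) * (D1 \<eta> N * v) powr (1 / \<eta>)"
          by (simp only: mult_ac)
        also have "kern k (N / \<eta> + 2 * n) x y * sdist k x y powr (N / \<eta>) = kern k (2 * n) x y"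
          unfolding kern_sdist by simp
        finally show "ennreal (kern k (N / \<eta> + 2 * n) x y) * ennreal (g k y) \<le> ennreal (kern k (2 * n) x y) * ennreal ((D1 \<eta> N * v) powr (1 / \<eta>))"
          using g0 by (simp flip: ennreal_mult)
      qed
      also have "\<dots> \<le> ennreal (2 ^ DIM(real^'n)) * ennreal ((D1 \<eta> N * v) powr (1 / \<eta>))"
        by (rule avg_const_le) (simp add: n_def)
      also have "\<dots> = ennreal (2 ^ CARD('n)) * epowr (ennreal (D1 \<eta> N) * ennreal v) (1 / \<eta>)"
        using real D1[of \<eta> N] by (simp add: epowr_ennreal less_imp_le flip: ennreal_mult)
      finally show ?thesis using real by simp
    next
      case top
      then show ?thesis using D1[of \<eta> N] by (simp add: ennreal_mult_top)
    qed
    have t1: "ennreal (t k x powr \<eta>) \<le> ennreal (D2 \<eta> N) * (\<Sum>l\<in>L. avg (k + l) N (\<lambda>y. ennreal (g (k + l) y powr \<eta>)) x)"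
      if \<eta>: "0 < \<eta>" and N: "2 * n \<le> N" for \<eta> N k x
    proof -
      have N0: "0 \<le> N / \<eta> + 2 * n" using N \<eta> unfolding n_def by (smt (verit) of_nat_0_le_iff divide_nonneg_nonneg)
      let ?e = "\<lambda>l. epowr (ennreal (D1 \<eta> N) * avg (k + l) N (\<lambda>y. ennreal (g (k + l) y powr \<eta>)) x) (1 / \<eta>)"
      have "ennreal (t k x) \<le> ennreal (K (N / \<eta> + 2 * n)) * (\<Sum>l\<in>L. avg (k + l) (N / \<eta> + 2 * n) (\<lambda>y. ennreal (g (k + l) y)) x)"
        by (rule tK[OF N0])
      also have "\<dots> \<le> ennreal (K (N / \<eta> + 2 * n) + 1) * (\<Sum>l\<in>L. ennreal (2 ^ CARD('n)) * ?e l)"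
        by (intro mult_mono sum_mono Avg[OF \<eta> N] ennreal_leI) auto
      also have "\<dots> = ennreal (K' \<eta> N) * (\<Sum>l\<in>L. ?e l)"
        using K[of "N / \<eta> + 2 * n"] by (simp add: K'_def ennreal_mult mult.assoc sum_distrib_left[symmetric])
      finally have "epowr (ennreal (t k x)) \<eta> \<le> epowr (ennreal (K' \<eta> N) * (\<Sum>l\<in>L. ?e l)) \<eta>"
        using \<eta> by (intro epowr_mono) auto
      also have "\<dots> = ennreal (K' \<eta> N powr \<eta>) * epowr (\<Sum>l\<in>L. ?e l) \<eta>" by (rule epowr_cmult[OF K'])
      also have "\<dots> \<le> ennreal (K' \<eta> N powr \<eta>) * (ennreal (real (card L) powr \<eta>) * (\<Sum>l\<in>L. epowr (?e l) \<eta>))"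
        by (intro mult_left_mono epowr_sum_le L \<eta>) auto
      also have "\<dots> = ennreal (D2 \<eta> N) * (\<Sum>l\<in>L. avg (k + l) N (\<lambda>y. ennreal (g (k + l) y powr \<eta>)) x)"
        using D1[of \<eta> N] \<eta> by (simp add: epowr_inverse D2_def ennreal_mult less_imp_le mult.assoc sum_distrib_left[symmetric])
      finally show ?thesis using t0 by (simp add: epowr_ennreal)
    qed
    show ?thesis unfolding controlled_def
    proof (intro conjI allI impI)
      fix \<eta> N :: real and k x assume \<eta>: "0 < \<eta>" and N: "2 * real CARD('n) \<le> N"
      have "ennreal (g k x powr \<eta>) \<le> ennreal (D1 \<eta> N) * avg k N (\<lambda>y. ennreal (g k y powr \<eta>)) x"
        using g1[OF \<eta>] N by (simp add: n_def)
      also have "\<dots> \<le> ennreal (D \<eta> N) * avg k N (\<lambda>y. ennreal (g k y powr \<eta>)) x"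
        by (intro mult_right_mono ennreal_leI D) auto
      finally show "ennreal (g k x powr \<eta>) \<le> \<dots>" .
      have "ennreal (t k x powr \<eta>) \<le> ennreal (D2 \<eta> N) * (\<Sum>l\<in>L. avg (k + l) N (\<lambda>y. ennreal (g (k + l) y powr \<eta>)) x)"
        using t1[OF \<eta>] N by (simp add: n_def)
      also have "\<dots> \<le> ennreal (D \<eta> N) * (\<Sum>l\<in>L. avg (k + l) N (\<lambda>y. ennreal (g (k + l) y powr \<eta>)) x)"
        by (intro mult_right_mono ennreal_leI D) auto
      finally show "ennreal (t k x powr \<eta>) \<le> \<dots>" .
    qed (use meas g0 t0 in auto)
  qed
  with D(1) show ?thesis by blast
qed

subsection \<open>Smooth functions and test functions\<close>

lemma partial_deriv_eq: "(f has_derivative f') (at x) \<Longrightarrow> partial_deriv i f x = f' (axis i 1)"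
  by (simp add: partial_deriv_def frechet_derivative_at[symmetric])

lemma has_derivative_of_differentiable:
  "f differentiable (at x) \<Longrightarrow> (f has_derivative frechet_derivative f (at x)) (at x)"
  by (simp add: frechet_derivative_works)

lemma iter_partial_Nil [simp]: "iter_partial [] f = f"
  and iter_partial_Cons [simp]: "iter_partial (d # ds) f = partial_deriv d (iter_partial ds f)"
  by (simp_all add: iter_partial_def)

lemma iter_partial_snoc: "iter_partial ds (partial_deriv i f) = iter_partial (ds @ [i]) f"
  by (simp add: iter_partial_def)

lemma smooth_differentiable: "smooth f \<Longrightarrow> f differentiable (at x)"
  unfolding smooth_def by (metis iter_partial_Nil)

lemma smooth_partial: "smooth f \<Longrightarrow> smooth (partial_deriv i f)"
  unfolding smooth_def iter_partial_snoc by blast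

text \<open>Spares formulas for iterated derivatives: it is enough to exhibit a set of
  differentiable functions that a single partial derivative does not leave, except into functions
  already known to be smooth.\<close>

lemma smooth_coinduct:
  assumes "f \<in> X"
    and "\<And>f x. f \<in> X \<Longrightarrow> f differentiable (at x)"
    and "\<And>f i. f \<in> X \<Longrightarrow> partial_deriv i f \<in> X \<or> smooth (partial_deriv i f)"
  shows "smooth f"
proof -
  have "iter_partial ds f \<in> X \<or> smooth (iter_partial ds f)" for ds
    by (induction ds) (use assms(1,3) smooth_partial in auto)
  then show ?thesis unfolding smooth_def[of f] using assms(2) smooth_differentiable by blast
qed

lemma smooth_iter_partial: "smooth f \<Longrightarrow> smooth (iter_partial ds f)"
  by (induction ds) (auto intro: smooth_partial)

lemma smooth_has_derivative: "smooth f \<Longrightarrow> (f has_derivative frechet_derivative f (at x)) (at x)"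
  by (intro has_derivative_of_differentiable smooth_differentiable)

lemma smooth_continuous_on: "smooth f \<Longrightarrow> continuous_on S f"
  by (intro continuous_at_imp_continuous_on ballI differentiable_imp_continuous_within smooth_differentiable)

lemma smooth_measurable: "smooth f \<Longrightarrow> f \<in> borel_measurable borel"
  by (intro borel_measurable_continuous_onI smooth_continuous_on)

lemma partial_deriv_add:
  assumes "f differentiable (at x)" "g differentiable (at x)"
  shows "partial_deriv i (\<lambda>x. f x + g x) x = partial_deriv i f x + partial_deriv i g x"
  using partial_deriv_eq[OF has_derivative_add[OF assms[THEN has_derivative_of_differentiable]]]
  by (simp add: partial_deriv_def)

lemma partial_deriv_mult:
  assumes "f differentiable (at x)" "g differentiable (at x)"
  shows "partial_deriv i (\<lambda>x. f x * g x) x = f x * partial_deriv i g x + partial_deriv i f x * g x"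
  using partial_deriv_eq[OF has_derivative_mult[OF assms[THEN has_derivative_of_differentiable]]]
  by (simp add: partial_deriv_def)

lemma partial_deriv_cmult:
  assumes "f differentiable (at x)"
  shows "partial_deriv i (\<lambda>x. c * f x) x = c * partial_deriv i f x"
  using partial_deriv_eq[OF has_derivative_mult_right[OF assms[THEN has_derivative_of_differentiable]]]
  by (simp add: partial_deriv_def)

lemma smooth_add:
  assumes "smooth f" "smooth g"
  shows "smooth (\<lambda>x. f x + g x)"
proof (rule smooth_coinduct[where X = "{\<lambda>x. f x + g x | f g. smooth f \<and> smooth g}"])
  fix h :: "real ^ 'a \<Rightarrow> complex" and i x
  assume "h \<in> {\<lambda>x. f x + g x | f g. smooth f \<and> smooth g}"
  then obtain f g where h: "h = (\<lambda>x. f x + g x)" "smooth f" "smooth g" by blast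
  show "h differentiable (at x)" unfolding h(1) using h by (intro differentiable_add smooth_differentiable)
  have "partial_deriv i h = (\<lambda>x. partial_deriv i f x + partial_deriv i g x)"
    unfolding h(1) using h by (intro ext partial_deriv_add smooth_differentiable)
  then show "partial_deriv i h \<in> {\<lambda>x. f x + g x | f g. smooth f \<and> smooth g} \<or> smooth (partial_deriv i h)"
    using h smooth_partial by blast
qed (use assms in blast)

text \<open>The Leibniz rule leads out of the set of products, so the invariant for
  \<open>smooth_mult\<close> has to be closed under sums.\<close>

inductive_set prod_sums :: "(real ^ 'n::finite \<Rightarrow> complex) set" where
  prod: "smooth f \<Longrightarrow> smooth g \<Longrightarrow> (\<lambda>x. f x * g x) \<in> prod_sums"
| add: "u \<in> prod_sums \<Longrightarrow> v \<in> prod_sums \<Longrightarrow> (\<lambda>x. u x + v x) \<in> prod_sums"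

lemma prod_sums_step:
  "h \<in> prod_sums \<Longrightarrow> (\<forall>x. h differentiable (at x)) \<and> (\<forall>i. partial_deriv i h \<in> prod_sums)"
proof (induction rule: prod_sums.induct)
  case (prod f g)
  have "partial_deriv i (\<lambda>x. f x * g x) = (\<lambda>x. f x * partial_deriv i g x + partial_deriv i f x * g x)" for i
    using prod by (intro ext partial_deriv_mult smooth_differentiable)
  moreover have "(\<lambda>x. f x * partial_deriv i g x + partial_deriv i f x * g x) \<in> prod_sums" for i
    using prod by (intro prod_sums.add prod_sums.prod smooth_partial)
  moreover have "(\<lambda>x. f x * g x) differentiable (at x)" for x
    using prod by (intro differentiable_mult smooth_differentiable)
  ultimately show ?case by simp
next
  case (add u v)
  have "partial_deriv i (\<lambda>x. u x + v x) = (\<lambda>x. partial_deriv i u x + partial_deriv i v x)" for i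
    using add by (intro ext partial_deriv_add) auto
  then show ?case using add by (auto intro!: prod_sums.intros)
qed

lemma smooth_mult:
  assumes "smooth f" "smooth g"
  shows "smooth (\<lambda>x. f x * g x)"
  by (rule smooth_coinduct[where X = prod_sums]) (use assms prod_sums_step in \<open>auto intro: prod_sums.intros\<close>)

lemma smooth_const: "smooth (\<lambda>x :: real ^ 'n::finite. c)"
proof (rule smooth_coinduct[where X = "range (\<lambda>c x. c)"])
  fix f :: "real ^ 'n \<Rightarrow> complex" and i x assume "f \<in> range (\<lambda>c x. c)"
  then obtain c where f: "f = (\<lambda>x. c)" by blast
  show "f differentiable (at x)" unfolding f by simp
  have "partial_deriv i f = (\<lambda>x. 0)"
    unfolding f by (rule ext) (simp add: partial_deriv_eq[OF has_derivative_const])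
  then show "partial_deriv i f \<in> range (\<lambda>c x. c) \<or> smooth (partial_deriv i f)" by blast
qed simp

lemma smooth_cmult: "smooth f \<Longrightarrow> smooth (\<lambda>x. c * f x)"
  by (intro smooth_mult smooth_const)

lemma smooth_diff: "smooth f \<Longrightarrow> smooth g \<Longrightarrow> smooth (\<lambda>x. f x - g x)"
  using smooth_add[OF _ smooth_cmult[of g "-1"], of f] by simp

lemma smooth_sum: "finite A \<Longrightarrow> (\<And>a. a \<in> A \<Longrightarrow> smooth (f a)) \<Longrightarrow> smooth (\<lambda>x. \<Sum>a\<in>A. f a x)"
  by (induction A rule: finite_induct) (auto intro: smooth_const smooth_add)

lemma partial_deriv_cnj:
  assumes "f differentiable (at x)"
  shows "partial_deriv i (\<lambda>x. cnj (f x)) x = cnj (partial_deriv i f x)"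
  using partial_deriv_eq[OF bounded_linear.has_derivative[OF bounded_linear_cnj assms[THEN has_derivative_of_differentiable]]]
  by (simp add: partial_deriv_def)

lemma smooth_cnj:
  assumes "smooth f"
  shows "smooth (\<lambda>x. cnj (f x))"
proof (rule smooth_coinduct[where X = "{\<lambda>x. cnj (f x) | f. smooth f}"])
  fix h :: "real ^ 'a \<Rightarrow> complex" and i x
  assume "h \<in> {\<lambda>x. cnj (f x) | f. smooth f}"
  then obtain f where h: "h = (\<lambda>x. cnj (f x))" "smooth f" by blast
  show "h differentiable (at x)" unfolding h(1)
    using bounded_linear.has_derivative[OF bounded_linear_cnj smooth_has_derivative[OF h(2)]] by (auto simp: differentiable_def)
  have "partial_deriv i h = (\<lambda>x. cnj (partial_deriv i f x))"
    unfolding h(1) using h by (intro ext partial_deriv_cnj smooth_differentiable)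
  then show "partial_deriv i h \<in> {\<lambda>x. cnj (f x) | f. smooth f} \<or> smooth (partial_deriv i h)"
    using h smooth_partial by blast
qed (use assms in blast)

lemma has_derivative_affine:
  assumes "f differentiable (at (c *\<^sub>R x + v))"
  shows "((\<lambda>x. f (c *\<^sub>R x + v)) has_derivative (\<lambda>h. frechet_derivative f (at (c *\<^sub>R x + v)) (c *\<^sub>R h))) (at x)"
proof -
  have "((\<lambda>x. c *\<^sub>R x + v) has_derivative (\<lambda>h. c *\<^sub>R h)) (at x)"
    by (auto intro!: derivative_eq_intros)
  from has_derivative_compose[OF this has_derivative_of_differentiable[OF assms]] show ?thesis .
qed

lemma partial_deriv_affine:
  assumes "f differentiable (at (c *\<^sub>R x + v))"
  shows "partial_deriv i (\<lambda>x. f (c *\<^sub>R x + v)) x = of_real c * partial_deriv i f (c *\<^sub>R x + v)"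
proof -
  have "linear (frechet_derivative f (at (c *\<^sub>R x + v)))"
    by (rule linear_frechet_derivative[OF assms])
  then show ?thesis
    unfolding partial_deriv_eq[OF has_derivative_affine[OF assms]] unfolding partial_deriv_def
    by (simp only: linear_scale scaleR_conv_of_real[of c "frechet_derivative f _ _"])
qed

lemma smooth_affine:
  assumes "smooth f"
  shows "smooth (\<lambda>x. f (c *\<^sub>R x + v))"
proof -
  have "smooth (\<lambda>x. 1 * f (c *\<^sub>R x + v))"
  proof (rule smooth_coinduct[where X = "{\<lambda>x. a * f (c *\<^sub>R x + v) | a f. smooth f}"])
    fix h :: "real ^ 'a \<Rightarrow> complex" and i x
    assume "h \<in> {\<lambda>x. a * f (c *\<^sub>R x + v) | a f. smooth f}"
    then obtain a f where h: "h = (\<lambda>x. a * f (c *\<^sub>R x + v))" "smooth f" by blast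
    have d: "(\<lambda>x. f (c *\<^sub>R x + v)) differentiable (at x)" for x
      using has_derivative_affine[OF smooth_differentiable[OF h(2)]] by (auto simp: differentiable_def)
    show "h differentiable (at x)" unfolding h(1) by (intro differentiable_mult d) simp
    have "partial_deriv i h = (\<lambda>x. (a * of_real c) * partial_deriv i f (c *\<^sub>R x + v))"
      unfolding h(1) using h by (intro ext) (simp add: partial_deriv_cmult d partial_deriv_affine smooth_differentiable)
    then show "partial_deriv i h \<in> {\<lambda>x. a * f (c *\<^sub>R x + v) | a f. smooth f} \<or> smooth (partial_deriv i h)"
      using h smooth_partial by blast
  qed (use assms in blast)
  then show ?thesis by simp
qed

lemma has_derivative_coord:
  "((\<lambda>x :: real ^ 'n::finite. of_real (x $ i) :: complex) has_derivative (\<lambda>h. of_real (h $ i))) (at x)"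
  by (intro has_derivative_of_real bounded_linear.has_derivative[OF bounded_linear_vec_nth] has_derivative_ident)

lemma smooth_coord: "smooth (\<lambda>x :: real ^ 'n::finite. of_real (x $ i))"
proof (rule smooth_coinduct[where X = "{\<lambda>x. of_real (x $ i)}"])
  fix h :: "real ^ 'n \<Rightarrow> complex" and j x
  assume "h \<in> {\<lambda>x. of_real (x $ i)}"
  then have h: "h = (\<lambda>x. of_real (x $ i))" by simp
  show "h differentiable (at x)" unfolding h using has_derivative_coord differentiable_def by blast
  have "partial_deriv j h = (\<lambda>x. of_real ((axis j 1 :: real ^ 'n) $ i))"
    unfolding h by (rule ext) (simp add: partial_deriv_eq[OF has_derivative_coord])
  then show "partial_deriv j h \<in> {\<lambda>x. of_real (x $ i)} \<or> smooth (partial_deriv j h)"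
    by (simp add: smooth_const)
qed simp

lemma has_derivative_iexp:
  "((\<lambda>x :: real ^ 'n::finite. exp (\<i> * of_real (y \<bullet> x))) has_derivative
    (\<lambda>h. \<i> * of_real (y \<bullet> h) * exp (\<i> * of_real (y \<bullet> x)))) (at x)"
proof -
  have "((\<lambda>x :: real ^ 'n. \<i> * of_real (y \<bullet> x)) has_derivative (\<lambda>h. \<i> * of_real (y \<bullet> h))) (at x)"
    by (auto intro!: derivative_eq_intros)
  from has_derivative_compose[OF this DERIV_exp[unfolded has_field_derivative_def]]
  show ?thesis by (simp add: mult.commute)
qed

lemma smooth_iexp: "smooth (\<lambda>x :: real ^ 'n::finite. exp (\<i> * of_real (y \<bullet> x)))"
proof -
  have "smooth (\<lambda>x :: real ^ 'n. 1 * exp (\<i> * of_real (y \<bullet> x)))"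
  proof (rule smooth_coinduct[where X = "range (\<lambda>a x. a * exp (\<i> * of_real (y \<bullet> x)))"])
    fix h :: "real ^ 'n \<Rightarrow> complex" and j x
    assume "h \<in> range (\<lambda>a x. a * exp (\<i> * of_real (y \<bullet> x)))"
    then obtain a where h: "h = (\<lambda>x. a * exp (\<i> * of_real (y \<bullet> x)))" by blast
    have d: "(\<lambda>x :: real ^ 'n. exp (\<i> * of_real (y \<bullet> x)) :: complex) differentiable (at x)" for x
      using has_derivative_iexp differentiable_def by blast
    show "h differentiable (at x)" unfolding h by (intro differentiable_mult d) simp
    have "partial_deriv j h = (\<lambda>x. (a * \<i> * of_real (y $ j)) * exp (\<i> * of_real (y \<bullet> x)))"
      unfolding h by (rule ext) (simp add: partial_deriv_cmult d partial_deriv_eq[OF has_derivative_iexp] inner_axis mult_ac)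
    then show "partial_deriv j h \<in> range (\<lambda>a x. a * exp (\<i> * of_real (y \<bullet> x))) \<or> smooth (partial_deriv j h)"
      by blast
  qed blast
  then show ?thesis by simp
qed

lemma not_in_supp: "x \<notin> supp f \<Longrightarrow> f x = 0"
  using closure_subset by (force simp: supp_def)

lemma supp_closed [simp]: "closed (supp f)"
  by (simp add: supp_def)

lemma compact_supp_subset: "compact K \<Longrightarrow> supp f \<subseteq> K \<Longrightarrow> compact (supp f)"
  by (metis compact_Int_closed inf.absorb2 supp_closed)

lemma supp_subsetI: "(\<And>x. x \<notin> S \<Longrightarrow> f x = 0) \<Longrightarrow> closed S \<Longrightarrow> supp f \<subseteq> S"
  unfolding supp_def by (rule closure_minimal) auto

lemma has_derivative_zero_outside_supp:
  assumes "x \<notin> supp f"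
  shows "(f has_derivative (\<lambda>h. 0)) (at x)"
proof (rule has_derivative_transform_within_open[where f = "\<lambda>x. 0" and s = "- supp f"])
  show "open (- supp f)" by (simp add: open_Compl)
qed (use assms not_in_supp in auto)

lemma partial_deriv_zero_outside_supp: "x \<notin> supp f \<Longrightarrow> partial_deriv i f x = 0"
  by (simp add: partial_deriv_eq[OF has_derivative_zero_outside_supp])

lemma supp_partial_deriv: "supp (partial_deriv i f) \<subseteq> supp f"
  by (intro supp_subsetI partial_deriv_zero_outside_supp) auto

lemma supp_mult_left: "supp (\<lambda>x. f x * g x) \<subseteq> supp f"
  by (intro supp_subsetI) (auto simp: not_in_supp)

lemma supp_mult_right: "supp (\<lambda>x. f x * g x) \<subseteq> supp g"
  by (intro supp_subsetI) (auto simp: not_in_supp)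

lemma has_derivative_quotient:
  assumes "u differentiable (at x)" "h differentiable (at x)" "h x \<noteq> (0::complex)"
  shows "((\<lambda>x. u x / h x) has_derivative (\<lambda>y. (frechet_derivative u (at x) y * h x - u x * frechet_derivative h (at x) y) / (h x * h x))) (at x)"
  by (rule has_derivative_divide'[OF assms(1,2)[THEN has_derivative_of_differentiable] assms(3)])

text \<open>Off \<open>supp u\<close> the quotient is 0 whatever \<open>h\<close> is. The quotient
  rule reproduces the form of the function, with denominator \<open>h * h\<close> and a numerator
  that still lives in \<open>supp u\<close>, so coinduction applies.\<close>

lemma smooth_quotient:
  assumes "smooth u" "smooth h" "\<And>x. x \<in> supp u \<Longrightarrow> h x \<noteq> 0"
  shows "smooth (\<lambda>x. u x / h x)"
proof (rule smooth_coinduct[where X = "{\<lambda>x. u x / h x | u h. smooth u \<and> smooth h \<and> (\<forall>x\<in>supp u. h x \<noteq> 0)}"])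
  fix f :: "real ^ 'a \<Rightarrow> complex" and i x
  assume "f \<in> {\<lambda>x. u x / h x | u h. smooth u \<and> smooth h \<and> (\<forall>x\<in>supp u. h x \<noteq> 0)}"
  then obtain u h where f: "f = (\<lambda>x. u x / h x)" and uh: "smooth u" "smooth h" "\<And>x. x \<in> supp u \<Longrightarrow> h x \<noteq> 0" by blast
  define u' where "u' x = partial_deriv i u x * h x - u x * partial_deriv i h x" for x
  have sf: "supp f \<subseteq> supp u" unfolding f by (intro supp_subsetI) (auto simp: not_in_supp)
  have D: "(f has_derivative (\<lambda>y. (frechet_derivative u (at x) y * h x - u x * frechet_derivative h (at x) y) / (h x * h x))) (at x)"
    if "x \<in> supp u" for x
    unfolding f using uh that by (intro has_derivative_quotient smooth_differentiable)
  show "f differentiable (at x)"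
    using D[of x] has_derivative_zero_outside_supp[of x f] sf by (cases "x \<in> supp u") (auto simp: differentiable_def)
  have "partial_deriv i f x = u' x / (h x * h x)" for x
  proof (cases "x \<in> supp u")
    case True
    then show ?thesis unfolding partial_deriv_eq[OF D[OF True]] by (simp add: u'_def partial_deriv_def)
  next
    case False
    then have "x \<notin> supp f" using sf by blast
    with False show ?thesis by (simp add: u'_def not_in_supp partial_deriv_zero_outside_supp)
  qed
  moreover have "smooth u'" unfolding u'_def by (intro smooth_diff smooth_mult smooth_partial uh)
  moreover have "smooth (\<lambda>x. h x * h x)" by (intro smooth_mult uh)
  moreover have "supp u' \<subseteq> supp u"
    by (intro supp_subsetI) (auto simp: u'_def not_in_supp partial_deriv_zero_outside_supp)
  ultimately show "partial_deriv i f \<in> {\<lambda>x. u x / h x | u h. smooth u \<and> smooth h \<and> (\<forall>x\<in>supp u. h x \<noteq> 0)} \<or> smooth (partial_deriv i f)"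
    using uh(3) by (intro disjI1 CollectI exI[of _ u'] exI[of _ "\<lambda>x. h x * h x"]) auto
qed (use assms in blast)

section \<open>Test functions\<close>

definition testfn :: "(real ^ 'n::finite \<Rightarrow> complex) \<Rightarrow> bool"
  where "testfn m \<longleftrightarrow> smooth m \<and> compact (supp m)"

lemma testfnD: "testfn m \<Longrightarrow> smooth m" "testfn m \<Longrightarrow> compact (supp m)"
  by (auto simp: testfn_def)

lemma testfn_subset:
  assumes "smooth f" "testfn m" "supp f \<subseteq> supp m"
  shows "testfn f"
  unfolding testfn_def using assms compact_supp_subset testfnD by blast

lemma testfn_partial: "testfn m \<Longrightarrow> testfn (partial_deriv i m)"
  by (rule testfn_subset[OF smooth_partial _ supp_partial_deriv]) (auto simp: testfn_def)

lemma testfn_mult_left: "testfn f \<Longrightarrow> smooth g \<Longrightarrow> testfn (\<lambda>x. f x * g x)"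
  by (rule testfn_subset[OF smooth_mult _ supp_mult_left]) (auto simp: testfn_def)

lemma testfn_mult_right: "smooth f \<Longrightarrow> testfn g \<Longrightarrow> testfn (\<lambda>x. f x * g x)"
  by (rule testfn_subset[OF smooth_mult _ supp_mult_right]) (auto simp: testfn_def)

lemma testfn_add:
  assumes "testfn f" "testfn g"
  shows "testfn (\<lambda>x. f x + g x)"
proof -
  have "supp (\<lambda>x. f x + g x) \<subseteq> supp f \<union> supp g" by (intro supp_subsetI) (auto simp: not_in_supp)
  then have "compact (supp (\<lambda>x. f x + g x))"
    using assms compact_supp_subset[OF compact_Un] by (auto simp: testfn_def)
  then show ?thesis using assms by (auto simp: testfn_def intro: smooth_add)
qed

lemma testfn_integrable:
  assumes "testfn m"
  shows "integrable lborel m"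
proof -
  have "integrable lborel (\<lambda>x. indicator (supp m) x *\<^sub>R m x)"
    using assms by (intro borel_integrable_compact smooth_continuous_on) (auto simp: testfn_def)
  moreover have "(\<lambda>x. indicator (supp m) x *\<^sub>R m x) = m"
    by (auto simp: indicator_def not_in_supp fun_eq_iff)
  ultimately show ?thesis by simp
qed

lemma testfn_bounded:
  assumes "testfn m"
  shows "\<exists>B>0. \<forall>x. cmod (m x) \<le> B"
proof -
  have "bounded (m ` supp m)"
    using assms by (intro compact_imp_bounded compact_continuous_image smooth_continuous_on) (auto simp: testfn_def)
  then obtain B where B: "0 < B" "\<And>x. x \<in> supp m \<Longrightarrow> cmod (m x) \<le> B"
    by (auto simp: bounded_pos)
  then have "cmod (m x) \<le> B" for x by (cases "x \<in> supp m") (auto simp: not_in_supp)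
  then show ?thesis using B by blast
qed

lemma affine_supp:
  fixes f :: "real ^ 'n::finite \<Rightarrow> complex"
  assumes "x \<in> supp (\<lambda>x. f (c *\<^sub>R x + v))"
  shows "c *\<^sub>R x + v \<in> supp f"
proof -
  have "supp (\<lambda>x. f (c *\<^sub>R x + v)) \<subseteq> (\<lambda>x. c *\<^sub>R x + v) -` supp f"
  proof (rule supp_subsetI)
    show "closed ((\<lambda>x. c *\<^sub>R x + v) -` supp f)"
      by (intro continuous_closed_vimage supp_closed) (auto intro!: continuous_intros)
  qed (auto simp: not_in_supp)
  with assms show ?thesis by blast
qed

lemma testfn_affine:
  assumes "testfn f" "c \<noteq> 0"
  shows "testfn (\<lambda>x. f (c *\<^sub>R x + v))"
proof -
  have "supp (\<lambda>x. f (c *\<^sub>R x + v)) \<subseteq> (\<lambda>y. (1 / c) *\<^sub>R (y - v)) ` supp f"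
  proof
    fix x assume "x \<in> supp (\<lambda>x. f (c *\<^sub>R x + v))"
    then have "c *\<^sub>R x + v \<in> supp f" by (rule affine_supp)
    moreover have "x = (1 / c) *\<^sub>R ((c *\<^sub>R x + v) - v)" using assms(2) by simp
    ultimately show "x \<in> (\<lambda>y. (1 / c) *\<^sub>R (y - v)) ` supp f" by blast
  qed
  moreover have "compact ((\<lambda>y. (1 / c) *\<^sub>R (y - v)) ` supp f)"
    using assms by (intro compact_continuous_image) (auto simp: testfn_def intro!: continuous_intros)
  ultimately have "compact (supp (\<lambda>x. f (c *\<^sub>R x + v)))"
    by (rule compact_supp_subset[rotated])
  then show ?thesis using assms by (auto simp: testfn_def intro: smooth_affine)
qed

subsection \<open>Fourier transforms of test functions\<close>

text \<open>The integral in \<open>inv_fourier\<close> without its normalising factor; the powers of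
  \<open>2 * pi\<close> return in \<open>fourier_multiplier_eq_dual_conv\<close>.\<close>

definition ft :: "(real ^ 'n::finite \<Rightarrow> complex) \<Rightarrow> real ^ 'n \<Rightarrow> complex"
  where "ft m x = (\<integral>\<xi>. m \<xi> * exp (\<i> * of_real (x \<bullet> \<xi>)) \<partial>lborel)"

lemma integral_norm_le:
  fixes f :: "'a \<Rightarrow> 'b::{banach, second_countable_topology}"
  assumes "integrable M f" "integrable M g" "\<And>x. norm (f x) \<le> g x"
  shows "norm (integral\<^sup>L M f) \<le> integral\<^sup>L M g"
  using assms by (intro order_trans[OF integral_norm_bound] integral_mono) auto

lemma lborel_integral_affine:
  fixes f :: "'a::euclidean_space \<Rightarrow> 'b::{banach, second_countable_topology}"
  assumes [measurable]: "f \<in> borel_measurable borel" and c: "c \<noteq> 0"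
  shows "(\<integral>x. f x \<partial>lborel) = \<bar>c\<bar> ^ DIM('a) *\<^sub>R (\<integral>x. f (t + c *\<^sub>R x) \<partial>lborel)"
proof -
  have "(\<integral>x. f x \<partial>lborel) = (\<integral>x. f x \<partial>density (distr lborel borel (\<lambda>x. t + c *\<^sub>R x)) (\<lambda>_. ennreal (\<bar>c\<bar> ^ DIM('a))))"
    by (subst lborel_affine[OF c, of t]) (simp add: ennreal_power)
  also have "\<dots> = (\<integral>x. \<bar>c\<bar> ^ DIM('a) *\<^sub>R f x \<partial>distr lborel borel (\<lambda>x. t + c *\<^sub>R x))"
    by (subst integral_density) auto
  also have "\<dots> = (\<integral>x. \<bar>c\<bar> ^ DIM('a) *\<^sub>R f (t + c *\<^sub>R x) \<partial>lborel)"
    by (subst integral_distr) auto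
  finally show ?thesis by simp
qed

lemma lborel_integral_translate:
  fixes f :: "'a::euclidean_space \<Rightarrow> 'b::{banach, second_countable_topology}"
  assumes "f \<in> borel_measurable borel"
  shows "(\<integral>x. f (x + t) \<partial>lborel) = (\<integral>x. f x \<partial>lborel)"
  using lborel_integral_affine[OF assms, of 1 t] by (simp add: add.commute)

lemma lborel_integrable_affine:
  fixes f :: "'a::euclidean_space \<Rightarrow> 'b::{banach, second_countable_topology}"
  assumes f: "integrable lborel f" and c: "c \<noteq> 0"
  shows "integrable lborel (\<lambda>x. f (t + c *\<^sub>R x))"
proof -
  have [measurable]: "f \<in> borel_measurable borel" using borel_measurable_integrable[OF f] by simp
  have "integrable (density (distr lborel borel (\<lambda>x. t + c *\<^sub>R x)) (\<lambda>_. ennreal (\<bar>c\<bar> ^ DIM('a)))) f"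
    using f by (subst (asm) lborel_affine[OF c, of t]) (simp add: ennreal_power)
  then have "integrable lborel (\<lambda>x. \<bar>c\<bar> ^ DIM('a) *\<^sub>R f (t + c *\<^sub>R x))"
    by (simp add: integrable_density integrable_distr_eq)
  then have "integrable lborel (\<lambda>x. (1 / \<bar>c\<bar> ^ DIM('a)) *\<^sub>R \<bar>c\<bar> ^ DIM('a) *\<^sub>R f (t + c *\<^sub>R x))"
    by (rule integrable_scaleR_right)
  then show ?thesis using c by simp
qed

lemma line_has_vector_derivative:
  fixes u :: "real ^ 'n::finite \<Rightarrow> complex"
  assumes "smooth u"
  shows "((\<lambda>t. u (x + t *\<^sub>R axis i 1)) has_vector_derivative partial_deriv i u (x + t *\<^sub>R axis i 1)) (at t within S)"
proof -
  have "((\<lambda>t. x + t *\<^sub>R axis i 1) has_derivative (\<lambda>t. t *\<^sub>R axis i 1)) (at t within S)"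
    by (auto intro!: derivative_eq_intros)
  from has_derivative_compose[OF this smooth_has_derivative[OF assms]]
  have "((\<lambda>t. u (x + t *\<^sub>R axis i 1)) has_derivative (\<lambda>s. frechet_derivative u (at (x + t *\<^sub>R axis i 1)) (s *\<^sub>R axis i 1))) (at t within S)" .
  moreover have "linear (frechet_derivative u (at (x + t *\<^sub>R axis i 1)))"
    by (rule linear_frechet_derivative[OF smooth_differentiable[OF assms]])
  ultimately show ?thesis
    by (simp add: has_vector_derivative_def partial_deriv_def linear_scale)
qed

text \<open>The difference \<open>u (x + e) - u x\<close> integrates to 0 by translation invariance,
  and it is the integral of the derivative over a unit segment. By Fubini's theorem its integral is
  also that of the derivative, and the measure need not be split into coordinates.\<close>

lemma integral_partial_deriv_zero:
  assumes "testfn u"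
  shows "(\<integral>x. partial_deriv i u x \<partial>lborel) = 0"
proof -
  define e where "e = (axis i 1 :: real ^ 'a)"
  define v where "v = partial_deriv i u"
  have v: "testfn v" unfolding v_def by (rule testfn_partial[OF assms])
  have [measurable]: "v \<in> borel_measurable borel" "u \<in> borel_measurable borel"
    using v assms by (auto simp: testfn_def intro: smooth_measurable)
  have iv: "integrable lborel v" and iu: "integrable lborel u"
    using v assms by (auto intro: testfn_integrable)
  have ivt: "integrable lborel (\<lambda>x. v (x + t *\<^sub>R e))" for t
    using lborel_integrable_affine[OF iv, of 1 "t *\<^sub>R e"] by (simp add: add.commute)
  define f where "f t x = indicator {0..1} t *\<^sub>R v (x + t *\<^sub>R e)" for t :: real and x
  have [measurable]: "(\<lambda>(t, x). f t x) \<in> borel_measurable (lborel \<Otimes>\<^sub>M lborel)"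
    unfolding f_def by measurable
  have f1: "(\<integral>x. norm (f t x) \<partial>lborel) = indicator {0..1} t *\<^sub>R (\<integral>x. norm (v x) \<partial>lborel)" for t
  proof -
    have "(\<integral>x. norm (f t x) \<partial>lborel) = (\<integral>x. indicator {0..1} t * norm (v (x + t *\<^sub>R e)) \<partial>lborel)"
      by (intro Bochner_Integration.integral_cong) (auto simp: f_def indicator_def)
    also have "\<dots> = indicator {0..1} t * (\<integral>x. norm (v (x + t *\<^sub>R e)) \<partial>lborel)" by simp
    also have "(\<integral>x. norm (v (x + t *\<^sub>R e)) \<partial>lborel) = (\<integral>x. norm (v x) \<partial>lborel)"
      by (rule lborel_integral_translate) measurable
    finally show ?thesis by simp
  qed
  have int: "integrable (lborel \<Otimes>\<^sub>M lborel) (\<lambda>(t, x). f t x)"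
  proof (rule lborel_pair.Fubini_integrable)
    show "integrable lborel (\<lambda>t. \<integral>x. norm (case (t, x) of (t, x) \<Rightarrow> f t x) \<partial>lborel)"
      by (simp add: f1 integrable_indicator_iff)
    show "AE t in lborel. integrable lborel (\<lambda>x. case (t, x) of (t, x) \<Rightarrow> f t x)"
      using ivt by (simp add: f_def)
  qed measurable
  have "(\<integral>x. \<integral>t. f t x \<partial>lborel \<partial>lborel) = (\<integral>t. \<integral>x. f t x \<partial>lborel \<partial>lborel)"
    by (rule lborel_pair.Fubini_integral[OF int])
  moreover have "(\<integral>t. f t x \<partial>lborel) = u (x + e) - u x" for x
  proof -
    have "(\<integral>t. f t x \<partial>lborel) = u (x + 1 *\<^sub>R e) - u (x + 0 *\<^sub>R e)"
      unfolding f_def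
    proof (rule integral_FTC_atLeastAtMost)
      show "((\<lambda>t. u (x + t *\<^sub>R e)) has_vector_derivative v (x + t *\<^sub>R e)) (at t within {0..1})" for t
        unfolding e_def v_def using assms by (intro line_has_vector_derivative) (simp add: testfn_def)
      have "continuous_on UNIV v" using v by (auto simp: testfn_def intro: smooth_continuous_on)
      then show "continuous_on {0..1} (\<lambda>t. v (x + t *\<^sub>R e))"
        by (rule continuous_on_compose2) (auto intro!: continuous_intros)
    qed simp
    then show ?thesis by simp
  qed
  moreover have "(\<integral>x. f t x \<partial>lborel) = indicator {0..1} t *\<^sub>R (\<integral>x. v x \<partial>lborel)" for t
    by (simp add: f_def lborel_integral_translate)
  ultimately have "(\<integral>x. u (x + e) - u x \<partial>lborel) = (\<integral>t. indicator {0..1::real} t *\<^sub>R (\<integral>x. v x \<partial>lborel) \<partial>lborel)"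
    by simp
  moreover have "(\<integral>x. u (x + e) - u x \<partial>lborel) = 0"
    using lborel_integrable_affine[OF iu, of 1 e] iu
    by (subst Bochner_Integration.integral_diff) (auto simp: lborel_integral_translate add.commute)
  ultimately show ?thesis by (simp add: v_def)
qed

lemma testfn_iexp: "testfn m \<Longrightarrow> testfn (\<lambda>\<xi>. m \<xi> * exp (\<i> * of_real (x \<bullet> \<xi>)))"
  by (intro testfn_mult_left smooth_iexp)

lemma ft_integrable_integrand: "testfn m \<Longrightarrow> integrable lborel (\<lambda>\<xi>. m \<xi> * exp (\<i> * of_real (x \<bullet> \<xi>)))"
  by (intro testfn_integrable testfn_iexp)

lemma ft_norm_le: "cmod (ft m x) \<le> (\<integral>\<xi>. cmod (m \<xi>) \<partial>lborel)"
  using integral_norm_bound[of lborel "\<lambda>\<xi>. m \<xi> * exp (\<i> * of_real (x \<bullet> \<xi>))"] by (simp add: ft_def norm_mult)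

lemma ft_cmult: "ft (\<lambda>\<xi>. c * m \<xi>) x = c * ft m x"
  by (simp add: ft_def mult.assoc)

lemma ft_sum:
  assumes "\<And>l. l \<in> L \<Longrightarrow> testfn (m l)"
  shows "ft (\<lambda>\<xi>. \<Sum>l\<in>L. m l \<xi>) x = (\<Sum>l\<in>L. ft (m l) x)"
  unfolding ft_def sum_distrib_right
  by (rule Bochner_Integration.integral_sum) (use assms ft_integrable_integrand in auto)

lemma ft_partial_deriv:
  assumes "testfn m"
  shows "ft (partial_deriv j m) x = - \<i> * of_real (x $ j) * ft m x"
proof -
  define e where "e \<xi> = exp (\<i> * complex_of_real (x \<bullet> \<xi>))" for \<xi> :: "real ^ 'a"
  have pe: "partial_deriv j e \<xi> = \<i> * of_real (x $ j) * e \<xi>" for \<xi>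
    unfolding e_def by (simp add: partial_deriv_eq[OF has_derivative_iexp] inner_axis)
  have se: "smooth e" unfolding e_def by (rule smooth_iexp)
  have sm: "smooth m" using assms by (simp add: testfn_def)
  have "0 = (\<integral>\<xi>. partial_deriv j (\<lambda>\<xi>. m \<xi> * e \<xi>) \<xi> \<partial>lborel)"
    using integral_partial_deriv_zero[OF testfn_mult_left[OF assms se]] by simp
  also have "\<dots> = (\<integral>\<xi>. m \<xi> * (\<i> * of_real (x $ j) * e \<xi>) + partial_deriv j m \<xi> * e \<xi> \<partial>lborel)"
    using sm se by (intro Bochner_Integration.integral_cong) (auto simp: partial_deriv_mult smooth_differentiable pe)
  also have "\<dots> = (\<integral>\<xi>. (\<i> * of_real (x $ j)) * (m \<xi> * e \<xi>) + partial_deriv j m \<xi> * e \<xi> \<partial>lborel)"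
    by (simp only: mult_ac)
  also have "\<dots> = \<i> * of_real (x $ j) * ft m x + ft (partial_deriv j m) x"
    unfolding ft_def e_def
    using ft_integrable_integrand[OF assms, where x = x] ft_integrable_integrand[OF testfn_partial[OF assms], where x = x]
    by (subst Bochner_Integration.integral_add) auto
  finally show ?thesis by (simp add: add_eq_0_iff2)
qed

text \<open>A quadratic remainder estimate replaces differentiation under the integral sign in
  \<open>ft_has_derivative\<close>.\<close>

lemma has_derivative_quadratic:
  fixes f :: "'a::real_normed_vector \<Rightarrow> 'b::real_normed_vector"
  assumes "bounded_linear L" "\<And>y. norm (f y - f x - L (y - x)) \<le> C * (norm (y - x))\<^sup>2"
  shows "(f has_derivative L) (at x)"
  unfolding has_derivative_at_alt
proof (intro conjI allI impI assms(1))
  fix e :: real assume e: "0 < e"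
  show "\<exists>d>0. \<forall>y. norm (y - x) < d \<longrightarrow> norm (f y - f x - L (y - x)) \<le> e * norm (y - x)"
  proof (intro exI[of _ "e / (\<bar>C\<bar> + 1)"] conjI allI impI)
    show "0 < e / (\<bar>C\<bar> + 1)" using e by simp
    fix y assume y: "norm (y - x) < e / (\<bar>C\<bar> + 1)"
    then have "(\<bar>C\<bar> + 1) * norm (y - x) \<le> e" by (simp add: field_simps)
    then have "(\<bar>C\<bar> + 1) * norm (y - x) * norm (y - x) \<le> e * norm (y - x)" by (intro mult_right_mono) auto
    moreover have "C * (norm (y - x))\<^sup>2 \<le> (\<bar>C\<bar> + 1) * (norm (y - x))\<^sup>2" by (intro mult_right_mono) auto
    ultimately show "norm (f y - f x - L (y - x)) \<le> e * norm (y - x)"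
      using assms(2)[of y] by (simp add: power2_eq_square mult.assoc)
  qed
qed

definition mul_coord :: "'n::finite \<Rightarrow> (real ^ 'n \<Rightarrow> complex) \<Rightarrow> real ^ 'n \<Rightarrow> complex"
  where "mul_coord j m \<xi> = \<i> * of_real (\<xi> $ j) * m \<xi>"

lemma testfn_mul_coord: "testfn m \<Longrightarrow> testfn (mul_coord j m)"
  unfolding mul_coord_def[abs_def] by (intro testfn_mult_right smooth_mult smooth_const smooth_coord)

text \<open>The second-order bound for the exponential along an imaginary argument is uniform on the
  bounded support of \<open>m\<close>, so the remainder can be integrated directly.\<close>

lemma ft_has_derivative:
  assumes "testfn m"
  shows "(ft m has_derivative (\<lambda>h. \<Sum>j\<in>UNIV. h $ j *\<^sub>R ft (mul_coord j m) x)) (at x)"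
proof -
  obtain R where R: "0 < R" "\<And>\<xi>. \<xi> \<in> supp m \<Longrightarrow> norm \<xi> \<le> R"
    using compact_imp_bounded[of "supp m"] assms by (auto simp: testfn_def bounded_pos)
  define I where "I = (\<integral>\<xi>. cmod (m \<xi>) \<partial>lborel)"
  have L: "(\<Sum>j\<in>UNIV. h $ j *\<^sub>R ft (mul_coord j m) x) = (\<integral>\<xi>. m \<xi> * (\<i> * of_real (h \<bullet> \<xi>)) * exp (\<i> * of_real (x \<bullet> \<xi>)) \<partial>lborel)" for h
  proof -
    have "(\<integral>\<xi>. m \<xi> * (\<i> * of_real (h \<bullet> \<xi>)) * exp (\<i> * of_real (x \<bullet> \<xi>)) \<partial>lborel) =
        (\<integral>\<xi>. (\<Sum>j\<in>UNIV. h $ j *\<^sub>R (mul_coord j m \<xi> * exp (\<i> * of_real (x \<bullet> \<xi>)))) \<partial>lborel)"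
      by (intro Bochner_Integration.integral_cong refl)
        (simp add: mul_coord_def inner_vec_def sum_distrib_left sum_distrib_right scaleR_conv_of_real mult_ac)
    also have "\<dots> = (\<Sum>j\<in>UNIV. \<integral>\<xi>. h $ j *\<^sub>R (mul_coord j m \<xi> * exp (\<i> * of_real (x \<bullet> \<xi>))) \<partial>lborel)"
      using ft_integrable_integrand[OF testfn_mul_coord[OF assms], where x = x]
      by (intro Bochner_Integration.integral_sum) auto
    finally show ?thesis by (simp add: ft_def)
  qed
  show ?thesis
  proof (rule has_derivative_quadratic[where C = "R\<^sup>2 / 2 * I"])
    show "bounded_linear (\<lambda>h. \<Sum>j\<in>UNIV. h $ j *\<^sub>R ft (mul_coord j m) x)"
      by (intro bounded_linear_sum bounded_linear_scaleR_left[THEN bounded_linear_compose] bounded_linear_vec_nth)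
    fix y
    define h where "h = y - x"
    let ?g = "\<lambda>\<xi>. m \<xi> * exp (\<i> * of_real (x \<bullet> \<xi>)) * (exp (\<i> * of_real (h \<bullet> \<xi>)) - (1 + \<i> * of_real (h \<bullet> \<xi>)))"
    have i3: "integrable lborel (\<lambda>\<xi>. m \<xi> * (\<i> * of_real (h \<bullet> \<xi>)) * exp (\<i> * of_real (x \<bullet> \<xi>)))"
    proof -
      have "integrable lborel (\<lambda>\<xi>. (\<Sum>j\<in>UNIV. h $ j *\<^sub>R (mul_coord j m \<xi> * exp (\<i> * of_real (x \<bullet> \<xi>)))))"
        using ft_integrable_integrand[OF testfn_mul_coord[OF assms], where x = x] by auto
      then show ?thesis
        by (simp add: mul_coord_def inner_vec_def sum_distrib_left sum_distrib_right scaleR_conv_of_real mult_ac)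
    qed
    have "ft m y - ft m x - (\<Sum>j\<in>UNIV. h $ j *\<^sub>R ft (mul_coord j m) x) =
        (\<integral>\<xi>. m \<xi> * exp (\<i> * of_real (y \<bullet> \<xi>)) - m \<xi> * exp (\<i> * of_real (x \<bullet> \<xi>)) -
           m \<xi> * (\<i> * of_real (h \<bullet> \<xi>)) * exp (\<i> * of_real (x \<bullet> \<xi>)) \<partial>lborel)"
      unfolding L unfolding ft_def using i3 ft_integrable_integrand[OF assms]
      by (subst Bochner_Integration.integral_diff) auto
    also have "\<dots> = (\<integral>\<xi>. ?g \<xi> \<partial>lborel)"
    proof (intro Bochner_Integration.integral_cong refl)
      fix \<xi>
      have "exp (\<i> * of_real (y \<bullet> \<xi>)) = exp (\<i> * complex_of_real (x \<bullet> \<xi>)) * exp (\<i> * of_real (h \<bullet> \<xi>))"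
        by (simp add: h_def inner_diff_left ring_distribs flip: exp_add)
      then show "m \<xi> * exp (\<i> * of_real (y \<bullet> \<xi>)) - m \<xi> * exp (\<i> * of_real (x \<bullet> \<xi>)) -
           m \<xi> * (\<i> * of_real (h \<bullet> \<xi>)) * exp (\<i> * of_real (x \<bullet> \<xi>)) = ?g \<xi>"
        by (simp add: ring_distribs)
    qed
    also have "cmod \<dots> \<le> (\<integral>\<xi>. R\<^sup>2 / 2 * (norm h)\<^sup>2 * cmod (m \<xi>) \<partial>lborel)"
    proof (rule integral_norm_le)
      have e: "?g = (\<lambda>\<xi>. m \<xi> * exp (\<i> * of_real (y \<bullet> \<xi>)) - m \<xi> * exp (\<i> * of_real (x \<bullet> \<xi>)) -
           m \<xi> * (\<i> * of_real (h \<bullet> \<xi>)) * exp (\<i> * of_real (x \<bullet> \<xi>)))"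
        by (rule ext) (simp add: h_def inner_diff_left ring_distribs exp_diff)
      show "integrable lborel ?g" unfolding e using i3 ft_integrable_integrand[OF assms]
        by (intro Bochner_Integration.integrable_diff) auto
      show "integrable lborel (\<lambda>\<xi>. R\<^sup>2 / 2 * (norm h)\<^sup>2 * cmod (m \<xi>))"
        using testfn_integrable[OF assms] by auto
      fix \<xi>
      show "cmod (?g \<xi>) \<le> R\<^sup>2 / 2 * (norm h)\<^sup>2 * cmod (m \<xi>)"
      proof (cases "\<xi> \<in> supp m")
        case True
        have "cmod (exp (\<i> * of_real (h \<bullet> \<xi>)) - (1 + \<i> * of_real (h \<bullet> \<xi>))) \<le> \<bar>h \<bullet> \<xi>\<bar>\<^sup>2 / 2"
          using iexp_approx1[of "h \<bullet> \<xi>" 1] by (simp add: numeral_2_eq_2)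
        also have "\<dots> \<le> (norm h * R)\<^sup>2 / 2"
          using order_trans[OF Cauchy_Schwarz_ineq2[of h \<xi>] mult_left_mono[OF R(2)[OF True] norm_ge_zero]]
          by (intro divide_right_mono power_mono) auto
        finally have "cmod (m \<xi>) * cmod (exp (\<i> * of_real (h \<bullet> \<xi>)) - (1 + \<i> * of_real (h \<bullet> \<xi>))) \<le> cmod (m \<xi>) * ((norm h * R)\<^sup>2 / 2)"
          by (intro mult_left_mono) auto
        then show ?thesis by (simp add: norm_mult power_mult_distrib mult_ac)
      qed (auto simp: not_in_supp)
    qed
    also have "\<dots> = R\<^sup>2 / 2 * I * (norm h)\<^sup>2" by (simp add: I_def)
    finally show "norm (ft m y - ft m x - (\<Sum>j\<in>UNIV. (y - x) $ j *\<^sub>R ft (mul_coord j m) x)) \<le> R\<^sup>2 / 2 * I * (norm (y - x))\<^sup>2"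
      by (simp add: h_def)
  qed
qed

lemma partial_deriv_ft: "testfn m \<Longrightarrow> partial_deriv j (ft m) = ft (mul_coord j m)"
proof
  fix x assume "testfn m"
  then have "partial_deriv j (ft m) x = (\<Sum>i\<in>UNIV. (axis j 1 :: real ^ 'a) $ i *\<^sub>R ft (mul_coord i m) x)"
    by (intro partial_deriv_eq ft_has_derivative)
  also have "\<dots> = (\<Sum>i\<in>UNIV. if i = j then ft (mul_coord i m) x else 0)"
    by (intro sum.cong) (auto simp: axis_def)
  finally show "partial_deriv j (ft m) x = ft (mul_coord j m) x" by simp
qed

lemma smooth_ft: "testfn m \<Longrightarrow> smooth (ft m)"
  by (rule smooth_coinduct[where X = "ft ` Collect testfn"])
    (auto simp: partial_deriv_ft intro: testfn_mul_coord ft_has_derivative[THEN differentiableI])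

definition mul_coords :: "'n::finite list \<Rightarrow> (real ^ 'n \<Rightarrow> complex) \<Rightarrow> real ^ 'n \<Rightarrow> complex"
  where "mul_coords ds m = foldr mul_coord ds m"

lemma testfn_mul_coords: "testfn m \<Longrightarrow> testfn (mul_coords ds m)"
  by (induction ds) (auto simp: mul_coords_def intro: testfn_mul_coord)

lemma mul_coords_eq: "mul_coords ds m \<xi> = mul_coords ds (\<lambda>_. 1) \<xi> * m \<xi>"
  by (induction ds) (auto simp: mul_coords_def mul_coord_def)

lemma iter_partial_ft: "testfn m \<Longrightarrow> iter_partial ds (ft m) = ft (mul_coords ds m)"
  by (induction ds) (auto simp: mul_coords_def partial_deriv_ft testfn_mul_coords[unfolded mul_coords_def])

text \<open>Each differentiation of the test function produces a coordinate, and the factor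
  \<open>\<i>\<close> cancels \<open>- \<i>\<close>. The inclusion of supports is recorded because
  it yields the vanishing moments later.\<close>

lemma ft_coord_power:
  assumes "testfn m"
  shows "\<exists>m'. testfn m' \<and> supp m' \<subseteq> supp m \<and> (\<forall>x. of_real ((x $ j) ^ N) * ft m x = ft m' x)"
proof (induction N)
  case 0
  then show ?case using assms by auto
next
  case (Suc N)
  then obtain m' where m': "testfn m'" "supp m' \<subseteq> supp m" "\<And>x. of_real ((x $ j) ^ N) * ft m x = ft m' x" by blast
  define m'' where "m'' \<xi> = \<i> * partial_deriv j m' \<xi>" for \<xi>
  have "testfn m''" unfolding m''_def by (intro testfn_mult_right smooth_const testfn_partial m')
  moreover have "supp m'' \<subseteq> supp m"
    unfolding m''_def using supp_mult_right[of "\<lambda>_. \<i>" "partial_deriv j m'"] supp_partial_deriv[of j m'] m'(2) by blast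
  moreover have "of_real ((x $ j) ^ Suc N) * ft m x = ft m'' x" for x
    unfolding m''_def ft_cmult ft_partial_deriv[OF m'(1)] m'(3)[symmetric] by (simp add: mult_ac)
  ultimately show ?case by blast
qed

lemma ft_monomial:
  fixes m :: "real ^ 'n::finite \<Rightarrow> complex"
  assumes "testfn m"
  shows "\<exists>m'. testfn m' \<and> supp m' \<subseteq> supp m \<and> (\<forall>x. of_real (monomial \<alpha> x) * ft m x = ft m' x)"
proof -
  have "\<exists>m'. testfn m' \<and> supp m' \<subseteq> supp m \<and> (\<forall>x. of_real (\<Prod>i\<in>S. (x $ i) ^ \<alpha> i) * ft m x = ft m' x)" for S :: "'n set"
    using finite[of S]
  proof (induction S rule: finite_induct)
    case empty
    then show ?case using assms by auto
  next
    case (insert i S)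
    then obtain m' where m': "testfn m'" "supp m' \<subseteq> supp m" "\<And>x. of_real (\<Prod>i\<in>S. (x $ i) ^ \<alpha> i) * ft m x = ft m' x" by blast
    obtain m'' where m'': "testfn m''" "supp m'' \<subseteq> supp m'" "\<And>x. of_real ((x $ i) ^ \<alpha> i) * ft m' x = ft m'' x"
      using ft_coord_power[OF m'(1)] by blast
    have "of_real (\<Prod>i\<in>insert i S. (x $ i) ^ \<alpha> i) * ft m x = ft m'' x" for x
      using insert.hyps by (simp add: m''(3)[symmetric] m'(3)[symmetric] mult.assoc)
    then show ?case using m' m'' by blast
  qed
  from this[of UNIV] show ?thesis by (simp add: monomial_def)
qed

lemma one_plus_norm_power_le:
  fixes x :: "real ^ 'n::finite"
  shows "(1 + norm x) ^ N \<le> (1 + real CARD('n)) ^ N * (1 + (\<Sum>j\<in>UNIV. \<bar>x $ j\<bar> ^ N))"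
proof -
  define M where "M = Max (range (\<lambda>j. \<bar>x $ j\<bar>))"
  have "M \<in> range (\<lambda>j. \<bar>x $ j\<bar>)" unfolding M_def by (rule Max_in) auto
  then obtain j where j: "\<bar>x $ j\<bar> = M" by force
  have M: "\<bar>x $ i\<bar> \<le> M" for i unfolding M_def by (rule Max_ge) auto
  have M0: "0 \<le> M" using j by (metis abs_ge_zero)
  have "norm x \<le> (\<Sum>j\<in>UNIV. \<bar>x $ j\<bar>)" by (rule norm_le_l1_cart)
  also have "\<dots> \<le> (\<Sum>j\<in>(UNIV::'n set). M)" by (intro sum_mono M)
  finally have "1 + norm x \<le> 1 + real CARD('n) * M" by simp
  also have "\<dots> \<le> (1 + real CARD('n)) * max 1 M"
  proof -
    have "real CARD('n) * M \<le> real CARD('n) * max 1 M" by (intro mult_left_mono) auto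
    then have "1 + real CARD('n) * M \<le> max 1 M + real CARD('n) * max 1 M" by (intro add_mono) auto
    then show ?thesis by (simp add: distrib_right)
  qed
  finally have "(1 + norm x) ^ N \<le> ((1 + real CARD('n)) * max 1 M) ^ N" by (intro power_mono) auto
  also have "\<dots> = (1 + real CARD('n)) ^ N * max 1 M ^ N" by (simp add: power_mult_distrib)
  also have "max 1 M ^ N \<le> 1 + M ^ N" using M0 by (auto simp: max_def)
  also have "M ^ N \<le> (\<Sum>j\<in>UNIV. \<bar>x $ j\<bar> ^ N)"
    unfolding j[symmetric] by (rule member_le_sum) auto
  finally show ?thesis by (simp add: mult_left_mono)
qed

text \<open>Multiplication by powers of coordinates stays within transforms of test functions, and
  these are bounded.\<close>

lemma ft_decay:
  fixes m :: "real ^ 'n::finite \<Rightarrow> complex"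
  assumes "testfn m"
  shows "\<exists>C>0. \<forall>x. (1 + norm x) ^ N * cmod (ft m x) \<le> C"
proof -
  have "\<exists>C. \<forall>x. \<bar>x $ j\<bar> ^ N * cmod (ft m x) \<le> C" for j
  proof -
    obtain m' where m': "testfn m'" "\<And>x. of_real ((x $ j) ^ N) * ft m x = ft m' x"
      using ft_coord_power[OF assms] by blast
    have "\<bar>x $ j\<bar> ^ N * cmod (ft m x) = cmod (of_real ((x $ j) ^ N) * ft m x)" for x
      by (simp add: norm_mult norm_power)
    then have "\<bar>x $ j\<bar> ^ N * cmod (ft m x) \<le> (\<integral>\<xi>. cmod (m' \<xi>) \<partial>lborel)" for x
      unfolding m'(2) using ft_norm_le by metis
    then show ?thesis by blast
  qed
  then obtain C where C: "\<And>j x. \<bar>x $ j\<bar> ^ N * cmod (ft m x) \<le> C j" by metis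
  define D where "D = (1 + real CARD('n)) ^ N * ((\<integral>\<xi>. cmod (m \<xi>) \<partial>lborel) + (\<Sum>j\<in>UNIV. C j))"
  have "(1 + norm x) ^ N * cmod (ft m x) \<le> D" for x
  proof -
    have "(1 + norm x) ^ N * cmod (ft m x) \<le> (1 + real CARD('n)) ^ N * (1 + (\<Sum>j\<in>UNIV. \<bar>x $ j\<bar> ^ N)) * cmod (ft m x)"
      by (intro mult_right_mono one_plus_norm_power_le) auto
    also have "\<dots> = (1 + real CARD('n)) ^ N * (cmod (ft m x) + (\<Sum>j\<in>UNIV. \<bar>x $ j\<bar> ^ N * cmod (ft m x)))"
      by (simp add: distrib_right sum_distrib_right mult.assoc)
    also have "\<dots> \<le> D" unfolding D_def
      by (intro mult_left_mono add_mono ft_norm_le sum_mono C) auto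
    finally show ?thesis .
  qed
  then have "\<forall>x. (1 + norm x) ^ N * cmod (ft m x) \<le> max D 1" by (meson max.coboundedI1)
  then show ?thesis by (intro exI[of _ "max D 1"]) auto
qed

lemma integrable_inverse_power:
  "integrable lborel (\<lambda>x::'a::euclidean_space. 1 / (1 + norm x) ^ (2 * DIM('a)))"
proof (rule integrableI_bounded)
  have "(\<integral>\<^sup>+x. ennreal (norm (1 / (1 + norm x) ^ (2 * DIM('a)))) \<partial>(lborel :: 'a measure)) = (\<integral>\<^sup>+x. ennreal (kern 0 (2 * real DIM('a)) 0 x) \<partial>(lborel :: 'a measure))"
  proof (intro nn_integral_cong arg_cong[where f = ennreal])
    fix x :: 'a
    have "0 < 1 + norm x" by (simp add: add_pos_nonneg)
    then show "norm (1 / (1 + norm x) ^ (2 * DIM('a))) = kern 0 (2 * real DIM('a)) 0 x"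
      using powr_realpow[of "1 + norm x" "2 * DIM('a)"] by (simp add: kern_def sdist_def powr_minus divide_inverse)
  qed
  also have "\<dots> \<le> ennreal (2 ^ DIM('a))" by (rule nn_integral_kern_le) simp
  also have "\<dots> < \<infinity>" by simp
  finally show "(\<integral>\<^sup>+x. ennreal (norm (1 / (1 + norm x) ^ (2 * DIM('a)))) \<partial>(lborel :: 'a measure)) < \<infinity>" .
qed measurable

lemma integrable_of_decay:
  fixes f :: "'a::euclidean_space \<Rightarrow> 'b::{banach, second_countable_topology}"
  assumes "f \<in> borel_measurable borel" "\<And>x. (1 + norm x) ^ (2 * DIM('a)) * norm (f x) \<le> C"
  shows "integrable lborel f"
proof (rule Bochner_Integration.integrable_bound)
  show "integrable lborel (\<lambda>x::'a. C * (1 / (1 + norm x) ^ (2 * DIM('a))))"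
    using integrable_inverse_power by (rule integrable_mult_right)
  show "AE x in lborel. norm (f x) \<le> norm (C * (1 / (1 + norm x) ^ (2 * DIM('a))))"
  proof (rule AE_I2)
    fix x :: 'a
    have p: "0 < (1 + norm x) ^ (2 * DIM('a))" by (intro zero_less_power) (simp add: add_pos_nonneg)
    then have "norm (f x) \<le> C / (1 + norm x) ^ (2 * DIM('a))"
      using assms(2)[of x] by (simp add: field_simps)
    then show "norm (f x) \<le> norm (C * (1 / (1 + norm x) ^ (2 * DIM('a))))" by (simp add: abs_if split: if_splits)
  qed
qed (use assms in simp)

lemma ft_measurable: "testfn m \<Longrightarrow> ft m \<in> borel_measurable borel"
  by (intro smooth_measurable smooth_ft)

lemma ft_integrable:
  fixes m :: "real ^ 'n::finite \<Rightarrow> complex"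
  assumes "testfn m"
  shows "integrable lborel (ft m)"
proof -
  obtain C where "\<forall>x. (1 + norm x) ^ (2 * DIM(real^'n)) * cmod (ft m x) \<le> C"
    using ft_decay[OF assms] by blast
  then show ?thesis by (intro integrable_of_decay[where C = C] ft_measurable assms) auto
qed

section \<open>Gaussians and Fourier inversion\<close>

lemma integral_lborel_prod:
  fixes f :: "'a::euclidean_space \<Rightarrow> real \<Rightarrow> complex"
  assumes f: "\<And>b. b \<in> Basis \<Longrightarrow> integrable lborel (f b)"
  shows "integrable lborel (\<lambda>x::'a. \<Prod>b\<in>Basis. f b (x \<bullet> b))"
    and "(\<integral>x. (\<Prod>b\<in>Basis. f b (x \<bullet> b)) \<partial>(lborel :: 'a measure)) = (\<Prod>b\<in>Basis. (\<integral>t. f b t \<partial>lborel))"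
proof -
  interpret product_sigma_finite "\<lambda>_::'a. lborel :: real measure" ..
  have [measurable]: "f b \<in> borel_measurable borel" if "b \<in> Basis" for b
    using borel_measurable_integrable[OF f[OF that]] by simp
  have e: "(\<Sum>b\<in>Basis. g b *\<^sub>R b) \<bullet> b' = g b'" if "b' \<in> Basis" for g :: "'a \<Rightarrow> real" and b'
    using that by (simp add: inner_sum_left inner_Basis if_distrib cong: if_cong)
  have e': "(\<Prod>b\<in>Basis. f b ((\<Sum>b\<in>Basis. g b *\<^sub>R b) \<bullet> b)) = (\<Prod>b\<in>Basis. f b (g b))" for g :: "'a \<Rightarrow> real"
    by (intro prod.cong) (simp_all add: e)
  have [measurable]: "(\<lambda>g. \<Sum>b\<in>Basis. g b *\<^sub>R b :: 'a) \<in> borel_measurable (\<Pi>\<^sub>M b\<in>Basis. lborel :: real measure)"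
    by measurable
  have [measurable]: "(\<lambda>x::'a. \<Prod>b\<in>Basis. f b (x \<bullet> b)) \<in> borel_measurable borel" by measurable
  have "integrable (\<Pi>\<^sub>M b\<in>Basis. lborel) (\<lambda>g. \<Prod>b\<in>Basis. f b (g b))"
    by (rule product_integrable_prod) (use f in auto)
  then show "integrable lborel (\<lambda>x::'a. \<Prod>b\<in>Basis. f b (x \<bullet> b))"
    unfolding lborel_eq[where 'a = 'a] by (subst integrable_distr_eq) (simp_all add: e')
  have "(\<integral>x. (\<Prod>b\<in>Basis. f b (x \<bullet> b)) \<partial>(lborel :: 'a measure)) = (\<integral>g. (\<Prod>b\<in>Basis. f b (g b)) \<partial>(\<Pi>\<^sub>M b\<in>Basis. lborel))"
    unfolding lborel_eq[where 'a = 'a] by (subst integral_distr) (simp_all add: e')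
  also have "\<dots> = (\<Prod>b\<in>Basis. (\<integral>t. f b t \<partial>lborel))"
    by (rule product_integral_prod) (use f in auto)
  finally show "(\<integral>x. (\<Prod>b\<in>Basis. f b (x \<bullet> b)) \<partial>(lborel :: 'a measure)) = (\<Prod>b\<in>Basis. (\<integral>t. f b t \<partial>lborel))" .
qed

text \<open>A product of standard normal densities, so that its transform can be read off the
  characteristic function of the normal distribution.\<close>

definition gauss :: "'a::euclidean_space \<Rightarrow> real"
  where "gauss x = (\<Prod>b\<in>Basis. std_normal_density (x \<bullet> b))"

lemma gauss_continuous: "continuous_on UNIV gauss"
  unfolding gauss_def std_normal_density_def[abs_def] by (intro continuous_intros) auto

lemma gauss_measurable [measurable]: "gauss \<in> borel_measurable borel"
  by (rule borel_measurable_continuous_onI[OF gauss_continuous])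

lemma gauss_pos: "0 < gauss x"
  unfolding gauss_def by (intro prod_pos) (auto simp: std_normal_density_def)

lemma gauss_le: "gauss (x :: 'a::euclidean_space) \<le> gauss (0 :: 'a)"
  unfolding gauss_def by (intro prod_mono) (auto simp: std_normal_density_def intro!: divide_right_mono)

lemma integrable_std_normal: "integrable lborel (\<lambda>t. complex_of_real (std_normal_density t))"
  using integrable_std_normal_moment[of 0] by simp

lemma integrable_gauss: "integrable lborel (\<lambda>x::'a::euclidean_space. complex_of_real (gauss x))"
  using integral_lborel_prod(1)[of "\<lambda>b::'a. \<lambda>t. complex_of_real (std_normal_density t)", OF integrable_std_normal]
  by (simp add: gauss_def)

lemma integrable_gauss_real: "integrable lborel (gauss :: 'a::euclidean_space \<Rightarrow> real)"
  using integrable_gauss[where 'a = 'a] by (simp add: complex_of_real_integrable_eq)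

lemma integral_std_normal: "(\<integral>t. complex_of_real (std_normal_density t) \<partial>lborel) = 1"
  using integral_std_normal_moment_even[of 0] by simp

lemma integral_gauss: "(\<integral>x. complex_of_real (gauss x) \<partial>(lborel :: ('a::euclidean_space) measure)) = 1"
  using integral_lborel_prod(2)[of "\<lambda>b::'a. \<lambda>t. complex_of_real (std_normal_density t)", OF integrable_std_normal]
  by (simp add: gauss_def integral_std_normal)

lemma std_normal_fourier:
  "(\<integral>t. complex_of_real (std_normal_density t) * exp (\<i> * of_real (t * s)) \<partial>lborel) = of_real (sqrt (2 * pi) * std_normal_density s)"
proof -
  have "char std_normal_distribution s = (\<integral>t. std_normal_density t *\<^sub>R exp (\<i> * of_real (s * t)) \<partial>lborel)"
    unfolding char_def by (subst integral_density) auto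
  also have "\<dots> = (\<integral>t. complex_of_real (std_normal_density t) * exp (\<i> * of_real (t * s)) \<partial>lborel)"
    by (simp only: scaleR_conv_of_real mult.commute[of s])
  finally have "(\<integral>t. complex_of_real (std_normal_density t) * exp (\<i> * of_real (t * s)) \<partial>lborel) = complex_of_real (exp (- (s\<^sup>2) / 2))"
    by (simp only: char_std_normal_distribution)
  moreover have "sqrt (2 * pi) * std_normal_density s = exp (- (s\<^sup>2) / 2)"
    by (simp add: std_normal_density_def)
  ultimately show ?thesis by (simp only:)
qed

lemma gauss_fourier:
  fixes \<xi> :: "'a::euclidean_space"
  shows "(\<integral>x. complex_of_real (gauss x) * exp (\<i> * of_real (x \<bullet> \<xi>)) \<partial>lborel) = of_real (sqrt (2 * pi) ^ DIM('a) * gauss \<xi>)"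
proof -
  have i: "integrable lborel (\<lambda>t. complex_of_real (std_normal_density t) * exp (\<i> * of_real (t * s)))" for s
    using integrable_std_normal by (rule Bochner_Integration.integrable_bound) (auto simp: norm_mult)
  have "complex_of_real (gauss x) * exp (\<i> * of_real (x \<bullet> \<xi>)) =
      (\<Prod>b\<in>Basis. complex_of_real (std_normal_density (x \<bullet> b)) * exp (\<i> * of_real ((x \<bullet> b) * (\<xi> \<bullet> b))))" for x
    by (simp add: gauss_def euclidean_inner[of x \<xi>] prod.distrib sum_distrib_left exp_sum)
  then have "(\<integral>x. complex_of_real (gauss x) * exp (\<i> * of_real (x \<bullet> \<xi>)) \<partial>lborel) =
      (\<integral>x. (\<Prod>b\<in>Basis. complex_of_real (std_normal_density (x \<bullet> b)) * exp (\<i> * of_real ((x \<bullet> b) * (\<xi> \<bullet> b)))) \<partial>lborel)"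
    by (simp only:)
  also have "\<dots> = (\<Prod>b\<in>Basis. (\<integral>t. complex_of_real (std_normal_density t) * exp (\<i> * of_real (t * (\<xi> \<bullet> b))) \<partial>lborel))"
    by (rule integral_lborel_prod(2)[OF i])
  also have "\<dots> = of_real (\<Prod>b\<in>Basis. sqrt (2 * pi) * std_normal_density (\<xi> \<bullet> b))"
    by (simp only: std_normal_fourier of_real_prod)
  also have "(\<Prod>b\<in>Basis. sqrt (2 * pi) * std_normal_density (\<xi> \<bullet> b)) = sqrt (2 * pi) ^ DIM('a) * gauss \<xi>"
    by (simp only: prod.distrib prod_constant gauss_def)
  finally show ?thesis .
qed

text \<open>The multiplication formula, combined with the fact that the Gaussian is its own
  transform up to a factor.\<close>

lemma ft_gauss_swap:
  fixes m :: "real ^ 'n::finite \<Rightarrow> complex"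
  assumes "testfn m"
  shows "(\<integral>x. ft m x * of_real (gauss x) \<partial>lborel) = (\<integral>\<xi>. m \<xi> * of_real (sqrt (2 * pi) ^ CARD('n) * gauss \<xi>) \<partial>lborel)"
proof -
  have [measurable]: "m \<in> borel_measurable borel" using assms by (auto simp: testfn_def intro: smooth_measurable)
  define f where "f x \<xi> = m \<xi> * exp (\<i> * of_real (x \<bullet> \<xi>)) * of_real (gauss x)" for x \<xi>
  have int: "integrable (lborel \<Otimes>\<^sub>M lborel) (\<lambda>(x, \<xi>). f x \<xi>)"
  proof (rule lborel_pair.Fubini_integrable)
    show "(\<lambda>(x, \<xi>). f x \<xi>) \<in> borel_measurable (lborel \<Otimes>\<^sub>M lborel)" unfolding f_def by measurable
    have "(\<integral>\<xi>. norm (f x \<xi>) \<partial>lborel) = gauss x * (\<integral>\<xi>. cmod (m \<xi>) \<partial>lborel)" for x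
      using gauss_pos[of x] by (simp add: f_def norm_mult mult.commute)
    then show "integrable lborel (\<lambda>x. \<integral>\<xi>. norm (case (x, \<xi>) of (x, \<xi>) \<Rightarrow> f x \<xi>) \<partial>lborel)"
      using integrable_gauss_real[where 'a = "real^'n"] by simp
    show "AE x in lborel. integrable lborel (\<lambda>\<xi>. case (x, \<xi>) of (x, \<xi>) \<Rightarrow> f x \<xi>)"
      using ft_integrable_integrand[OF assms] by (simp add: f_def)
  qed
  have "(\<integral>x. ft m x * of_real (gauss x) \<partial>lborel) = (\<integral>x. \<integral>\<xi>. f x \<xi> \<partial>lborel \<partial>lborel)"
    by (simp add: f_def ft_def)
  also have "\<dots> = (\<integral>\<xi>. \<integral>x. f x \<xi> \<partial>lborel \<partial>lborel)"
    by (rule lborel_pair.Fubini_integral[OF int, symmetric])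
  also have "\<dots> = (\<integral>\<xi>. m \<xi> * of_real (sqrt (2 * pi) ^ CARD('n) * gauss \<xi>) \<partial>lborel)"
  proof (intro Bochner_Integration.integral_cong refl)
    fix \<xi> :: "real ^ 'n"
    have "(\<integral>x. f x \<xi> \<partial>lborel) = (\<integral>x. m \<xi> * (of_real (gauss x) * exp (\<i> * of_real (x \<bullet> \<xi>))) \<partial>lborel)"
      by (simp add: f_def mult_ac)
    also have "\<dots> = m \<xi> * of_real (sqrt (2 * pi) ^ CARD('n) * gauss \<xi>)"
      using gauss_fourier[of \<xi>] by simp
    finally show "(\<integral>x. f x \<xi> \<partial>lborel) = m \<xi> * of_real (sqrt (2 * pi) ^ CARD('n) * gauss \<xi>)" .
  qed
  finally show ?thesis .
qed

lemma ft_scale: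
  fixes m :: "real ^ 'n::finite \<Rightarrow> complex"
  assumes "m \<in> borel_measurable borel" "0 < c"
  shows "ft m x = c ^ CARD('n) *\<^sub>R ft (\<lambda>\<xi>. m (c *\<^sub>R \<xi>)) (c *\<^sub>R x)"
proof -
  note [measurable] = assms(1)
  have "ft m x = \<bar>c\<bar> ^ DIM(real^'n) *\<^sub>R (\<integral>\<xi>. m (0 + c *\<^sub>R \<xi>) * exp (\<i> * of_real (x \<bullet> (0 + c *\<^sub>R \<xi>))) \<partial>lborel)"
    unfolding ft_def using assms(2) by (intro lborel_integral_affine) auto
  then show ?thesis using assms(2) by (simp add: ft_def)
qed

text \<open>This constant is \<open>(2 * pi) ^ CARD('n)\<close>, but only its positivity matters.\<close>

definition inv_const :: "'n::finite itself \<Rightarrow> real"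
  where "inv_const _ = sqrt (2 * pi) ^ CARD('n) / gauss (0 :: real ^ 'n)"

lemma inv_const_pos: "0 < inv_const TYPE('n::finite)"
  unfolding inv_const_def using gauss_pos[of "0 :: real ^ 'n"] by simp

text \<open>A Gaussian that becomes flat tends to the constant \<open>gauss 0\<close> against the
  transform, while on the other side the argument of \<open>m\<close> shrinks to the origin.
  Dominated convergence in both integrals evaluates the limit.\<close>

lemma integral_ft:
  fixes m :: "real ^ 'n::finite \<Rightarrow> complex"
  assumes m: "testfn m"
  shows "(\<integral>x. ft m x \<partial>lborel) = of_real (inv_const TYPE('n)) * m 0"
proof -
  define \<epsilon> where "\<epsilon> k = inverse (real (Suc k))" for k
  have \<epsilon>: "0 < \<epsilon> k" for k by (simp add: \<epsilon>_def)
  have \<epsilon>0: "\<epsilon> \<longlonglongrightarrow> 0" unfolding \<epsilon>_def by (rule LIMSEQ_inverse_real_of_nat)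
  have [measurable]: "m \<in> borel_measurable borel" "ft m \<in> borel_measurable borel"
    using m by (auto simp: testfn_def intro: smooth_measurable ft_measurable)
  define s where "s = sqrt (2 * pi) ^ CARD('n)"
  \<comment> \<open>The multiplication formula for the dilated test function, with the dilation
    carried over to the Gaussian on the left.\<close>
  have eq: "(\<integral>y. ft m y * of_real (gauss (\<epsilon> k *\<^sub>R y)) \<partial>lborel) = (\<integral>\<xi>. m (\<epsilon> k *\<^sub>R \<xi>) * of_real (s * gauss \<xi>) \<partial>lborel)" for k
  proof -
    define u where "u = (\<lambda>\<xi>. m (\<epsilon> k *\<^sub>R \<xi>))"
    have u: "testfn u" unfolding u_def using testfn_affine[OF m, of "\<epsilon> k" 0] \<epsilon>[of k] by simp
    have [measurable]: "ft u \<in> borel_measurable borel" by (rule ft_measurable[OF u])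
    have "(\<integral>\<xi>. m (\<epsilon> k *\<^sub>R \<xi>) * of_real (s * gauss \<xi>) \<partial>lborel) = (\<integral>x. ft u x * of_real (gauss x) \<partial>lborel)"
      using ft_gauss_swap[OF u] by (simp add: u_def s_def)
    also have "\<dots> = \<bar>\<epsilon> k\<bar> ^ DIM(real^'n) *\<^sub>R (\<integral>y. ft u (0 + \<epsilon> k *\<^sub>R y) * of_real (gauss (0 + \<epsilon> k *\<^sub>R y)) \<partial>lborel)"
      using \<epsilon>[of k] by (intro lborel_integral_affine) auto
    also have "\<dots> = (\<integral>y. (\<epsilon> k ^ CARD('n) *\<^sub>R ft u (\<epsilon> k *\<^sub>R y)) * of_real (gauss (\<epsilon> k *\<^sub>R y)) \<partial>lborel)"
      using \<epsilon>[of k] by (subst integral_scaleR_right[symmetric]) (simp add: less_imp_le)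
    also have "\<dots> = (\<integral>y. ft m y * of_real (gauss (\<epsilon> k *\<^sub>R y)) \<partial>lborel)"
      using ft_scale[OF _ \<epsilon>[of k], of m] by (simp add: u_def)
    finally show ?thesis by simp
  qed
  have L: "(\<lambda>k. \<integral>y. ft m y * of_real (gauss (\<epsilon> k *\<^sub>R y)) \<partial>lborel) \<longlonglongrightarrow> (\<integral>y. ft m y * of_real (gauss (0 :: real ^ 'n)) \<partial>lborel)"
  proof (rule integral_dominated_convergence)
    show "integrable lborel (\<lambda>y. gauss (0 :: real ^ 'n) * cmod (ft m y))"
      using ft_integrable[OF m] by auto
    show "AE y in lborel. (\<lambda>k. ft m y * of_real (gauss (\<epsilon> k *\<^sub>R y))) \<longlonglongrightarrow> ft m y * of_real (gauss (0 :: real ^ 'n))"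
    proof (rule AE_I2)
      fix y :: "real ^ 'n"
      have "(\<lambda>k. \<epsilon> k *\<^sub>R y) \<longlonglongrightarrow> 0 *\<^sub>R y" by (intro tendsto_intros \<epsilon>0)
      then have "(\<lambda>k. gauss (\<epsilon> k *\<^sub>R y)) \<longlonglongrightarrow> gauss (0 *\<^sub>R y)"
        using continuous_on_tendsto_compose[OF gauss_continuous] by auto
      then show "(\<lambda>k. ft m y * of_real (gauss (\<epsilon> k *\<^sub>R y))) \<longlonglongrightarrow> ft m y * of_real (gauss (0 :: real ^ 'n))"
        by (intro tendsto_intros) simp
    qed
    show "AE y in lborel. norm (ft m y * of_real (gauss (\<epsilon> k *\<^sub>R y))) \<le> gauss (0 :: real ^ 'n) * cmod (ft m y)" for k
    proof (rule AE_I2)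
      fix y :: "real ^ 'n"
      have "cmod (ft m y) * gauss (\<epsilon> k *\<^sub>R y) \<le> cmod (ft m y) * gauss (0 :: real ^ 'n)"
        by (intro mult_left_mono gauss_le) auto
      then show "norm (ft m y * of_real (gauss (\<epsilon> k *\<^sub>R y))) \<le> gauss (0 :: real ^ 'n) * cmod (ft m y)"
        using gauss_pos[of "\<epsilon> k *\<^sub>R y"] by (simp add: norm_mult mult.commute)
    qed
  qed measurable
  obtain B where B: "\<And>\<xi>. cmod (m \<xi>) \<le> B" using testfn_bounded[OF m] by blast
  have R: "(\<lambda>k. \<integral>\<xi>. m (\<epsilon> k *\<^sub>R \<xi>) * of_real (s * gauss \<xi>) \<partial>lborel) \<longlonglongrightarrow> (\<integral>\<xi>. m 0 * of_real (s * gauss \<xi>) \<partial>(lborel :: (real ^ 'n) measure))"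
  proof (rule integral_dominated_convergence)
    have "integrable lborel (\<lambda>\<xi> :: real ^ 'n. norm (complex_of_real (gauss \<xi>)))"
      by (intro integrable_norm integrable_gauss)
    then show "integrable lborel (\<lambda>\<xi> :: real ^ 'n. B * s * norm (complex_of_real (gauss \<xi>)))" by simp
    show "AE \<xi> in lborel. (\<lambda>k. m (\<epsilon> k *\<^sub>R \<xi>) * of_real (s * gauss \<xi>)) \<longlonglongrightarrow> m 0 * of_real (s * gauss \<xi>)"
    proof (rule AE_I2)
      fix y :: "real ^ 'n"
      have "(\<lambda>k. \<epsilon> k *\<^sub>R y) \<longlonglongrightarrow> 0 *\<^sub>R y" by (intro tendsto_intros \<epsilon>0)
      moreover have "continuous_on UNIV m" using m by (auto simp: testfn_def intro: smooth_continuous_on)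
      ultimately have "(\<lambda>k. m (\<epsilon> k *\<^sub>R y)) \<longlonglongrightarrow> m (0 *\<^sub>R y)"
        using continuous_on_tendsto_compose[of UNIV m] by auto
      then show "(\<lambda>k. m (\<epsilon> k *\<^sub>R y) * of_real (s * gauss y)) \<longlonglongrightarrow> m 0 * of_real (s * gauss y)"
        by (intro tendsto_intros) simp
    qed
    show "AE \<xi> in lborel. norm (m (\<epsilon> k *\<^sub>R \<xi>) * of_real (s * gauss \<xi>)) \<le> B * s * norm (complex_of_real (gauss \<xi>))" for k
    proof (rule AE_I2)
      fix \<xi> :: "real ^ 'n"
      have "cmod (m (\<epsilon> k *\<^sub>R \<xi>)) * \<bar>s * gauss \<xi>\<bar> \<le> B * \<bar>s * gauss \<xi>\<bar>" by (intro mult_right_mono B) auto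
      then show "norm (m (\<epsilon> k *\<^sub>R \<xi>) * of_real (s * gauss \<xi>)) \<le> B * s * norm (complex_of_real (gauss \<xi>))"
        by (simp only: norm_mult norm_of_real abs_mult) (simp add: s_def mult.assoc)
    qed
  qed measurable
  have "(\<integral>y. ft m y * of_real (gauss (0 :: real ^ 'n)) \<partial>lborel) = (\<integral>\<xi>. m 0 * of_real (s * gauss \<xi>) \<partial>(lborel :: (real ^ 'n) measure))"
    using LIMSEQ_unique[OF L[unfolded eq] R] .
  then have "(\<integral>y. ft m y \<partial>lborel) * of_real (gauss (0 :: real ^ 'n)) = m 0 * of_real s"
    using integral_gauss[where 'a = "real ^ 'n"] by (simp add: mult.assoc[symmetric])
  then show ?thesis
    using gauss_pos[of "0 :: real ^ 'n"] by (simp add: inv_const_def s_def field_simps)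
qed

lemma ft_translate:
  fixes m :: "real ^ 'n::finite \<Rightarrow> complex"
  assumes "m \<in> borel_measurable borel"
  shows "ft (\<lambda>\<xi>. m (\<xi> + \<eta>)) x = exp (- \<i> * of_real (x \<bullet> \<eta>)) * ft m x"
proof -
  note [measurable] = assms
  have "ft m x = (\<integral>\<xi>. m (\<xi> + \<eta>) * exp (\<i> * of_real (x \<bullet> (\<xi> + \<eta>))) \<partial>lborel)"
    unfolding ft_def by (subst lborel_integral_translate[of _ \<eta>, symmetric]) auto
  also have "\<dots> = (\<integral>\<xi>. exp (\<i> * of_real (x \<bullet> \<eta>)) * (m (\<xi> + \<eta>) * exp (\<i> * of_real (x \<bullet> \<xi>))) \<partial>lborel)"
    by (intro Bochner_Integration.integral_cong refl) (simp add: inner_add_right ring_distribs exp_add)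
  also have "\<dots> = exp (\<i> * of_real (x \<bullet> \<eta>)) * ft (\<lambda>\<xi>. m (\<xi> + \<eta>)) x" by (simp add: ft_def)
  finally have "ft m x = exp (\<i> * of_real (x \<bullet> \<eta>)) * ft (\<lambda>\<xi>. m (\<xi> + \<eta>)) x" .
  moreover have "exp (- \<i> * complex_of_real (x \<bullet> \<eta>)) * exp (\<i> * of_real (x \<bullet> \<eta>)) = 1" by (simp flip: exp_add)
  ultimately show ?thesis by (simp add: mult.assoc[symmetric])
qed

text \<open>Translating the test function turns the value at \<xi> into the value at 0.\<close>

lemma fourier_inversion:
  fixes m :: "real ^ 'n::finite \<Rightarrow> complex"
  assumes m: "testfn m"
  shows "(\<integral>x. ft m x * exp (- \<i> * of_real (x \<bullet> \<xi>)) \<partial>lborel) = of_real (inv_const TYPE('n)) * m \<xi>"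
proof -
  have [measurable]: "m \<in> borel_measurable borel" using m by (auto simp: testfn_def intro: smooth_measurable)
  have "testfn (\<lambda>\<eta>. m (\<eta> + \<xi>))" using testfn_affine[OF m, of 1 \<xi>] by simp
  from integral_ft[OF this] show ?thesis by (simp add: ft_translate mult.commute)
qed

text \<open>Just the transform of \<open>m2\<close> is opened as an integral; after Fubini's theorem
  the integral in \<open>y\<close> is the inversion formula for \<open>m1\<close>.\<close>

lemma ft_convolution:
  fixes m1 m2 :: "real ^ 'n::finite \<Rightarrow> complex"
  assumes m1: "testfn m1" and m2: "testfn m2"
  shows "(\<integral>y. ft m1 (x - y) * ft m2 (y - w) \<partial>lborel) = of_real (inv_const TYPE('n)) * ft (\<lambda>\<xi>. m1 \<xi> * m2 \<xi>) (x - w)"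
proof -
  have [measurable]: "m2 \<in> borel_measurable borel" "ft m1 \<in> borel_measurable borel"
    using m1 m2 by (auto simp: testfn_def intro: smooth_measurable ft_measurable)
  define f where "f y \<xi> = ft m1 (x - y) * (m2 \<xi> * exp (\<i> * of_real ((y - w) \<bullet> \<xi>)))" for y \<xi>
  have i1: "integrable lborel (\<lambda>y. ft m1 (x - y))"
    using lborel_integrable_affine[OF ft_integrable[OF m1], of "-1" x] by simp
  have int: "integrable (lborel \<Otimes>\<^sub>M lborel) (\<lambda>(y, \<xi>). f y \<xi>)"
  proof (rule lborel_pair.Fubini_integrable)
    show "(\<lambda>(y, \<xi>). f y \<xi>) \<in> borel_measurable (lborel \<Otimes>\<^sub>M lborel)" unfolding f_def by measurable
    have "(\<integral>\<xi>. norm (f y \<xi>) \<partial>lborel) = cmod (ft m1 (x - y)) * (\<integral>\<xi>. cmod (m2 \<xi>) \<partial>lborel)" for y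
      by (simp add: f_def norm_mult)
    then show "integrable lborel (\<lambda>y. \<integral>\<xi>. norm (case (y, \<xi>) of (y, \<xi>) \<Rightarrow> f y \<xi>) \<partial>lborel)"
      using i1 by simp
    show "AE y in lborel. integrable lborel (\<lambda>\<xi>. case (y, \<xi>) of (y, \<xi>) \<Rightarrow> f y \<xi>)"
      using ft_integrable_integrand[OF m2] by (simp add: f_def)
  qed
  have "(\<integral>y. ft m1 (x - y) * ft m2 (y - w) \<partial>lborel) = (\<integral>y. \<integral>\<xi>. f y \<xi> \<partial>lborel \<partial>lborel)"
    by (simp add: f_def ft_def[of m2])
  also have "\<dots> = (\<integral>\<xi>. \<integral>y. f y \<xi> \<partial>lborel \<partial>lborel)"
    by (rule lborel_pair.Fubini_integral[OF int, symmetric])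
  also have "\<dots> = (\<integral>\<xi>. of_real (inv_const TYPE('n)) * (m1 \<xi> * m2 \<xi> * exp (\<i> * of_real ((x - w) \<bullet> \<xi>))) \<partial>lborel)"
  proof (intro Bochner_Integration.integral_cong refl)
    fix \<xi> :: "real ^ 'n"
    have "(\<integral>y. f y \<xi> \<partial>lborel) = \<bar>- 1\<bar> ^ DIM(real^'n) *\<^sub>R (\<integral>y. f (x + (-1) *\<^sub>R y) \<xi> \<partial>lborel)"
      by (rule lborel_integral_affine) (auto simp: f_def)
    also have "\<dots> = (\<integral>y. (m2 \<xi> * exp (\<i> * of_real ((x - w) \<bullet> \<xi>))) * (ft m1 y * exp (- \<i> * of_real (y \<bullet> \<xi>))) \<partial>lborel)"
    proof -
      have "exp (\<i> * complex_of_real ((x - y - w) \<bullet> \<xi>)) = exp (\<i> * of_real ((x - w) \<bullet> \<xi>)) * exp (- \<i> * of_real (y \<bullet> \<xi>))" for y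
      proof -
        have "\<i> * complex_of_real ((x - y - w) \<bullet> \<xi>) = \<i> * of_real ((x - w) \<bullet> \<xi>) + (- \<i> * of_real (y \<bullet> \<xi>))"
          by (simp add: inner_diff_left ring_distribs)
        then show ?thesis by (simp only: exp_add)
      qed
      then show ?thesis by (simp add: f_def mult_ac)
    qed
    also have "\<dots> = (m2 \<xi> * exp (\<i> * of_real ((x - w) \<bullet> \<xi>))) * (of_real (inv_const TYPE('n)) * m1 \<xi>)"
      by (simp only: integral_mult_right_zero fourier_inversion[OF m1])
    finally show "(\<integral>y. f y \<xi> \<partial>lborel) = of_real (inv_const TYPE('n)) * (m1 \<xi> * m2 \<xi> * exp (\<i> * of_real ((x - w) \<bullet> \<xi>)))"
      by (simp add: mult_ac)
  qed
  also have "\<dots> = of_real (inv_const TYPE('n)) * ft (\<lambda>\<xi>. m1 \<xi> * m2 \<xi>) (x - w)"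
    by (simp add: ft_def)
  finally show ?thesis .
qed

subsection \<open>Functionals on the Schwartz space\<close>

definition testfn0 :: "(real ^ 'n::finite \<Rightarrow> complex) \<Rightarrow> bool"
  where "testfn0 m \<longleftrightarrow> testfn m \<and> 0 \<notin> supp m"

lemma testfn0_testfn: "testfn0 m \<Longrightarrow> testfn m"
  by (simp add: testfn0_def)

lemma testfn0_add: "testfn0 f \<Longrightarrow> testfn0 g \<Longrightarrow> testfn0 (\<lambda>x. f x + g x)"
proof -
  assume *: "testfn0 f" "testfn0 g"
  have "supp (\<lambda>x. f x + g x) \<subseteq> supp f \<union> supp g" by (intro supp_subsetI) (auto simp: not_in_supp)
  with * show ?thesis by (auto simp: testfn0_def intro: testfn_add)
qed

lemma testfn0_mult_right: "smooth f \<Longrightarrow> testfn0 g \<Longrightarrow> testfn0 (\<lambda>x. f x * g x)"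
  using supp_mult_right[of f g] by (auto simp: testfn0_def intro: testfn_mult_right)

lemma testfn0_mult_left: "testfn0 f \<Longrightarrow> smooth g \<Longrightarrow> testfn0 (\<lambda>x. f x * g x)"
  using supp_mult_left[of f g] by (auto simp: testfn0_def intro: testfn_mult_left)

lemma testfn0_cmult: "testfn0 g \<Longrightarrow> testfn0 (\<lambda>x. c * g x)"
  by (intro testfn0_mult_right smooth_const)

lemma testfn0_zero: "testfn0 (\<lambda>x :: real ^ 'n::finite. 0)"
  by (simp add: testfn0_def testfn_def smooth_const supp_def)

lemma testfn0_sum: "finite A \<Longrightarrow> (\<And>a. a \<in> A \<Longrightarrow> testfn0 (f a)) \<Longrightarrow> testfn0 (\<lambda>x. \<Sum>a\<in>A. f a x)"
  by (induction A rule: finite_induct) (auto intro: testfn0_zero testfn0_add)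

lemma ft_add: "testfn f \<Longrightarrow> testfn g \<Longrightarrow> ft (\<lambda>\<xi>. f \<xi> + g \<xi>) x = ft f x + ft g x"
  unfolding ft_def distrib_right
  by (rule Bochner_Integration.integral_add) (auto intro: ft_integrable_integrand)

text \<open>Weighted derivatives of a transform are again transforms of test functions, hence
  bounded.\<close>

lemma ft_schwartz: "testfn m \<Longrightarrow> ft m \<in> schwartz"
proof -
  assume m: "testfn m"
  have "bounded (range (\<lambda>x. monomial \<alpha> x *\<^sub>R iter_partial ds (ft m) x))" for \<alpha> ds
  proof -
    obtain m' where m': "\<And>x. of_real (monomial \<alpha> x) * ft (mul_coords ds m) x = ft m' x"
      using ft_monomial[OF testfn_mul_coords[OF m]] by blast
    have "monomial \<alpha> x *\<^sub>R iter_partial ds (ft m) x = ft m' x" for x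
      by (simp add: iter_partial_ft[OF m] scaleR_conv_of_real m')
    then show ?thesis unfolding bounded_iff using ft_norm_le[of m'] by auto
  qed
  then show ?thesis using smooth_ft[OF m] by (simp add: schwartz_def)
qed

text \<open>Up to a constant, a moment of the transform is the value at 0 of a test function
  supported in \<open>supp m\<close>.\<close>

lemma ft_schwartz_inf: "testfn0 m \<Longrightarrow> ft m \<in> schwartz_inf"
proof -
  assume m: "testfn0 m"
  have "(\<integral>x. monomial \<alpha> x *\<^sub>R ft m x \<partial>lborel) = 0" for \<alpha>
  proof -
    obtain m' where m': "testfn m'" "supp m' \<subseteq> supp m" "\<And>x. of_real (monomial \<alpha> x) * ft m x = ft m' x"
      using ft_monomial[OF testfn0_testfn[OF m]] by blast
    have "(\<integral>x. monomial \<alpha> x *\<^sub>R ft m x \<partial>lborel) = (\<integral>x. ft m' x \<partial>lborel)"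
      by (simp add: scaleR_conv_of_real m')
    also have "\<dots> = 0" using integral_ft[OF m'(1)] m' m not_in_supp[of 0 m'] by (auto simp: testfn0_def)
    finally show ?thesis .
  qed
  then show ?thesis using ft_schwartz[OF testfn0_testfn[OF m]] by (simp add: schwartz_inf_def)
qed

text \<open>The test function whose transform is the convolution kernel \<open>ft m (y - w)\<close>
  as a function of \<open>w\<close>; see \<open>ft_reflect\<close>. With it, functionals are
  evaluated on transforms throughout.\<close>

definition reflect :: "real ^ 'n::finite \<Rightarrow> (real ^ 'n \<Rightarrow> complex) \<Rightarrow> real ^ 'n \<Rightarrow> complex"
  where "reflect y m \<xi> = m (- \<xi>) * exp (\<i> * of_real ((- y) \<bullet> \<xi>))"

lemma testfn_reflect: "testfn m \<Longrightarrow> testfn (reflect y m)"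
  unfolding reflect_def[abs_def] using testfn_affine[of m "-1" 0] by (intro testfn_mult_left smooth_iexp) auto

lemma testfn0_reflect: "testfn0 m \<Longrightarrow> testfn0 (reflect y m)"
proof -
  assume m: "testfn0 m"
  have "testfn0 (\<lambda>\<xi>. m ((-1) *\<^sub>R \<xi> + 0))"
    using m testfn_affine[of m "-1" 0] affine_supp[of 0 m "-1" 0] by (auto simp: testfn0_def)
  then show ?thesis unfolding reflect_def[abs_def] by (intro testfn0_mult_left smooth_iexp) simp
qed

lemma ft_reflect:
  fixes m :: "real ^ 'n::finite \<Rightarrow> complex"
  assumes "testfn m"
  shows "ft (reflect y m) w = ft m (y - w)"
proof -
  have [measurable]: "m \<in> borel_measurable borel" using assms by (auto simp: testfn_def intro: smooth_measurable)
  have "ft m (y - w) = \<bar>- 1\<bar> ^ DIM(real^'n) *\<^sub>R (\<integral>\<xi>. m (0 + (-1) *\<^sub>R \<xi>) * exp (\<i> * of_real ((y - w) \<bullet> (0 + (-1) *\<^sub>R \<xi>))) \<partial>lborel)"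
    unfolding ft_def by (rule lborel_integral_affine) auto
  also have "\<dots> = (\<integral>\<xi>. reflect y m \<xi> * exp (\<i> * of_real (w \<bullet> \<xi>)) \<partial>lborel)"
  proof -
    have "exp (\<i> * complex_of_real ((y - w) \<bullet> (- \<xi>))) = exp (\<i> * of_real ((- y) \<bullet> \<xi>)) * exp (\<i> * of_real (w \<bullet> \<xi>))" for \<xi>
    proof -
      have "\<i> * complex_of_real ((y - w) \<bullet> (- \<xi>)) = \<i> * of_real ((- y) \<bullet> \<xi>) + \<i> * of_real (w \<bullet> \<xi>)"
        by (simp add: inner_diff_left ring_distribs)
      then show ?thesis by (simp only: exp_add)
    qed
    then show ?thesis by (simp add: reflect_def mult.assoc)
  qed
  finally show ?thesis by (simp add: ft_def)
qed

lemma mul_coords_reflect: "mul_coords ds (reflect y m) = (\<lambda>\<xi>. (- 1) ^ length ds * reflect y (mul_coords ds m) \<xi>)"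
proof (induction ds)
  case (Cons d ds)
  have "mul_coords (d # ds) (reflect y m) = mul_coord d (mul_coords ds (reflect y m))" by (simp add: mul_coords_def)
  also have "\<dots> = (\<lambda>\<xi>. (- 1) ^ length (d # ds) * reflect y (mul_coords (d # ds) m) \<xi>)"
    unfolding Cons by (rule ext) (simp add: mul_coord_def reflect_def mul_coords_def)
  finally show ?case .
qed (simp add: mul_coords_def)

lemma mul_coords_linear: "mul_coords ds (\<lambda>\<xi>. f \<xi> + g \<xi>) = (\<lambda>\<xi>. mul_coords ds f \<xi> + mul_coords ds g \<xi>)"
  "mul_coords ds (\<lambda>\<xi>. c * f \<xi>) = (\<lambda>\<xi>. c * mul_coords ds f \<xi>)"
  "mul_coords ds (\<lambda>\<xi>. \<Sum>a\<in>A. h a \<xi>) = (\<lambda>\<xi>. \<Sum>a\<in>A. mul_coords ds (h a) \<xi>)"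
  by (rule ext, subst mul_coords_eq, subst (2) mul_coords_eq, (subst (3) mul_coords_eq)?, simp add: distrib_left sum_distrib_left)+

lemma iter_partial_add:
  "smooth f \<Longrightarrow> smooth g \<Longrightarrow> iter_partial ds (\<lambda>x. f x + g x) = (\<lambda>x. iter_partial ds f x + iter_partial ds g x)"
  by (induction ds) (auto intro!: partial_deriv_add smooth_differentiable smooth_iter_partial)

lemma iter_partial_cmult:
  "smooth f \<Longrightarrow> iter_partial ds (\<lambda>x. c * f x) = (\<lambda>x. c * iter_partial ds f x)"
  by (induction ds) (auto intro!: partial_deriv_cmult smooth_differentiable smooth_iter_partial)

lemma seminorm_upper:
  assumes "f \<in> schwartz"
  shows "cmod (monomial \<alpha> x *\<^sub>R iter_partial ds f x) \<le> schwartz_seminorm \<alpha> ds f"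
proof -
  have "bounded (range (\<lambda>x. monomial \<alpha> x *\<^sub>R iter_partial ds f x))" using assms by (simp add: schwartz_def)
  then have "bdd_above (range (\<lambda>x. cmod (monomial \<alpha> x *\<^sub>R iter_partial ds f x)))"
    by (auto simp: bounded_iff bdd_above_def)
  then show ?thesis unfolding schwartz_seminorm_def by (rule cSUP_upper[rotated]) simp
qed

lemma seminorm_least:
  "(\<And>x. cmod (monomial \<alpha> x *\<^sub>R iter_partial ds f x) \<le> B) \<Longrightarrow> schwartz_seminorm \<alpha> ds f \<le> B"
  unfolding schwartz_seminorm_def by (rule cSUP_least) auto

lemma seminorm_triangle:
  assumes "f \<in> schwartz" "g \<in> schwartz"
  shows "schwartz_seminorm \<alpha> ds (\<lambda>x. f x + g x) \<le> schwartz_seminorm \<alpha> ds f + schwartz_seminorm \<alpha> ds g"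
proof (rule seminorm_least)
  fix x
  have "cmod (monomial \<alpha> x *\<^sub>R iter_partial ds (\<lambda>x. f x + g x) x) \<le>
      cmod (monomial \<alpha> x *\<^sub>R iter_partial ds f x) + cmod (monomial \<alpha> x *\<^sub>R iter_partial ds g x)"
  proof -
    have "smooth f" "smooth g" using assms by (auto simp: schwartz_def)
    then show ?thesis by (simp only: iter_partial_add scaleR_add_right norm_triangle_ineq)
  qed
  also have "\<dots> \<le> schwartz_seminorm \<alpha> ds f + schwartz_seminorm \<alpha> ds g"
    by (intro add_mono seminorm_upper assms)
  finally show "cmod (monomial \<alpha> x *\<^sub>R iter_partial ds (\<lambda>x. f x + g x) x) \<le> \<dots>" .
qed

lemma schwartz_cmult:
  assumes "f \<in> schwartz"
  shows "(\<lambda>x. c * f x) \<in> schwartz"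
proof -
  have sf: "smooth f" using assms by (simp add: schwartz_def)
  have "bounded (range (\<lambda>x. monomial \<alpha> x *\<^sub>R iter_partial ds (\<lambda>x. c * f x) x))" for \<alpha> ds
    unfolding bounded_iff
  proof (intro exI ballI)
    fix v assume "v \<in> range (\<lambda>x. monomial \<alpha> x *\<^sub>R iter_partial ds (\<lambda>x. c * f x) x)"
    then obtain x where v: "v = monomial \<alpha> x *\<^sub>R iter_partial ds (\<lambda>x. c * f x) x" by blast
    have "cmod v = cmod c * cmod (monomial \<alpha> x *\<^sub>R iter_partial ds f x)"
      unfolding v iter_partial_cmult[OF sf] by (simp add: norm_mult)
    also have "\<dots> \<le> cmod c * schwartz_seminorm \<alpha> ds f" by (intro mult_left_mono seminorm_upper assms) auto
    finally show "cmod v \<le> cmod c * schwartz_seminorm \<alpha> ds f" .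
  qed
  then show ?thesis using sf by (auto simp: schwartz_def intro: smooth_cmult)
qed

text \<open>Induction over the generation of the topology: intersections unite the finite sets of
  seminorms and take the smaller radius, and a union is handled by one member that contains
  0.\<close>

lemma schwartz_nhd_zero:
  fixes V :: "(real ^ 'n::finite \<Rightarrow> complex) set"
  assumes "openin schwartz_topology V" "(\<lambda>x. 0) \<in> V"
  shows "\<exists>P e. finite P \<and> 0 < e \<and> (\<forall>g\<in>schwartz. (\<forall>(\<alpha>, ds)\<in>P. schwartz_seminorm \<alpha> ds g < e) \<longrightarrow> g \<in> V)"
proof -
  have "generate_topology_on {{g \<in> schwartz. schwartz_seminorm \<alpha> ds (\<lambda>x. g x - f x) < e} | f \<alpha> ds e. f \<in> (schwartz :: (real ^ 'n \<Rightarrow> complex) set) \<and> 0 < e} V"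
    using assms(1) unfolding schwartz_topology_def openin_topology_generated_by_iff .
  then show ?thesis using assms(2)
  proof (induction rule: generate_topology_on.induct)
    case Empty
    then show ?case by simp
  next
    case (Int a b)
    from Int.IH(1)[OF IntD1[OF Int.prems]] obtain P e where 1:
      "finite P" "0 < e" "\<forall>g\<in>schwartz. (\<forall>(\<alpha>, ds)\<in>P. schwartz_seminorm \<alpha> ds g < e) \<longrightarrow> g \<in> a"
      by blast
    from Int.IH(2)[OF IntD2[OF Int.prems]] obtain P' e' where 2:
      "finite P'" "0 < e'" "\<forall>g\<in>schwartz. (\<forall>(\<alpha>, ds)\<in>P'. schwartz_seminorm \<alpha> ds g < e') \<longrightarrow> g \<in> b"
      by blast
    note * = 1 2
    show ?case
    proof (intro exI[of _ "P \<union> P'"] exI[of _ "min e e'"] conjI ballI impI)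
      fix g assume g: "g \<in> schwartz" "\<forall>(\<alpha>, ds)\<in>P \<union> P'. schwartz_seminorm \<alpha> ds g < min e e'"
      have "\<forall>(\<alpha>, ds)\<in>P. schwartz_seminorm \<alpha> ds g < e" "\<forall>(\<alpha>, ds)\<in>P'. schwartz_seminorm \<alpha> ds g < e'"
        using g(2) by auto
      then show "g \<in> a \<inter> b" using * g(1) by blast
    qed (use * in auto)
  next
    case (UN K)
    then obtain k where k: "k \<in> K" "(\<lambda>x. 0) \<in> k" by blast
    from UN.IH[OF k] obtain P e where "finite P" "0 < e" "\<forall>g\<in>schwartz. (\<forall>(\<alpha>, ds)\<in>P. schwartz_seminorm \<alpha> ds g < e) \<longrightarrow> g \<in> k"
      by blast
    then show ?case using k(1) by (intro exI[of _ P] exI[of _ e]) blast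
  next
    case (Basis s)
    then obtain f \<alpha> ds e where s: "s = {g \<in> schwartz. schwartz_seminorm \<alpha> ds (\<lambda>x. g x - f x) < e}" and f: "f \<in> schwartz"
      by blast
    \<comment> \<open>The subbasic set is centred at \<open>f\<close> and not at 0; the seminorm of
      \<open>- f\<close> is subtracted from its radius.\<close>
    have z: "schwartz_seminorm \<alpha> ds (\<lambda>x. - f x) < e" using Basis.prems s by simp
    show ?case
    proof (intro exI[of _ "{(\<alpha>, ds)}"] exI[of _ "e - schwartz_seminorm \<alpha> ds (\<lambda>x. - f x)"] conjI ballI impI)
      fix g assume g: "g \<in> schwartz" "\<forall>(\<alpha>', ds')\<in>{(\<alpha>, ds)}. schwartz_seminorm \<alpha>' ds' g < e - schwartz_seminorm \<alpha> ds (\<lambda>x. - f x)"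
      have "schwartz_seminorm \<alpha> ds (\<lambda>x. g x + - f x) \<le> schwartz_seminorm \<alpha> ds g + schwartz_seminorm \<alpha> ds (\<lambda>x. - f x)"
        using g(1) schwartz_cmult[OF f, of "-1"] by (intro seminorm_triangle) auto
      then show "g \<in> s" using g s by simp
    qed (use z in auto)
  qed
qed

lemma monomial_le: "\<bar>monomial \<alpha> x\<bar> \<le> (1 + norm x) ^ (\<Sum>i\<in>UNIV. \<alpha> i)"
proof -
  have "\<bar>monomial \<alpha> x\<bar> = (\<Prod>i\<in>UNIV. \<bar>x $ i\<bar> ^ \<alpha> i)" by (simp add: monomial_def abs_prod power_abs)
  also have "\<dots> \<le> (\<Prod>i\<in>UNIV. (1 + norm x) ^ \<alpha> i)"
    by (intro prod_mono conjI power_mono zero_le_power) (use component_le_norm_cart[of x] in \<open>auto intro: order_trans add_increasing\<close>)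
  also have "\<dots> = (1 + norm x) ^ (\<Sum>i\<in>UNIV. \<alpha> i)" by (simp add: power_sum)
  finally show ?thesis .
qed

lemma dual_linear:
  assumes T: "T \<in> schwartz_inf_dual"
  shows "testfn0 f \<Longrightarrow> testfn0 g \<Longrightarrow> T (ft (\<lambda>\<xi>. f \<xi> + g \<xi>)) = T (ft f) + T (ft g)"
    and "testfn0 f \<Longrightarrow> T (ft (\<lambda>\<xi>. c * f \<xi>)) = c * T (ft f)"
proof -
  assume f: "testfn0 f"
  have "ft (\<lambda>\<xi>. c * f \<xi>) = (\<lambda>x. c * ft f x)" by (rule ext) (rule ft_cmult)
  then show "T (ft (\<lambda>\<xi>. c * f \<xi>)) = c * T (ft f)"
    using T ft_schwartz_inf[OF f] by (auto simp: schwartz_inf_dual_def)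
  assume g: "testfn0 g"
  have "ft (\<lambda>\<xi>. f \<xi> + g \<xi>) = (\<lambda>x. ft f x + ft g x)" by (rule ext) (intro ft_add testfn0_testfn f g)
  then show "T (ft (\<lambda>\<xi>. f \<xi> + g \<xi>)) = T (ft f) + T (ft g)"
    using T ft_schwartz_inf[OF f] ft_schwartz_inf[OF g] by (auto simp: schwartz_inf_dual_def)
qed

lemma dual_sum:
  assumes T: "T \<in> schwartz_inf_dual" and "finite A" "\<And>a. a \<in> A \<Longrightarrow> testfn0 (f a)"
  shows "T (ft (\<lambda>\<xi>. \<Sum>a\<in>A. c a * f a \<xi>)) = (\<Sum>a\<in>A. c a * T (ft (f a)))"
  using assms(2,3)
proof (induction A rule: finite_induct)
  case empty
  have "T (ft (\<lambda>\<xi>. 0 * 0)) = 0 * T (ft (\<lambda>\<xi>. 0))" by (rule dual_linear(2)[OF T testfn0_zero])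
  then show ?case by simp
next
  case (insert a A)
  then have t: "testfn0 (\<lambda>\<xi>. c a * f a \<xi>)" "testfn0 (\<lambda>\<xi>. \<Sum>a\<in>A. c a * f a \<xi>)"
    by (auto intro!: testfn0_cmult testfn0_sum)
  have "T (ft (\<lambda>\<xi>. \<Sum>a\<in>insert a A. c a * f a \<xi>)) = T (ft (\<lambda>\<xi>. c a * f a \<xi> + (\<Sum>a\<in>A. c a * f a \<xi>)))"
    using insert.hyps by simp
  also have "\<dots> = c a * T (ft (f a)) + (\<Sum>a\<in>A. c a * T (ft (f a)))"
    using insert by (subst dual_linear(1)[OF T t]) (simp add: dual_linear(2)[OF T])
  finally show ?case using insert.hyps by simp
qed

text \<open>Continuity at 0 gives smallness for finitely many small seminorms, and homogeneity turns
  this into a bound. Derivatives of the transform are expressed by \<open>mul_coords\<close>, and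
  all monomials are majorised by a single power of \<open>1 + norm w\<close>.\<close>

lemma dual_bound:
  fixes T :: "(real ^ 'n::finite \<Rightarrow> complex) \<Rightarrow> complex"
  assumes T: "T \<in> schwartz_inf_dual"
  shows "\<exists>C>0. \<exists>M Ds. finite Ds \<and> (\<forall>m B. testfn0 m \<longrightarrow> 0 \<le> B \<longrightarrow>
    (\<forall>ds\<in>Ds. \<forall>w. (1 + norm w) ^ M * cmod (ft (mul_coords ds m) w) \<le> B) \<longrightarrow> cmod (T (ft m)) \<le> C * B)"
proof -
  have z: "ft (\<lambda>\<xi>. 0) = (\<lambda>x :: real ^ 'n. 0)" by (rule ext) (simp add: ft_def)
  have z_in: "(\<lambda>x :: real ^ 'n. 0) \<in> schwartz_inf"
  proof -
    have "ft (\<lambda>\<xi> :: real ^ 'n. 0) \<in> schwartz_inf" by (rule ft_schwartz_inf[OF testfn0_zero])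
    then show ?thesis by (simp only: z)
  qed
  have Tz: "T (\<lambda>x. 0) = 0" using dual_linear(2)[OF T testfn0_zero, of 0] by (simp add: z)
  have cont: "continuous_map (subtopology schwartz_topology schwartz_inf) euclidean T"
    using T by (simp add: schwartz_inf_dual_def)
  have "openin (subtopology schwartz_topology schwartz_inf) {f \<in> topspace (subtopology schwartz_topology schwartz_inf). T f \<in> ball 0 1}"
    by (rule openin_continuous_map_preimage[OF cont]) simp
  then obtain V where V: "openin schwartz_topology V"
    "{f \<in> topspace (subtopology schwartz_topology schwartz_inf). T f \<in> ball 0 1} = V \<inter> schwartz_inf"
    by (auto simp: openin_subtopology)
  have top: "(schwartz :: (real ^ 'n \<Rightarrow> complex) set) \<subseteq> topspace schwartz_topology"
  proof
    fix f :: "real ^ 'n \<Rightarrow> complex" assume f: "f \<in> schwartz"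
    have "schwartz_seminorm (\<lambda>_. 0) [] (\<lambda>x. f x - f x) \<le> 0" by (rule seminorm_least) simp
    then have "f \<in> {g \<in> schwartz. schwartz_seminorm (\<lambda>_. 0) [] (\<lambda>x. g x - f x) < 1}" using f by simp
    moreover have "openin schwartz_topology {g \<in> schwartz. schwartz_seminorm (\<lambda>_. 0) [] (\<lambda>x. g x - f x) < 1}"
      unfolding schwartz_topology_def
      by (rule topology_generated_by_Basis, rule CollectI, rule exI[of _ f], rule exI[of _ "\<lambda>_. 0"],
          rule exI[of _ "[]"], rule exI[of _ 1]) (use f in simp)
    ultimately show "f \<in> topspace schwartz_topology" using openin_subset by blast
  qed
  have inS: "schwartz_inf \<subseteq> (schwartz :: (real ^ 'n \<Rightarrow> complex) set)" by (auto simp: schwartz_inf_def)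
  have "(\<lambda>x. 0) \<in> {f \<in> topspace (subtopology schwartz_topology schwartz_inf). T f \<in> ball 0 1}"
    using z_in inS top Tz by auto
  then have "(\<lambda>x. 0) \<in> V" using V by blast
  from schwartz_nhd_zero[OF V(1) this] obtain P e where P: "finite P" "0 < e"
    "\<And>g. g \<in> schwartz \<Longrightarrow> (\<forall>(\<alpha>, ds)\<in>P. schwartz_seminorm \<alpha> ds g < e) \<Longrightarrow> g \<in> V" by blast
  have T1: "cmod (T (ft m)) < 1" if "testfn0 m" "\<forall>(\<alpha>, ds)\<in>P. schwartz_seminorm \<alpha> ds (ft m) < e" for m
  proof -
    have "ft m \<in> V \<inter> schwartz_inf" using P(3)[of "ft m"] that ft_schwartz_inf[OF that(1)] inS by blast
    then show ?thesis unfolding V(2)[symmetric] by simp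
  qed
  define M where "M = (\<Sum>(\<alpha>, ds)\<in>P. \<Sum>i\<in>UNIV. \<alpha> i)"
  define Ds where "Ds = snd ` P"
  have M: "(\<Sum>i\<in>UNIV. \<alpha> i) \<le> M" if "(\<alpha>, ds) \<in> P" for \<alpha> ds
    unfolding M_def using member_le_sum[OF that, of "\<lambda>(\<alpha>, ds). \<Sum>i\<in>UNIV. \<alpha> i"] P(1) by simp
  have "cmod (T (ft m)) \<le> 2 / e * B"
    if m: "testfn0 m" and B: "0 \<le> B" "\<forall>ds\<in>Ds. \<forall>w. (1 + norm w) ^ M * cmod (ft (mul_coords ds m) w) \<le> B" for m B
  proof (rule field_le_epsilon)
    fix \<delta> :: real assume \<delta>: "0 < \<delta>"
    \<comment> \<open>With this factor the scaled seminorms are at most \<open>e / 2\<close>, while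
      \<open>1 / lam\<close> is \<open>2 / e * B + \<delta>\<close>. The term with \<delta> covers
      the case \<open>B = 0\<close>.\<close>
    define lam where "lam = (e / 2) / (B + e / 2 * \<delta>)"
    have pos: "0 < B + e / 2 * \<delta>" using B(1) \<delta> P(2) by (simp add: add_nonneg_pos)
    have lam: "0 < lam" using pos P(2) by (simp add: lam_def)
    have m': "testfn0 (\<lambda>\<xi>. of_real lam * m \<xi>)" by (rule testfn0_cmult[OF m])
    have "schwartz_seminorm \<alpha> ds (ft (\<lambda>\<xi>. of_real lam * m \<xi>)) < e" if "(\<alpha>, ds) \<in> P" for \<alpha> ds
    proof -
      have "schwartz_seminorm \<alpha> ds (ft (\<lambda>\<xi>. of_real lam * m \<xi>)) \<le> lam * B"
      proof (rule seminorm_least)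
        fix x
        have "cmod (monomial \<alpha> x *\<^sub>R iter_partial ds (ft (\<lambda>\<xi>. of_real lam * m \<xi>)) x) = lam * (\<bar>monomial \<alpha> x\<bar> * cmod (ft (mul_coords ds m) x))"
          using lam by (simp add: iter_partial_ft[OF testfn0_testfn[OF m']] mul_coords_linear ft_cmult norm_mult)
        also have "\<bar>monomial \<alpha> x\<bar> * cmod (ft (mul_coords ds m) x) \<le> (1 + norm x) ^ M * cmod (ft (mul_coords ds m) x)"
          using order_trans[OF monomial_le power_increasing[OF M[OF that]]] by (intro mult_right_mono) auto
        also have "\<dots> \<le> B" using B(2) that by (force simp: Ds_def)
        finally show "cmod (monomial \<alpha> x *\<^sub>R iter_partial ds (ft (\<lambda>\<xi>. of_real lam * m \<xi>)) x) \<le> lam * B"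
          using lam by (simp add: mult_left_mono)
      qed
      also have "lam * B \<le> e / 2"
        using pos P(2) \<delta> B(1) by (simp add: lam_def field_simps)
      also have "\<dots> < e" using P(2) by simp
      finally show ?thesis .
    qed
    then have "cmod (T (ft (\<lambda>\<xi>. of_real lam * m \<xi>))) < 1" by (intro T1[OF m']) auto
    then have "lam * cmod (T (ft m)) < 1" using lam by (simp add: dual_linear(2)[OF T m] norm_mult)
    then have "cmod (T (ft m)) < 1 / lam" using lam by (simp add: field_simps)
    also have "1 / lam = 2 / e * B + \<delta>" using P(2) by (simp add: lam_def field_simps)
    finally show "cmod (T (ft m)) \<le> 2 / e * B + \<delta>" by simp
  qed
  moreover have "finite Ds" using P(1) by (simp add: Ds_def)
  moreover have "0 < 2 / e" using P(2) by simp
  ultimately show ?thesis by blast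
qed

text \<open>The decay of the kernel in \<open>y - w\<close> is converted into decay in
  \<open>w\<close> at the price of polynomial growth in \<open>y\<close>.\<close>

lemma kernel_weight:
  fixes m :: "real ^ 'n::finite \<Rightarrow> complex"
  assumes "testfn m"
  shows "\<exists>C>0. \<forall>y w. (1 + norm w) ^ M * cmod (ft m (y - w)) \<le> C * (1 + norm y) ^ M"
proof -
  obtain C where C: "0 < C" "\<And>z. (1 + norm z) ^ M * cmod (ft m z) \<le> C" using ft_decay[OF assms] by blast
  have "(1 + norm w) ^ M * cmod (ft m (y - w)) \<le> C * (1 + norm y) ^ M" for y w
  proof -
    have "norm w \<le> norm y + norm (y - w)" using norm_triangle_sub[of w y] by (simp add: norm_minus_commute)
    then have "1 + norm w \<le> (1 + norm y) * (1 + norm (y - w))"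
      using mult_nonneg_nonneg[OF norm_ge_zero[of y] norm_ge_zero[of "y - w"]]
      by (simp only: distrib_left distrib_right mult_1 mult_1_right)
    then have "(1 + norm w) ^ M \<le> ((1 + norm y) * (1 + norm (y - w))) ^ M" by (intro power_mono) auto
    then have "(1 + norm w) ^ M * cmod (ft m (y - w)) \<le> (1 + norm y) ^ M * ((1 + norm (y - w)) ^ M * cmod (ft m (y - w)))"
      by (simp add: power_mult_distrib mult_right_mono flip: mult.assoc)
    also have "\<dots> \<le> (1 + norm y) ^ M * C" by (intro mult_left_mono C) auto
    finally show ?thesis by (simp add: mult.commute)
  qed
  with C(1) show ?thesis by blast
qed

text \<open>The mean value inequality on the segment from \<open>y - w\<close> to
  \<open>y' - w\<close>: each of its points \<open>z\<close> satisfies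
  \<open>1 + norm w \<le> (1 + norm y + norm y') * (1 + norm z)\<close>, so decay in
  \<open>z\<close> becomes decay in \<open>w\<close>.\<close>

lemma kernel_diff:
  fixes m :: "real ^ 'n::finite \<Rightarrow> complex"
  assumes "testfn m"
  shows "\<exists>C>0. \<forall>y y' w. (1 + norm w) ^ M * cmod (ft m (y - w) - ft m (y' - w)) \<le> C * (1 + norm y + norm y') ^ M * norm (y - y')"
proof -
  have "\<exists>C>0. \<forall>z. (1 + norm z) ^ M * cmod (ft (mul_coord j m) z) \<le> C" for j
    by (rule ft_decay[OF testfn_mul_coord[OF assms]])
  then obtain C where C: "\<And>j. 0 < C j" "\<And>j z. (1 + norm z) ^ M * cmod (ft (mul_coord j m) z) \<le> C j" by metis
  define D where "D = (\<Sum>j\<in>UNIV. C j)"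
  have D0: "0 < D" unfolding D_def using C(1) by (intro sum_pos) auto
  have "(1 + norm w) ^ M * cmod (ft m (y - w) - ft m (y' - w)) \<le> D * (1 + norm y + norm y') ^ M * norm (y - y')" for y y' w
  proof -
    define B where "B = D * (1 + norm y + norm y') ^ M / (1 + norm w) ^ M"
    have pw: "0 < (1 + norm w) ^ M" by (intro zero_less_power) (simp add: add_pos_nonneg)
    define S where "S = closed_segment (y - w) (y' - w)"
    have "norm (ft m (y - w) - ft m (y' - w)) \<le> B * norm ((y - w) - (y' - w))"
    proof (rule differentiable_bound[where S = S])
      show "convex S" by (simp add: S_def)
      show "(ft m has_derivative (\<lambda>h. \<Sum>j\<in>UNIV. h $ j *\<^sub>R ft (mul_coord j m) z)) (at z within S)" for z
        by (rule has_derivative_at_withinI[OF ft_has_derivative[OF assms]])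
      fix z assume z: "z \<in> S"
      then obtain u where u: "0 \<le> u" "u \<le> 1" "z = (1 - u) *\<^sub>R (y - w) + u *\<^sub>R (y' - w)"
        unfolding S_def closed_segment_def by blast
      have "w = ((1 - u) *\<^sub>R y + u *\<^sub>R y') - z" by (simp add: u(3) algebra_simps)
      then have "norm w \<le> norm ((1 - u) *\<^sub>R y + u *\<^sub>R y') + norm z" by (metis norm_triangle_ineq4)
      also have "norm ((1 - u) *\<^sub>R y + u *\<^sub>R y') \<le> (1 - u) * norm y + u * norm y'"
        using norm_triangle_ineq[of "(1 - u) *\<^sub>R y" "u *\<^sub>R y'"] u by simp
      also have "\<dots> \<le> 1 * norm y + 1 * norm y'" using u by (intro add_mono mult_right_mono) auto
      finally have "norm w \<le> norm y + norm y' + norm z" by simp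
      moreover have "0 \<le> (norm y + norm y') * norm z" by (intro mult_nonneg_nonneg add_nonneg_nonneg norm_ge_zero)
      moreover have "(1 + norm y + norm y') * (1 + norm z) = 1 + norm y + norm y' + norm z + (norm y + norm y') * norm z"
        by (simp add: distrib_left distrib_right)
      ultimately have "1 + norm w \<le> (1 + norm y + norm y') * (1 + norm z)" by linarith
      then have "(1 + norm w) ^ M \<le> ((1 + norm y + norm y') * (1 + norm z)) ^ M" by (intro power_mono) auto
      then have le: "(1 + norm w) ^ M \<le> (1 + norm y + norm y') ^ M * (1 + norm z) ^ M" by (simp add: power_mult_distrib)
      have vj: "cmod (ft (mul_coord j m) z) \<le> C j * (1 + norm y + norm y') ^ M / (1 + norm w) ^ M" for j
      proof -
        have "(1 + norm w) ^ M * cmod (ft (mul_coord j m) z) \<le> (1 + norm y + norm y') ^ M * ((1 + norm z) ^ M * cmod (ft (mul_coord j m) z))"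
          using mult_right_mono[OF le, of "cmod (ft (mul_coord j m) z)"] by (simp add: mult.assoc)
        also have "\<dots> \<le> (1 + norm y + norm y') ^ M * C j" by (intro mult_left_mono C) auto
        finally show ?thesis using pw by (simp add: field_simps)
      qed
      show "onorm (\<lambda>h. \<Sum>j\<in>UNIV. h $ j *\<^sub>R ft (mul_coord j m) z) \<le> B"
      proof (rule onorm_le)
        fix h :: "real ^ 'n"
        have "norm (\<Sum>j\<in>UNIV. h $ j *\<^sub>R ft (mul_coord j m) z) \<le> (\<Sum>j\<in>UNIV. \<bar>h $ j\<bar> * cmod (ft (mul_coord j m) z))"
          by (rule order_trans[OF norm_sum]) simp
        also have "\<dots> \<le> (\<Sum>j\<in>UNIV. norm h * (C j * (1 + norm y + norm y') ^ M / (1 + norm w) ^ M))"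
          by (intro sum_mono mult_mono component_le_norm_cart vj) auto
        also have "\<dots> = B * norm h"
          by (simp add: B_def D_def sum_distrib_left sum_distrib_right sum_divide_distrib mult_ac)
        finally show "norm (\<Sum>j\<in>UNIV. h $ j *\<^sub>R ft (mul_coord j m) z) \<le> B * norm h" .
      qed
    qed (auto simp: S_def)
    then show ?thesis using pw by (simp add: B_def field_simps)
  qed
  with D0 show ?thesis by blast
qed

section \<open>Convolution of a functional with a transform\<close>

definition dual_conv :: "((real ^ 'n::finite \<Rightarrow> complex) \<Rightarrow> complex) \<Rightarrow> (real ^ 'n \<Rightarrow> complex) \<Rightarrow> real ^ 'n \<Rightarrow> complex"
  where "dual_conv T m y = T (\<lambda>w. ft m (y - w))"

lemma dual_conv_reflect: "testfn m \<Longrightarrow> dual_conv T m y = T (ft (reflect y m))"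
  unfolding dual_conv_def by (rule arg_cong[where f = T]) (simp add: ft_reflect fun_eq_iff)

lemma ft_mul_coords_reflect: "testfn m \<Longrightarrow> ft (mul_coords ds (reflect y m)) w = (- 1) ^ length ds * ft (mul_coords ds m) (y - w)"
  by (simp add: mul_coords_reflect ft_cmult ft_reflect testfn_mul_coords)

lemma dual_conv_growth:
  fixes T :: "(real ^ 'n::finite \<Rightarrow> complex) \<Rightarrow> complex"
  assumes T: "T \<in> schwartz_inf_dual" and m: "testfn0 m"
  shows "\<exists>C>0. \<exists>M. \<forall>y. cmod (dual_conv T m y) \<le> C * (1 + norm y) ^ M"
proof -
  obtain C M Ds where C: "0 < C" "finite Ds" "\<And>m B. testfn0 m \<Longrightarrow> 0 \<le> B \<Longrightarrow>
    (\<forall>ds\<in>Ds. \<forall>w. (1 + norm w) ^ M * cmod (ft (mul_coords ds m) w) \<le> B) \<Longrightarrow> cmod (T (ft m)) \<le> C * B"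
    using dual_bound[OF T] by blast
  have tm: "testfn m" by (rule testfn0_testfn[OF m])
  have "\<exists>E>0. \<forall>y w. (1 + norm w) ^ M * cmod (ft (mul_coords ds m) (y - w)) \<le> E * (1 + norm y) ^ M" for ds
    by (rule kernel_weight[OF testfn_mul_coords[OF tm]])
  then obtain E where E: "\<And>ds. 0 < E ds" "\<And>ds y w. (1 + norm w) ^ M * cmod (ft (mul_coords ds m) (y - w)) \<le> E ds * (1 + norm y) ^ M" by metis
  define E' where "E' = (\<Sum>ds\<in>Ds. E ds) + 1"
  have E': "E ds \<le> E'" if "ds \<in> Ds" for ds
    using member_le_sum[OF that, of E] E(1) C(2) by (auto simp: E'_def less_imp_le intro: add_increasing2)
  have E'0: "0 < E'" using E(1) by (simp add: E'_def add_nonneg_pos sum_nonneg less_imp_le)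
  have "cmod (dual_conv T m y) \<le> (C * E') * (1 + norm y) ^ M" for y
    unfolding dual_conv_reflect[OF tm] mult.assoc
  proof (rule C(3)[OF testfn0_reflect[OF m]], goal_cases)
    case 2
    show ?case
    proof (intro ballI allI)
      fix ds w assume ds: "ds \<in> Ds"
      have "(1 + norm w) ^ M * cmod (ft (mul_coords ds (reflect y m)) w) \<le> E ds * (1 + norm y) ^ M"
        using E(2)[of w ds y] by (simp add: ft_mul_coords_reflect[OF tm] norm_mult norm_power)
      also have "\<dots> \<le> E' * (1 + norm y) ^ M" by (intro mult_right_mono E' ds) auto
      finally show "(1 + norm w) ^ M * cmod (ft (mul_coords ds (reflect y m)) w) \<le> E' * (1 + norm y) ^ M" .
    qed
  qed (use E'0 in auto)
  moreover have "0 < C * E'" using C(1) E'0 by simp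
  ultimately show ?thesis by blast
qed

text \<open>Differences of translated kernels are small in the finitely many seminorms that bound
  \<open>T\<close>, which yields a local Lipschitz estimate.\<close>

lemma dual_conv_continuous:
  fixes T :: "(real ^ 'n::finite \<Rightarrow> complex) \<Rightarrow> complex"
  assumes T: "T \<in> schwartz_inf_dual" and m: "testfn0 m"
  shows "continuous_on UNIV (dual_conv T m)"
proof -
  obtain C M Ds where C: "0 < C" "finite Ds" "\<And>m B. testfn0 m \<Longrightarrow> 0 \<le> B \<Longrightarrow>
    (\<forall>ds\<in>Ds. \<forall>w. (1 + norm w) ^ M * cmod (ft (mul_coords ds m) w) \<le> B) \<Longrightarrow> cmod (T (ft m)) \<le> C * B"
    using dual_bound[OF T] by blast
  have tm: "testfn m" by (rule testfn0_testfn[OF m])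
  have "\<exists>E>0. \<forall>y y' w. (1 + norm w) ^ M * cmod (ft (mul_coords ds m) (y - w) - ft (mul_coords ds m) (y' - w)) \<le> E * (1 + norm y + norm y') ^ M * norm (y - y')" for ds
    by (rule kernel_diff[OF testfn_mul_coords[OF tm]])
  then obtain E where E: "\<And>ds. 0 < E ds" "\<And>ds y y' w. (1 + norm w) ^ M * cmod (ft (mul_coords ds m) (y - w) - ft (mul_coords ds m) (y' - w)) \<le> E ds * (1 + norm y + norm y') ^ M * norm (y - y')"
    by metis
  define E' where "E' = (\<Sum>ds\<in>Ds. E ds) + 1"
  have E': "E ds \<le> E'" if "ds \<in> Ds" for ds
    using member_le_sum[OF that, of E] E(1) C(2) by (auto simp: E'_def less_imp_le intro: add_increasing2)
  have E'0: "0 < E'" using E(1) by (simp add: E'_def add_nonneg_pos sum_nonneg less_imp_le)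
  have lip: "cmod (dual_conv T m y - dual_conv T m y') \<le> C * (E' * (1 + norm y + norm y') ^ M * norm (y - y'))" for y y'
  proof -
    define u where "u = (\<lambda>\<xi>. reflect y m \<xi> + (- 1) * reflect y' m \<xi>)"
    have t: "testfn0 (reflect y m)" "testfn0 (\<lambda>\<xi>. (- 1) * reflect y' m \<xi>)" by (intro testfn0_cmult testfn0_reflect m)+
    have u: "testfn0 u" unfolding u_def by (rule testfn0_add[OF t])
    have "dual_conv T m y - dual_conv T m y' = T (ft u)"
      unfolding u_def dual_linear(1)[OF T t] dual_linear(2)[OF T testfn0_reflect[OF m]] by (simp add: dual_conv_reflect[OF tm])
    moreover have "cmod (T (ft u)) \<le> C * (E' * (1 + norm y + norm y') ^ M * norm (y - y'))"
    proof (rule C(3)[OF u], goal_cases)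
      case 2
      show ?case
      proof (intro ballI allI)
        fix ds w assume ds: "ds \<in> Ds"
        have t1: "testfn (mul_coords ds (reflect y m))" by (intro testfn_mul_coords testfn_reflect tm)
        have t2: "testfn (\<lambda>\<xi>. (- 1) * mul_coords ds (reflect y' m) \<xi>)"
          by (intro testfn_mult_right smooth_const testfn_mul_coords testfn_reflect tm)
        have "ft (mul_coords ds u) w = ft (\<lambda>\<xi>. mul_coords ds (reflect y m) \<xi> + (- 1) * mul_coords ds (reflect y' m) \<xi>) w"
          unfolding u_def mul_coords_linear ..
        also have "\<dots> = ft (mul_coords ds (reflect y m)) w + (- 1) * ft (mul_coords ds (reflect y' m)) w"
          by (subst ft_add[OF t1 t2]) (simp only: ft_cmult)
        also have "\<dots> = (- 1) ^ length ds * (ft (mul_coords ds m) (y - w) - ft (mul_coords ds m) (y' - w))"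
          unfolding ft_mul_coords_reflect[OF tm] by (simp add: right_diff_distrib)
        finally have "(1 + norm w) ^ M * cmod (ft (mul_coords ds u) w) \<le> E ds * (1 + norm y + norm y') ^ M * norm (y - y')"
          using E(2)[of w ds y y'] by (simp add: norm_mult norm_power)
        also have "\<dots> \<le> E' * (1 + norm y + norm y') ^ M * norm (y - y')" by (intro mult_right_mono E' ds) auto
        finally show "(1 + norm w) ^ M * cmod (ft (mul_coords ds u) w) \<le> E' * (1 + norm y + norm y') ^ M * norm (y - y')" .
      qed
    qed (use E'0 in auto)
    ultimately show ?thesis by simp
  qed
  have "isCont (dual_conv T m) y" for y
    unfolding isCont_def
  proof (rule Lim_null[THEN iffD2], rule Lim_null_comparison)
    show "\<forall>\<^sub>F z in at y. norm (dual_conv T m z - dual_conv T m y) \<le> C * (E' * (1 + norm z + norm y) ^ M * norm (z - y))"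
      using lip by (intro always_eventually allI)
    have "((\<lambda>z. C * (E' * (1 + norm z + norm y) ^ M * norm (z - y))) \<longlongrightarrow> C * (E' * (1 + norm y + norm y) ^ M * norm (y - y))) (at y)"
      by (intro tendsto_intros)
    then show "((\<lambda>z. C * (E' * (1 + norm z + norm y) ^ M * norm (z - y))) \<longlongrightarrow> 0) (at y)" by simp
  qed
  then show ?thesis by (simp add: continuous_at_imp_continuous_on)
qed

text \<open>The factor 3 anticipates sample points with
  \<open>norm (s i y) \<le> 2 * norm y\<close>, for which
  \<open>1 + norm y + norm (s i y) \<le> 1 + 3 * norm y\<close>.\<close>

lemma ft_shift_weight_integrable:
  fixes m :: "real ^ 'n::finite \<Rightarrow> complex"
  assumes "testfn m"
  shows "integrable lborel (\<lambda>y. cmod (ft m (x - y)) * (1 + 3 * norm y) ^ M)"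
proof -
  obtain C where C: "0 < C" "\<And>z. (1 + norm z) ^ (M + 2 * DIM(real^'n)) * cmod (ft m z) \<le> C" using ft_decay[OF assms] by blast
  have [measurable]: "ft m \<in> borel_measurable borel" by (rule ft_measurable[OF assms])
  have "integrable lborel (\<lambda>z. cmod (ft m z) * (1 + norm z) ^ M)"
    using C(2) by (intro integrable_of_decay[where C = C]) (auto simp: power_add mult_ac abs_mult power_abs)
  then have i: "integrable lborel (\<lambda>y. cmod (ft m (x + (-1) *\<^sub>R y)) * (1 + norm (x + (-1) *\<^sub>R y)) ^ M)"
    by (rule lborel_integrable_affine) simp
  have "integrable lborel (\<lambda>y. (3 * (1 + norm x)) ^ M * (cmod (ft m (x - y)) * (1 + norm (x - y)) ^ M))"
    using i by (intro integrable_mult_right) simp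
  then show ?thesis
  proof (rule Bochner_Integration.integrable_bound)
    show "AE y in lborel. norm (cmod (ft m (x - y)) * (1 + 3 * norm y) ^ M) \<le> norm ((3 * (1 + norm x)) ^ M * (cmod (ft m (x - y)) * (1 + norm (x - y)) ^ M))"
    proof (rule AE_I2)
      fix y
      have "norm y \<le> norm x + norm (x - y)" using norm_triangle_sub[of y x] by (simp add: norm_minus_commute)
      moreover have "0 \<le> norm x * norm (x - y)" by (intro mult_nonneg_nonneg norm_ge_zero)
      moreover have "3 * (1 + norm x) * (1 + norm (x - y)) = 3 + 3 * norm x + 3 * norm (x - y) + 3 * (norm x * norm (x - y))"
        by (simp add: distrib_left distrib_right)
      ultimately have "1 + 3 * norm y \<le> 3 * (1 + norm x) * (1 + norm (x - y))" by linarith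
      then have "(1 + 3 * norm y) ^ M \<le> (3 * (1 + norm x) * (1 + norm (x - y))) ^ M" by (intro power_mono) auto
      then have "cmod (ft m (x - y)) * (1 + 3 * norm y) ^ M \<le> cmod (ft m (x - y)) * (3 * (1 + norm x) * (1 + norm (x - y))) ^ M"
        by (intro mult_left_mono) auto
      then show "norm (cmod (ft m (x - y)) * (1 + 3 * norm y) ^ M) \<le> norm ((3 * (1 + norm x)) ^ M * (cmod (ft m (x - y)) * (1 + norm (x - y)) ^ M))"
        by (simp add: power_mult_distrib abs_mult power_abs mult_ac)
    qed
  qed measurable
qed

text \<open>The functional is exchanged with the integral by sampling only the second kernel at the
  points of simple functions converging to the identity.\<close>

lemma dual_exchange:
  fixes T :: "(real ^ 'n::finite \<Rightarrow> complex) \<Rightarrow> complex"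
  assumes T: "T \<in> schwartz_inf_dual" and m1: "testfn m1" and m2: "testfn0 m2"
  shows "of_real (inv_const TYPE('n)) * dual_conv T (\<lambda>\<xi>. m1 \<xi> * m2 \<xi>) x = (\<integral>y. ft m1 (x - y) * dual_conv T m2 y \<partial>lborel)"
proof -
  define c where "c = complex_of_real (inv_const TYPE('n))"
  define K where "K y = ft m1 (x - y)" for y
  define g where "g = dual_conv T m2"
  define m where "m = (\<lambda>\<xi>. m1 \<xi> * m2 \<xi>)"
  have tm2: "testfn m2" by (rule testfn0_testfn[OF m2])
  have m: "testfn0 m" unfolding m_def using m1 m2 by (intro testfn0_mult_right) (auto simp: testfn_def)
  have tm: "testfn m" by (rule testfn0_testfn[OF m])
  have [measurable]: "ft m1 \<in> borel_measurable borel" by (rule ft_measurable[OF m1])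
  have [measurable]: "K \<in> borel_measurable borel" unfolding K_def by measurable
  have cube_const: "continuous_on UNIV g" unfolding g_def by (rule dual_conv_continuous[OF T m2])
  have [measurable]: "g \<in> borel_measurable borel" by (rule borel_measurable_continuous_onI[OF cube_const])
  have Kint: "integrable lborel K" unfolding K_def
    using lborel_integrable_affine[OF ft_integrable[OF m1], of "-1" x] by simp
  obtain s :: "nat \<Rightarrow> real ^ 'n \<Rightarrow> real ^ 'n" where s: "\<And>i. simple_function lborel (s i)" "\<And>y. (\<lambda>i. s i y) \<longlonglongrightarrow> y" "\<And>i y. norm (s i y) \<le> 2 * norm y"
  proof -
    have "(\<lambda>y :: real ^ 'n. y) \<in> borel_measurable lborel" by simp
    from borel_measurable_implies_sequence_metric[OF this, of 0] show ?thesis using that by (auto simp: dist_norm)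
  qed
  have [measurable]: "s i \<in> borel_measurable borel" for i using borel_measurable_simple_function[OF s(1)] by simp
  define cut where "cut i y = (if norm y \<le> real i then 1 else 0 :: complex)" for i :: nat and y :: "real ^ 'n"
  have [measurable]: "cut i \<in> borel_measurable borel" for i unfolding cut_def by measurable
  define R where "R i = s i ` UNIV" for i
  have finR: "finite (R i)" for i using s(1)[of i] by (simp add: R_def simple_function_def)
  \<comment> \<open>The exact mass of the first kernel on the part of the ball of radius
    \<open>i\<close> sampled at \<open>p\<close>; by \<open>dF\<close> the finite sums over
    \<open>p\<close> are again integrals against \<open>K\<close>.\<close>
  define d where "d i p = (\<integral>y. cut i y * (if s i y = p then 1 else 0) * K y \<partial>lborel)" for i p
  have dF: "(\<Sum>p\<in>R i. d i p * F p) = (\<integral>y. cut i y * K y * F (s i y) \<partial>lborel)" for i and F :: "real ^ 'n \<Rightarrow> complex"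
  proof -
    have int: "integrable lborel (\<lambda>y. cut i y * (if s i y = p then 1 else 0) * K y * F p)" for p
    proof (rule Bochner_Integration.integrable_bound)
      show "integrable lborel (\<lambda>y. cmod (K y) * cmod (F p))" using Kint by auto
      show "AE y in lborel. norm (cut i y * (if s i y = p then 1 else 0) * K y * F p) \<le> norm (cmod (K y) * cmod (F p))"
        by (rule AE_I2) (simp add: cut_def norm_mult)
    qed measurable
    have "(\<Sum>p\<in>R i. d i p * F p) = (\<Sum>p\<in>R i. \<integral>y. cut i y * (if s i y = p then 1 else 0) * K y * F p \<partial>lborel)"
      unfolding d_def by simp
    also have "\<dots> = (\<integral>y. (\<Sum>p\<in>R i. cut i y * (if s i y = p then 1 else 0) * K y * F p) \<partial>lborel)"
      using int by (intro Bochner_Integration.integral_sum[symmetric]) auto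
    also have "\<dots> = (\<integral>y. cut i y * K y * F (s i y) \<partial>lborel)"
    proof (intro Bochner_Integration.integral_cong refl)
      fix y
      have "(\<Sum>p\<in>R i. cut i y * (if s i y = p then 1 else 0) * K y * F p) = (\<Sum>p\<in>R i. if p = s i y then cut i y * K y * F p else 0)"
        by (intro sum.cong) auto
      also have "\<dots> = cut i y * K y * F (s i y)" using finR[of i] by (simp add: R_def)
      finally show "(\<Sum>p\<in>R i. cut i y * (if s i y = p then 1 else 0) * K y * F p) = cut i y * K y * F (s i y)" .
    qed
    finally show ?thesis .
  qed
  obtain C M Ds where C: "0 < C" "finite Ds" "\<And>m B. testfn0 m \<Longrightarrow> 0 \<le> B \<Longrightarrow>
    (\<forall>ds\<in>Ds. \<forall>w. (1 + norm w) ^ M * cmod (ft (mul_coords ds m) w) \<le> B) \<Longrightarrow> cmod (T (ft m)) \<le> C * B"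
    using dual_bound[OF T] by blast
  have "\<exists>E>0. \<forall>y w. (1 + norm w) ^ M * cmod (ft (mul_coords ds m2) (y - w)) \<le> E * (1 + norm y) ^ M" for ds
    by (rule kernel_weight[OF testfn_mul_coords[OF tm2]])
  then obtain E1 where E1: "\<And>ds. 0 < E1 ds" "\<And>ds y w. (1 + norm w) ^ M * cmod (ft (mul_coords ds m2) (y - w)) \<le> E1 ds * (1 + norm y) ^ M" by metis
  have "\<exists>E>0. \<forall>y y' w. (1 + norm w) ^ M * cmod (ft (mul_coords ds m2) (y - w) - ft (mul_coords ds m2) (y' - w)) \<le> E * (1 + norm y + norm y') ^ M * norm (y - y')" for ds
    by (rule kernel_diff[OF testfn_mul_coords[OF tm2]])
  then obtain E2 where E2: "\<And>ds. 0 < E2 ds" "\<And>ds y y' w. (1 + norm w) ^ M * cmod (ft (mul_coords ds m2) (y - w) - ft (mul_coords ds m2) (y' - w)) \<le> E2 ds * (1 + norm y + norm y') ^ M * norm (y - y')"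
    by metis
  define E where "E = (\<Sum>ds\<in>Ds. E1 ds + E2 ds)"
  have E0: "0 \<le> E" unfolding E_def using E1(1) E2(1) by (intro sum_nonneg add_nonneg_nonneg) (auto simp: less_imp_le)
  have E: "E1 ds \<le> E" "E2 ds \<le> E" if "ds \<in> Ds" for ds
  proof -
    have "E1 ds + E2 ds \<le> E" unfolding E_def
      using that C(2) E1(1) E2(1) by (intro member_le_sum) (auto simp: less_imp_le intro: add_nonneg_nonneg)
    then show "E1 ds \<le> E" "E2 ds \<le> E" using E1(1)[of ds] E2(1)[of ds] by linarith+
  qed
  \<comment> \<open>A majorant, uniform in \<open>w\<close>, of the pointwise sampling error: the
    increment of the second kernel in the ball of radius \<open>i\<close>, and the whole kernel
    outside, where nothing is sampled.\<close>
  define \<theta> where "\<theta> i y = E * (1 + 3 * norm y) ^ M * (if norm y \<le> real i then norm (y - s i y) else 1)" for i :: nat and y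
  have [measurable]: "\<theta> i \<in> borel_measurable borel" for i unfolding \<theta>_def by measurable
  have \<theta>0: "0 \<le> \<theta> i y" for i y using E0 by (simp add: \<theta>_def)
  have \<theta>le: "\<theta> i y \<le> E * (1 + 3 * norm y) ^ (M + 1)" for i y
  proof -
    have "norm (y - s i y) \<le> 3 * norm y" using norm_triangle_ineq4[of y "s i y"] s(3)[of i y] by linarith
    then have "(if norm y \<le> real i then norm (y - s i y) else 1) \<le> 1 + 3 * norm y" by auto
    then have "E * (1 + 3 * norm y) ^ M * (if norm y \<le> real i then norm (y - s i y) else 1) \<le> E * (1 + 3 * norm y) ^ M * (1 + 3 * norm y)"
      using E0 by (intro mult_left_mono) auto
    then show ?thesis by (simp add: \<theta>_def mult_ac)
  qed
  have ptw: "(1 + norm w) ^ M * cmod (ft (mul_coords ds m2) (y - w) - cut i y * ft (mul_coords ds m2) (s i y - w)) \<le> \<theta> i y" if ds: "ds \<in> Ds" for ds w i y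
  proof (cases "norm y \<le> real i")
    case True
    have "(1 + norm w) ^ M * cmod (ft (mul_coords ds m2) (y - w) - ft (mul_coords ds m2) (s i y - w)) \<le> E2 ds * (1 + norm y + norm (s i y)) ^ M * norm (y - s i y)"
      by (rule E2(2))
    also have "\<dots> \<le> E * (1 + 3 * norm y) ^ M * norm (y - s i y)"
      using E(2)[OF ds] E0 s(3)[of i y] by (intro mult_right_mono mult_mono power_mono) auto
    finally show ?thesis using True by (simp add: cut_def \<theta>_def)
  next
    case False
    have "(1 + norm w) ^ M * cmod (ft (mul_coords ds m2) (y - w)) \<le> E1 ds * (1 + norm y) ^ M" by (rule E1(2))
    also have "\<dots> \<le> E * (1 + 3 * norm y) ^ M" using E(1)[OF ds] E0 by (intro mult_mono power_mono) auto
    finally show ?thesis using False by (simp add: cut_def \<theta>_def)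
  qed
  have dom: "integrable lborel (\<lambda>y. cmod (K y) * (E * (1 + 3 * norm y) ^ (M + 1)))"
    using ft_shift_weight_integrable[OF m1, of x "M + 1", THEN integrable_mult_right[where c = E]]
    by (simp only: K_def mult_ac)
  have \<theta>int: "integrable lborel (\<lambda>y. cmod (K y) * \<theta> i y)" for i
  proof (rule Bochner_Integration.integrable_bound[OF dom])
    show "AE y in lborel. norm (cmod (K y) * \<theta> i y) \<le> norm (cmod (K y) * (E * (1 + 3 * norm y) ^ (M + 1)))"
    proof (rule AE_I2)
      fix y
      have "cmod (K y) * \<theta> i y \<le> cmod (K y) * (E * (1 + 3 * norm y) ^ (M + 1))"
        by (intro mult_left_mono \<theta>le) auto
      then show "norm (cmod (K y) * \<theta> i y) \<le> norm (cmod (K y) * (E * (1 + 3 * norm y) ^ (M + 1)))"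
        using \<theta>0[of i y] E0 by (simp add: abs_mult)
    qed
  qed measurable
  define B where "B i = (\<integral>y. cmod (K y) * \<theta> i y \<partial>lborel)" for i
  have B0: "0 \<le> B i" for i unfolding B_def using \<theta>0 by (intro Bochner_Integration.integral_nonneg) auto
  have "(\<lambda>i. \<integral>y. cmod (K y) * \<theta> i y \<partial>lborel) \<longlonglongrightarrow> (\<integral>y. 0 \<partial>(lborel :: (real ^ 'n) measure))"
  proof (rule integral_dominated_convergence[OF _ _ dom])
    show "AE y in lborel. (\<lambda>i. cmod (K y) * \<theta> i y) \<longlonglongrightarrow> 0"
    proof (rule AE_I2)
      fix y
      have "(\<lambda>i. cmod (K y) * (E * (1 + 3 * norm y) ^ M * norm (y - s i y))) \<longlonglongrightarrow> cmod (K y) * (E * (1 + 3 * norm y) ^ M * norm (y - y))"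
        by (intro tendsto_intros s(2))
      moreover have "\<forall>\<^sub>F i in sequentially. cmod (K y) * (E * (1 + 3 * norm y) ^ M * norm (y - s i y)) = cmod (K y) * \<theta> i y"
        using eventually_ge_at_top[of "nat \<lceil>norm y\<rceil>"] by eventually_elim (auto simp: \<theta>_def)
      ultimately have "(\<lambda>i. cmod (K y) * \<theta> i y) \<longlonglongrightarrow> cmod (K y) * (E * (1 + 3 * norm y) ^ M * norm (y - y))"
        by (rule Lim_transform_eventually)
      then show "(\<lambda>i. cmod (K y) * \<theta> i y) \<longlonglongrightarrow> 0" by simp
    qed
    show "AE y in lborel. norm (cmod (K y) * \<theta> i y) \<le> cmod (K y) * (E * (1 + 3 * norm y) ^ (M + 1))" for i
      using mult_left_mono[OF \<theta>le norm_ge_zero] \<theta>0 E0 by (intro AE_I2) (simp add: abs_mult)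
  qed measurable
  then have Blim: "B \<longlonglongrightarrow> 0" unfolding B_def by simp
  \<comment> \<open>The exact kernel and the sampled sum combine into the transform of one test
    function \<open>u\<close>. The seminorm bound reduces the claim to a weighted estimate uniform
    in \<open>w\<close>, and integrating the pointwise errors gives \<open>B i\<close>.\<close>
  have TB: "cmod (c * dual_conv T m x - (\<Sum>p\<in>R i. d i p * g p)) \<le> C * B i" for i
  proof -
    define u where "u = (\<lambda>\<xi>. c * reflect x m \<xi> + (\<Sum>p\<in>R i. (- d i p) * reflect p m2 \<xi>))"
    have t: "testfn0 (\<lambda>\<xi>. c * reflect x m \<xi>)" "testfn0 (\<lambda>\<xi>. \<Sum>p\<in>R i. (- d i p) * reflect p m2 \<xi>)"
      by (intro testfn0_cmult testfn0_sum testfn0_reflect finR m m2)+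
    have u: "testfn0 u" unfolding u_def by (rule testfn0_add[OF t])
    have "T (ft u) = c * T (ft (reflect x m)) + (\<Sum>p\<in>R i. (- d i p) * T (ft (reflect p m2)))"
      unfolding u_def dual_linear(1)[OF T t] dual_linear(2)[OF T testfn0_reflect[OF m]]
      by (subst dual_sum[OF T finR]) (auto intro: testfn0_reflect[OF m2])
    then have Tu: "T (ft u) = c * dual_conv T m x - (\<Sum>p\<in>R i. d i p * g p)"
      by (simp add: g_def dual_conv_reflect[OF tm] dual_conv_reflect[OF tm2] sum_negf)
    have "cmod (T (ft u)) \<le> C * B i"
    proof (rule C(3)[OF u B0], intro ballI allI)
      fix ds w assume ds: "ds \<in> Ds"
      define K2 where "K2 = ft (mul_coords ds m2)"
      have [measurable]: "K2 \<in> borel_measurable borel" unfolding K2_def by (intro ft_measurable testfn_mul_coords tm2)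
      have tt: "testfn (\<lambda>\<xi>. c * mul_coords ds (reflect x m) \<xi>)" "\<And>p. testfn (\<lambda>\<xi>. (- d i p) * mul_coords ds (reflect p m2) \<xi>)"
        by (intro testfn_mult_right smooth_const testfn_mul_coords testfn_reflect tm tm2)+
      have "ft (mul_coords ds u) w = ft (\<lambda>\<xi>. c * mul_coords ds (reflect x m) \<xi> + (\<Sum>p\<in>R i. (- d i p) * mul_coords ds (reflect p m2) \<xi>)) w"
        unfolding u_def mul_coords_linear ..
      also have "\<dots> = c * ft (mul_coords ds (reflect x m)) w + (\<Sum>p\<in>R i. (- d i p) * ft (mul_coords ds (reflect p m2)) w)"
      proof -
        have "testfn (\<lambda>\<xi>. \<Sum>p\<in>R i. (- d i p) * mul_coords ds (reflect p m2) \<xi>)"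
          using t(2) testfn_mul_coords[OF testfn0_testfn[OF t(2)], of ds] unfolding mul_coords_linear by simp
        then show ?thesis by (subst ft_add[OF tt(1)]) (simp_all only: ft_sum[OF tt(2)] ft_cmult)
      qed
      also have "\<dots> = (- 1) ^ length ds * (c * ft (mul_coords ds m) (x - w) - (\<Sum>p\<in>R i. d i p * K2 (p - w)))"
        unfolding ft_mul_coords_reflect[OF tm] ft_mul_coords_reflect[OF tm2] K2_def
        by (simp add: sum_distrib_left right_diff_distrib sum_negf mult_ac)
      also have "c * ft (mul_coords ds m) (x - w) = (\<integral>y. K y * K2 (y - w) \<partial>lborel)"
      proof -
        have "mul_coords ds m = (\<lambda>\<xi>. m1 \<xi> * mul_coords ds m2 \<xi>)"
          unfolding m_def by (rule ext) (subst mul_coords_eq, subst (2) mul_coords_eq, simp)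
        then show ?thesis using ft_convolution[OF m1 testfn_mul_coords[OF tm2], of x ds w] by (simp add: K_def K2_def c_def)
      qed
      also have "(\<Sum>p\<in>R i. d i p * K2 (p - w)) = (\<integral>y. cut i y * K y * K2 (s i y - w) \<partial>lborel)" by (rule dF)
      finally have eq: "cmod (ft (mul_coords ds u) w) = cmod ((\<integral>y. K y * K2 (y - w) \<partial>lborel) - (\<integral>y. cut i y * K y * K2 (s i y - w) \<partial>lborel))"
        by (simp add: norm_mult norm_power)
      obtain b where b: "\<And>z. cmod (K2 z) \<le> b" unfolding K2_def using ft_norm_le by blast
      have i1: "integrable lborel (\<lambda>y. K y * K2 (y - w))" "integrable lborel (\<lambda>y. cut i y * K y * K2 (s i y - w))"
      proof -
        have ib: "integrable lborel (\<lambda>y. cmod (K y) * b)" using Kint by auto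
        have bb: "cmod (K y) * cmod (K2 z) \<le> cmod (K y) * \<bar>b\<bar>" for y z using b[of z] by (intro mult_left_mono) auto
        show "integrable lborel (\<lambda>y. K y * K2 (y - w))"
          by (rule Bochner_Integration.integrable_bound[OF ib]) (auto simp: norm_mult abs_mult bb)
        show "integrable lborel (\<lambda>y. cut i y * K y * K2 (s i y - w))"
          by (rule Bochner_Integration.integrable_bound[OF ib]) (auto simp: norm_mult abs_mult bb cut_def)
      qed
      have "(1 + norm w) ^ M * cmod (ft (mul_coords ds u) w) = cmod (\<integral>y. (1 + norm w) ^ M *\<^sub>R (K y * (K2 (y - w) - cut i y * K2 (s i y - w))) \<partial>lborel)"
        unfolding eq using i1 by (simp add: Bochner_Integration.integral_diff[symmetric] right_diff_distrib mult_ac del: Bochner_Integration.integral_diff)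
      also have "\<dots> \<le> B i" unfolding B_def
      proof (rule integral_norm_le[OF _ \<theta>int])
        show "integrable lborel (\<lambda>y. (1 + norm w) ^ M *\<^sub>R (K y * (K2 (y - w) - cut i y * K2 (s i y - w))))"
          using i1 by (auto simp: right_diff_distrib mult_ac)
        fix y
        have "cmod (K y) * ((1 + norm w) ^ M * cmod (K2 (y - w) - cut i y * K2 (s i y - w))) \<le> cmod (K y) * \<theta> i y"
          unfolding K2_def by (intro mult_left_mono ptw ds) auto
        then show "cmod ((1 + norm w) ^ M *\<^sub>R (K y * (K2 (y - w) - cut i y * K2 (s i y - w)))) \<le> cmod (K y) * \<theta> i y"
          by (simp add: norm_mult mult_ac)
      qed
      finally show "(1 + norm w) ^ M * cmod (ft (mul_coords ds u) w) \<le> B i" .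
    qed
    then show ?thesis by (simp add: Tu)
  qed
  have "(\<lambda>i. c * dual_conv T m x - (\<Sum>p\<in>R i. d i p * g p)) \<longlonglongrightarrow> 0"
  proof (rule Lim_null_comparison)
    show "(\<lambda>i. C * B i) \<longlonglongrightarrow> 0" using tendsto_mult_right_zero[OF Blim, of C] .
  qed (use TB in \<open>auto intro: always_eventually\<close>)
  then have lim1: "(\<lambda>i. \<Sum>p\<in>R i. d i p * g p) \<longlonglongrightarrow> c * dual_conv T m x"
    using Lim_null[of "\<lambda>i. \<Sum>p\<in>R i. d i p * g p" "c * dual_conv T m x" sequentially] tendsto_minus_cancel_left[of "\<lambda>i. c * dual_conv T m x - (\<Sum>p\<in>R i. d i p * g p)" 0 sequentially] by simp
  obtain C' M' where g': "0 < C'" "\<And>y. cmod (g y) \<le> C' * (1 + norm y) ^ M'" unfolding g_def using dual_conv_growth[OF T m2] by blast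
  have "(\<lambda>i. \<integral>y. cut i y * K y * g (s i y) \<partial>lborel) \<longlonglongrightarrow> (\<integral>y. K y * g y \<partial>lborel)"
  proof (rule integral_dominated_convergence)
    show "integrable lborel (\<lambda>y. cmod (K y) * (C' * (1 + 3 * norm y) ^ M'))"
      using ft_shift_weight_integrable[OF m1, of x "M'", THEN integrable_mult_right[where c = C']] by (simp only: K_def mult_ac)
    show "AE y in lborel. (\<lambda>i. cut i y * K y * g (s i y)) \<longlonglongrightarrow> K y * g y"
    proof (rule AE_I2)
      fix y
      have "(\<lambda>i. g (s i y)) \<longlonglongrightarrow> g y" using continuous_on_tendsto_compose[OF cube_const s(2)] by auto
      then have "(\<lambda>i. K y * g (s i y)) \<longlonglongrightarrow> K y * g y" by (rule tendsto_mult_left)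
      moreover have "\<forall>\<^sub>F i in sequentially. K y * g (s i y) = cut i y * K y * g (s i y)"
        using eventually_ge_at_top[of "nat \<lceil>norm y\<rceil>"] by eventually_elim (auto simp: cut_def)
      ultimately show "(\<lambda>i. cut i y * K y * g (s i y)) \<longlonglongrightarrow> K y * g y" by (rule Lim_transform_eventually)
    qed
    show "AE y in lborel. norm (cut i y * K y * g (s i y)) \<le> cmod (K y) * (C' * (1 + 3 * norm y) ^ M')" for i
    proof (rule AE_I2)
      fix y
      have s3: "norm (s i y) \<le> 3 * norm y" using s(3)[of i y] norm_ge_zero[of y] by linarith
      have "cmod (g (s i y)) \<le> C' * (1 + norm (s i y)) ^ M'" by (rule g')
      also have "\<dots> \<le> C' * (1 + 3 * norm y) ^ M'" using g'(1) s3 by (intro mult_left_mono power_mono) auto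
      finally have "cmod (K y) * cmod (g (s i y)) \<le> cmod (K y) * (C' * (1 + 3 * norm y) ^ M')" by (intro mult_left_mono) auto
      then show "norm (cut i y * K y * g (s i y)) \<le> cmod (K y) * (C' * (1 + 3 * norm y) ^ M')"
        using g'(1) by (simp add: cut_def norm_mult)
    qed
  qed measurable
  then have "(\<lambda>i. \<Sum>p\<in>R i. d i p * g p) \<longlonglongrightarrow> (\<integral>y. K y * g y \<partial>lborel)" unfolding dF .
  from LIMSEQ_unique[OF lim1 this] show ?thesis by (simp add: c_def K_def g_def m_def)
qed

subsection \<open>Fourier multipliers and their decomposition\<close>

text \<open>The factor \<open>(2 * pi) powr (- (real CARD('n) / 2))\<close> enters twice, through
  the inverse transform and through the definition of the multiplier.\<close>

lemma fourier_multiplier_eq_dual_conv: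
  fixes m :: "real ^ 'n::finite \<Rightarrow> complex"
  assumes T: "T \<in> schwartz_inf_dual" and m: "testfn0 m"
  shows "fourier_multiplier m T x = of_real ((2 * pi) powr (- real CARD('n))) * dual_conv T m x"
proof -
  define c where "c = (2 * pi) powr (- (real CARD('n) / 2))"
  have tm: "testfn m" by (rule testfn0_testfn[OF m])
  have "inv_fourier m w = of_real c * ft m w" for w by (simp add: inv_fourier_def ft_def c_def)
  then have "(\<lambda>y. inv_fourier m (x - y)) = ft (\<lambda>\<xi>. of_real c * reflect x m \<xi>)"
    by (simp add: fun_eq_iff ft_cmult ft_reflect[OF tm])
  then have "fourier_multiplier m T x = of_real c * (of_real c * T (ft (reflect x m)))"
    by (simp add: fourier_multiplier_def c_def dual_linear(2)[OF T testfn0_reflect[OF m]])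
  moreover have "c * c = (2 * pi) powr (- real CARD('n))" by (simp add: c_def flip: powr_add)
  ultimately show ?thesis by (simp add: dual_conv_reflect[OF tm] flip: mult.assoc of_real_mult)
qed

lemma fourier_multiplier_growth:
  fixes m :: "real ^ 'n::finite \<Rightarrow> complex"
  assumes T: "T \<in> schwartz_inf_dual" and m: "testfn0 m"
  shows "\<exists>H M. \<forall>y. cmod (fourier_multiplier m T y) \<le> H * (1 + norm y) powr M"
proof -
  obtain C M where C: "\<And>y. cmod (dual_conv T m y) \<le> C * (1 + norm y) ^ M" using dual_conv_growth[OF T m] by blast
  have "cmod (fourier_multiplier m T y) \<le> ((2 * pi) powr (- real CARD('n)) * C) * (1 + norm y) powr real M" for y
  proof -
    have "0 < 1 + norm y" by (simp add: add_pos_nonneg)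
    then have "(1 + norm y) powr real M = (1 + norm y) ^ M" by (rule powr_realpow)
    moreover have "(2 * pi) powr (- real CARD('n)) * cmod (dual_conv T m y) \<le> (2 * pi) powr (- real CARD('n)) * (C * (1 + norm y) ^ M)"
      by (intro mult_left_mono C) auto
    ultimately show ?thesis by (simp add: fourier_multiplier_eq_dual_conv[OF T m] norm_mult mult.assoc)
  qed
  then show ?thesis by blast
qed

lemma fourier_multiplier_measurable:
  fixes m :: "real ^ 'n::finite \<Rightarrow> complex"
  assumes T: "T \<in> schwartz_inf_dual" and m: "testfn0 m"
  shows "fourier_multiplier m T \<in> borel_measurable borel"
proof -
  have [measurable]: "dual_conv T m \<in> borel_measurable borel"
    by (rule borel_measurable_continuous_onI[OF dual_conv_continuous[OF T m]])
  have "(\<lambda>x. of_real ((2 * pi) powr (- real CARD('n))) * dual_conv T m x) \<in> borel_measurable borel" by measurable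
  then show ?thesis by (simp add: fourier_multiplier_eq_dual_conv[OF T m, abs_def])
qed

lemma fourier_multiplier_sum:
  assumes T: "T \<in> schwartz_inf_dual" and "finite A" and f: "\<And>a. a \<in> A \<Longrightarrow> testfn0 (f a)"
  shows "fourier_multiplier (\<lambda>\<xi>. \<Sum>a\<in>A. f a \<xi>) T x = (\<Sum>a\<in>A. fourier_multiplier (f a) T x)"
proof -
  have s: "testfn0 (\<lambda>\<xi>. \<Sum>a\<in>A. f a \<xi>)" by (rule testfn0_sum[OF assms(2) f])
  have "dual_conv T (\<lambda>\<xi>. \<Sum>a\<in>A. f a \<xi>) x = T (ft (\<lambda>\<xi>. \<Sum>a\<in>A. 1 * reflect x (f a) \<xi>))"
    unfolding dual_conv_reflect[OF testfn0_testfn[OF s]]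
    by (intro arg_cong[where f = T] arg_cong[where f = ft] ext) (simp add: reflect_def sum_distrib_right)
  also have "\<dots> = (\<Sum>a\<in>A. dual_conv T (f a) x)"
    using dual_sum[OF T assms(2), of "\<lambda>a. reflect x (f a)" "\<lambda>a. 1"] f by (simp add: dual_conv_reflect testfn0_testfn testfn0_reflect)
  finally show ?thesis
    unfolding fourier_multiplier_eq_dual_conv[OF T s] using f by (simp add: fourier_multiplier_eq_dual_conv[OF T] sum_distrib_left)
qed

text \<open>A product of multipliers acts as convolution of the piece for \<open>m2\<close> with the
  transform of \<open>m1\<close>, up to \<open>inv_const\<close>; the decay of that transform then
  dominates the convolution by an average.\<close>

lemma fourier_multiplier_mult_le:
  fixes m1 m2 :: "real ^ 'n::finite \<Rightarrow> complex"
  assumes T: "T \<in> schwartz_inf_dual" and m1: "testfn m1" and m2: "testfn0 m2"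
    and k: "\<And>y. cmod (ft m1 (x - y)) \<le> C * kern k N x y" and C: "0 \<le> C"
  shows "ennreal (cmod (fourier_multiplier (\<lambda>\<xi>. m1 \<xi> * m2 \<xi>) T x)) \<le>
    ennreal (C / inv_const TYPE('n)) * avg k N (\<lambda>y. ennreal (cmod (fourier_multiplier m2 T y))) x"
proof -
  let ?g = "fourier_multiplier m2 T" and ?i = "inv_const TYPE('n)"
  note i = inv_const_pos[where 'n = 'n]
  have [measurable]: "?g \<in> borel_measurable borel" by (rule fourier_multiplier_measurable[OF T m2])
  have m: "testfn0 (\<lambda>\<xi>. m1 \<xi> * m2 \<xi>)" using m1 m2 by (intro testfn0_mult_right) (auto simp: testfn_def)
  define I where "I = (\<integral>y. ft m1 (x - y) * ?g y \<partial>lborel)"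
  have "I = (\<integral>y. of_real ((2 * pi) powr (- real CARD('n))) * (ft m1 (x - y) * dual_conv T m2 y) \<partial>lborel)"
    unfolding I_def fourier_multiplier_eq_dual_conv[OF T m2] by (simp add: mult_ac)
  also have "\<dots> = of_real ?i * fourier_multiplier (\<lambda>\<xi>. m1 \<xi> * m2 \<xi>) T x"
    unfolding fourier_multiplier_eq_dual_conv[OF T m] integral_mult_right_zero dual_exchange[OF T m1 m2, symmetric]
    by (simp only: mult_ac)
  finally have I: "cmod (fourier_multiplier (\<lambda>\<xi>. m1 \<xi> * m2 \<xi>) T x) = cmod I / ?i"
    using i by (simp add: norm_mult)
  \<comment> \<open>The Bochner integral of a function that is not integrable is 0, so the bound
    holds in either case.\<close>
  have "ennreal (cmod I) \<le> (\<integral>\<^sup>+y. ennreal (cmod (ft m1 (x - y) * ?g y)) \<partial>lborel)"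
    unfolding I_def using integral_norm_bound_ennreal not_integrable_integral_eq
    by (cases "integrable lborel (\<lambda>y. ft m1 (x - y) * ?g y)") fastforce+
  also have "\<dots> \<le> (\<integral>\<^sup>+y. ennreal C * (ennreal (kern k N x y) * ennreal (cmod (?g y))) \<partial>lborel)"
  proof (intro nn_integral_mono)
    fix y
    have "cmod (ft m1 (x - y) * ?g y) \<le> C * kern k N x y * cmod (?g y)"
      unfolding norm_mult by (intro mult_right_mono k) auto
    then have "ennreal (cmod (ft m1 (x - y) * ?g y)) \<le> ennreal (C * kern k N x y * cmod (?g y))" by (rule ennreal_leI)
    also have "\<dots> = ennreal C * (ennreal (kern k N x y) * ennreal (cmod (?g y)))"
      using C by (simp add: ennreal_mult mult.assoc)
    finally show "ennreal (cmod (ft m1 (x - y) * ?g y)) \<le> ennreal C * (ennreal (kern k N x y) * ennreal (cmod (?g y)))" .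
  qed
  also have "\<dots> = ennreal C * avg k N (\<lambda>y. ennreal (cmod (?g y))) x"
    unfolding avg_def by (subst nn_integral_cmult) auto
  finally have "ennreal (1 / ?i) * ennreal (cmod I) \<le> ennreal (1 / ?i) * (ennreal C * avg k N (\<lambda>y. ennreal (cmod (?g y))) x)"
    by (intro mult_left_mono) auto
  moreover have "ennreal (1 / ?i) * ennreal (cmod I) = ennreal (cmod I / ?i)"
    using i by (subst ennreal_mult[symmetric]) auto
  moreover have "ennreal (C / ?i) = ennreal (1 / ?i) * ennreal C"
    using i C by (subst ennreal_mult[symmetric]) auto
  ultimately show ?thesis unfolding I by (simp add: mult.assoc)
qed

lemma dilate_add: "dilate i (dilate j m) = dilate (i + j) m"
  by (simp add: dilate_def fun_eq_iff powi_powr mult.commute flip: powr_add)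

lemma dilate_zero [simp]: "dilate 0 m = m"
  by (simp add: dilate_def fun_eq_iff)

lemma testfn_dilate: "testfn m \<Longrightarrow> testfn (dilate j m)"
  using testfn_affine[of m "2 powi (-j)" 0] by (simp add: dilate_def[abs_def])

lemma testfn0_dilate: "testfn0 m \<Longrightarrow> testfn0 (dilate j m)"
  using affine_supp[of 0 m "2 powi (-j)" 0] testfn_dilate[of m j] by (auto simp: testfn0_def dilate_def[abs_def])

text \<open>Dilating the frequencies by \<open>2 powr j\<close> contracts the kernel to the length
  \<open>2 powr - j\<close>, so a single decay constant of \<open>ft m\<close> serves all
  scales.\<close>

lemma ft_dilate_le_kern:
  fixes m :: "real ^ 'n::finite \<Rightarrow> complex"
  assumes m: "testfn m" and N: "0 \<le> N"
  shows "\<exists>C>0. \<forall>j x y. cmod (ft (dilate j m) (x - y)) \<le> C * kern j N x y"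
proof -
  obtain C where C: "0 < C" "\<And>z. (1 + norm z) ^ nat \<lceil>N\<rceil> * cmod (ft m z) \<le> C" using ft_decay[OF m] by blast
  have "cmod (ft (dilate j m) (x - y)) \<le> C * kern j N x y" for j x y
  proof -
    define c where "c = (2::real) powr real_of_int j"
    have c: "0 < c" by (simp add: c_def)
    have "(\<lambda>\<xi>. dilate j m (c *\<^sub>R \<xi>)) = m" by (simp add: dilate_def c_def powi_powr powr_minus fun_eq_iff)
    then have e: "ft (dilate j m) (x - y) = c ^ CARD('n) *\<^sub>R ft m (c *\<^sub>R (x - y))"
      using ft_scale[of "dilate j m" c "x - y"] testfn_dilate[OF m, of j] c by (auto simp: testfn_def intro: smooth_measurable)
    define z where "z = c *\<^sub>R (x - y)"
    have d: "sdist j x y = 1 + norm z" using c by (simp add: sdist_def z_def c_def dist_norm)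
    have "(1 + norm z) powr N \<le> (1 + norm z) powr real (nat \<lceil>N\<rceil>)" by (intro powr_mono) (auto simp: of_nat_ceiling)
    also have "\<dots> = (1 + norm z) ^ nat \<lceil>N\<rceil>" by (intro powr_realpow) (simp add: add_pos_nonneg)
    finally have "(1 + norm z) powr N * cmod (ft m z) \<le> C"
      by (intro order_trans[OF mult_right_mono C(2)]) auto
    moreover have "0 < (1 + norm z) powr N" by (smt (verit) norm_ge_zero powr_gt_zero)
    ultimately have "cmod (ft m z) \<le> C * (1 + norm z) powr (- N)" by (simp add: powr_minus field_simps)
    then have "c ^ CARD('n) * cmod (ft m z) \<le> c ^ CARD('n) * (C * (1 + norm z) powr (- N))"
      using c by (intro mult_left_mono) auto
    moreover have "c ^ CARD('n) = 2 powr (real_of_int j * real CARD('n))"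
      using c by (simp add: c_def powr_powr flip: powr_realpow)
    ultimately show ?thesis using c unfolding e z_def[symmetric] by (simp add: kern_def d mult_ac)
  qed
  with C(1) show ?thesis by blast
qed

section \<open>Cutoff functions\<close>

definition bump :: "(real ^ 'n::finite \<Rightarrow> real) \<Rightarrow> bool"
  where "bump h \<longleftrightarrow> testfn (\<lambda>x. of_real (h x)) \<and> (\<forall>x. 0 \<le> h x)"

lemma bump_open: "bump h \<Longrightarrow> open {x. 0 < h x}"
proof -
  assume h: "bump h"
  then have "continuous_on UNIV (\<lambda>x. complex_of_real (h x))" by (intro smooth_continuous_on) (simp add: bump_def testfn_def)
  then have "open {x. complex_of_real (h x) \<noteq> 0}" by (rule open_Collect_neq) (rule continuous_on_const)
  moreover have "{x. complex_of_real (h x) \<noteq> 0} = {x. 0 < h x}" using h by (auto simp: bump_def order_less_le)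
  ultimately show ?thesis by simp
qed

lemma bump_sum:
  "finite A \<Longrightarrow> (\<And>a. a \<in> A \<Longrightarrow> bump (h a)) \<Longrightarrow> bump (\<lambda>x. \<Sum>a\<in>A. h a x)"
proof (induction A rule: finite_induct)
  case empty
  then show ?case using testfn0_testfn[OF testfn0_zero] by (simp add: bump_def)
next
  case (insert a A)
  then show ?case using testfn_add[of "\<lambda>x. complex_of_real (h a x)" "\<lambda>x. complex_of_real (\<Sum>a\<in>A. h a x)"] by (auto simp: bump_def)
qed

lemma bump_cmod_square: "testfn m \<Longrightarrow> bump (\<lambda>x. (cmod (m x))\<^sup>2)"
  using testfn_mult_left[of m "\<lambda>x. cnj (m x)"] smooth_cnj[of m] by (simp add: bump_def testfn_def flip: complex_norm_square)

text \<open>No explicit bump is written down: the squared modulus of a given nonzero test function,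
  contracted about a point where it does not vanish and moved to \<open>x0\<close>, has the required
  properties.\<close>

lemma bump_ball:
  fixes m :: "real ^ 'n::finite \<Rightarrow> complex"
  assumes m: "testfn m" and p: "m p \<noteq> 0" and \<epsilon>: "0 < \<epsilon>"
  shows "\<exists>h :: real ^ 'n \<Rightarrow> real. bump h \<and> 0 < h x0 \<and> (\<forall>x. \<epsilon> \<le> dist x0 x \<longrightarrow> h x = 0)"
proof -
  have "bounded (supp m)" using m by (auto simp: testfn_def compact_imp_bounded)
  then obtain R where R: "0 < R" "\<And>x. x \<in> supp m \<Longrightarrow> norm x \<le> R" using bounded_pos by blast
  \<comment> \<open>Since \<open>b * \<epsilon>\<close> exceeds \<open>R + norm p\<close>, points at
    distance at least \<epsilon> from \<open>x0\<close> are mapped outside the support of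
    \<open>m\<close>.\<close>
  define b where "b = (R + norm p + 1) / \<epsilon>"
  have b: "0 < b" using R(1) \<epsilon> by (simp add: b_def add_pos_nonneg)
  define h where "h x = (cmod (m (b *\<^sub>R x + (p - b *\<^sub>R x0))))\<^sup>2" for x
  have "bump h" unfolding h_def[abs_def] using b by (intro bump_cmod_square testfn_affine[OF m]) auto
  moreover have "0 < h x0" using p by (simp add: h_def)
  moreover have "h x = 0" if "\<epsilon> \<le> dist x0 x" for x
  proof (rule ccontr)
    assume "h x \<noteq> 0"
    then have "b *\<^sub>R x + (p - b *\<^sub>R x0) \<in> supp m" using not_in_supp by (force simp: h_def)
    then have "norm (b *\<^sub>R (x - x0) + p) \<le> R" using R(2) by (force simp: algebra_simps)
    then have "b * norm (x - x0) \<le> R + norm p"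
      using norm_triangle_ineq2[of "b *\<^sub>R (x - x0)" "- p"] b by simp
    moreover have "b * \<epsilon> \<le> b * norm (x - x0)" using b that by (simp add: dist_norm norm_minus_commute)
    moreover have "b * \<epsilon> = R + norm p + 1" using \<epsilon> by (simp add: b_def)
    ultimately show False by simp
  qed
  ultimately show ?thesis by blast
qed

lemma bump_compact:
  fixes m :: "real ^ 'n::finite \<Rightarrow> complex"
  assumes m: "testfn m" "m p \<noteq> 0" and Z: "compact Z" and K: "closed K" "Z \<inter> K = {}"
  shows "\<exists>h :: real ^ 'n \<Rightarrow> real. bump h \<and> (\<forall>x\<in>Z. 0 < h x) \<and> (\<forall>x\<in>K. h x = 0)"
proof -
  have "\<exists>h. bump h \<and> 0 < h z \<and> (\<forall>x\<in>K. h x = 0)" if "z \<in> Z" for z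
  proof -
    have "open (- K)" "z \<in> - K" using K that by auto
    then obtain \<epsilon> where \<epsilon>: "0 < \<epsilon>" "ball z \<epsilon> \<subseteq> - K" using open_contains_ball by blast
    obtain h where "bump h" "0 < h z" "\<And>x. \<epsilon> \<le> dist z x \<Longrightarrow> h x = 0"
      using bump_ball[OF m \<epsilon>(1), of z] by blast
    then show ?thesis using \<epsilon>(2) by (intro exI[of _ h]) (force simp: not_less[symmetric])
  qed
  then obtain h where h: "\<And>z. z \<in> Z \<Longrightarrow> bump (h z)" "\<And>z. z \<in> Z \<Longrightarrow> 0 < h z z" "\<And>z x. z \<in> Z \<Longrightarrow> x \<in> K \<Longrightarrow> h z x = 0"
    by metis
  obtain C where C: "C \<subseteq> Z" "finite C" "Z \<subseteq> (\<Union>c\<in>C. {x. 0 < h c x})"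
    using compactE_image[OF Z, of Z "\<lambda>c. {x. 0 < h c x}"] bump_open[OF h(1)] h(2) by blast
  have "bump (\<lambda>x. \<Sum>c\<in>C. h c x)" using C h(1) by (intro bump_sum) auto
  moreover have "0 < (\<Sum>c\<in>C. h c x)" if x: "x \<in> Z" for x
  proof -
    obtain c where c: "c \<in> C" "0 < h c x" using C(3) x by blast
    show ?thesis using C h(1) c by (intro sum_pos2[of C c]) (auto simp: bump_def)
  qed
  moreover have "(\<Sum>c\<in>C. h c x) = 0" if "x \<in> K" for x using C h(3) that by (intro sum.neutral) auto
  ultimately show ?thesis by blast
qed

text \<open>The cutoff is \<open>h1 / (h1 + h2)\<close> with \<open>h1\<close> positive on
  \<open>supp m\<close>. There \<open>h2\<close> vanishes and the quotient is 1; at the zeros of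
  \<open>h1\<close> inside its closed support \<open>h2\<close> is positive, so the denominator does
  not vanish where smoothness is at stake.\<close>

lemma cutoff_exists:
  fixes m :: "real ^ 'n::finite \<Rightarrow> complex"
  assumes m: "testfn m" and p: "m p \<noteq> 0"
  shows "\<exists>c. testfn c \<and> (\<forall>x. c x * m x = m x)"
proof -
  have "compact (supp m)" using m by (simp add: testfn_def)
  then obtain h1 where h1: "bump h1" "\<And>x. x \<in> supp m \<Longrightarrow> 0 < h1 x"
    using bump_compact[OF m p, of "supp m" "{}"] by auto
  define H1 where "H1 x = complex_of_real (h1 x)" for x
  have t1: "testfn H1" using h1(1) by (simp add: bump_def H1_def[abs_def])
  define Z where "Z = supp H1 \<inter> {x. H1 x = 0}"
  have "closed {x. H1 x = 0}"
    using t1 by (intro closed_Collect_eq smooth_continuous_on continuous_on_const) (simp add: testfn_def)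
  then have "compact Z" unfolding Z_def using t1 by (intro compact_Int_closed) (auto simp: testfn_def)
  moreover have "Z \<inter> supp m = {}" using h1(2) by (fastforce simp: Z_def H1_def)
  ultimately obtain h2 where h2: "bump h2" "\<And>x. x \<in> Z \<Longrightarrow> 0 < h2 x" "\<And>x. x \<in> supp m \<Longrightarrow> h2 x = 0"
    using bump_compact[OF m p, of Z "supp m"] by auto
  define H2 where "H2 x = complex_of_real (h2 x)" for x
  have t2: "testfn H2" using h2(1) by (simp add: bump_def H2_def[abs_def])
  have nz: "H1 x + H2 x \<noteq> 0" if "x \<in> supp H1" for x
  proof -
    have "0 \<le> h1 x" "0 \<le> h2 x" using h1(1) h2(1) by (auto simp: bump_def)
    moreover have "h1 x \<noteq> 0 \<or> 0 < h2 x" using that h2(2) by (auto simp: Z_def H1_def)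
    ultimately have "h1 x + h2 x \<noteq> 0" by linarith
    then show ?thesis unfolding H1_def H2_def of_real_add[symmetric] of_real_eq_0_iff .
  qed
  define c where "c x = H1 x / (H1 x + H2 x)" for x
  have "smooth c" unfolding c_def[abs_def]
    using t1 t2 nz by (intro smooth_quotient smooth_add) (auto simp: testfn_def)
  moreover have "supp c \<subseteq> supp H1" unfolding c_def[abs_def] divide_inverse by (rule supp_mult_left)
  ultimately have "testfn c" using testfn_subset[OF _ t1] by blast
  moreover have "c x * m x = m x" for x
  proof (cases "x \<in> supp m")
    case True
    then show ?thesis using h1(2)[OF True] h2(3)[OF True] by (simp add: c_def H1_def H2_def)
  qed (simp add: not_in_supp)
  ultimately show ?thesis by blast
qed

lemma admissible_testfn0: "admissible \<tau> \<Longrightarrow> testfn0 \<tau>"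
  by (auto simp: admissible_def testfn0_def testfn_def)

lemma admissible_dilate_nonzero:
  fixes \<tau> :: "real ^ 'n::finite \<Rightarrow> complex"
  assumes "admissible \<tau>" "\<xi> \<noteq> 0"
  shows "\<exists>l. dilate l \<tau> \<xi> \<noteq> 0"
proof -
  define M where "M = Max (range (\<lambda>i. \<bar>\<xi> $ i\<bar>))"
  have le: "\<bar>\<xi> $ i\<bar> \<le> M" for i unfolding M_def by (rule Max_ge) auto
  have "M \<in> range (\<lambda>i. \<bar>\<xi> $ i\<bar>)" unfolding M_def by (rule Max_in) auto
  then obtain k where k: "M = \<bar>\<xi> $ k\<bar>" by blast
  have M: "0 < M"
  proof (rule ccontr)
    assume "\<not> 0 < M"
    then have "\<xi> $ i = 0" for i using le[of i] by linarith
    then show False using assms(2) by (simp add: vec_eq_iff)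
  qed
  \<comment> \<open>Rounding places \<open>2 powi (- l) * M\<close> in the interval
    \<open>(1, 2]\<close>; the left end is excluded because the closed cube \<open>cube 1\<close> is
    removed from the annulus.\<close>
  define l where "l = \<lceil>log 2 M\<rceil> - 1"
  define a where "a = (2::real) powi (- l)"
  have a: "a = 2 powr (- real_of_int l)" "0 < a" by (simp_all add: a_def powi_powr)
  have "a * M = 2 powr (log 2 M - real_of_int l)" using M by (simp add: a powr_diff powr_minus divide_inverse)
  moreover have "0 < log 2 M - real_of_int l" "log 2 M - real_of_int l \<le> 1" unfolding l_def by linarith+
  ultimately have aM: "1 < a * M" "a * M \<le> 2"
    using powr_less_mono[of 0 "log 2 M - real_of_int l" 2] powr_mono[of "log 2 M - real_of_int l" 1 2] by simp_all
  have "\<bar>(a *\<^sub>R \<xi>) $ i\<bar> \<le> 2" for i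
  proof -
    have "\<bar>(a *\<^sub>R \<xi>) $ i\<bar> = a * \<bar>\<xi> $ i\<bar>" using a(2) by (simp add: abs_mult)
    also have "\<dots> \<le> a * M" using a(2) by (intro mult_left_mono le) auto
    finally show ?thesis using aM(2) by linarith
  qed
  moreover have "\<not> \<bar>(a *\<^sub>R \<xi>) $ k\<bar> \<le> 1" using aM(1) a(2) by (simp add: abs_mult k)
  ultimately have "a *\<^sub>R \<xi> \<in> cube 2 - cube 1" by (auto simp: cube_def)
  then have "0 < Re (\<tau> (a *\<^sub>R \<xi>))" using assms(1) by (simp add: admissible_def)
  then show ?thesis by (intro exI[of _ l]) (auto simp: dilate_def a_def)
qed

text \<open>Compactness of the support selects finitely many dilates of \<tau>' without a common
  zero on it. The division is by the sum of their squared moduli, since \<tau>' may take complex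
  values off the annulus and a plain sum could cancel.\<close>

lemma dilate_decomposition:
  fixes \<tau> \<tau>' :: "real ^ 'n::finite \<Rightarrow> complex"
  assumes \<tau>: "testfn0 \<tau>" and \<tau>': "admissible \<tau>'"
  shows "\<exists>L \<mu>. finite L \<and> (\<forall>l. testfn (\<mu> l)) \<and> \<tau> = (\<lambda>\<xi>. \<Sum>l\<in>L. dilate l (\<lambda>\<eta>. \<mu> l \<eta> * \<tau>' \<eta>) \<xi>)"
proof -
  have t': "testfn (dilate l \<tau>')" for l by (intro testfn_dilate testfn0_testfn admissible_testfn0 \<tau>')
  have op: "open {\<xi>. dilate l \<tau>' \<xi> \<noteq> 0}" for l
    using t'[of l] by (intro open_Collect_neq smooth_continuous_on continuous_on_const) (simp add: testfn_def)
  have "compact (supp \<tau>)" using \<tau> by (simp add: testfn0_def testfn_def)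
  moreover have "supp \<tau> \<subseteq> (\<Union>l\<in>UNIV. {\<xi>. dilate l \<tau>' \<xi> \<noteq> 0})"
  proof
    fix \<xi> assume "\<xi> \<in> supp \<tau>"
    then have "\<xi> \<noteq> 0" using \<tau> by (auto simp: testfn0_def)
    then obtain l where "dilate l \<tau>' \<xi> \<noteq> 0" using admissible_dilate_nonzero[OF \<tau>'] by blast
    then show "\<xi> \<in> (\<Union>l\<in>UNIV. {\<xi>. dilate l \<tau>' \<xi> \<noteq> 0})" by blast
  qed
  ultimately obtain L where "L \<subseteq> UNIV" and L: "finite L" "supp \<tau> \<subseteq> (\<Union>l\<in>L. {\<xi>. dilate l \<tau>' \<xi> \<noteq> 0})"
    by (rule compactE_image[OF _ op])
  define h where "h \<xi> = (\<Sum>l\<in>L. dilate l \<tau>' \<xi> * cnj (dilate l \<tau>' \<xi>))" for \<xi>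
  have sm: "smooth h" unfolding h_def[abs_def] using t' L(1) by (intro smooth_sum smooth_mult smooth_cnj) (auto simp: testfn_def)
  have hn: "h \<xi> \<noteq> 0" if \<xi>: "\<xi> \<in> supp \<tau>" for \<xi>
  proof -
    obtain l where l: "l \<in> L" "dilate l \<tau>' \<xi> \<noteq> 0" using L(2) \<xi> by blast
    have "0 < (\<Sum>l\<in>L. (cmod (dilate l \<tau>' \<xi>))\<^sup>2)" using l L(1) by (intro sum_pos2[of L l]) auto
    moreover have "h \<xi> = of_real (\<Sum>l\<in>L. (cmod (dilate l \<tau>' \<xi>))\<^sup>2)" by (simp only: h_def complex_norm_square of_real_sum)
    ultimately show ?thesis by (simp only: of_real_eq_0_iff)
  qed
  define u where "u l \<xi> = (\<tau> \<xi> * cnj (dilate l \<tau>' \<xi>)) / h \<xi>" for l \<xi>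
  have "testfn (u l)" for l
  proof -
    have su: "supp (\<lambda>\<xi>. \<tau> \<xi> * cnj (dilate l \<tau>' \<xi>)) \<subseteq> supp \<tau>" by (rule supp_mult_left)
    have "smooth (u l)" unfolding u_def[abs_def]
      using \<tau> t'[of l] sm hn su by (intro smooth_quotient smooth_mult smooth_cnj) (auto simp: testfn_def testfn0_def)
    moreover have "supp (u l) \<subseteq> supp (\<lambda>\<xi>. \<tau> \<xi> * cnj (dilate l \<tau>' \<xi>))"
      unfolding u_def[abs_def] divide_inverse by (rule supp_mult_left)
    ultimately show ?thesis using testfn_subset[OF _ testfn0_testfn[OF \<tau>]] su by blast
  qed
  \<comment> \<open>The factors \<open>u l\<close> are dilated back, so that the factor and \<tau>'
    stand under one common dilation.\<close>
  then have "\<forall>l. testfn (dilate (- l) (u l))" by (intro allI testfn_dilate)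
  moreover have "\<tau> \<xi> = (\<Sum>l\<in>L. dilate l (\<lambda>\<eta>. dilate (- l) (u l) \<eta> * \<tau>' \<eta>) \<xi>)" for \<xi>
  proof -
    have "dilate l (\<lambda>\<eta>. dilate (- l) (u l) \<eta> * \<tau>' \<eta>) \<xi> = dilate l (dilate (- l) (u l)) \<xi> * dilate l \<tau>' \<xi>" for l
      by (simp add: dilate_def)
    then have "(\<Sum>l\<in>L. dilate l (\<lambda>\<eta>. dilate (- l) (u l) \<eta> * \<tau>' \<eta>) \<xi>) = (\<Sum>l\<in>L. u l \<xi> * dilate l \<tau>' \<xi>)"
      by (simp add: dilate_add)
    also have "\<dots> = \<tau> \<xi> * h \<xi> / h \<xi>"
      by (simp add: u_def h_def sum_distrib_left sum_divide_distrib mult_ac)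
    also have "\<dots> = \<tau> \<xi>" using hn[of \<xi>] not_in_supp[of \<xi> \<tau>] by (cases "\<xi> \<in> supp \<tau>") auto
    finally show ?thesis by simp
  qed
  ultimately show ?thesis using L(1) by (intro exI[of _ L] exI[of _ "\<lambda>l. dilate (- l) (u l)"]) (auto simp: fun_eq_iff)
qed

lemma band_limited_fourier_multiplier:
  fixes \<tau> \<tau>' :: "real ^ 'n::finite \<Rightarrow> complex"
  assumes \<tau>: "admissible \<tau>" and \<tau>': "admissible \<tau>'"
  shows "\<exists>K L. (\<forall>N. 0 \<le> K N) \<and> finite L \<and> (\<forall>f\<in>schwartz_inf_dual. band_limited K L
    (\<lambda>j x. cmod (fourier_multiplier (dilate j \<tau>) f x)) (\<lambda>j x. cmod (fourier_multiplier (dilate j \<tau>') f x)))"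
proof -
  have t: "testfn0 (dilate j \<tau>)" "testfn0 (dilate j \<tau>')" for j
    by (intro testfn0_dilate admissible_testfn0 assms)+
  obtain L \<mu> where L: "finite L" and \<mu>: "\<And>l. testfn (\<mu> l)" "\<tau> = (\<lambda>\<xi>. \<Sum>l\<in>L. dilate l (\<lambda>\<eta>. \<mu> l \<eta> * \<tau>' \<eta>) \<xi>)"
    using dilate_decomposition[OF admissible_testfn0[OF \<tau>] \<tau>'] by blast
  \<comment> \<open>A nonzero value of \<tau>' is the seed from which the cutoff is built.\<close>
  obtain p where "\<tau>' p \<noteq> 0"
    using admissible_dilate_nonzero[OF \<tau>', of "axis undefined 1"] by (auto simp: dilate_def axis_eq_0_iff)
  then obtain c where c: "testfn c" "\<And>x. c x * \<tau>' x = \<tau>' x"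
    using cutoff_exists[OF testfn0_testfn[OF admissible_testfn0[OF \<tau>']]] by blast
  \<comment> \<open>The constants are chosen as a function of \<open>m\<close> and \<open>N\<close>,
    so that finitely many of them can be added up in \<open>K N\<close>.\<close>
  define C where "C m N = (SOME C. 0 < C \<and> (\<forall>j x y. cmod (ft (dilate j (m :: real ^ 'n \<Rightarrow> complex)) (x - y)) \<le> C * kern j N x y))" for m N
  have "0 < C m N \<and> (\<forall>j x y. cmod (ft (dilate j m) (x - y)) \<le> C m N * kern j N x y)" if "testfn m" "0 \<le> N" for m N
    unfolding C_def by (rule someI_ex[OF ft_dilate_le_kern[OF that]])
  then have C: "testfn m \<Longrightarrow> 0 \<le> N \<Longrightarrow> 0 \<le> C m N"
    "testfn m \<Longrightarrow> 0 \<le> N \<Longrightarrow> cmod (ft (dilate j m) (x - y)) \<le> C m N * kern j N x y" for m N j x y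
    by (auto simp: less_imp_le)
  \<comment> \<open>The maximum with 0 keeps \<open>K N\<close> nonnegative also for negative
    \<open>N\<close>, where the chosen constants carry no information.\<close>
  define K where "K N = max 0 ((C c N + (\<Sum>l\<in>L. C (\<mu> l) N)) / inv_const TYPE('n))" for N
  note i = inv_const_pos[where 'n = 'n]
  have K0: "0 \<le> K N" for N by (simp add: K_def)
  have K: "C c N / inv_const TYPE('n) \<le> K N" "l \<in> L \<Longrightarrow> C (\<mu> l) N / inv_const TYPE('n) \<le> K N" if "0 \<le> N" for l N
  proof -
    have "C c N \<le> C c N + (\<Sum>l\<in>L. C (\<mu> l) N)" "l \<in> L \<Longrightarrow> C (\<mu> l) N \<le> C c N + (\<Sum>l\<in>L. C (\<mu> l) N)"
      using L C(1)[OF c(1) that] C(1)[OF \<mu>(1) that]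
      by (auto intro!: sum_nonneg add_increasing member_le_sum[of l L "\<lambda>l. C (\<mu> l) N"])
    then show "C c N / inv_const TYPE('n) \<le> K N" "l \<in> L \<Longrightarrow> C (\<mu> l) N / inv_const TYPE('n) \<le> K N"
      using i unfolding K_def by (auto intro!: max.coboundedI2 divide_right_mono)
  qed
  have "band_limited K L (\<lambda>j x. cmod (fourier_multiplier (dilate j \<tau>) f x)) (\<lambda>j x. cmod (fourier_multiplier (dilate j \<tau>') f x))"
    if f: "f \<in> schwartz_inf_dual" for f
  proof -
    let ?t = "\<lambda>j x. cmod (fourier_multiplier (dilate j \<tau>) f x)" and ?g = "\<lambda>j x. cmod (fourier_multiplier (dilate j \<tau>') f x)"
    have piece: "ennreal (cmod (fourier_multiplier (dilate k (\<lambda>\<eta>. m \<eta> * \<tau>' \<eta>)) f x)) \<le> ennreal (K N) * avg k N (\<lambda>y. ennreal (?g k y)) x"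
      if m: "testfn m" "C m N / inv_const TYPE('n) \<le> K N" and N: "0 \<le> N" for m N k x
    proof -
      have "dilate k (\<lambda>\<eta>. m \<eta> * \<tau>' \<eta>) = (\<lambda>\<xi>. dilate k m \<xi> * dilate k \<tau>' \<xi>)" by (simp add: dilate_def fun_eq_iff)
      then have "ennreal (cmod (fourier_multiplier (dilate k (\<lambda>\<eta>. m \<eta> * \<tau>' \<eta>)) f x)) \<le>
          ennreal (C m N / inv_const TYPE('n)) * avg k N (\<lambda>y. ennreal (?g k y)) x"
        using fourier_multiplier_mult_le[OF f testfn_dilate[OF m(1)] t(2) C(2)[OF m(1) N]] C(1)[OF m(1) N] by simp
      also have "\<dots> \<le> ennreal (K N) * avg k N (\<lambda>y. ennreal (?g k y)) x"
        by (intro mult_right_mono ennreal_leI m) auto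
      finally show ?thesis .
    qed
    \<comment> \<open>As \<open>c x * \<tau>' x = \<tau>' x\<close>, the product multiplier is the
      piece itself, which is thus bounded by its own average.\<close>
    have g: "ennreal (?g k x) \<le> ennreal (K N) * avg k N (\<lambda>y. ennreal (?g k y)) x" if "0 \<le> N" for N k x
      using piece[OF c(1) K(1)[OF that] that, of k x] by (simp add: c(2))
    have tg: "ennreal (?t k x) \<le> ennreal (K N) * (\<Sum>l\<in>L. avg (k + l) N (\<lambda>y. ennreal (?g (k + l) y)) x)" if N: "0 \<le> N" for N k x
    proof -
      have t0: "testfn0 (dilate (k + l) (\<lambda>\<eta>. \<mu> l \<eta> * \<tau>' \<eta>))" for l
        by (intro testfn0_dilate testfn0_mult_right admissible_testfn0 \<tau>' testfnD \<mu>)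
      have "dilate k \<tau> = dilate k (\<lambda>\<xi>. \<Sum>l\<in>L. dilate l (\<lambda>\<eta>. \<mu> l \<eta> * \<tau>' \<eta>) \<xi>)" using \<mu>(2) by simp
      also have "\<dots> = (\<lambda>\<xi>. \<Sum>l\<in>L. dilate (k + l) (\<lambda>\<eta>. \<mu> l \<eta> * \<tau>' \<eta>) \<xi>)"
        unfolding dilate_add[symmetric] by (simp add: dilate_def fun_eq_iff)
      finally have "?t k x = cmod (\<Sum>l\<in>L. fourier_multiplier (dilate (k + l) (\<lambda>\<eta>. \<mu> l \<eta> * \<tau>' \<eta>)) f x)"
        by (simp add: fourier_multiplier_sum[OF f L t0])
      also have "\<dots> \<le> (\<Sum>l\<in>L. cmod (fourier_multiplier (dilate (k + l) (\<lambda>\<eta>. \<mu> l \<eta> * \<tau>' \<eta>)) f x))" by (rule norm_sum)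
      finally have "ennreal (?t k x) \<le> (\<Sum>l\<in>L. ennreal (cmod (fourier_multiplier (dilate (k + l) (\<lambda>\<eta>. \<mu> l \<eta> * \<tau>' \<eta>)) f x)))"
        by (subst sum_ennreal) (auto intro: ennreal_leI)
      also have "\<dots> \<le> (\<Sum>l\<in>L. ennreal (K N) * avg (k + l) N (\<lambda>y. ennreal (?g (k + l) y)) x)"
        by (intro sum_mono piece \<mu> K N)
      finally show ?thesis by (simp add: sum_distrib_left)
    qed
    have [measurable]: "fourier_multiplier (dilate k \<tau>) f \<in> borel_measurable borel" "fourier_multiplier (dilate k \<tau>') f \<in> borel_measurable borel" for k
      by (intro fourier_multiplier_measurable f t)+
    show ?thesis unfolding band_limited_def
      by (intro conjI allI impI g tg fourier_multiplier_growth[OF f t(2)]) auto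
  qed
  then show ?thesis using K0 L by blast
qed

text \<open>Pure quantifier bookkeeping: a constant valid for all controlled families is specialised
  to the families that come from functionals.\<close>

lemma ex_bound_instance:
  fixes P :: "real \<Rightarrow> 'a \<Rightarrow> 'b \<Rightarrow> bool"
  assumes "\<exists>C>0. \<forall>t g. R t g \<longrightarrow> P C t g" "\<And>f. f \<in> S \<Longrightarrow> R (t f) (g f)"
  shows "\<exists>C>0. \<forall>f\<in>S. P C (t f) (g f)"
  using assms by blast

lemma hom_norm_le:
  fixes q s :: real and r :: ennreal and \<tau> \<tau>' :: "real ^ 'n::finite \<Rightarrow> complex"
  assumes q: "0 < q" and r: "0 < r" and \<phi>: "\<phi> \<in> Gclass CARD('n) q"
    and eps: "A = E_scale \<Longrightarrow> r < \<infinity> \<Longrightarrow>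
      \<exists>\<epsilon>>0. \<exists>C0>0. \<forall>t u. 0 < u \<and> u \<le> t \<longrightarrow> t powr \<epsilon> / \<phi> t \<le> C0 * (u powr \<epsilon> / \<phi> u)"
    and \<tau>: "admissible \<tau>" and \<tau>': "admissible \<tau>'"
  shows "\<exists>C>0. \<forall>f\<in>schwartz_inf_dual. hom_norm A s \<phi> q r \<tau> f \<le> ennreal C * hom_norm A s \<phi> q r \<tau>' f"
proof -
  obtain K L where K: "\<And>N. 0 \<le> K N" and L: "finite L" and b: "\<And>f. f \<in> schwartz_inf_dual \<Longrightarrow> band_limited K L
    (\<lambda>j x. cmod (fourier_multiplier (dilate j \<tau>) f x)) (\<lambda>j x. cmod (fourier_multiplier (dilate j \<tau>') f x))"
    using band_limited_fourier_multiplier[OF \<tau> \<tau>'] by blast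
  obtain D where D: "(\<forall>\<eta> N. 0 < D \<eta> N) \<and> (\<forall>t g :: int \<Rightarrow> real ^ 'n \<Rightarrow> real. band_limited K L t g \<longrightarrow> controlled D L t g)"
    using controlled_of_band_limited[OF K L] by (rule exE)
  let ?t = "\<lambda>f j x. cmod (fourier_multiplier (dilate j \<tau>) f x)" and ?g = "\<lambda>f j x. cmod (fourier_multiplier (dilate j \<tau>') f x)"
  have D0: "0 < D \<eta> N" for \<eta> N using D by blast
  have c: "controlled D L (?t f) (?g f)" if "f \<in> schwartz_inf_dual" for f using D b[OF that] by blast
  consider "A = N_scale" | "A = E_scale" "r < \<infinity>" | "A = E_scale" "r = \<infinity>"
    using top.not_eq_extremum[of r] unfolding infinity_ennreal_def by (cases A) blast+
  then show ?thesis
  proof cases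
    case 1
    show ?thesis unfolding 1 hom_norm.simps
      by (rule ex_bound_instance[OF controlled_N[where D = D and s = s, OF q r \<phi> L D0], where t = ?t and g = ?g, OF c])
  next
    case 2
    show ?thesis unfolding 2(1) hom_norm.simps
      by (rule ex_bound_instance[OF controlled_E_finite[where D = D and s = s, OF q r 2(2) \<phi> eps[OF 2] L D0], where t = ?t and g = ?g, OF c])
  next
    case 3
    show ?thesis unfolding 3 hom_norm.simps
      by (rule ex_bound_instance[OF controlled_E_infinite[where D = D and s = s, OF q \<phi> L D0], where t = ?t and g = ?g, OF c])
  qed
qed

theorem theorem6p2:
  fixes q s :: real and r :: ennreal and \<phi> :: "real \<Rightarrow> real" and A :: scale
    and \<tau> \<tau>' :: "real ^ 'n::finite \<Rightarrow> complex"
  assumes "0 < q" and "0 < r" and "\<phi> \<in> Gclass CARD('n) q"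
    and "A = E_scale \<Longrightarrow> r < \<infinity> \<Longrightarrow>
      \<exists>\<epsilon>>0. \<exists>C0>0. \<forall>t u. 0 < u \<and> u \<le> t \<longrightarrow> t powr \<epsilon> / \<phi> t \<le> C0 * (u powr \<epsilon> / \<phi> u)"
    and "admissible \<tau>" and "admissible \<tau>'"
  shows "\<exists>C::real. C \<ge> 1 \<and> (\<forall>f\<in>schwartz_inf_dual.
      ennreal (inverse C) * hom_norm A s \<phi> q r \<tau>' f \<le> hom_norm A s \<phi> q r \<tau> f \<and>
      hom_norm A s \<phi> q r \<tau> f \<le> ennreal C * hom_norm A s \<phi> q r \<tau>' f)"
proof -
  obtain C1 where C1: "\<And>f. f \<in> schwartz_inf_dual \<Longrightarrow> hom_norm A s \<phi> q r \<tau> f \<le> ennreal C1 * hom_norm A s \<phi> q r \<tau>' f"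
    using hom_norm_le[OF assms(1-6), where s = s] by metis
  obtain C2 where C2: "\<And>f. f \<in> schwartz_inf_dual \<Longrightarrow> hom_norm A s \<phi> q r \<tau>' f \<le> ennreal C2 * hom_norm A s \<phi> q r \<tau> f"
    using hom_norm_le[OF assms(1-4,6,5), where s = s] by metis
  \<comment> \<open>One constant for both directions, which are the same estimate with \<tau> and
    \<tau>' exchanged.\<close>
  define C where "C = max 1 (max C1 C2)"
  have C: "1 \<le> C" "C1 \<le> C" "C2 \<le> C" by (auto simp: C_def)
  have "ennreal (inverse C) * hom_norm A s \<phi> q r \<tau>' f \<le> hom_norm A s \<phi> q r \<tau> f"
    "hom_norm A s \<phi> q r \<tau> f \<le> ennreal C * hom_norm A s \<phi> q r \<tau>' f" if f: "f \<in> schwartz_inf_dual" for f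
  proof -
    have "ennreal C1 * hom_norm A s \<phi> q r \<tau>' f \<le> ennreal C * hom_norm A s \<phi> q r \<tau>' f"
      "ennreal C2 * hom_norm A s \<phi> q r \<tau> f \<le> ennreal C * hom_norm A s \<phi> q r \<tau> f"
      by (intro mult_right_mono ennreal_leI C; simp)+
    note le = order_trans[OF C1[OF f] this(1)] order_trans[OF C2[OF f] this(2)]
    show "hom_norm A s \<phi> q r \<tau> f \<le> ennreal C * hom_norm A s \<phi> q r \<tau>' f" by (rule le(1))
    have "ennreal (inverse C) * hom_norm A s \<phi> q r \<tau>' f \<le> ennreal (inverse C) * (ennreal C * hom_norm A s \<phi> q r \<tau> f)"
      by (intro mult_left_mono le(2)) simp
    also have "\<dots> = hom_norm A s \<phi> q r \<tau> f"
      using C(1) by (simp flip: mult.assoc ennreal_mult)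
    finally show "ennreal (inverse C) * hom_norm A s \<phi> q r \<tau>' f \<le> hom_norm A s \<phi> q r \<tau> f" .
  qed
  with C(1) show ?thesis by blast
qed

end
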